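(* There exist $\rho>0$ and $R>0$ such that, for every $(a_0,u_0)\in(PM^{d-1}\cap PM^{d})\times PM^{d-1}$ satisfying $$\|(a_0,|D|a_0,u_0)\|_{PM^{d-1}}\le\rho,$$ there exists a unique solution $(a,u)\in X_\infty$ of the Cauchy problem (NSK) with initial condition $(a,u)|_{t=0}=(a_0,u_0)$ such that $\|(a,u)\|_{X_\infty}\le R$.
   Context: Standing assumptions: $d\ge 2$ is an integer, $p>2$ is real with $d-3+\frac4p>0$; $\mu,\nu,\kappa,\alpha$ are real constants with $\mu>0$, $\mu+\nu>0$, $\kappa>0$, $\alpha>0$. Spaces. $\widehat{g}$ is the Fourier transform in the space variable and $m(D)$ the Fourier multiplier with symbol $m(\xi)$. For $r\ge0$, $PM^r=PM^r(\mathbb R^d)$ is the set of $g\in\mathcal S'(\mathbb R^d)$ with $\widehat g\in L^1_{loc}$ and $\|g\|_{PM^r}:=\sup_{\xi}|\xi|^r|\widehat g(\xi)|<\infty$ (essential supremum); for vector-valued $g$, $|\widehat g|$ is the Euclidean norm. In particular $\|(a_0,|D|a_0,u_0)\|_{PM^{r}}=\sup_\xi |\xi|^{r}|(\widehat a_0,|\xi|\widehat a_0,\widehat u_0)(\xi)|$. For $r>0$, $K^{p,r}_\infty$ is the space of continuous $u:\,]0,+\infty[\to PM^{r+2/p}$ with $\|u\|_{K^{p,r}_\infty}:=\sup_{t>0}t^{1/p}\|u(t)\|_{PM^{r+2/p}}<\infty$. $X_\infty$ is the space of $(a,u)\in(K^{p,d-1}_\infty\cap K^{p,d}_\infty)\times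 K^{p,d-1}_\infty$ ($a$ scalar, $u$ with $d$ components) with norm $\|(a,u)\|_{X_\infty}:=\max\{\|a\|_{K^{p,d-1}_\infty},\|a\|_{K^{p,d}_\infty}\}+\|u\|_{K^{p,d-1}_\infty}$. System (NSK): $$\partial_t a+\operatorname{div}u=f(u,a),\qquad \partial_t u-\mu\Delta u-(\mu+\nu)\nabla\operatorname{div}u+\alpha\nabla a-\kappa\nabla\Delta a=g(u,a),$$ with $f(u,a)=-u\cdot\nabla a$ and $g(u,a)=-u\cdot\nabla u+\mu\nabla a\cdot\nabla u+(\mu+\nu)\nabla a\cdot Du+\frac{\kappa}{2}\nabla(\nabla a\cdot\nabla a)$, where $(\nabla a\cdot\nabla u)_j=\sum_i\partial_i a\,\partial_i u_j$ and $(\nabla a\cdot Du)_j=\sum_i\partial_i a\,\partial_j u_i$. Products are understood through convolution of Fourier transforms. Solutions are mild solutions: $(a,u)\in X_\infty$ is a solution with data $(a_0,u_0)$ if for all $t>0$ $$(a,u)(t)=W(t)(a_0,u_0)+\int_0^tW(t-s)\big(f(u,a)(s),g(u,a)(s)\big)ds,$$ where $W(t)=e^{-tA(D)}$ and, for $b\in\mathbb C$, $w\in\mathbb C^d$, $A(\xi)(b,w)=\big(i\xi\cdot w,\ i(\alpha+\kappa|\xi|^2)b\,\xi+\mu|\xi|^2w+(\mu+\nu)(\xi\cdot w)\xi\big)$. *)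

theory Defs
  imports "HOL-Probability.Essential_Supremum"
begin

section \<open>Tempered distributions\<close>

definition partial_deriv :: "'d::finite \<Rightarrow> (real^'d \<Rightarrow> complex) \<Rightarrow> real^'d \<Rightarrow> complex" where
  "partial_deriv j f x = frechet_derivative f (at x) (axis j 1)"

definition iter_partial :: "'d::finite list \<Rightarrow> (real^'d \<Rightarrow> complex) \<Rightarrow> real^'d \<Rightarrow> complex" where
  "iter_partial js f = foldr partial_deriv js f"

definition schwartz :: "(real^'d::finite \<Rightarrow> complex) set" where
  "schwartz = {\<phi>. \<forall>js. iter_partial js \<phi> differentiable_on UNIV \<and>
     (\<forall>k::nat. bounded (range (\<lambda>x. (1 + norm x) ^ k *\<^sub>R iter_partial js \<phi> x)))}"

definition schwartz_norm :: "nat \<Rightarrow> (real^'d::finite \<Rightarrow> complex) \<Rightarrow> real" where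
  "schwartz_norm N \<phi> =
     (\<Sum>js\<in>{js. length js \<le> N}. SUP x. (1 + norm x) ^ N * cmod (iter_partial js \<phi> x))"

text \<open>
  A distribution is a functional on the set \<^const>\<open>schwartz\<close>. It is set to zero off that set, so
  that equality of functions is equality of distributions and the pointwise operations stay within
  the space.
\<close>

type_synonym 'd dist = "(real^'d \<Rightarrow> complex) \<Rightarrow> complex"

definition tempered :: "('d::finite) dist set" where
  "tempered = {T.
     (\<forall>\<phi>. \<phi> \<notin> schwartz \<longrightarrow> T \<phi> = 0) \<and>
     (\<forall>\<phi>\<in>schwartz. \<forall>\<psi>\<in>schwartz. T (\<lambda>x. \<phi> x + \<psi> x) = T \<phi> + T \<psi>) \<and>
     (\<forall>c. \<forall>\<phi>\<in>schwartz. T (\<lambda>x. c * \<phi> x) = c * T \<phi>) \<and>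
     (\<exists>C N. \<forall>\<phi>\<in>schwartz. cmod (T \<phi>) \<le> C * schwartz_norm N \<phi>)}"

definition dist_diff :: "'d::finite dist \<Rightarrow> 'd dist \<Rightarrow> 'd dist" where
  "dist_diff S T = (\<lambda>\<phi>. S \<phi> - T \<phi>)"

definition dist_partial :: "'d::finite \<Rightarrow> 'd dist \<Rightarrow> 'd dist" where
  "dist_partial j T = (\<lambda>\<phi>. if \<phi> \<in> schwartz then - T (partial_deriv j \<phi>) else 0)"


section \<open>Fourier transform\<close>

definition fourier :: "(real^'d::finite \<Rightarrow> complex) \<Rightarrow> real^'d \<Rightarrow> complex" where
  "fourier \<phi> \<xi> = (\<integral>x. cis (- (x \<bullet> \<xi>)) * \<phi> x \<partial>lborel)"

definition inv_fourier :: "(real^'d::finite \<Rightarrow> complex) \<Rightarrow> real^'d \<Rightarrow> complex" where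
  "inv_fourier \<phi> x = complex_of_real (1 / (2 * pi) ^ CARD('d)) * (\<integral>\<xi>. cis (x \<bullet> \<xi>) * \<phi> \<xi> \<partial>lborel)"

definition dist_fourier :: "'d::finite dist \<Rightarrow> 'd dist" where
  "dist_fourier T = (\<lambda>\<phi>. if \<phi> \<in> schwartz then T (fourier \<phi>) else 0)"

definition L1_loc :: "(real^'d::finite \<Rightarrow> complex) set" where
  "L1_loc = {h. \<forall>K. compact K \<longrightarrow> set_integrable lborel K h}"

definition dist_of_fun :: "(real^'d::finite \<Rightarrow> complex) \<Rightarrow> 'd dist" where
  "dist_of_fun h = (\<lambda>\<phi>. if \<phi> \<in> schwartz then (\<integral>\<xi>. h \<xi> * \<phi> \<xi> \<partial>lborel) else 0)"

text \<open>
  The Fourier transform of \<open>T\<close> is the locally integrable function \<open>h\<close>. Integrability of \<open>h\<close> against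
  Schwartz functions is automatic when some \<open>|\<xi>|\<^sup>r h(\<xi>)\<close> is essentially bounded, as is the case
  in the spaces below.
\<close>

definition has_fourier_fun :: "'d::finite dist \<Rightarrow> (real^'d \<Rightarrow> complex) \<Rightarrow> bool" where
  "has_fourier_fun T h \<longleftrightarrow> h \<in> L1_loc \<and>
     (\<forall>\<phi>\<in>schwartz. integrable lborel (\<lambda>\<xi>. h \<xi> * \<phi> \<xi>)) \<and> dist_fourier T = dist_of_fun h"

text \<open>This function is determined almost everywhere only; all uses below respect this.\<close>

definition fourier_fun :: "'d::finite dist \<Rightarrow> real^'d \<Rightarrow> complex" where
  "fourier_fun T = (SOME h. has_fourier_fun T h)"

definition fourier_fun_vec :: "('d::finite dist)^'d \<Rightarrow> real^'d \<Rightarrow> complex^'d" where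
  "fourier_fun_vec u \<xi> = (\<chi> j. fourier_fun (u $ j) \<xi>)"

text \<open>The distribution whose Fourier transform is the function \<open>h\<close>:\<close>

definition dist_with_fourier :: "(real^'d::finite \<Rightarrow> complex) \<Rightarrow> 'd dist" where
  "dist_with_fourier h = (\<lambda>\<phi>. if \<phi> \<in> schwartz then dist_of_fun h (inv_fourier \<phi>) else 0)"

text \<open>With the convention of \<^const>\<open>fourier\<close>, the Fourier transform of a product is
  \<open>(2 \<pi>)\<^sup>-\<^sup>d\<close> times the convolution of the Fourier transforms.\<close>

definition dist_prod :: "'d::finite dist \<Rightarrow> 'd dist \<Rightarrow> 'd dist" where
  "dist_prod S T = dist_with_fourier
     (\<lambda>\<xi>. complex_of_real (1 / (2 * pi) ^ CARD('d)) *
          (\<integral>\<eta>. fourier_fun S (\<xi> - \<eta>) * fourier_fun T \<eta> \<partial>lborel))"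


section \<open>The function spaces\<close>

definition weighted_sup :: "real \<Rightarrow> (real^'d::finite \<Rightarrow> 'b::real_normed_vector) \<Rightarrow> ennreal" where
  "weighted_sup r h = esssup lborel (\<lambda>\<xi>. ennreal (norm \<xi> powr r * norm (h \<xi>)))"

definition PM_norm :: "real \<Rightarrow> 'd::finite dist \<Rightarrow> ennreal" where
  "PM_norm r T = weighted_sup r (fourier_fun T)"

definition PM :: "real \<Rightarrow> ('d::finite) dist set" where
  "PM r = {T \<in> tempered. (\<exists>h. has_fourier_fun T h) \<and> PM_norm r T < \<infinity>}"

definition PM_vec_norm :: "real \<Rightarrow> ('d::finite dist)^'d \<Rightarrow> ennreal" where
  "PM_vec_norm r u = weighted_sup r (fourier_fun_vec u)"

definition PM_vec :: "real \<Rightarrow> (('d::finite dist)^'d) set" where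
  "PM_vec r = {u. (\<forall>j. u $ j \<in> tempered \<and> (\<exists>h. has_fourier_fun (u $ j) h)) \<and>
     PM_vec_norm r u < \<infinity>}"

text \<open>The norm of \<open>(a\<^sub>0, |D| a\<^sub>0, u\<^sub>0)\<close> in \<open>PM\<^sup>r\<close>; the product norm is Euclidean.\<close>

definition data_norm :: "real \<Rightarrow> 'd::finite dist \<Rightarrow> ('d dist)^'d \<Rightarrow> ennreal" where
  "data_norm r a0 u0 = weighted_sup r
     (\<lambda>\<xi>. (fourier_fun a0 \<xi>, norm \<xi> *\<^sub>R fourier_fun a0 \<xi>, fourier_fun_vec u0 \<xi>))"

text \<open>Curves are functions on the reals of which only the restriction to positive times matters.\<close>

definition K_norm :: "real \<Rightarrow> real \<Rightarrow> (real \<Rightarrow> 'd::finite dist) \<Rightarrow> ennreal" where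
  "K_norm p r a = (SUP t\<in>{0<..}. ennreal (t powr (1 / p)) * PM_norm (r + 2 / p) (a t))"

definition K_space :: "real \<Rightarrow> real \<Rightarrow> (real \<Rightarrow> 'd::finite dist) set" where
  "K_space p r = {a. (\<forall>t>0. a t \<in> PM (r + 2 / p)) \<and>
     (\<forall>t>0. ((\<lambda>s. PM_norm (r + 2 / p) (dist_diff (a s) (a t))) \<longlongrightarrow> 0) (at t)) \<and>
     K_norm p r a < \<infinity>}"

definition K_vec_norm :: "real \<Rightarrow> real \<Rightarrow> (real \<Rightarrow> ('d::finite dist)^'d) \<Rightarrow> ennreal" where
  "K_vec_norm p r u = (SUP t\<in>{0<..}. ennreal (t powr (1 / p)) * PM_vec_norm (r + 2 / p) (u t))"

definition K_vec_space :: "real \<Rightarrow> real \<Rightarrow> (real \<Rightarrow> ('d::finite dist)^'d) set" where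
  "K_vec_space p r = {u. (\<forall>t>0. u t \<in> PM_vec (r + 2 / p)) \<and>
     (\<forall>t>0. ((\<lambda>s. PM_vec_norm (r + 2 / p) (\<chi> j. dist_diff (u s $ j) (u t $ j))) \<longlongrightarrow> 0) (at t)) \<and>
     K_vec_norm p r u < \<infinity>}"

definition X_space :: "real \<Rightarrow> ((real \<Rightarrow> 'd::finite dist) \<times> (real \<Rightarrow> ('d dist)^'d)) set" where
  "X_space p = (K_space p (real CARD('d) - 1) \<inter> K_space p (real CARD('d)))
     \<times> K_vec_space p (real CARD('d) - 1)"

definition X_norm :: "real \<Rightarrow> (real \<Rightarrow> 'd::finite dist) \<times> (real \<Rightarrow> ('d dist)^'d) \<Rightarrow> ennreal" where
  "X_norm p = (\<lambda>(a, u). max (K_norm p (real CARD('d) - 1) a) (K_norm p (real CARD('d)) a)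
     + K_vec_norm p (real CARD('d) - 1) u)"


section \<open>The system and its mild solutions\<close>

definition nsk_f :: "('d::finite dist)^'d \<Rightarrow> 'd dist \<Rightarrow> 'd dist" where
  "nsk_f u a = (\<lambda>\<phi>. - (\<Sum>i\<in>UNIV. dist_prod (u $ i) (dist_partial i a) \<phi>))"

definition nsk_g :: "real \<Rightarrow> real \<Rightarrow> real \<Rightarrow> ('d::finite dist)^'d \<Rightarrow> 'd dist \<Rightarrow> ('d dist)^'d" where
  "nsk_g \<mu> \<nu> \<kappa> u a = (\<chi> j. (\<lambda>\<phi>.
     - (\<Sum>i\<in>UNIV. dist_prod (u $ i) (dist_partial i (u $ j)) \<phi>)
     + complex_of_real \<mu> * (\<Sum>i\<in>UNIV. dist_prod (dist_partial i a) (dist_partial i (u $ j)) \<phi>)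
     + complex_of_real (\<mu> + \<nu>) * (\<Sum>i\<in>UNIV. dist_prod (dist_partial i a) (dist_partial j (u $ i)) \<phi>)
     + complex_of_real (\<kappa> / 2) *
         dist_partial j (\<lambda>\<psi>. \<Sum>i\<in>UNIV. dist_prod (dist_partial i a) (dist_partial i a) \<psi>) \<phi>))"

text \<open>\<open>cdot \<xi> w\<close> is the bilinear product \<open>\<xi> \<cdot> w\<close>.\<close>

definition cdot :: "real^'d::finite \<Rightarrow> complex^'d \<Rightarrow> complex" where
  "cdot \<xi> w = (\<Sum>i\<in>UNIV. complex_of_real (\<xi> $ i) * w $ i)"

definition nsk_symbol ::
  "real \<Rightarrow> real \<Rightarrow> real \<Rightarrow> real \<Rightarrow> real^'d::finite \<Rightarrow> complex \<times> (complex^'d) \<Rightarrow> complex \<times> (complex^'d)" where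
  "nsk_symbol \<mu> \<nu> \<kappa> \<alpha> \<xi> = (\<lambda>(b, w).
     (\<i> * cdot \<xi> w,
      \<chi> j. \<i> * complex_of_real (\<alpha> + \<kappa> * (norm \<xi>)\<^sup>2) * b * complex_of_real (\<xi> $ j)
        + complex_of_real (\<mu> * (norm \<xi>)\<^sup>2) * w $ j
        + complex_of_real (\<mu> + \<nu>) * cdot \<xi> w * complex_of_real (\<xi> $ j)))"

definition exp_nsk_symbol ::
  "real \<Rightarrow> real \<Rightarrow> real \<Rightarrow> real \<Rightarrow> real \<Rightarrow> real^'d::finite \<Rightarrow> complex \<times> (complex^'d) \<Rightarrow> complex \<times> (complex^'d)" where
  "exp_nsk_symbol \<mu> \<nu> \<kappa> \<alpha> t \<xi> z =
     (\<Sum>n. ((- t) ^ n / fact n) *\<^sub>R (nsk_symbol \<mu> \<nu> \<kappa> \<alpha> \<xi> ^^ n) z)"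

definition nsk_semigroup ::
  "real \<Rightarrow> real \<Rightarrow> real \<Rightarrow> real \<Rightarrow> real \<Rightarrow> 'd::finite dist \<times> (('d dist)^'d) \<Rightarrow> 'd dist \<times> (('d dist)^'d)" where
  "nsk_semigroup \<mu> \<nu> \<kappa> \<alpha> t = (\<lambda>(b, w).
     let h = (\<lambda>\<xi>. exp_nsk_symbol \<mu> \<nu> \<kappa> \<alpha> t \<xi> (fourier_fun b \<xi>, fourier_fun_vec w \<xi>))
     in (dist_with_fourier (\<lambda>\<xi>. fst (h \<xi>)), \<chi> j. dist_with_fourier (\<lambda>\<xi>. snd (h \<xi>) $ j)))"

text \<open>The integral in time of a curve of distributions is understood weakly, that is, after
  evaluation at each Schwartz function.\<close>

definition nsk_mild_solution ::
  "real \<Rightarrow> real \<Rightarrow> real \<Rightarrow> real \<Rightarrow> real \<Rightarrow> 'd::finite dist \<times> (('d dist)^'d)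
    \<Rightarrow> (real \<Rightarrow> 'd dist) \<times> (real \<Rightarrow> ('d dist)^'d) \<Rightarrow> bool" where
  "nsk_mild_solution p \<mu> \<nu> \<kappa> \<alpha> U0 U \<longleftrightarrow> U \<in> X_space p \<and>
     (case U of (a, u) \<Rightarrow> \<forall>t>0. \<forall>\<phi>\<in>schwartz.
       let F = (\<lambda>s. nsk_semigroup \<mu> \<nu> \<kappa> \<alpha> (t - s) (nsk_f (u s) (a s), nsk_g \<mu> \<nu> \<kappa> (u s) (a s)));
           L = nsk_semigroup \<mu> \<nu> \<kappa> \<alpha> t U0
       in set_integrable lborel {0<..<t} (\<lambda>s. fst (F s) \<phi>) \<and>
          a t \<phi> = fst L \<phi> + (LBINT s:{0<..<t}. fst (F s) \<phi>) \<and>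
          (\<forall>j. set_integrable lborel {0<..<t} (\<lambda>s. (snd (F s) $ j) \<phi>) \<and>
               (u t $ j) \<phi> = (snd L $ j) \<phi> + (LBINT s:{0<..<t}. (snd (F s) $ j) \<phi>)))"

end

(*
  Everything happens on the Fourier side. In the norm (1 + |xi|) |b| + |w| of a state (b, w) at
  frequency xi, the semigroup of the symbol decays like exp (- c t |xi|^2); the Lyapunov functional
  behind this has a cross term that produces the damping of b. The quadratic terms are convolutions
  of functions bounded by powers of |xi|; they converge because d - 3 + 4/p > 0 and are bounded by
  t^(-2/p) |xi|^(-(d - 3 + 4/p)). The smoothing of the semigroup and a beta integral in time turn
  this into t^(-1/p) |xi|^(-(d - 1 + 2/p)), the bound that defines X, so the Duhamel map is a
  contraction on a small ball.

  For uniqueness, the difference of two solutions is estimated after pairing with Schwartz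
  functions, and a bound on all such pairings yields a pointwise bound almost everywhere. Each
  round halves the constant in the bound, so the difference vanishes.
*)

theory Submission
  imports Defs "HOL-Probability.Probability"
begin

section \<open>Convolution of powers of the norm\<close>

text \<open>Scaling dictates the exponents. The unknowns have weight \<open>r1\<close> = d - 1 + 2/p
  and the quadratic terms \<open>r2\<close> = d - 3 + 4/p. The semigroup regains the gap 2 - 2/p at
  the price (t - s)^(1/p - 1); against the factor s^(-2/p) of the source this is a convergent beta
  integral because p > 2. The weight on the density comes from capillarity: \<alpha> + \<kappa>
  |\<xi>|^2 is comparable with (1 + |\<xi>|)^2, so the coupling of b and w is skew in an equivalent
  norm and the third-order term costs only two powers of |\<xi>|. The obstacle is measurability. A
  solution is a curve of distributions whose Fourier transforms are functions chosen separately at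
  each time, so nothing is known jointly in (t, \<xi>). Existence constructs a jointly measurable
  function instead. Uniqueness must go through pairings, which calls for Fourier inversion on
  Schwartz functions and for a converse of the estimate under the integral sign. Testing one
  component at a time costs a factor 1 + d, and this factor enters the choice of the radius.\<close>

lemma nn_integral_lborel_scale_shift:
  fixes f :: "'a::euclidean_space \<Rightarrow> ennreal"
  assumes [measurable]: "f \<in> borel_measurable borel" and "c \<noteq> 0"
  shows "(\<integral>\<^sup>+x. f x \<partial>lborel) = ennreal (\<bar>c\<bar> ^ DIM('a)) * (\<integral>\<^sup>+x. f (t + c *\<^sub>R x) \<partial>lborel)"
  by (subst lborel_affine[OF \<open>c \<noteq> 0\<close>, of t])
     (simp add: nn_integral_density nn_integral_distr nn_integral_cmult)

lemma nn_integral_lborel_reflect: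
  fixes f :: "'a::euclidean_space \<Rightarrow> ennreal"
  assumes [measurable]: "f \<in> borel_measurable borel"
  shows "(\<integral>\<^sup>+x. f (a - x) \<partial>lborel) = (\<integral>\<^sup>+x. f x \<partial>lborel)"
  using nn_integral_lborel_scale_shift[of f "-1" a] by simp

text \<open>Supplies the index of the dyadic shell that contains a point, for the two power
  integrals that follow.\<close>

lemma dyadic_bracket:
  fixes x :: real
  assumes "x \<ge> 1"
  obtains k :: nat where "2 ^ k \<le> x" "x < 2 ^ Suc k"
proof -
  define k where "k = (LEAST n. x < 2 ^ Suc n)"
  have "\<exists>n. x < 2 ^ Suc n"
    using real_arch_pow[of 2 x] by (metis less_1_mult less_trans one_less_numeral_iff power_Suc mult_2 add_strict_increasing assms less_eq_real_def semiring_norm(76) power_strict_increasing lessI)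
  then have 1: "x < 2 ^ Suc k" unfolding k_def by (rule LeastI_ex)
  have "2 ^ k \<le> x"
  proof (cases k)
    case (Suc m)
    then have "\<not> x < 2 ^ Suc m" using not_less_Least[of m "\<lambda>n. x < 2 ^ Suc n"] by (simp add: k_def)
    then show ?thesis using Suc by simp
  qed (use assms in simp)
  with 1 show ?thesis using that by blast
qed

lemma ennreal_le_suminf: "f k \<le> (\<Sum>k. f k)" for f :: "nat \<Rightarrow> ennreal"
  using sum_le_suminf[of f "{k}"] by simp

text \<open>The shell between the radii R/2^(k+1) and R/2^k is enlarged to the full ball, which only
  costs a constant: the k-th term is a multiple of R^(d - a) q^k with q = 2^(a - d) < 1, and the
  geometric series is summed.\<close>

lemma nn_integral_near:
  assumes "0 \<le> a" "a < real DIM('a::euclidean_space)"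
  shows "\<exists>C\<ge>0. \<forall>R>0. (\<integral>\<^sup>+x\<in>cball 0 R. ennreal (norm (x::'a) powr - a) \<partial>lborel)
    \<le> ennreal (C * R powr (real DIM('a) - a))"
proof -
  let ?d = "real DIM('a)"
  let ?\<omega> = "unit_ball_vol ?d"
  define q where "q = 2 powr (a - ?d)"
  have q: "0 < q" "q < 1" using assms by (auto simp: q_def powr_less_one)
  have \<omega>: "?\<omega> \<ge> 0" by simp
  define C where "C = 2 powr a * ?\<omega> / (1 - q)"
  show ?thesis
  proof (intro exI[of _ C] conjI allI impI)
    show "C \<ge> 0" using q by (simp add: C_def)
    fix R :: real assume R: "R > 0"
    define s where "s k = R / 2 ^ k" for k :: nat
    have s: "s k > 0" for k using R by (simp add: s_def)
    have pt: "ennreal (norm x powr - a) * indicator (cball 0 R) x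
        \<le> (\<Sum>k. ennreal ((s k / 2) powr - a) * indicator (cball 0 (s k)) x)" for x :: 'a
    \<comment> \<open>The origin lies in no shell, but there the left side is 0 because
      \<open>0 powr - a = 0\<close>.\<close>
    proof (cases "x \<in> cball 0 R \<and> x \<noteq> 0")
      case True
      then have "R / norm x \<ge> 1" by simp
      then obtain k where k: "2 ^ k \<le> R / norm x" "R / norm x < 2 ^ Suc k"
        by (rule dyadic_bracket)
      have "norm x \<le> s k" "s k / 2 \<le> norm x"
        using k True R by (auto simp: s_def field_simps)
      then have "ennreal (norm x powr - a) * indicator (cball 0 R) x
        \<le> ennreal ((s k / 2) powr - a) * indicator (cball 0 (s k)) x"
        using True s[of k] assms by (auto intro!: ennreal_leI powr_mono2')
      also have "\<dots> \<le> (\<Sum>k. ennreal ((s k / 2) powr - a) * indicator (cball 0 (s k)) x)"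
        by (rule ennreal_le_suminf[of "\<lambda>k. ennreal ((s k / 2) powr - a) * indicator (cball 0 (s k)) x"])
      finally show ?thesis .
    qed auto
    have "(\<integral>\<^sup>+x\<in>cball 0 R. ennreal (norm (x::'a) powr - a) \<partial>lborel)
      \<le> (\<integral>\<^sup>+x. (\<Sum>k. ennreal ((s k / 2) powr - a) * indicator (cball 0 (s k)) (x::'a)) \<partial>lborel)"
      by (rule nn_integral_mono) (rule pt)
    also have "\<dots> = (\<Sum>k. \<integral>\<^sup>+x. ennreal ((s k / 2) powr - a) * indicator (cball 0 (s k)) (x::'a) \<partial>lborel)"
      by (rule nn_integral_suminf) (intro borel_measurable_times_ennreal borel_measurable_const borel_measurable_indicator sets_lborel[THEN equalityD2, THEN subsetD] borel_closed closed_cball)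
    also have "\<dots> = (\<Sum>k. ennreal ((s k / 2) powr - a * (?\<omega> * s k ^ DIM('a))))"
      by (intro suminf_cong, subst nn_integral_cmult_indicator) (use s in \<open>auto simp: emeasure_cball less_imp_le ennreal_mult\<close>)
    also have "\<dots> = (\<Sum>k. ennreal (2 powr a * ?\<omega> * R powr (?d - a) * q ^ k))"
    proof (intro suminf_cong arg_cong[where f = ennreal])
      fix k
      have e1: "s k = R * 2 powr - real k"
        using R by (simp add: s_def powr_minus powr_realpow divide_simps)
      have e2: "s k ^ DIM('a) = (s k) powr ?d" using s by (simp add: powr_realpow)
      have "(s k / 2) powr - a = 2 powr a * s k powr - a"
        using s[of k] by (simp add: powr_divide powr_minus divide_simps)
      then have "(s k / 2) powr - a * (?\<omega> * s k ^ DIM('a)) = 2 powr a * ?\<omega> * (s k powr - a * s k powr ?d)"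
        by (simp add: e2 algebra_simps)
      also have "s k powr - a * s k powr ?d = s k powr (?d - a)"
        by (simp add: powr_add[symmetric])
      also have "\<dots> = R powr (?d - a) * (2 powr (a - ?d)) powr real k"
        using R by (simp add: e1 powr_mult powr_powr algebra_simps)
      also have "(2 powr (a - ?d)) powr real k = q ^ k"
        using q by (simp add: q_def powr_realpow)
      finally show "(s k / 2) powr - a * (?\<omega> * s k ^ DIM('a)) = 2 powr a * ?\<omega> * R powr (?d - a) * q ^ k"
        by (simp add: algebra_simps)
    qed
    also have "\<dots> = ennreal (2 powr a * ?\<omega> * R powr (?d - a) * (1 / (1 - q)))"
    proof (rule suminf_ennreal_eq)
      show "(\<lambda>k. 2 powr a * ?\<omega> * R powr (?d - a) * q ^ k) sums (2 powr a * ?\<omega> * R powr (?d - a) * (1 / (1 - q)))"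
        using q by (intro sums_mult geometric_sums) auto
    qed (use q R in simp)
    also have "2 powr a * ?\<omega> * R powr (?d - a) * (1 / (1 - q)) = C * R powr (?d - a)" by (simp add: C_def)
    finally show "(\<integral>\<^sup>+x\<in>cball 0 R. ennreal (norm (x::'a) powr - a) \<partial>lborel) \<le> ennreal (C * R powr (?d - a))" .
  qed
qed

text \<open>The shells now run outwards from radius R; convergence comes from the opposite
  inequality a > d, with ratio 2^(d - a) < 1.\<close>

lemma nn_integral_far:
  assumes "real DIM('a::euclidean_space) < a"
  shows "\<exists>C\<ge>0. \<forall>R>0. (\<integral>\<^sup>+x\<in>- ball 0 R. ennreal (norm (x::'a) powr - a) \<partial>lborel)
    \<le> ennreal (C * R powr (real DIM('a) - a))"
proof -
  let ?d = "real DIM('a)"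
  let ?\<omega> = "unit_ball_vol ?d"
  define q where "q = 2 powr (?d - a)"
  have q: "0 < q" "q < 1" using assms by (auto simp: q_def powr_less_one)
  have \<omega>: "?\<omega> \<ge> 0" by simp
  define C where "C = 2 powr ?d * ?\<omega> / (1 - q)"
  show ?thesis
  proof (intro exI[of _ C] conjI allI impI)
    show "C \<ge> 0" using q by (simp add: C_def)
    fix R :: real assume R: "R > 0"
    define s where "s k = R * 2 ^ k" for k :: nat
    define t where "t k = 2 * s k" for k
    have s: "s k > 0" for k using R by (simp add: s_def)
    have t: "t k > 0" for k using s by (simp add: t_def)
    have pt: "ennreal (norm x powr - a) * indicator (- ball 0 R) x
        \<le> (\<Sum>k. ennreal (s k powr - a) * indicator (cball 0 (t k)) x)" for x :: 'a
    proof (cases "x \<in> - ball 0 R")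
      case True
      then have x: "norm x / R \<ge> 1" using R by simp
      then obtain k where k: "2 ^ k \<le> norm x / R" "norm x / R < 2 ^ Suc k"
        by (rule dyadic_bracket)
      have "norm x \<le> t k" "s k \<le> norm x"
        using k R by (auto simp: s_def t_def field_simps)
      then have "ennreal (norm x powr - a) * indicator (- ball 0 R) x
        \<le> ennreal (s k powr - a) * indicator (cball 0 (t k)) x"
        using True s[of k] assms by (auto intro!: ennreal_leI powr_mono2' simp: less_imp_le)
      also have "\<dots> \<le> (\<Sum>k. ennreal (s k powr - a) * indicator (cball 0 (t k)) x)"
        by (rule ennreal_le_suminf[of "\<lambda>k. ennreal (s k powr - a) * indicator (cball 0 (t k)) x"])
      finally show ?thesis .
    qed auto
    have "(\<integral>\<^sup>+x\<in>- ball 0 R. ennreal (norm (x::'a) powr - a) \<partial>lborel)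
      \<le> (\<integral>\<^sup>+x. (\<Sum>k. ennreal (s k powr - a) * indicator (cball 0 (t k)) (x::'a)) \<partial>lborel)"
      by (rule nn_integral_mono) (rule pt)
    also have "\<dots> = (\<Sum>k. \<integral>\<^sup>+x. ennreal (s k powr - a) * indicator (cball 0 (t k)) (x::'a) \<partial>lborel)"
      by (rule nn_integral_suminf) (intro borel_measurable_times_ennreal borel_measurable_const borel_measurable_indicator sets_lborel[THEN equalityD2, THEN subsetD] borel_closed closed_cball)
    also have "\<dots> = (\<Sum>k. ennreal (s k powr - a * (?\<omega> * t k ^ DIM('a))))"
      by (intro suminf_cong, subst nn_integral_cmult_indicator) (use t in \<open>auto simp: emeasure_cball less_imp_le ennreal_mult\<close>)
    also have "\<dots> = (\<Sum>k. ennreal (2 powr ?d * ?\<omega> * R powr (?d - a) * q ^ k))"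
    proof (intro suminf_cong arg_cong[where f = ennreal])
      fix k
      have e1: "s k = R * 2 powr real k"
        using R by (simp add: s_def powr_realpow)
      have e2: "t k ^ DIM('a) = 2 powr ?d * (s k) powr ?d"
        using s[of k] by (simp add: t_def powr_realpow power_mult_distrib)
      have "s k powr - a * (?\<omega> * t k ^ DIM('a)) = 2 powr ?d * ?\<omega> * (s k powr - a * s k powr ?d)"
        by (simp add: e2 algebra_simps)
      also have "s k powr - a * s k powr ?d = s k powr (?d - a)"
        by (simp add: powr_add[symmetric])
      also have "\<dots> = R powr (?d - a) * (2 powr (?d - a)) powr real k"
        using R by (simp add: e1 powr_mult powr_powr algebra_simps)
      also have "(2 powr (?d - a)) powr real k = q ^ k"
        using q by (simp add: q_def powr_realpow)
      finally show "s k powr - a * (?\<omega> * t k ^ DIM('a)) = 2 powr ?d * ?\<omega> * R powr (?d - a) * q ^ k"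
        by (simp add: algebra_simps)
    qed
    also have "\<dots> = ennreal (2 powr ?d * ?\<omega> * R powr (?d - a) * (1 / (1 - q)))"
    proof (rule suminf_ennreal_eq)
      show "(\<lambda>k. 2 powr ?d * ?\<omega> * R powr (?d - a) * q ^ k) sums (2 powr ?d * ?\<omega> * R powr (?d - a) * (1 / (1 - q)))"
        using q by (intro sums_mult geometric_sums) auto
    qed (use q R in simp)
    also have "2 powr ?d * ?\<omega> * R powr (?d - a) * (1 / (1 - q)) = C * R powr (?d - a)" by (simp add: C_def)
    finally show "(\<integral>\<^sup>+x\<in>- ball 0 R. ennreal (norm (x::'a) powr - a) \<partial>lborel) \<le> ennreal (C * R powr (?d - a))" .
  qed
qed

text \<open>Let R = |\<xi>|/2. In the ball of radius R about one singularity the other factor is at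
  most a power of R. Outside both balls |\<eta>| is at most 3 |\<xi> - \<eta>|, so the product is
  bounded by the single power |\<eta>|^(\<theta>1 + \<theta>2 - 2d), which is integrable at infinity
  because \<theta>1 + \<theta>2 < d.\<close>

lemma riesz_convolution:
  assumes "0 < \<theta>1" "0 < \<theta>2" "\<theta>1 + \<theta>2 < real DIM('a::euclidean_space)"
  shows "\<exists>C\<ge>0. \<forall>\<xi>::'a. \<xi> \<noteq> 0 \<longrightarrow>
    (\<integral>\<^sup>+\<eta>. ennreal (norm (\<xi> - \<eta>) powr (\<theta>1 - DIM('a)) * norm \<eta> powr (\<theta>2 - DIM('a))) \<partial>lborel)
    \<le> ennreal (C * norm \<xi> powr (\<theta>1 + \<theta>2 - DIM('a)))"
proof -
  let ?d = "real DIM('a)"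
  obtain C1 where C1: "C1 \<ge> 0" "\<And>R. R > 0 \<Longrightarrow> (\<integral>\<^sup>+x\<in>cball 0 R. ennreal (norm (x::'a) powr (\<theta>1 - ?d)) \<partial>lborel)
    \<le> ennreal (C1 * R powr \<theta>1)"
    using nn_integral_near[of "?d - \<theta>1", where 'a='a] assms by auto
  obtain C2 where C2: "C2 \<ge> 0" "\<And>R. R > 0 \<Longrightarrow> (\<integral>\<^sup>+x\<in>cball 0 R. ennreal (norm (x::'a) powr (\<theta>2 - ?d)) \<partial>lborel)
    \<le> ennreal (C2 * R powr \<theta>2)"
    using nn_integral_near[of "?d - \<theta>2", where 'a='a] assms by auto
  obtain C3 where C3: "C3 \<ge> 0" "\<And>R. R > 0 \<Longrightarrow> (\<integral>\<^sup>+x\<in>-ball 0 R. ennreal (norm (x::'a) powr (\<theta>1 + \<theta>2 - 2 * ?d)) \<partial>lborel)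
    \<le> ennreal (C3 * R powr (\<theta>1 + \<theta>2 - ?d))"
    using nn_integral_far[of "2 * ?d - \<theta>1 - \<theta>2", where 'a='a] assms by (auto simp: algebra_simps)
  \<comment> \<open>The factor (1/2)^(\<theta>1 + \<theta>2 - d) rewrites powers of R as powers of
    |\<xi>|; 3^(d - \<theta>1) pays for comparing |\<xi> - \<eta>| with |\<eta>| away from both
    singularities.\<close>
  define C where "C = (C1 + C2 + 3 powr (?d - \<theta>1) * C3) * (1/2) powr (\<theta>1 + \<theta>2 - ?d)"
  show ?thesis
  proof (intro exI[of _ C] conjI allI impI)
    show "C \<ge> 0" using C1 C2 C3 by (simp add: C_def)
    fix \<xi> :: 'a assume \<xi>: "\<xi> \<noteq> 0"
    define R where "R = norm \<xi> / 2"
    have R: "R > 0" using \<xi> by (simp add: R_def)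
    define f1 where "f1 x = ennreal (norm (x::'a) powr (\<theta>1 - ?d)) * indicator (cball 0 R) x" for x
    define f2 where "f2 x = ennreal (norm (x::'a) powr (\<theta>2 - ?d)) * indicator (cball 0 R) x" for x
    define f3 where "f3 x = ennreal (norm (x::'a) powr (\<theta>1 + \<theta>2 - 2 * ?d)) * indicator (- ball 0 R) x" for x
    have [measurable]: "cball 0 R \<in> sets (borel :: 'a measure)" "- ball 0 R \<in> sets (borel :: 'a measure)" by auto
    have [measurable]: "f1 \<in> borel_measurable borel" unfolding f1_def by measurable
    have [measurable]: "f2 \<in> borel_measurable borel" unfolding f2_def by measurable
    have [measurable]: "f3 \<in> borel_measurable borel" unfolding f3_def by measurable
    have pt: "ennreal (norm (\<xi> - \<eta>) powr (\<theta>1 - ?d) * norm \<eta> powr (\<theta>2 - ?d))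
      \<le> ennreal (R powr (\<theta>1 - ?d)) * f2 \<eta> + ennreal (R powr (\<theta>2 - ?d)) * f1 (\<xi> - \<eta>)
        + ennreal (3 powr (?d - \<theta>1)) * f3 \<eta>" (is "?L \<le> ?A + ?B + ?D") for \<eta>
    proof -
      have tri: "2 * R \<le> norm (\<xi> - \<eta>) + norm \<eta>"
        using norm_triangle_ineq[of "\<xi> - \<eta>" \<eta>] by (simp add: R_def)
      consider "\<eta> = \<xi> \<or> \<eta> = 0" | "norm \<eta> \<le> R" "\<eta> \<noteq> 0" | "norm (\<xi> - \<eta>) \<le> R" "\<eta> \<noteq> \<xi>"
        | "norm \<eta> > R" "norm (\<xi> - \<eta>) > R" by fastforce
      then show ?thesis
      proof cases
        case 1
        then have z: "norm (\<xi> - \<eta>) powr (\<theta>1 - ?d) * norm \<eta> powr (\<theta>2 - ?d) = 0" by auto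
        show ?thesis unfolding z by simp
      next
        case 2
        have "norm (\<xi> - \<eta>) powr (\<theta>1 - ?d) \<le> R powr (\<theta>1 - ?d)"
          using 2 tri R assms by (intro powr_mono2') auto
        then have "?L \<le> ?A"
          using 2 by (auto simp: f2_def ennreal_mult[symmetric] intro!: ennreal_leI mult_mono)
        then show ?thesis by (simp add: add.assoc add_increasing2)
      next
        case 3
        have "norm \<eta> powr (\<theta>2 - ?d) \<le> R powr (\<theta>2 - ?d)"
          using 3 tri R assms by (intro powr_mono2') auto
        then have "?L \<le> ?B"
          using 3 by (auto simp: f1_def ennreal_mult[symmetric] mult.commute intro!: ennreal_leI mult_mono)
        then show ?thesis by (metis add.commute add_increasing2 zero_le)
      next
        case 4
        have "norm \<eta> \<le> norm (\<xi> - \<eta>) + 2 * R"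
          using norm_triangle_ineq4[of \<xi> "\<xi> - \<eta>"] by (simp add: R_def)
        then have "norm \<eta> / 3 \<le> norm (\<xi> - \<eta>)" using 4 by simp
        then have "norm (\<xi> - \<eta>) powr (\<theta>1 - ?d) \<le> (norm \<eta> / 3) powr (\<theta>1 - ?d)"
          using 4 R assms by (intro powr_mono2') auto
        also have "\<dots> = 3 powr (?d - \<theta>1) * norm \<eta> powr (\<theta>1 - ?d)"
          using powr_minus_divide[of 3 "?d - \<theta>1"] by (simp add: powr_divide)
        finally have "norm (\<xi> - \<eta>) powr (\<theta>1 - ?d) * norm \<eta> powr (\<theta>2 - ?d)
          \<le> 3 powr (?d - \<theta>1) * (norm \<eta> powr (\<theta>1 - ?d) * norm \<eta> powr (\<theta>2 - ?d))"
          by (simp add: mult_right_mono flip: mult.assoc)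
        also have "norm \<eta> powr (\<theta>1 - ?d) * norm \<eta> powr (\<theta>2 - ?d) = norm \<eta> powr (\<theta>1 + \<theta>2 - 2 * ?d)"
          by (simp add: powr_add[symmetric])
        finally have "?L \<le> ?D"
          using 4 by (auto simp: f3_def ennreal_mult[symmetric] intro!: ennreal_leI)
        then show ?thesis by (simp add: add_increasing)
      qed
    qed
    have "(\<integral>\<^sup>+\<eta>. ennreal (norm (\<xi> - \<eta>) powr (\<theta>1 - ?d) * norm \<eta> powr (\<theta>2 - ?d)) \<partial>lborel)
      \<le> (\<integral>\<^sup>+\<eta>. ennreal (R powr (\<theta>1 - ?d)) * f2 \<eta> + ennreal (R powr (\<theta>2 - ?d)) * f1 (\<xi> - \<eta>)
        + ennreal (3 powr (?d - \<theta>1)) * f3 \<eta> \<partial>lborel)"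
      by (rule nn_integral_mono) (rule pt)
    also have "\<dots> = ennreal (R powr (\<theta>1 - ?d)) * (\<integral>\<^sup>+\<eta>. f2 \<eta> \<partial>lborel)
       + ennreal (R powr (\<theta>2 - ?d)) * (\<integral>\<^sup>+\<eta>. f1 \<eta> \<partial>lborel)
        + ennreal (3 powr (?d - \<theta>1)) * (\<integral>\<^sup>+\<eta>. f3 \<eta> \<partial>lborel)"
      by (simp add: nn_integral_add nn_integral_cmult nn_integral_lborel_reflect)
    also have "\<dots> \<le> ennreal (R powr (\<theta>1 - ?d)) * ennreal (C2 * R powr \<theta>2)
       + ennreal (R powr (\<theta>2 - ?d)) * ennreal (C1 * R powr \<theta>1)
        + ennreal (3 powr (?d - \<theta>1)) * ennreal (C3 * R powr (\<theta>1 + \<theta>2 - ?d))"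
      using C1(2)[OF R] C2(2)[OF R] C3(2)[OF R]
      by (intro add_mono mult_left_mono) (auto simp: f1_def f2_def f3_def)
    also have "\<dots> = ennreal (R powr (\<theta>1 - ?d) * (C2 * R powr \<theta>2)
       + R powr (\<theta>2 - ?d) * (C1 * R powr \<theta>1) + 3 powr (?d - \<theta>1) * (C3 * R powr (\<theta>1 + \<theta>2 - ?d)))"
      using C1(1) C2(1) C3(1) by (simp add: ennreal_mult)
    also have "R powr (\<theta>1 - ?d) * (C2 * R powr \<theta>2) = C2 * R powr (\<theta>1 + \<theta>2 - ?d)"
      by (simp add: powr_add[symmetric] algebra_simps)
    also have "R powr (\<theta>2 - ?d) * (C1 * R powr \<theta>1) = C1 * R powr (\<theta>1 + \<theta>2 - ?d)"
      by (simp add: powr_add[symmetric] algebra_simps)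
    also have "C2 * R powr (\<theta>1 + \<theta>2 - ?d) + C1 * R powr (\<theta>1 + \<theta>2 - ?d) + 3 powr (?d - \<theta>1) * (C3 * R powr (\<theta>1 + \<theta>2 - ?d))
      = (C1 + C2 + 3 powr (?d - \<theta>1) * C3) * R powr (\<theta>1 + \<theta>2 - ?d)" by (simp add: algebra_simps)
    also have "R powr (\<theta>1 + \<theta>2 - ?d) = norm \<xi> powr (\<theta>1 + \<theta>2 - ?d) * (1/2) powr (\<theta>1 + \<theta>2 - ?d)"
      by (simp add: R_def flip: powr_mult)
    finally show "(\<integral>\<^sup>+\<eta>. ennreal (norm (\<xi> - \<eta>) powr (\<theta>1 - ?d) * norm \<eta> powr (\<theta>2 - ?d)) \<partial>lborel)
       \<le> ennreal (C * norm \<xi> powr (\<theta>1 + \<theta>2 - ?d))" by (simp add: C_def algebra_simps)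
  qed
qed

section \<open>Schwartz functions\<close>

lemma coord_has_derivative: "((\<lambda>x::real^'d::finite. x $ i) has_derivative (\<lambda>h. h $ i)) F"
  by (rule bounded_linear_imp_has_derivative[OF bounded_linear_vec_nth])

text \<open>Membership in \<open>schwartz\<close> speaks about all iterated partial derivatives. A
  set that is stable under partial derivatives and whose members are differentiable and rapidly
  decaying contains every iterate, so each closure property reduces to exhibiting such a
  set.\<close>

lemma schwartz_coinduct:
  assumes "\<phi> \<in> A" "\<And>f. f \<in> A \<Longrightarrow> f differentiable_on UNIV" "\<And>f j. f \<in> A \<Longrightarrow> partial_deriv j f \<in> A"
    "\<And>f k. f \<in> A \<Longrightarrow> bounded (range (\<lambda>x. (1 + norm x) ^ k *\<^sub>R f x))"
  shows "\<phi> \<in> schwartz"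
proof -
  have "iter_partial js \<phi> \<in> A" for js by (induction js) (auto simp: iter_partial_def assms)
  then show ?thesis using assms by (auto simp: schwartz_def)
qed

lemma schwartz_iter_partial: "\<phi> \<in> schwartz \<Longrightarrow> iter_partial js \<phi> \<in> schwartz"
  by (auto simp: schwartz_def iter_partial_def simp flip: foldr_append)

lemma schwartz_partial_deriv: "\<phi> \<in> schwartz \<Longrightarrow> partial_deriv j \<phi> \<in> schwartz"
  using schwartz_iter_partial[of \<phi> "[j]"] by (simp add: iter_partial_def)

lemma partial_deriv_eqI: "(f has_derivative D) (at x) \<Longrightarrow> partial_deriv j f x = D (axis j 1)"
  unfolding partial_deriv_def using frechet_derivative_at by metis

lemma schwartz_differentiable: "\<phi> \<in> schwartz \<Longrightarrow> \<phi> differentiable (at x)"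
  by (auto simp: schwartz_def iter_partial_def differentiable_on_def dest: spec[of _ "[]"])

lemma vec_eq_sum_axis: "(h :: real^'d::finite) = (\<Sum>j\<in>UNIV. h $ j *\<^sub>R axis j 1)"
  by (simp add: vec_eq_iff axis_def if_distrib[of "\<lambda>c. _ * c"] cong: if_cong)

lemma schwartz_has_derivative:
  assumes "\<phi> \<in> schwartz"
  shows "(\<phi> has_derivative (\<lambda>h. \<Sum>j\<in>UNIV. of_real (h $ j) * partial_deriv j \<phi> x)) (at x)"
proof -
  have D: "(\<phi> has_derivative frechet_derivative \<phi> (at x)) (at x)"
    using schwartz_differentiable[OF assms] by (simp add: frechet_derivative_works)
  then have "bounded_linear (frechet_derivative \<phi> (at x))" by (rule has_derivative_bounded_linear)
  then interpret bounded_linear "frechet_derivative \<phi> (at x)" .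
  have "frechet_derivative \<phi> (at x) h = (\<Sum>j\<in>UNIV. of_real (h $ j) * partial_deriv j \<phi> x)" for h
    by (subst vec_eq_sum_axis[of h], simp only: sum scaleR partial_deriv_def) (simp add: scaleR_conv_of_real)
  then show ?thesis using D by presburger
qed

lemma schwartz_decay:
  assumes "\<phi> \<in> schwartz"
  obtains C where "C \<ge> 0" "\<And>x. (1 + norm x) ^ k * cmod (\<phi> x) \<le> C"
proof -
  have "bounded (range (\<lambda>x. (1 + norm x) ^ k *\<^sub>R \<phi> x))"
    using assms by (auto simp: schwartz_def iter_partial_def dest: spec[of _ "[]"])
  then obtain C where "\<And>x. norm ((1 + norm x) ^ k *\<^sub>R \<phi> x) \<le> C" by (auto simp: bounded_iff)
  then have C: "(1 + norm x) ^ k * cmod (\<phi> x) \<le> C" for x by simp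
  have "0 \<le> (1 + norm (0 :: real^'a)) ^ k * cmod (\<phi> 0)" by simp
  then have "C \<ge> 0" using C[of 0] by linarith
  with C show ?thesis using that by blast
qed

lemma schwartz_continuous: "\<phi> \<in> schwartz \<Longrightarrow> continuous_on UNIV \<phi>"
  using schwartz_differentiable differentiable_imp_continuous_within
  by (metis continuous_at_imp_continuous_on)

lemma schwartz_measurable: "\<phi> \<in> schwartz \<Longrightarrow> \<phi> \<in> borel_measurable borel"
  by (intro borel_measurable_continuous_onI schwartz_continuous)

lemma bounded_decayI:
  fixes f :: "real^'d::finite \<Rightarrow> complex"
  assumes "\<And>x. (1 + norm x) ^ k * cmod (f x) \<le> C"
  shows "bounded (range (\<lambda>x. (1 + norm x) ^ k *\<^sub>R f x))"
  using assms by (auto simp: bounded_iff intro!: exI[of _ C])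

lemma schwartz_lin_comb:
  assumes "\<phi> \<in> schwartz" "\<psi> \<in> schwartz"
  shows "(\<lambda>x. a * \<phi> x + b * \<psi> x) \<in> schwartz"
proof (rule schwartz_coinduct)
  let ?A = "{\<lambda>x. a * f x + b * g x |f g. f \<in> schwartz \<and> g \<in> schwartz}"
  show "(\<lambda>x. a * \<phi> x + b * \<psi> x) \<in> ?A" using assms by blast
  fix h assume "h \<in> ?A"
  then obtain f g where h: "h = (\<lambda>x. a * f x + b * g x)" and f: "f \<in> schwartz" and g: "g \<in> schwartz" by blast
  have D: "(h has_derivative (\<lambda>y. a * (\<Sum>j\<in>UNIV. of_real (y $ j) * partial_deriv j f x)
      + b * (\<Sum>j\<in>UNIV. of_real (y $ j) * partial_deriv j g x))) (at x)" for x
    unfolding h by (intro derivative_intros schwartz_has_derivative f g)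
  show "h differentiable_on UNIV" using D by (auto simp: differentiable_on_def differentiable_def intro: has_derivative_at_withinI)
  have "partial_deriv j h = (\<lambda>x. a * partial_deriv j f x + b * partial_deriv j g x)" for j
    by (rule ext, subst partial_deriv_eqI[OF D]) (simp add: axis_def if_distrib[of "\<lambda>c. c * _"] if_distrib[of "of_real"] cong: if_cong)
  then show "partial_deriv j h \<in> ?A" for j
    using schwartz_partial_deriv[OF f] schwartz_partial_deriv[OF g] by blast
  fix k
  obtain C where C: "\<And>x. (1 + norm x) ^ k * cmod (f x) \<le> C" using schwartz_decay[OF f] by metis
  obtain C' where C': "\<And>x. (1 + norm x) ^ k * cmod (g x) \<le> C'" using schwartz_decay[OF g] by metis
  show "bounded (range (\<lambda>x. (1 + norm x) ^ k *\<^sub>R h x))"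
  proof (rule bounded_decayI)
    fix x
    have "(1 + norm x) ^ k * cmod (h x) \<le> (1 + norm x) ^ k * (cmod a * cmod (f x) + cmod b * cmod (g x))"
      unfolding h by (intro mult_left_mono order_trans[OF norm_triangle_ineq]) (auto simp: norm_mult)
    also have "\<dots> = cmod a * ((1 + norm x) ^ k * cmod (f x)) + cmod b * ((1 + norm x) ^ k * cmod (g x))"
      by (simp add: algebra_simps)
    also have "\<dots> \<le> cmod a * C + cmod b * C'" by (intro add_mono mult_left_mono C C') auto
    finally show "(1 + norm x) ^ k * cmod (h x) \<le> cmod a * C + cmod b * C'" .
  qed
qed

lemma schwartz_cmult: "\<phi> \<in> schwartz \<Longrightarrow> (\<lambda>x. c * \<phi> x) \<in> schwartz"
  using schwartz_lin_comb[of \<phi> \<phi> c 0] by simp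

lemma schwartz_coord_mult:
  assumes "\<phi> \<in> schwartz"
  shows "(\<lambda>x. of_real (x $ i) * \<phi> x) \<in> schwartz"
proof (rule schwartz_coinduct)
  \<comment> \<open>Differentiating x_i g produces a summand without the factor x_i, so the stable
    set has to consist of sums.\<close>
  let ?A = "{\<lambda>x. f x + of_real (x $ i) * g x |f g. f \<in> schwartz \<and> g \<in> schwartz}"
  show "(\<lambda>x. of_real (x $ i) * \<phi> x) \<in> ?A"
    using assms schwartz_cmult[OF assms, of 0] by force
  fix h assume "h \<in> ?A"
  then obtain f g where h: "h = (\<lambda>x. f x + of_real (x $ i) * g x)" and f: "f \<in> schwartz" and g: "g \<in> schwartz" by blast
  have D: "(h has_derivative (\<lambda>y. (\<Sum>j\<in>UNIV. of_real (y $ j) * partial_deriv j f x)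
      + (of_real (x $ i) * (\<Sum>j\<in>UNIV. of_real (y $ j) * partial_deriv j g x) + of_real (y $ i) * g x))) (at x)" for x
    unfolding h by (auto intro!: derivative_eq_intros coord_has_derivative schwartz_has_derivative f g)
  show "h differentiable_on UNIV" using D by (auto simp: differentiable_on_def differentiable_def intro: has_derivative_at_withinI)
  have "partial_deriv j h = (\<lambda>x. (partial_deriv j f x + (if j = i then 1 else 0) * g x) + of_real (x $ i) * partial_deriv j g x)" for j
    by (rule ext, subst partial_deriv_eqI[OF D]) (auto simp: axis_def if_distrib[of "\<lambda>c. c * _"] if_distrib[of "of_real"] cong: if_cong)
  then show "partial_deriv j h \<in> ?A" for j
    using schwartz_lin_comb[OF schwartz_partial_deriv[OF f] g, of 1 _ "(if j = i then 1 else 0)"] schwartz_partial_deriv[OF g] by force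
  fix k
  obtain C where C: "\<And>x. (1 + norm x) ^ k * cmod (f x) \<le> C" using schwartz_decay[OF f] by metis
  obtain C' where C': "\<And>x. (1 + norm x) ^ Suc k * cmod (g x) \<le> C'" using schwartz_decay[OF g] by metis
  show "bounded (range (\<lambda>x. (1 + norm x) ^ k *\<^sub>R h x))"
  proof (rule bounded_decayI)
    fix x
    have "\<bar>x $ i\<bar> \<le> 1 + norm x" using component_le_norm_cart[of x i] by simp
    then have "(1 + norm x) ^ k * cmod (h x) \<le> (1 + norm x) ^ k * (cmod (f x) + (1 + norm x) * cmod (g x))"
      unfolding h by (intro mult_left_mono order_trans[OF norm_triangle_ineq]) (auto simp: norm_mult mult_right_mono)
    also have "\<dots> = ((1 + norm x) ^ k * cmod (f x)) + ((1 + norm x) ^ Suc k * cmod (g x))"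
      by (simp add: algebra_simps)
    also have "\<dots> \<le> C + C'" by (intro add_mono C C')
    finally show "(1 + norm x) ^ k * cmod (h x) \<le> C + C'" .
  qed
qed

lemma schwartz_reflect:
  assumes "\<phi> \<in> schwartz"
  shows "(\<lambda>x. \<phi> (- x)) \<in> schwartz"
proof (rule schwartz_coinduct)
  let ?A = "{\<lambda>x. f (- x) |f. f \<in> schwartz}"
  show "(\<lambda>x. \<phi> (- x)) \<in> ?A" using assms by blast
  fix h assume "h \<in> ?A"
  then obtain f where h: "h = (\<lambda>x. f (- x))" and f: "f \<in> schwartz" by blast
  have D: "(h has_derivative (\<lambda>y. \<Sum>j\<in>UNIV. of_real ((- y) $ j) * partial_deriv j f (- x))) (at x)" for x
    unfolding h by (rule has_derivative_compose[OF _ schwartz_has_derivative[OF f]]) (auto intro!: derivative_eq_intros)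
  show "h differentiable_on UNIV" using D by (auto simp: differentiable_on_def differentiable_def intro: has_derivative_at_withinI)
  have "partial_deriv j h = (\<lambda>x. (- 1) * partial_deriv j f (- x))" for j
    by (rule ext, subst partial_deriv_eqI[OF D]) (simp add: axis_def sum_negf if_distrib[of "\<lambda>c. c * _"] if_distrib[of "of_real"] cong: if_cong)
  then show "partial_deriv j h \<in> ?A" for j
    using schwartz_cmult[OF schwartz_partial_deriv[OF f], of "-1"] by force
  fix k
  obtain C where C: "\<And>x. (1 + norm x) ^ k * cmod (f x) \<le> C" using schwartz_decay[OF f] by metis
  show "bounded (range (\<lambda>x. (1 + norm x) ^ k *\<^sub>R h x))"
    using C[of "- _"] by (intro bounded_decayI[of _ _ C]) (auto simp: h)
qed

lemma power_le_fact_exp: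
  fixes x :: real
  assumes "x \<ge> 0"
  shows "x ^ k \<le> fact k * exp x"
proof -
  have "(\<Sum>n\<in>{k}. x ^ n /\<^sub>R fact n) \<le> (\<Sum>n. x ^ n /\<^sub>R fact n)"
    by (rule sum_le_suminf) (auto simp: assms summable_exp)
  then show ?thesis by (simp add: exp_def field_simps)
qed

text \<open>With r = |x - y|, the quantity 1 + |x| is at most (2 + |y|)(1 + r^2), and a power of c
  (1 + r^2) is dominated by its exponential. The Gaussian cancels all of that exponential except the
  constant exp c.\<close>

lemma gaussian_decay:
  assumes "c > 0"
  shows "\<exists>C. \<forall>x::'a::real_normed_vector. (1 + norm x) ^ k * exp (- c * (norm (x - y))\<^sup>2) \<le> C"
proof -
  have "(1 + norm x) ^ k * exp (- c * (norm (x - y))\<^sup>2)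
    \<le> (2 + norm y) ^ k * (exp c * (fact k / c ^ k))" for x
  proof -
    define r where "r = norm (x - y)"
    have r: "r \<ge> 0" by (simp add: r_def)
    have "norm x \<le> r + norm y" using norm_triangle_ineq[of "x - y" y] by (simp add: r_def)
    moreover have "r \<le> 1 + r\<^sup>2" using sum_squares_bound[of r 1] r by (simp add: power2_eq_square) 
    ultimately have "1 + norm x \<le> (2 + norm y) * (1 + r\<^sup>2)"
      by (simp add: algebra_simps) (smt (verit) mult_nonneg_nonneg norm_ge_zero zero_le_power2)
    then have "(1 + norm x) ^ k \<le> ((2 + norm y) * (1 + r\<^sup>2)) ^ k" by (intro power_mono) auto
    also have "\<dots> = (2 + norm y) ^ k * ((c * (1 + r\<^sup>2)) ^ k / c ^ k)"
      using assms by (simp add: power_mult_distrib)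
    also have "\<dots> \<le> (2 + norm y) ^ k * (fact k * exp (c * (1 + r\<^sup>2)) / c ^ k)"
      using assms by (intro mult_left_mono divide_right_mono power_le_fact_exp) auto
    finally have "(1 + norm x) ^ k * exp (- c * r\<^sup>2) \<le> (2 + norm y) ^ k * (fact k * exp (c * (1 + r\<^sup>2)) / c ^ k) * exp (- c * r\<^sup>2)"
      by (rule mult_right_mono) simp
    also have "\<dots> = (2 + norm y) ^ k * (fact k / c ^ k) * (exp (c * (1 + r\<^sup>2)) * exp (- c * r\<^sup>2))" by simp
    also have "exp (c * (1 + r\<^sup>2)) * exp (- c * r\<^sup>2) = exp c" by (simp add: exp_add[symmetric] algebra_simps)
    finally show ?thesis by (simp add: r_def mult_ac)
  qed
  then show ?thesis by blast
qed

text \<open>Gaussians times polynomials, given by generators: differentiating the Gaussian yields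
  factors x_j - y_j, so sums, multiples and coordinate factors are exactly what stability under
  partial derivatives calls for.\<close>

inductive_set gauss_poly :: "real \<Rightarrow> real^'d::finite \<Rightarrow> (real^'d \<Rightarrow> complex) set" for c y where
  gauss: "(\<lambda>x. of_real (exp (- c * (norm (x - y))\<^sup>2))) \<in> gauss_poly c y"
| add: "f \<in> gauss_poly c y \<Longrightarrow> g \<in> gauss_poly c y \<Longrightarrow> (\<lambda>x. f x + g x) \<in> gauss_poly c y"
| cmult: "f \<in> gauss_poly c y \<Longrightarrow> (\<lambda>x. a * f x) \<in> gauss_poly c y"
| coord: "f \<in> gauss_poly c y \<Longrightarrow> (\<lambda>x. of_real (x $ i) * f x) \<in> gauss_poly c y"

text \<open>The derivative field is part of the claim, so that one induction carries
  differentiability together with stability under partial derivatives.\<close>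

lemma gauss_poly_diff:
  assumes "f \<in> gauss_poly c y"
  shows "\<exists>D. (\<forall>x. (f has_derivative D x) (at x)) \<and> (\<forall>j. (\<lambda>x. D x (axis j 1)) \<in> gauss_poly c y)"
  using assms
proof induction
  case gauss
  let ?g = "\<lambda>x. complex_of_real (exp (- c * (norm (x - y))\<^sup>2))"
  have "(?g has_derivative (\<lambda>h. of_real (- 2 * c * ((x - y) \<bullet> h)) * ?g x)) (at x)" for x
    unfolding power2_norm_eq_inner
    by (auto intro!: derivative_eq_intros simp: inner_commute algebra_simps)
  moreover have "(\<lambda>x. of_real (- 2 * c * ((x - y) \<bullet> axis j 1)) * ?g x) \<in> gauss_poly c y" for j
  proof -
    have "(\<lambda>x. of_real (- 2 * c * ((x - y) \<bullet> axis j 1)) * ?g x)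
      = (\<lambda>x. of_real (- 2 * c) * (of_real (x $ j) * ?g x) + of_real (2 * c * y $ j) * ?g x)"
      by (auto simp: inner_axis algebra_simps fun_eq_iff)
    also have "\<dots> \<in> gauss_poly c y"
      by (intro gauss_poly.intros)
    finally show ?thesis .
  qed
  ultimately show ?case by (intro exI[of _ "\<lambda>x h. of_real (- 2 * c * ((x - y) \<bullet> h)) * ?g x"]) blast
next
  case (add f g)
  then obtain D E where "\<And>x. (f has_derivative D x) (at x)" "\<And>j. (\<lambda>x. D x (axis j 1)) \<in> gauss_poly c y"
    "\<And>x. (g has_derivative E x) (at x)" "\<And>j. (\<lambda>x. E x (axis j 1)) \<in> gauss_poly c y" by metis
  then show ?case by (intro exI[of _ "\<lambda>x h. D x h + E x h"]) (auto intro!: derivative_intros gauss_poly.intros)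
next
  case (cmult f a)
  then obtain D where "\<And>x. (f has_derivative D x) (at x)" "\<And>j. (\<lambda>x. D x (axis j 1)) \<in> gauss_poly c y" by metis
  then show ?case by (intro exI[of _ "\<lambda>x h. a * D x h"]) (auto intro!: derivative_intros gauss_poly.intros)
next
  case (coord f i)
  then obtain D where D: "\<And>x. (f has_derivative D x) (at x)" "\<And>j. (\<lambda>x. D x (axis j 1)) \<in> gauss_poly c y" by metis
  have "((\<lambda>x. of_real (x $ i) * f x) has_derivative (\<lambda>h. of_real (x $ i) * D x h + of_real (h $ i) * f x)) (at x)" for x
    by (auto intro!: derivative_eq_intros coord_has_derivative D)
  moreover have "(\<lambda>x. of_real (x $ i) * D x (axis j 1) + of_real (axis j (1::real) $ i) * f x) \<in> gauss_poly c y" for j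
    by (intro gauss_poly.intros D coord)
  ultimately show ?case by (intro exI[of _ "\<lambda>x h. of_real (x $ i) * D x h + of_real (h $ i) * f x"]) blast
qed

text \<open>The exponent \<open>k\<close> stays arbitrary in the induction because a coordinate
  factor is paid for with one more power of the weight.\<close>

lemma gauss_poly_decay:
  assumes "f \<in> gauss_poly c y" "c > 0"
  shows "\<exists>C. \<forall>x. (1 + norm x) ^ k * cmod (f x) \<le> C"
  using assms
proof (induction arbitrary: k)
  case gauss
  then show ?case using gaussian_decay[of c k y] by simp
next
  case (add f g)
  then obtain C D where C: "\<And>x. (1 + norm x) ^ k * cmod (f x) \<le> C" and D: "\<And>x. (1 + norm x) ^ k * cmod (g x) \<le> D" by metis
  have "(1 + norm x) ^ k * cmod (f x + g x) \<le> C + D" for x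
  proof -
    have "(1 + norm x) ^ k * cmod (f x + g x) \<le> (1 + norm x) ^ k * (cmod (f x) + cmod (g x))"
      by (intro mult_left_mono norm_triangle_ineq) simp
    also have "\<dots> = (1 + norm x) ^ k * cmod (f x) + (1 + norm x) ^ k * cmod (g x)" by (rule distrib_left)
    finally show ?thesis using C[of x] D[of x] by linarith
  qed
  then show ?case by blast
next
  case (cmult f a)
  then obtain C where "\<And>x. (1 + norm x) ^ k * cmod (f x) \<le> C" by metis
  then show ?case
    by (intro exI[of _ "cmod a * C"]) (auto simp: norm_mult mult.left_commute intro!: mult_left_mono)
next
  case (coord f i)
  then obtain C where C: "\<And>x. (1 + norm x) ^ Suc k * cmod (f x) \<le> C" by metis
  have "(1 + norm x) ^ k * cmod (of_real (x $ i) * f x) \<le> C" for x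
  proof -
    have "\<bar>x $ i\<bar> \<le> 1 + norm x" using component_le_norm_cart[of x i] by simp
    then have "(1 + norm x) ^ k * (\<bar>x $ i\<bar> * cmod (f x)) \<le> (1 + norm x) ^ k * ((1 + norm x) * cmod (f x))"
      by (intro mult_left_mono mult_right_mono) auto
    also have "\<dots> \<le> C" using C[of x] by (simp add: mult_ac)
    finally show ?thesis by (simp add: norm_mult)
  qed
  then show ?case by blast
qed

lemma gaussian_schwartz:
  assumes "c > 0"
  shows "(\<lambda>x. of_real (exp (- c * (norm (x - y))\<^sup>2))) \<in> schwartz"
proof (rule schwartz_coinduct[of _ "gauss_poly c y"])
  fix f :: "real^'a \<Rightarrow> complex" assume f: "f \<in> gauss_poly c y"
  then obtain D where D: "\<And>x. (f has_derivative D x) (at x)" "\<And>j. (\<lambda>x. D x (axis j 1)) \<in> gauss_poly c y"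
    using gauss_poly_diff by metis
  show "f differentiable_on UNIV" using D by (auto simp: differentiable_on_def differentiable_def intro: has_derivative_at_withinI)
  have "partial_deriv j f = (\<lambda>x. D x (axis j 1))" for j using partial_deriv_eqI[OF D(1)] by blast
  then show "partial_deriv j f \<in> gauss_poly c y" for j using D by simp
  show "bounded (range (\<lambda>x. (1 + norm x) ^ k *\<^sub>R f x))" for k
    using gauss_poly_decay[OF f assms, of k] bounded_decayI by metis
qed (rule gauss_poly.gauss)

lemma schwartz_norm_bound:
  assumes "\<phi> \<in> schwartz" "length js \<le> N"
  shows "(1 + norm x) ^ N * cmod (iter_partial js \<phi> x) \<le> schwartz_norm N \<phi>"
proof -
  \<comment> \<open>A real supremum only means something for a set bounded above, so boundedness
    precedes the comparison with \<open>SUP\<close>.\<close>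
  have bdd: "bdd_above (range (\<lambda>x. (1 + norm x) ^ N * cmod (iter_partial js \<phi> x)))" for js
  proof -
    obtain C where "\<And>x. (1 + norm x) ^ N * cmod (iter_partial js \<phi> x) \<le> C"
      using schwartz_decay[OF schwartz_iter_partial[OF assms(1)]] by metis
    then show ?thesis by (intro bdd_aboveI2[of _ _ C])
  qed
  have "(1 + norm x) ^ N * cmod (iter_partial js \<phi> x) \<le> (SUP x. (1 + norm x) ^ N * cmod (iter_partial js \<phi> x))" for js
    using bdd by (rule cSUP_upper[OF UNIV_I])
  moreover have "0 \<le> (SUP x. (1 + norm x) ^ N * cmod (iter_partial js \<phi> x))" for js
    by (rule order_trans[OF _ cSUP_upper[OF UNIV_I bdd, of 0]]) simp
  moreover have "finite {js :: 'a list. length js \<le> N}"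
    using finite_lists_length_le[of "UNIV :: 'a set" N] by simp
  ultimately show ?thesis unfolding schwartz_norm_def using assms(2)
    by (intro order_trans[OF _ member_le_sum[where i = js]]) auto
qed

section \<open>The Fourier transform of Schwartz functions\<close>

lemma one_plus_norm_power_pos [simp]: "0 < (1 + norm x) ^ n"
  by (intro zero_less_power add_pos_nonneg) auto

lemma integral_norm_le:
  fixes f :: "'a \<Rightarrow> 'b::{banach, second_countable_topology}"
  assumes "integrable M g" "\<And>x. norm (f x) \<le> g x"
  shows "norm (\<integral>x. f x \<partial>M) \<le> (\<integral>x. g x \<partial>M)"
  by (rule order_trans[OF integral_norm_bound], rule integral_mono')
    (use assms order_trans[OF norm_ge_zero assms(2)] in auto)

lemma integral_lborel_scale_shift:
  fixes f :: "'a::euclidean_space \<Rightarrow> 'b::{banach, second_countable_topology}"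
  assumes [measurable]: "f \<in> borel_measurable borel" and "c \<noteq> 0"
  shows "(\<integral>x. f x \<partial>lborel) = (\<bar>c\<bar> ^ DIM('a)) *\<^sub>R (\<integral>x. f (t + c *\<^sub>R x) \<partial>lborel)"
  by (subst lborel_affine[OF \<open>c \<noteq> 0\<close>, of t])
     (simp add: integral_density integral_distr)

lemma integrable_lborel_scale_shift:
  fixes f :: "'a::euclidean_space \<Rightarrow> 'b::{banach, second_countable_topology}"
  assumes f: "integrable lborel f" and "c \<noteq> 0"
  shows "integrable lborel (\<lambda>x. f (t + c *\<^sub>R x))"
proof -
  have [measurable]: "f \<in> borel_measurable borel" using borel_measurable_integrable[OF f] by simp
  have "integrable (density (distr lborel borel (\<lambda>x. t + c *\<^sub>R x)) (\<lambda>_. \<bar>c\<bar> ^ DIM('a))) f"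
    using f by (subst (asm) lborel_affine[OF \<open>c \<noteq> 0\<close>, of t])
  then have "integrable lborel (\<lambda>x. \<bar>c\<bar> ^ DIM('a) *\<^sub>R f (t + c *\<^sub>R x))"
    by (simp add: integrable_density integrable_distr_eq)
  then have "integrable lborel (\<lambda>x. (1 / \<bar>c\<bar> ^ DIM('a)) *\<^sub>R (\<bar>c\<bar> ^ DIM('a) *\<^sub>R f (t + c *\<^sub>R x)))"
    by (rule integrable_scaleR_right)
  then show ?thesis using \<open>c \<noteq> 0\<close> by simp
qed

text \<open>The singularity at the origin is integrable because r < d, and outside the unit ball at
  most |x|^-(d + 1) is left. Through this, a function bounded by C |\<xi>|^-r acts on Schwartz
  functions by integration.\<close>

lemma integrable_power_decay:
  assumes "0 \<le> r" "r < real DIM('a::euclidean_space)"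
  shows "integrable lborel (\<lambda>x::'a. norm x powr - r / (1 + norm x) ^ Suc DIM('a))"
proof (rule integrableI_bounded)
  obtain C1 where "\<And>R. R > 0 \<Longrightarrow> (\<integral>\<^sup>+x\<in>cball 0 R. ennreal (norm (x::'a) powr - r) \<partial>lborel) \<le> ennreal (C1 * R powr (real DIM('a) - r))"
    using nn_integral_near[OF assms] by blast
  from this[of 1] have C1: "(\<integral>\<^sup>+x\<in>cball 0 1. ennreal (norm (x::'a) powr - r) \<partial>lborel) \<le> ennreal C1" by simp
  have "real DIM('a) < real DIM('a) + 1" by simp
  from nn_integral_far[OF this] obtain C2 where "\<And>R. R > 0 \<Longrightarrow> (\<integral>\<^sup>+x\<in>- ball 0 R. ennreal (norm (x::'a) powr - (real DIM('a) + 1)) \<partial>lborel) \<le> ennreal (C2 * R powr (real DIM('a) - (real DIM('a) + 1)))"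
    by blast
  from this[of 1] have C2: "(\<integral>\<^sup>+x\<in>-ball 0 1. ennreal (norm (x::'a) powr - (real DIM('a) + 1)) \<partial>lborel) \<le> ennreal C2" by simp
  have [measurable]: "cball 0 1 \<in> sets (borel :: 'a measure)" "- ball 0 1 \<in> sets (borel :: 'a measure)" by auto
  have pt: "ennreal (norm (norm x powr - r / (1 + norm x) ^ Suc DIM('a)))
     \<le> ennreal (norm x powr - r) * indicator (cball 0 1) x + ennreal (norm x powr - (real DIM('a) + 1)) * indicator (- ball 0 1) x" for x :: 'a
  proof (cases "norm x \<le> 1")
    case True
    have "norm x powr - r / (1 + norm x) ^ Suc DIM('a) \<le> norm x powr - r / 1"
      by (intro divide_left_mono) (auto simp del: power_Suc)
    then have "ennreal (norm (norm x powr - r / (1 + norm x) ^ Suc DIM('a))) \<le> ennreal (norm x powr - r) * indicator (cball 0 1) x"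
      using True by (auto simp del: power_Suc intro!: ennreal_leI)
    then show ?thesis by (rule add_increasing2[rotated]) simp
  next
    case False
    have x0: "norm x > 0" "x \<noteq> 0" using False by auto
    have "norm x powr - r \<le> norm x powr 0" using False assms by (intro powr_mono) auto
    then have "norm x powr - r / (1 + norm x) ^ Suc DIM('a) \<le> 1 / norm x ^ Suc DIM('a)"
      using x0 by (intro frac_le power_mono zero_less_power) auto
    also have "\<dots> = norm x powr - (real DIM('a) + 1)"
    proof -
      have "norm x powr - (real DIM('a) + 1) = norm x powr - real (Suc DIM('a))" by (simp add: algebra_simps)
      also have "\<dots> = 1 / norm x ^ Suc DIM('a)"
        using x0 by (subst powr_minus_divide, subst powr_realpow) auto
      finally show ?thesis ..
    qed
    finally have "ennreal (norm (norm x powr - r / (1 + norm x) ^ Suc DIM('a)))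
       \<le> ennreal (norm x powr - (real DIM('a) + 1)) * indicator (- ball 0 1) x"
      using False by (auto simp del: power_Suc intro!: ennreal_leI)
    then show ?thesis by (rule add_increasing[rotated]) simp
  qed
  have "(\<integral>\<^sup>+x. ennreal (norm (norm (x::'a) powr - r / (1 + norm x) ^ Suc DIM('a))) \<partial>lborel)
    \<le> (\<integral>\<^sup>+x. ennreal (norm (x::'a) powr - r) * indicator (cball 0 1) x + ennreal (norm x powr - (real DIM('a) + 1)) * indicator (- ball 0 1) x \<partial>lborel)"
    by (intro nn_integral_mono pt)
  also have "\<dots> = (\<integral>\<^sup>+x\<in>cball 0 1. ennreal (norm (x::'a) powr - r) \<partial>lborel)
      + (\<integral>\<^sup>+x\<in>-ball 0 1. ennreal (norm (x::'a) powr - (real DIM('a) + 1)) \<partial>lborel)"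
    by (rule nn_integral_add) measurable
  also have "\<dots> \<le> ennreal C1 + ennreal C2" by (rule add_mono[OF C1 C2])
  also have "\<dots> < \<infinity>" by (simp add: ennreal_add_less_top)
  finally show "(\<integral>\<^sup>+x. ennreal (norm (norm (x::'a) powr - r / (1 + norm x) ^ Suc DIM('a))) \<partial>lborel) < \<infinity>" .
qed measurable

lemma integrable_decay: "integrable lborel (\<lambda>x::'a::euclidean_space. 1 / (1 + norm x) ^ Suc DIM('a))"
proof (rule integrable_cong_AE_imp[OF integrable_power_decay[of 0]])
  show "AE x in lborel. norm x powr - 0 / (1 + norm x) ^ Suc DIM('a) = 1 / (1 + norm (x::'a)) ^ Suc DIM('a)"
    using AE_lborel_singleton[of 0] by (rule AE_mp) (auto intro!: AE_I2)
qed (auto simp del: power_Suc)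

definition decay_mass :: "'a::euclidean_space itself \<Rightarrow> real" where
  "decay_mass _ = (\<integral>x. 1 / (1 + norm (x::'a)) ^ Suc DIM('a) \<partial>lborel)"

lemma decay_bound_integrable:
  fixes f :: "'a::euclidean_space \<Rightarrow> complex"
  assumes "f \<in> borel_measurable borel" "\<And>x. (1 + norm x) ^ Suc DIM('a) * cmod (f x) \<le> C"
  shows "integrable lborel f" "(\<integral>x. cmod (f x) \<partial>lborel) \<le> C * decay_mass TYPE('a)"
proof -
  have b: "cmod (f x) \<le> C * (1 / (1 + norm x) ^ Suc DIM('a))" for x
    using assms(2)[of x] by (simp add: field_simps del: power_Suc)
  have C: "0 \<le> C" using assms(2)[of 0] by (simp add: order_trans[OF norm_ge_zero])
  have i: "integrable lborel (\<lambda>x::'a. C * (1 / (1 + norm x) ^ Suc DIM('a)))"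
    using integrable_decay by (rule integrable_mult_right)
  then show 1: "integrable lborel f"
    by (rule Bochner_Integration.integrable_bound) (use b assms(1) C in \<open>auto simp del: power_Suc simp: abs_mult\<close>)
  have "(\<integral>x. cmod (f x) \<partial>lborel) \<le> (\<integral>x. C * (1 / (1 + norm (x::'a)) ^ Suc DIM('a)) \<partial>lborel)"
    by (rule integral_mono'[OF i b]) (use C in \<open>simp del: power_Suc\<close>)
  then show "(\<integral>x. cmod (f x) \<partial>lborel) \<le> C * decay_mass TYPE('a)"
    unfolding decay_mass_def by (simp only: integral_mult_right_zero)
qed

lemma schwartz_integrable:
  fixes \<phi> :: "real^'d::finite \<Rightarrow> complex"
  assumes "\<phi> \<in> schwartz" shows "integrable lborel \<phi>"
proof -
  obtain C where "\<And>x. (1 + norm x) ^ Suc DIM(real^'d) * cmod (\<phi> x) \<le> C"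
    using schwartz_decay[OF assms] by metis
  then show ?thesis by (rule decay_bound_integrable[OF schwartz_measurable[OF assms]])
qed

lemma fourier_integrand:
  assumes "\<phi> \<in> schwartz"
  shows "integrable lborel (\<lambda>x. cis (- (x \<bullet> \<xi>)) * \<phi> x)"
proof (rule Bochner_Integration.integrable_bound[OF schwartz_integrable[OF assms]])
  have "(\<lambda>x. cis (- (x \<bullet> \<xi>)) * \<phi> x) \<in> borel_measurable borel"
    by (intro borel_measurable_continuous_onI continuous_intros schwartz_continuous assms)
  then show "(\<lambda>x. cis (- (x \<bullet> \<xi>)) * \<phi> x) \<in> borel_measurable lborel" by simp
qed (simp add: norm_mult)

lemma norm_fourier_le: "\<phi> \<in> schwartz \<Longrightarrow> cmod (fourier \<phi> \<xi>) \<le> (\<integral>x. cmod (\<phi> x) \<partial>lborel)"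
  unfolding fourier_def
  by (rule order_trans[OF integral_norm_bound]) (simp add: norm_mult)

lemma cis_approx2: "cmod (cis x - 1 - \<i> * of_real x) \<le> x\<^sup>2"
proof -
  have "cmod (cis x - 1 - \<i> * of_real x) \<le> \<bar>x\<bar> ^ 2 / 2"
    using iexp_approx1[of x 1] by (simp add: cis_conv_exp numeral_2_eq_2 algebra_simps)
  also have "\<dots> \<le> x\<^sup>2" by simp
  finally show ?thesis .
qed

text \<open>A direct remainder estimate: |cis y - 1 - i y| is at most y^2, so the error at increment
  h is at most |h|^2 times the integral of |x|^2 |\<phi>(x)|.\<close>

lemma fourier_has_derivative:
  fixes \<phi> :: "real^'d::finite \<Rightarrow> complex"
  assumes "\<phi> \<in> schwartz"
  shows "(fourier \<phi> has_derivative (\<lambda>h. \<Sum>j\<in>UNIV. of_real (h $ j) * fourier (\<lambda>x. - \<i> * (of_real (x $ j) * \<phi> x)) \<xi>)) (at \<xi>)"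
    (is "(_ has_derivative ?D) _")
proof -
  have S: "(\<lambda>x. - \<i> * (of_real (x $ j) * \<phi> x)) \<in> schwartz" for j
    by (intro schwartz_cmult schwartz_coord_mult assms)
  have bl: "bounded_linear ?D"
    by (intro bounded_linear_sum bounded_linear_mult_const bounded_linear_compose[OF bounded_linear_of_real bounded_linear_vec_nth])
  \<comment> \<open>Two powers beyond the integrability threshold d + 1 absorb the factor |x|^2 of
    the second-order remainder.\<close>
  obtain C where C: "\<And>x. (1 + norm x) ^ (Suc DIM(real^'d) + 2) * cmod (\<phi> x) \<le> C"
    using schwartz_decay[OF assms] by metis
  define g where "g x = of_real ((norm x)\<^sup>2) * \<phi> x" for x
  have gm: "g \<in> borel_measurable borel" unfolding g_def
    by (intro borel_measurable_continuous_onI continuous_intros schwartz_continuous assms)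
  have gb: "(1 + norm x) ^ Suc DIM(real^'d) * cmod (g x) \<le> C" for x
  proof -
    have "(norm x)\<^sup>2 \<le> (1 + norm x)\<^sup>2" by (rule power_mono) auto
    then have "(1 + norm x) ^ Suc DIM(real^'d) * ((norm x)\<^sup>2 * cmod (\<phi> x))
      \<le> (1 + norm x) ^ Suc DIM(real^'d) * ((1 + norm x)\<^sup>2 * cmod (\<phi> x))"
      by (intro mult_left_mono mult_right_mono) (auto simp del: power_Suc)
    also have "\<dots> \<le> C" using C[of x] by (simp only: power_add mult.assoc)
    finally show ?thesis by (simp add: g_def norm_mult norm_power del: power_Suc)
  qed
  define K where "K = (\<integral>x. cmod (g x) \<partial>lborel)"
  have gi: "integrable lborel g" by (rule decay_bound_integrable[OF gm gb])
  have est: "cmod (fourier \<phi> (\<xi> + h) - fourier \<phi> \<xi> - ?D h) \<le> K * (norm h)\<^sup>2" for h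
  proof -
    have D: "?D h = (\<integral>x. cis (- (x \<bullet> \<xi>)) * (- \<i> * of_real (x \<bullet> h) * \<phi> x) \<partial>lborel)"
    proof -
      have "?D h = (\<Sum>j\<in>UNIV. \<integral>x. of_real (h $ j) * (cis (- (x \<bullet> \<xi>)) * (- \<i> * (of_real (x $ j) * \<phi> x))) \<partial>lborel)"
        by (simp add: fourier_def)
      also have "\<dots> = (\<integral>x. (\<Sum>j\<in>UNIV. of_real (h $ j) * (cis (- (x \<bullet> \<xi>)) * (- \<i> * (of_real (x $ j) * \<phi> x)))) \<partial>lborel)"
        by (rule Bochner_Integration.integral_sum[symmetric]) (rule integrable_mult_right[OF fourier_integrand[OF S]])
      also have "\<dots> = (\<integral>x. cis (- (x \<bullet> \<xi>)) * (- \<i> * of_real (x \<bullet> h) * \<phi> x) \<partial>lborel)"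
        by (rule Bochner_Integration.integral_cong) (auto simp: inner_vec_def sum_distrib_left sum_distrib_right algebra_simps)
      finally show ?thesis .
    qed
    have Di: "integrable lborel (\<lambda>x. cis (- (x \<bullet> \<xi>)) * (- \<i> * of_real (x \<bullet> h) * \<phi> x))"
    proof -
      have "integrable lborel (\<lambda>x. (\<Sum>j\<in>UNIV. of_real (h $ j) * (cis (- (x \<bullet> \<xi>)) * (- \<i> * (of_real (x $ j) * \<phi> x)))))"
        by (intro Bochner_Integration.integrable_sum integrable_mult_right fourier_integrand S)
      also have "(\<lambda>x. (\<Sum>j\<in>UNIV. of_real (h $ j) * (cis (- (x \<bullet> \<xi>)) * (- \<i> * (of_real (x $ j) * \<phi> x)))))
        = (\<lambda>x. cis (- (x \<bullet> \<xi>)) * (- \<i> * of_real (x \<bullet> h) * \<phi> x))"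
        by (auto simp: inner_vec_def sum_distrib_left sum_distrib_right algebra_simps fun_eq_iff)
      finally show ?thesis .
    qed
    have "fourier \<phi> (\<xi> + h) - fourier \<phi> \<xi> - ?D h =
      (\<integral>x. cis (- (x \<bullet> (\<xi> + h))) * \<phi> x - cis (- (x \<bullet> \<xi>)) * \<phi> x - cis (- (x \<bullet> \<xi>)) * (- \<i> * of_real (x \<bullet> h) * \<phi> x) \<partial>lborel)"
      unfolding D unfolding fourier_def
      by (subst Bochner_Integration.integral_diff[symmetric] | intro fourier_integrand assms Di Bochner_Integration.integrable_diff refl)+
    also have "cmod \<dots> \<le> (\<integral>x. (norm h)\<^sup>2 * cmod (g x) \<partial>lborel)"
    proof (rule integral_norm_le)
      show "integrable lborel (\<lambda>x. (norm h)\<^sup>2 * cmod (g x))" by (intro integrable_mult_right integrable_norm gi)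
      fix x
      have "cis (- (x \<bullet> (\<xi> + h))) * \<phi> x - cis (- (x \<bullet> \<xi>)) * \<phi> x - cis (- (x \<bullet> \<xi>)) * (- \<i> * of_real (x \<bullet> h) * \<phi> x)
        = cis (- (x \<bullet> \<xi>)) * (cis (- (x \<bullet> h)) - 1 - \<i> * of_real (- (x \<bullet> h))) * \<phi> x"
        using cis_mult[of "- (x \<bullet> \<xi>)" "- (x \<bullet> h)"] by (simp add: inner_add_right algebra_simps)
      also have "cmod \<dots> \<le> (- (x \<bullet> h))\<^sup>2 * cmod (\<phi> x)"
        unfolding norm_mult by (intro mult_right_mono) (use cis_approx2[of "- (x \<bullet> h)"] in auto)
      also have "(- (x \<bullet> h))\<^sup>2 \<le> (norm x * norm h)\<^sup>2"
        using Cauchy_Schwarz_ineq2[of x h] by (simp add: abs_le_square_iff[symmetric])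
      finally show "cmod (cis (- (x \<bullet> (\<xi> + h))) * \<phi> x - cis (- (x \<bullet> \<xi>)) * \<phi> x - cis (- (x \<bullet> \<xi>)) * (- \<i> * of_real (x \<bullet> h) * \<phi> x))
        \<le> (norm h)\<^sup>2 * cmod (g x)" by (simp add: g_def norm_mult norm_power mult_right_mono power_mult_distrib mult_ac)
    qed
    also have "\<dots> = K * (norm h)\<^sup>2" by (simp add: K_def)
    finally show ?thesis .
  qed
  show ?thesis unfolding has_derivative_at
  proof (intro conjI bl)
    show "((\<lambda>h. cmod (fourier \<phi> (\<xi> + h) - fourier \<phi> \<xi> - ?D h) / norm h) \<longlongrightarrow> 0) (at 0)"
    proof (rule Lim_null_comparison)
      show "\<forall>\<^sub>F h in at 0. norm (cmod (fourier \<phi> (\<xi> + h) - fourier \<phi> \<xi> - ?D h) / norm h) \<le> K * norm h"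
        by (rule always_eventually, rule allI, subst real_norm_def, subst abs_of_nonneg)
          (use est in \<open>auto simp: divide_simps power2_eq_square mult_ac\<close>)
      show "((\<lambda>h. K * norm h) \<longlongrightarrow> 0) (at (0::real^'d))"
        by (auto intro!: tendsto_eq_intros)
    qed
  qed
qed

lemma partial_deriv_fourier:
  assumes "\<phi> \<in> schwartz"
  shows "partial_deriv j (fourier \<phi>) = fourier (\<lambda>x. - \<i> * (of_real (x $ j) * \<phi> x))"
  by (rule ext, subst partial_deriv_eqI[OF fourier_has_derivative[OF assms]])
    (simp add: axis_def if_distrib[of "\<lambda>c. c * _"] if_distrib[of "of_real"] cong: if_cong)

lemma fourier_translate:
  assumes "\<phi> \<in> schwartz"
  shows "(\<integral>x. cis (- (x \<bullet> \<xi>)) * \<phi> (x + v) \<partial>lborel) = cis (v \<bullet> \<xi>) * fourier \<phi> \<xi>"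
proof -
  have [measurable]: "\<phi> \<in> borel_measurable borel" by (rule schwartz_measurable[OF assms])
  have m: "(\<lambda>x. cis (- (x \<bullet> \<xi>)) * \<phi> x) \<in> borel_measurable borel"
    by (intro borel_measurable_continuous_onI continuous_intros schwartz_continuous assms)
  have "cis (v \<bullet> \<xi>) * fourier \<phi> \<xi> = cis (v \<bullet> \<xi>) * (\<integral>x. cis (- ((v + x) \<bullet> \<xi>)) * \<phi> (v + x) \<partial>lborel)"
    unfolding fourier_def using integral_lborel_scale_shift[OF m, of 1 v] by simp
  also have "\<dots> = (\<integral>x. cis (v \<bullet> \<xi>) * (cis (- ((v + x) \<bullet> \<xi>)) * \<phi> (v + x)) \<partial>lborel)" by simp
  also have "\<dots> = (\<integral>x. cis (- (x \<bullet> \<xi>)) * \<phi> (x + v) \<partial>lborel)"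
    by (rule Bochner_Integration.integral_cong) (simp_all add: inner_add_left cis_mult add.commute flip: mult.assoc)
  finally show ?thesis ..
qed

text \<open>Integration by parts is replaced by translation. The transform of the difference
  quotient of \<phi> in direction j is (cis (t \<xi>_j) - 1)/t times
  \<open>fourier \<phi> \<xi>\<close>, and dominated convergence as t tends to 0 identifies both
  limits.\<close>

lemma fourier_partial_deriv:
  fixes \<phi> :: "real^'d::finite \<Rightarrow> complex"
  assumes "\<phi> \<in> schwartz"
  shows "fourier (partial_deriv j \<phi>) \<xi> = \<i> * of_real (\<xi> $ j) * fourier \<phi> \<xi>"
proof -
  let ?e = "axis j 1 :: real^'d"
  define t where "t n = 1 / real (Suc n)" for n
  have t: "0 < t n" "t n \<le> 1" for n by (auto simp: t_def)
  have t0: "t \<longlonglongrightarrow> 0" unfolding t_def by (rule lim_1_over_n[THEN LIMSEQ_Suc])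
  have pS: "partial_deriv j \<phi> \<in> schwartz" by (rule schwartz_partial_deriv[OF assms])
  obtain C where C: "C \<ge> 0" "\<And>x. (1 + norm x) ^ Suc DIM(real^'d) * cmod (partial_deriv j \<phi> x) \<le> C"
    using schwartz_decay[OF pS] by metis
  define dq where "dq n x = (\<phi> (x + t n *\<^sub>R ?e) - \<phi> x) /\<^sub>R t n" for n x
  have der: "((\<lambda>s. \<phi> (x + s *\<^sub>R ?e)) has_derivative (\<lambda>h. of_real h * partial_deriv j \<phi> (x + s *\<^sub>R ?e))) (at s within T)" for x s T
  proof -
    have "((\<lambda>s. \<phi> (x + s *\<^sub>R ?e)) has_derivative (\<lambda>h. \<Sum>i\<in>UNIV. of_real ((h *\<^sub>R ?e) $ i) * partial_deriv i \<phi> (x + s *\<^sub>R ?e))) (at s within T)"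
      by (rule has_derivative_compose[OF _ schwartz_has_derivative[OF assms]]) (auto intro!: derivative_eq_intros)
    then show ?thesis
      by (simp add: axis_def if_distrib[of "\<lambda>c. c * _"] if_distrib[of "\<lambda>c. _ * c"] if_distrib[of "of_real"] cong: if_cong)
  qed
  \<comment> \<open>Mean value inequality along the segment from x to x + t e_j. As t is at most 1,
    moving along it changes the weight 1 + |x| by a factor of at most 2, whence 2^(d + 1).\<close>
  have bound: "cmod (dq n x) \<le> (2 ^ Suc DIM(real^'d) * C) * (1 / (1 + norm x) ^ Suc DIM(real^'d))" for n x
  proof -
    let ?B = "(2 ^ Suc DIM(real^'d) * C) * (1 / (1 + norm x) ^ Suc DIM(real^'d))"
    have "norm (\<phi> (x + t n *\<^sub>R ?e) - \<phi> (x + 0 *\<^sub>R ?e)) \<le> ?B * norm (t n - 0)"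
    proof (rule differentiable_bound[of "{0..t n}"])
      fix s assume s: "s \<in> {0..t n}"
      let ?z = "x + s *\<^sub>R ?e"
      have "norm x \<le> norm ?z + 1" using norm_triangle_ineq4[of ?z "s *\<^sub>R ?e"] s t(2)[of n] by simp
      moreover have "a \<le> b + 1 \<Longrightarrow> 0 \<le> b \<Longrightarrow> 1 + a \<le> 2 * (1 + b)" for a b :: real by simp
      ultimately have "1 + norm x \<le> 2 * (1 + norm ?z)" using norm_ge_zero by blast
      then have "(1 + norm x) ^ Suc DIM(real^'d) \<le> (2 * (1 + norm ?z)) ^ Suc DIM(real^'d)"
        by (intro power_mono) auto
      then have "(1 + norm x) ^ Suc DIM(real^'d) * cmod (partial_deriv j \<phi> ?z)
        \<le> (2 * (1 + norm ?z)) ^ Suc DIM(real^'d) * cmod (partial_deriv j \<phi> ?z)" by (rule mult_right_mono) simp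
      also have "\<dots> = 2 ^ Suc DIM(real^'d) * ((1 + norm ?z) ^ Suc DIM(real^'d) * cmod (partial_deriv j \<phi> ?z))"
        by (simp only: power_mult_distrib mult.assoc)
      also have "\<dots> \<le> 2 ^ Suc DIM(real^'d) * C" using C(2)[of ?z] by (intro mult_left_mono) auto
      finally have "cmod (partial_deriv j \<phi> ?z) \<le> ?B"
        by (subst mult.commute[of _ "1 / _"]) (simp add: field_simps del: power_Suc)
      then show "onorm (\<lambda>h. complex_of_real h * partial_deriv j \<phi> ?z) \<le> ?B"
        by (intro onorm_le, unfold norm_mult norm_of_real real_norm_def, subst mult.commute, intro mult_right_mono) auto
    qed (use t(1)[of n] der in auto)
    moreover have "cmod (dq n x) = cmod (\<phi> (x + t n *\<^sub>R ?e) - \<phi> x) / t n"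
      using t(1)[of n] by (simp add: dq_def divide_inverse mult.commute)
    ultimately show ?thesis using t(1)[of n] by (simp add: pos_divide_le_eq del: power_Suc)
  qed
  have lim: "(\<lambda>n. dq n x) \<longlonglongrightarrow> partial_deriv j \<phi> x" for x
  proof -
    let ?r = "\<lambda>h. norm (\<phi> (x + (0 + h) *\<^sub>R ?e) - \<phi> (x + 0 *\<^sub>R ?e) - of_real h * partial_deriv j \<phi> (x + 0 *\<^sub>R ?e)) / norm h"
    have "(?r \<longlongrightarrow> 0) (at 0)"
      using der[of x 0 UNIV] unfolding has_derivative_at by blast
    then have "(\<lambda>n. ?r (t n)) \<longlonglongrightarrow> 0"
      by (rule filterlim_compose) (use t0 t(1) in \<open>auto simp: filterlim_at intro!: always_eventually less_imp_neq[symmetric]\<close>)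
    also have "(\<lambda>n. ?r (t n)) = (\<lambda>n. norm (dq n x - partial_deriv j \<phi> x))"
    proof
      fix n
      have "dq n x - partial_deriv j \<phi> x = (\<phi> (x + t n *\<^sub>R ?e) - \<phi> x - of_real (t n) * partial_deriv j \<phi> x) /\<^sub>R t n"
        using t(1)[of n] by (simp add: dq_def scaleR_conv_of_real field_simps)
      then show "?r (t n) = norm (dq n x - partial_deriv j \<phi> x)" using t(1)[of n] by (simp add: divide_inverse mult.commute)
    qed
    finally show ?thesis by (rule LIM_zero_cancel[OF tendsto_norm_zero_cancel])
  qed
  have sh: "continuous_on UNIV (\<lambda>x. \<phi> (x + v))" for v
    by (rule continuous_on_compose2[OF schwartz_continuous[OF assms]]) (auto intro!: continuous_intros)
  have m1: "(\<lambda>x. cis (- (x \<bullet> \<xi>)) * \<phi> (x + v)) \<in> borel_measurable borel" for v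
    by (intro borel_measurable_continuous_onI continuous_intros sh)
  have ti: "integrable lborel (\<lambda>x. cis (- (x \<bullet> \<xi>)) * \<phi> (x + v))" for v
  proof -
    have "integrable lborel (\<lambda>x. \<phi> (x + v))"
      using integrable_lborel_scale_shift[OF schwartz_integrable[OF assms], of 1 v] by (simp add: add.commute[of v])
    moreover have "(\<lambda>x. cis (- (x \<bullet> \<xi>)) * \<phi> (x + v)) \<in> borel_measurable lborel" using m1 by simp
    moreover have "AE x in lborel. norm (cis (- (x \<bullet> \<xi>)) * \<phi> (x + v)) \<le> norm (\<phi> (x + v))" by (simp add: norm_mult)
    ultimately show ?thesis by (rule Bochner_Integration.integrable_bound)
  qed
  have eq: "(\<integral>x. cis (- (x \<bullet> \<xi>)) * dq n x \<partial>lborel) = (cis (t n * \<xi> $ j) - 1) /\<^sub>R t n * fourier \<phi> \<xi>" for n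
  proof -
    have "(\<integral>x. cis (- (x \<bullet> \<xi>)) * dq n x \<partial>lborel) =
      (\<integral>x. (cis (- (x \<bullet> \<xi>)) * \<phi> (x + t n *\<^sub>R ?e) - cis (- (x \<bullet> \<xi>)) * \<phi> (x + 0)) /\<^sub>R t n \<partial>lborel)"
      by (rule Bochner_Integration.integral_cong) (auto simp: dq_def algebra_simps)
    also have "\<dots> = (cis ((t n *\<^sub>R ?e) \<bullet> \<xi>) * fourier \<phi> \<xi> - cis (0 \<bullet> \<xi>) * fourier \<phi> \<xi>) /\<^sub>R t n"
      by (simp only: integral_scaleR_right Bochner_Integration.integral_diff[OF ti ti] fourier_translate[OF assms])
    also have "(t n *\<^sub>R ?e) \<bullet> \<xi> = t n * \<xi> $ j" by (simp add: inner_commute[of ?e] inner_axis)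
    finally show ?thesis by (simp add: algebra_simps)
  qed
  have "(\<lambda>n. \<integral>x. cis (- (x \<bullet> \<xi>)) * dq n x \<partial>lborel) \<longlonglongrightarrow> (\<integral>x. cis (- (x \<bullet> \<xi>)) * partial_deriv j \<phi> x \<partial>lborel)"
  proof (rule integral_dominated_convergence[where w = "\<lambda>x. (2 ^ Suc DIM(real^'d) * C) * (1 / (1 + norm x) ^ Suc DIM(real^'d))"])
    have "(\<lambda>x. cis (- (x \<bullet> \<xi>)) * partial_deriv j \<phi> x) \<in> borel_measurable borel"
      by (intro borel_measurable_continuous_onI continuous_intros schwartz_continuous pS)
    then show "(\<lambda>x. cis (- (x \<bullet> \<xi>)) * partial_deriv j \<phi> x) \<in> borel_measurable lborel" by simp
    have "(\<lambda>x. cis (- (x \<bullet> \<xi>)) * dq n x) \<in> borel_measurable borel" for n unfolding dq_def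
      by (intro borel_measurable_continuous_onI continuous_intros schwartz_continuous assms sh)
    then show "(\<lambda>x. cis (- (x \<bullet> \<xi>)) * dq n x) \<in> borel_measurable lborel" for n by simp
    show "integrable lborel (\<lambda>x. (2 ^ Suc DIM(real^'d) * C) * (1 / (1 + norm (x::real^'d)) ^ Suc DIM(real^'d)))"
      by (intro integrable_mult_right integrable_decay)
    show "AE x in lborel. (\<lambda>n. cis (- (x \<bullet> \<xi>)) * dq n x) \<longlonglongrightarrow> cis (- (x \<bullet> \<xi>)) * partial_deriv j \<phi> x"
      by (intro AE_I2 tendsto_intros lim)
    show "AE x in lborel. norm (cis (- (x \<bullet> \<xi>)) * dq n x) \<le> (2 ^ Suc DIM(real^'d) * C) * (1 / (1 + norm x) ^ Suc DIM(real^'d))" for n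
      unfolding norm_mult norm_cis mult_1 by (intro AE_I2 bound)
  qed
  moreover have "(\<lambda>n. (cis (t n * \<xi> $ j) - 1) /\<^sub>R t n * fourier \<phi> \<xi>) \<longlonglongrightarrow> \<i> * of_real (\<xi> $ j) * fourier \<phi> \<xi>"
  proof (intro tendsto_mult tendsto_const)
    show "(\<lambda>n. (cis (t n * \<xi> $ j) - 1) /\<^sub>R t n) \<longlonglongrightarrow> \<i> * of_real (\<xi> $ j)"
    proof (rule LIM_zero_cancel, rule Lim_null_comparison)
      show "\<forall>\<^sub>F n in sequentially. cmod ((cis (t n * \<xi> $ j) - 1) /\<^sub>R t n - \<i> * of_real (\<xi> $ j)) \<le> t n * (\<xi> $ j)\<^sup>2"
      proof (intro always_eventually allI)
        fix n
        have "(cis (t n * \<xi> $ j) - 1) /\<^sub>R t n - \<i> * of_real (\<xi> $ j) = (cis (t n * \<xi> $ j) - 1 - \<i> * of_real (t n * \<xi> $ j)) /\<^sub>R t n"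
          using t(1)[of n] by (simp add: scaleR_conv_of_real field_simps)
        also have "cmod \<dots> \<le> (t n * \<xi> $ j)\<^sup>2 / t n"
          using cis_approx2[of "t n * \<xi> $ j"] t(1)[of n] by (simp add: divide_simps mult_ac)
        finally show "cmod ((cis (t n * \<xi> $ j) - 1) /\<^sub>R t n - \<i> * of_real (\<xi> $ j)) \<le> t n * (\<xi> $ j)\<^sup>2"
          using t(1)[of n] by (simp add: power2_eq_square mult_ac)
      qed
      show "(\<lambda>n. t n * (\<xi> $ j)\<^sup>2) \<longlonglongrightarrow> 0" using tendsto_mult_right[OF t0] by simp
    qed
  qed
  ultimately show ?thesis unfolding eq fourier_def[of "partial_deriv j \<phi>"] by (rule LIMSEQ_unique)
qed

text \<open>Each power of the weight is traded for a derivative: 1 + |\<xi>| is at most 1 plus the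
  sum of the |\<xi>_j|, and |\<xi>_j| times the transform is the transform of a further partial
  derivative. Hence the factor (1 + d) per power, and the index list that grows while
  \<open>k\<close> decreases.\<close>

lemma fourier_decay_iter:
  fixes \<phi> :: "real^'d::finite \<Rightarrow> complex"
  assumes "\<phi> \<in> schwartz" "length js + k \<le> N" "Suc DIM(real^'d) \<le> N"
  shows "(1 + norm \<xi>) ^ k * cmod (fourier (iter_partial js \<phi>) \<xi>)
    \<le> (1 + real CARD('d)) ^ k * decay_mass TYPE(real^'d) * schwartz_norm N \<phi>"
  using assms(2)
proof (induction k arbitrary: js)
  case 0
  have S: "iter_partial js \<phi> \<in> schwartz" by (rule schwartz_iter_partial[OF assms(1)])
  have "(1 + norm x) ^ Suc DIM(real^'d) * cmod (iter_partial js \<phi> x) \<le> schwartz_norm N \<phi>" for x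
  proof -
    have "(1 + norm x) ^ Suc DIM(real^'d) * cmod (iter_partial js \<phi> x) \<le> (1 + norm x) ^ N * cmod (iter_partial js \<phi> x)"
      by (intro mult_right_mono power_increasing assms) auto
    also have "\<dots> \<le> schwartz_norm N \<phi>" using 0 by (intro schwartz_norm_bound assms) auto
    finally show ?thesis .
  qed
  then have "(\<integral>x. cmod (iter_partial js \<phi> x) \<partial>lborel) \<le> schwartz_norm N \<phi> * decay_mass TYPE(real^'d)"
    by (rule decay_bound_integrable(2)[OF schwartz_measurable[OF S]])
  with norm_fourier_le[OF S, of \<xi>] show ?case by (simp add: mult.commute)
next
  case (Suc k)
  let ?f = "iter_partial js \<phi>"
  have S: "?f \<in> schwartz" by (rule schwartz_iter_partial[OF assms(1)])
  let ?B = "(1 + real CARD('d)) ^ k * decay_mass TYPE(real^'d) * schwartz_norm N \<phi>"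
  have j: "(1 + norm \<xi>) ^ k * (\<bar>\<xi> $ j\<bar> * cmod (fourier ?f \<xi>)) \<le> ?B" for j
  proof -
    have "fourier (iter_partial (j # js) \<phi>) \<xi> = \<i> * of_real (\<xi> $ j) * fourier ?f \<xi>"
      using fourier_partial_deriv[OF S, of j \<xi>] by (simp add: iter_partial_def)
    moreover have "(1 + norm \<xi>) ^ k * cmod (fourier (iter_partial (j # js) \<phi>) \<xi>) \<le> ?B"
      using Suc.prems by (intro Suc.IH) simp
    ultimately show ?thesis by (simp only: norm_mult norm_of_real norm_ii mult_1)
  qed
  have 0: "(1 + norm \<xi>) ^ k * cmod (fourier ?f \<xi>) \<le> ?B" using Suc.prems by (intro Suc.IH) simp
  have "(1 + norm \<xi>) ^ Suc k * cmod (fourier ?f \<xi>)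
    \<le> (1 + norm \<xi>) ^ k * ((1 + (\<Sum>j\<in>UNIV. \<bar>\<xi> $ j\<bar>)) * cmod (fourier ?f \<xi>))"
    unfolding power_Suc2 mult.assoc by (intro mult_left_mono mult_right_mono add_left_mono norm_le_l1_cart) auto
  also have "\<dots> = (1 + norm \<xi>) ^ k * cmod (fourier ?f \<xi>) + (\<Sum>j\<in>UNIV. (1 + norm \<xi>) ^ k * (\<bar>\<xi> $ j\<bar> * cmod (fourier ?f \<xi>)))"
    by (simp add: algebra_simps sum_distrib_left sum_distrib_right)
  also have "\<dots> \<le> ?B + (\<Sum>j\<in>(UNIV::'d set). ?B)" by (intro add_mono sum_mono j 0)
  finally show ?case by (simp add: algebra_simps)
qed

lemma fourier_decay:
  "\<exists>C\<ge>0. \<exists>N. \<forall>\<phi>\<in>(schwartz :: (real^'d::finite \<Rightarrow> complex) set). \<forall>\<xi>. (1 + norm \<xi>) ^ k * cmod (fourier \<phi> \<xi>) \<le> C * schwartz_norm N \<phi>"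
proof (intro exI conjI ballI allI)
  show "0 \<le> (1 + real CARD('d)) ^ k * decay_mass TYPE(real^'d)"
    unfolding decay_mass_def by (intro mult_nonneg_nonneg integral_nonneg_AE AE_I2) auto
  fix \<phi> :: "real^'d \<Rightarrow> complex" and \<xi> assume \<phi>: "\<phi> \<in> schwartz"
  show "(1 + norm \<xi>) ^ k * cmod (fourier \<phi> \<xi>) \<le> (1 + real CARD('d)) ^ k * decay_mass TYPE(real^'d) * schwartz_norm (k + Suc DIM(real^'d)) \<phi>"
    using fourier_decay_iter[OF \<phi>, of "[]" k "k + Suc DIM(real^'d)" \<xi>] by (simp add: iter_partial_def)
qed

text \<open>The set of all Fourier transforms of Schwartz functions is itself stable under partial
  derivatives, because differentiation on the frequency side is multiplication by - i x_j before
  transforming.\<close>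

lemma fourier_schwartz:
  fixes \<phi> :: "real^'d::finite \<Rightarrow> complex"
  assumes "\<phi> \<in> schwartz" shows "fourier \<phi> \<in> schwartz"
proof (rule schwartz_coinduct[of _ "fourier ` schwartz"])
  fix f :: "real^'d \<Rightarrow> complex" assume "f \<in> fourier ` schwartz"
  then obtain \<psi> where \<psi>: "\<psi> \<in> schwartz" "f = fourier \<psi>" by blast
  show "f differentiable_on UNIV" using fourier_has_derivative[OF \<psi>(1)]
    by (auto simp: \<psi>(2) differentiable_on_def differentiable_def)
  show "partial_deriv j f \<in> fourier ` schwartz" for j
    unfolding \<psi>(2) partial_deriv_fourier[OF \<psi>(1)]
    by (intro imageI schwartz_cmult schwartz_coord_mult \<psi>)
  show "bounded (range (\<lambda>x. (1 + norm x) ^ k *\<^sub>R f x))" for k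
  proof -
    obtain C N where C: "\<And>\<phi> \<xi>. \<phi> \<in> schwartz \<Longrightarrow> (1 + norm \<xi>) ^ k * cmod (fourier \<phi> \<xi>) \<le> C * schwartz_norm N (\<phi> :: real^'d \<Rightarrow> complex)"
      using fourier_decay[of k, where 'd='d] by blast
    show ?thesis unfolding \<psi>(2) by (rule bounded_decayI) (rule C[OF \<psi>(1)])
  qed
qed (use assms in auto)

section \<open>Fourier inversion\<close>

lemma cis_borel_measurable [measurable]: "cis \<in> borel_measurable borel"
  by (intro borel_measurable_continuous_onI continuous_intros)

text \<open>\<open>lborel\<close> on a Euclidean space is the image of the product of
  one-dimensional measures under the coordinate expansion, so Fubini for finite products
  applies.\<close>

lemma integral_lborel_prod:
  fixes g :: "'a::euclidean_space \<Rightarrow> real \<Rightarrow> complex"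
  assumes g: "\<And>b. b \<in> Basis \<Longrightarrow> integrable lborel (g b)"
  shows "integrable lborel (\<lambda>x. \<Prod>b\<in>Basis. g b (x \<bullet> b))"
    and "(\<integral>x. (\<Prod>b\<in>Basis. g b (x \<bullet> b)) \<partial>lborel) = (\<Prod>b\<in>Basis. \<integral>t. g b t \<partial>lborel)"
proof -
  interpret product_sigma_finite "\<lambda>_::'a. lborel :: real measure" by standard
  have gm: "g b \<in> borel_measurable borel" if "b \<in> Basis" for b
    using borel_measurable_integrable[OF g[OF that]] by simp
  have m: "(\<lambda>x. \<Prod>b\<in>Basis. g b (x \<bullet> b)) \<in> borel_measurable borel"
    by (intro borel_measurable_prod measurable_compose[OF _ gm]) auto
  have T: "(\<lambda>f. \<Sum>b\<in>Basis. f b *\<^sub>R b) \<in> (\<Pi>\<^sub>M b\<in>(Basis :: 'a set). lborel) \<rightarrow>\<^sub>M (borel :: 'a measure)"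
    by measurable
  have e: "(\<Prod>b\<in>Basis. g b ((\<Sum>c\<in>Basis. f c *\<^sub>R c) \<bullet> b)) = (\<Prod>b\<in>Basis. g b (f b))" for f :: "'a \<Rightarrow> real"
    by (intro prod.cong refl) simp
  show "integrable lborel (\<lambda>x. \<Prod>b\<in>Basis. g b (x \<bullet> b))"
    unfolding lborel_eq[where 'a='a] integrable_distr_eq[OF T m] e
    by (rule product_integrable_prod) (use g in auto)
  show "(\<integral>x. (\<Prod>b\<in>Basis. g b (x \<bullet> b)) \<partial>lborel) = (\<Prod>b\<in>Basis. \<integral>t. g b t \<partial>lborel)"
    unfolding lborel_eq[where 'a='a] integral_distr[OF T m] e
    by (rule product_integral_prod) (use g in auto)
qed

text \<open>This is the characteristic function of the standard normal law, with the normalising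
  factor moved to the other side.\<close>

lemma gaussian_fourier_real:
  "integrable lborel (\<lambda>t. exp (\<i> * of_real (u * t) + of_real (- (t\<^sup>2) / 2)))"
  "(\<integral>t. exp (\<i> * of_real (u * t) + of_real (- (t\<^sup>2) / 2)) \<partial>lborel) = of_real (sqrt (2 * pi) * exp (- (u\<^sup>2) / 2))"
proof -
  have e: "exp (\<i> * of_real (u * t) + of_real (- (t\<^sup>2) / 2)) = of_real (sqrt (2 * pi)) * (std_normal_density t *\<^sub>R iexp (u * t))" for t
    unfolding exp_add exp_of_real std_normal_density_def by (simp add: scaleR_conv_of_real)
  have i: "integrable lborel (\<lambda>t. std_normal_density t *\<^sub>R iexp (u * t))"
  proof (rule Bochner_Integration.integrable_bound[OF integrable_normal_density[of 1 0]])
    show "(\<lambda>t. std_normal_density t *\<^sub>R iexp (u * t)) \<in> borel_measurable lborel" by measurable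
  qed simp_all
  then show "integrable lborel (\<lambda>t. exp (\<i> * of_real (u * t) + of_real (- (t\<^sup>2) / 2)))"
    unfolding e by (rule integrable_mult_right)
  have "char std_normal_distribution u = (\<integral>t. std_normal_density t *\<^sub>R iexp (u * t) \<partial>lborel)"
    unfolding char_def by (rule integral_density) auto
  then have "(\<integral>t. std_normal_density t *\<^sub>R iexp (u * t) \<partial>lborel) = of_real (exp (- (u\<^sup>2) / 2))"
    by (simp add: char_std_normal_distribution)
  then show "(\<integral>t. exp (\<i> * of_real (u * t) + of_real (- (t\<^sup>2) / 2)) \<partial>lborel) = of_real (sqrt (2 * pi) * exp (- (u\<^sup>2) / 2))"
    unfolding e integral_mult_right_zero by simp
qed

definition gauss :: "'a::euclidean_space \<Rightarrow> real" where
  "gauss x = exp (- ((norm x)\<^sup>2) / 2)"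

lemma gauss_measurable [measurable]: "gauss \<in> borel_measurable borel"
  unfolding gauss_def by measurable

lemma gauss_bounds: "0 < gauss x" "gauss x \<le> 1" "0 \<le> gauss x"
  by (auto simp: gauss_def)

lemma gauss_minus [simp]: "gauss (- x) = gauss x"
  by (simp add: gauss_def)

lemma gaussian_fourier:
  fixes z :: "'a::euclidean_space"
  shows "integrable lborel (\<lambda>x::'a. cis (z \<bullet> x) * of_real (gauss x))"
    and "(\<integral>x. cis (z \<bullet> x) * of_real (gauss x) \<partial>lborel) = of_real (sqrt (2 * pi) ^ DIM('a) * gauss z)"
proof -
  let ?g = "\<lambda>b t. exp (\<i> * of_real ((z \<bullet> b) * t) + of_real (- (t\<^sup>2) / 2)) :: complex"
  have n2: "(norm x)\<^sup>2 = (\<Sum>b\<in>Basis. (x \<bullet> b)\<^sup>2)" for x :: 'a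
    by (subst power2_norm_eq_inner, subst euclidean_inner) (simp add: power2_eq_square)
  have e: "cis (z \<bullet> x) * of_real (gauss x) = (\<Prod>b\<in>Basis. ?g b (x \<bullet> b))" for x
    unfolding exp_sum[OF finite_Basis, symmetric] sum.distrib sum_distrib_left[symmetric] of_real_sum[symmetric] euclidean_inner[of z x, symmetric]
    unfolding sum_divide_distrib[symmetric] sum_negf n2[symmetric] exp_add cis_conv_exp gauss_def exp_of_real ..
  show "integrable lborel (\<lambda>x::'a. cis (z \<bullet> x) * of_real (gauss x))"
    unfolding e by (rule integral_lborel_prod(1)) (rule gaussian_fourier_real(1))
  have "(\<integral>x. cis (z \<bullet> x) * of_real (gauss x) \<partial>lborel) = (\<Prod>b\<in>Basis. \<integral>t. ?g b t \<partial>lborel)"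
    unfolding e by (rule integral_lborel_prod(2)) (rule gaussian_fourier_real(1))
  also have "\<dots> = (\<Prod>b\<in>(Basis :: 'a set). of_real (sqrt (2 * pi) * exp (- ((z \<bullet> b)\<^sup>2) / 2)))"
    by (simp only: gaussian_fourier_real(2))
  also have "\<dots> = of_real (sqrt (2 * pi) ^ DIM('a) * exp (\<Sum>b\<in>Basis. - ((z \<bullet> b)\<^sup>2) / 2))"
    unfolding of_real_prod[symmetric] prod.distrib exp_sum[OF finite_Basis] by simp
  also have "(\<Sum>b\<in>Basis. - ((z \<bullet> b)\<^sup>2) / 2) = - ((norm z)\<^sup>2) / 2"
    unfolding sum_divide_distrib[symmetric] sum_negf n2[symmetric] ..
  finally show "(\<integral>x. cis (z \<bullet> x) * of_real (gauss x) \<partial>lborel) = of_real (sqrt (2 * pi) ^ DIM('a) * gauss z)"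
    by (simp add: gauss_def)
qed

lemma gauss_integrable: "integrable lborel (gauss :: 'a::euclidean_space \<Rightarrow> real)"
proof -
  have "integrable lborel (\<lambda>x::'a. norm (cis (0 \<bullet> x) * complex_of_real (gauss x)))"
    by (intro integrable_norm gaussian_fourier)
  also have "(\<lambda>x::'a. norm (cis (0 \<bullet> x) * complex_of_real (gauss x))) = gauss"
    unfolding norm_mult norm_cis norm_of_real mult_1 abs_of_nonneg[OF gauss_bounds(3)] ..
  finally show ?thesis .
qed

lemma gauss_integral: "(\<integral>x. gauss (x :: 'a::euclidean_space) \<partial>lborel) = sqrt (2 * pi) ^ DIM('a)"
proof -
  have "complex_of_real (\<integral>x. gauss (x :: 'a) \<partial>lborel) = of_real (sqrt (2 * pi) ^ DIM('a) * gauss (0 :: 'a))"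
    using gaussian_fourier(2)[of "0 :: 'a"] by simp
  then show ?thesis by (simp only: of_real_eq_iff) (simp add: gauss_def)
qed

lemma gauss_scaled_integrable: "\<epsilon> \<noteq> 0 \<Longrightarrow> integrable lborel (\<lambda>x :: 'a::euclidean_space. gauss (\<epsilon> *\<^sub>R x))"
  using integrable_lborel_scale_shift[OF gauss_integrable, of \<epsilon> 0] by simp

lemma integrable_pair_mult:
  fixes u :: "'a::euclidean_space \<Rightarrow> real" and v :: "'b::euclidean_space \<Rightarrow> real"
  assumes u: "integrable lborel u" and v: "integrable lborel v"
  shows "integrable (lborel \<Otimes>\<^sub>M lborel) (\<lambda>(x, y). u x * v y)"
proof (rule lborel_pair.Fubini_integrable)
  have [measurable]: "u \<in> borel_measurable borel" "v \<in> borel_measurable borel"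
    using borel_measurable_integrable[OF u] borel_measurable_integrable[OF v] by auto
  show "(\<lambda>(x, y). u x * v y) \<in> borel_measurable (lborel \<Otimes>\<^sub>M lborel)" by measurable
  have "integrable lborel (\<lambda>x. \<bar>u x\<bar> * (\<integral>y. \<bar>v y\<bar> \<partial>lborel))"
    by (intro integrable_mult_left integrable_abs u)
  then show "integrable lborel (\<lambda>x. \<integral>y. norm (case (x, y) of (x, y) \<Rightarrow> u x * v y) \<partial>lborel)"
    by (simp add: abs_mult)
  show "AE x in lborel. integrable lborel (\<lambda>y. case (x, y) of (x, y) \<Rightarrow> u x * v y)"
    using v by (intro AE_I2) simp
qed

text \<open>The Gaussian cut-off makes the double integral absolutely convergent. After Fubini the
  inner integral is the known transform of a Gaussian, and the substitution y = x + \<epsilon> z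
  turns the outer one into an average of \<phi> near x.\<close>

lemma gauss_regularised_inversion:
  fixes \<phi> :: "real^'d::finite \<Rightarrow> complex"
  assumes "\<phi> \<in> schwartz" and \<epsilon>: "\<epsilon> > 0"
  shows "(\<integral>\<xi>. cis (x \<bullet> \<xi>) * fourier \<phi> \<xi> * of_real (gauss (\<epsilon> *\<^sub>R \<xi>)) \<partial>lborel)
    = of_real (sqrt (2 * pi) ^ CARD('d)) * (\<integral>z. \<phi> (x + \<epsilon> *\<^sub>R z) * of_real (gauss z) \<partial>lborel)"
proof -
  have [measurable]: "\<phi> \<in> borel_measurable borel" by (rule schwartz_measurable[OF assms(1)])
  let ?K = "\<lambda>\<xi> y. cis (x \<bullet> \<xi>) * (cis (- (y \<bullet> \<xi>)) * \<phi> y) * complex_of_real (gauss (\<epsilon> *\<^sub>R \<xi>))"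
  have K: "integrable (lborel \<Otimes>\<^sub>M lborel) (case_prod ?K)"
  proof (rule Bochner_Integration.integrable_bound)
    show "integrable (lborel \<Otimes>\<^sub>M lborel) (\<lambda>(\<xi>, y). gauss (\<epsilon> *\<^sub>R (\<xi> :: real^'d)) * cmod (\<phi> y))"
      using \<epsilon> by (intro integrable_pair_mult gauss_scaled_integrable integrable_norm schwartz_integrable assms) auto
    show "case_prod ?K \<in> borel_measurable (lborel \<Otimes>\<^sub>M lborel)" by measurable
    show "AE z in lborel \<Otimes>\<^sub>M lborel. norm (case_prod ?K z) \<le> norm (case z of (\<xi>, y) \<Rightarrow> gauss (\<epsilon> *\<^sub>R (\<xi> :: real^'d)) * cmod (\<phi> y))"
      by (intro AE_I2) (auto simp: norm_mult abs_mult gauss_bounds)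
  qed
  have "(\<integral>\<xi>. cis (x \<bullet> \<xi>) * fourier \<phi> \<xi> * of_real (gauss (\<epsilon> *\<^sub>R \<xi>)) \<partial>lborel) = (\<integral>\<xi>. (\<integral>y. ?K \<xi> y \<partial>lborel) \<partial>lborel)"
    by (simp add: fourier_def)
  also have "\<dots> = (\<integral>y. (\<integral>\<xi>. ?K \<xi> y \<partial>lborel) \<partial>lborel)"
    by (rule lborel_pair.Fubini_integral[OF K, symmetric])
  also have "\<dots> = (\<integral>y. of_real (sqrt (2 * pi) ^ CARD('d) / \<epsilon> ^ CARD('d)) * (\<phi> y * of_real (gauss ((1 / \<epsilon>) *\<^sub>R (x - y)))) \<partial>lborel)"
  proof (rule Bochner_Integration.integral_cong[OF refl])
    fix y
    let ?h = "\<lambda>\<zeta>. cis (((1 / \<epsilon>) *\<^sub>R (x - y)) \<bullet> \<zeta>) * complex_of_real (gauss \<zeta>)"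
    have "(\<integral>\<xi>. ?K \<xi> y \<partial>lborel) = (\<integral>\<xi>. \<phi> y * ?h (0 + \<epsilon> *\<^sub>R \<xi>) \<partial>lborel)"
      using \<epsilon> by (intro Bochner_Integration.integral_cong refl) (simp add: cis_mult inner_diff_left)
    also have "\<dots> = \<phi> y * (\<integral>\<xi>. ?h (0 + \<epsilon> *\<^sub>R \<xi>) \<partial>lborel)" by simp
    also have "(\<integral>\<xi>. ?h (0 + \<epsilon> *\<^sub>R \<xi>) \<partial>lborel) = (1 / \<epsilon> ^ CARD('d)) *\<^sub>R (\<integral>\<zeta>. ?h \<zeta> \<partial>lborel)"
      by (subst integral_lborel_scale_shift[of ?h \<epsilon> 0]) (use \<epsilon> in \<open>auto, measurable\<close>)
    also have "(\<integral>\<zeta>. ?h \<zeta> \<partial>lborel) = of_real (sqrt (2 * pi) ^ CARD('d) * gauss ((1 / \<epsilon>) *\<^sub>R (x - y)))"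
      by (subst gaussian_fourier(2)) simp
    finally show "(\<integral>\<xi>. ?K \<xi> y \<partial>lborel) = of_real (sqrt (2 * pi) ^ CARD('d) / \<epsilon> ^ CARD('d)) * (\<phi> y * of_real (gauss ((1 / \<epsilon>) *\<^sub>R (x - y))))"
      by (simp add: scaleR_conv_of_real)
  qed
  also have "\<dots> = of_real (sqrt (2 * pi) ^ CARD('d) / \<epsilon> ^ CARD('d)) * (\<integral>y. \<phi> y * of_real (gauss ((1 / \<epsilon>) *\<^sub>R (x - y))) \<partial>lborel)"
    by simp
  also have "(\<integral>y. \<phi> y * of_real (gauss ((1 / \<epsilon>) *\<^sub>R (x - y))) \<partial>lborel)
    = (\<epsilon> ^ CARD('d)) *\<^sub>R (\<integral>z. \<phi> (x + \<epsilon> *\<^sub>R z) * of_real (gauss z) \<partial>lborel)"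
    by (subst integral_lborel_scale_shift[where c = \<epsilon> and t = x]) (use \<epsilon> in auto)
  finally show ?thesis using \<epsilon> by (simp add: scaleR_conv_of_real)
qed

lemma gauss_average_tendsto:
  fixes f :: "'a::euclidean_space \<Rightarrow> 'b::{banach, second_countable_topology}"
  assumes "continuous_on UNIV f" "\<And>x. norm (f x) \<le> B" "\<epsilon> \<longlonglongrightarrow> 0"
  shows "(\<lambda>n. \<integral>z. gauss z *\<^sub>R f (x + \<epsilon> n *\<^sub>R z) \<partial>lborel) \<longlonglongrightarrow> (sqrt (2 * pi) ^ DIM('a)) *\<^sub>R f x"
proof -
  have [measurable]: "f \<in> borel_measurable borel" by (intro borel_measurable_continuous_onI assms)
  have "(\<lambda>n. \<integral>z. gauss z *\<^sub>R f (x + \<epsilon> n *\<^sub>R z) \<partial>lborel) \<longlonglongrightarrow> (\<integral>z. gauss (z::'a) *\<^sub>R f x \<partial>lborel)"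
  proof (rule integral_dominated_convergence[where w = "\<lambda>z::'a. gauss z * B"])
    show "integrable lborel (\<lambda>z::'a. gauss z * B)" by (intro integrable_mult_left gauss_integrable)
    show "AE z in lborel. (\<lambda>n. gauss z *\<^sub>R f (x + \<epsilon> n *\<^sub>R z)) \<longlonglongrightarrow> gauss z *\<^sub>R f x"
    proof (intro AE_I2 tendsto_intros)
      fix z
      have "isCont f x" using assms(1) by (simp add: continuous_on_eq_continuous_at)
      moreover have "(\<lambda>n. x + \<epsilon> n *\<^sub>R z) \<longlonglongrightarrow> x" using assms(3) by (auto intro!: tendsto_eq_intros)
      ultimately show "(\<lambda>n. f (x + \<epsilon> n *\<^sub>R z)) \<longlonglongrightarrow> f x" by (rule isCont_tendsto_compose)
    qed
    show "AE z in lborel. norm (gauss z *\<^sub>R f (x + \<epsilon> n *\<^sub>R z)) \<le> gauss z * B" for n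
      by (intro AE_I2) (auto simp: gauss_bounds intro!: mult_left_mono assms(2))
  qed measurable
  also have "(\<integral>z. gauss (z::'a) *\<^sub>R f x \<partial>lborel) = (sqrt (2 * pi) ^ DIM('a)) *\<^sub>R f x"
    using gauss_integrable[where 'a='a] by (simp add: gauss_integral)
  finally show ?thesis .
qed

text \<open>Let the cut-off in the regularised identity tend to 1. The left side converges because
  \<open>fourier \<phi>\<close> is integrable, and the right side is an approximate identity at x.
  The two factors (2 pi)^(d/2) multiply to the normalisation of \<open>inv_fourier\<close>.\<close>

lemma inv_fourier_fourier:
  fixes \<phi> :: "real^'d::finite \<Rightarrow> complex"
  assumes "\<phi> \<in> schwartz"
  shows "inv_fourier (fourier \<phi>) = \<phi>"
proof
  fix x
  define \<epsilon> where "\<epsilon> n = 1 / real (Suc n)" for n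
  have \<epsilon>: "\<epsilon> n > 0" for n by (simp add: \<epsilon>_def)
  have \<epsilon>0: "\<epsilon> \<longlonglongrightarrow> 0" unfolding \<epsilon>_def by (rule lim_1_over_n[THEN LIMSEQ_Suc])
  let ?s = "sqrt (2 * pi) ^ CARD('d)"
  have F: "fourier \<phi> \<in> schwartz" by (rule fourier_schwartz[OF assms])
  have [measurable]: "fourier \<phi> \<in> borel_measurable borel" by (rule schwartz_measurable[OF F])
  obtain B where B: "\<And>x. cmod (\<phi> x) \<le> B" using schwartz_decay[OF assms, of 0] by auto
  have "(\<lambda>n. \<integral>\<xi>. cis (x \<bullet> \<xi>) * fourier \<phi> \<xi> * of_real (gauss (\<epsilon> n *\<^sub>R \<xi>)) \<partial>lborel) \<longlonglongrightarrow> (\<integral>\<xi>. cis (x \<bullet> \<xi>) * fourier \<phi> \<xi> \<partial>lborel)"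
  proof (rule integral_dominated_convergence[where w = "\<lambda>\<xi>. cmod (fourier \<phi> \<xi>)"])
    show "integrable lborel (\<lambda>\<xi>. cmod (fourier \<phi> \<xi>))" by (intro integrable_norm schwartz_integrable F)
    show "AE \<xi> in lborel. (\<lambda>n. cis (x \<bullet> \<xi>) * fourier \<phi> \<xi> * of_real (gauss (\<epsilon> n *\<^sub>R \<xi>))) \<longlonglongrightarrow> cis (x \<bullet> \<xi>) * fourier \<phi> \<xi>"
      unfolding gauss_def using \<epsilon>0 by (intro AE_I2) (auto intro!: tendsto_eq_intros)
    show "AE \<xi> in lborel. norm (cis (x \<bullet> \<xi>) * fourier \<phi> \<xi> * of_real (gauss (\<epsilon> n *\<^sub>R \<xi>))) \<le> cmod (fourier \<phi> \<xi>)" for n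
      by (intro AE_I2) (auto simp: norm_mult gauss_bounds intro!: mult_left_le)
  qed measurable
  moreover have "(\<lambda>n. \<integral>\<xi>. cis (x \<bullet> \<xi>) * fourier \<phi> \<xi> * of_real (gauss (\<epsilon> n *\<^sub>R \<xi>)) \<partial>lborel) \<longlonglongrightarrow> of_real ?s * (?s *\<^sub>R \<phi> x)"
  proof -
    have "(\<lambda>n. \<integral>z. gauss z *\<^sub>R \<phi> (x + \<epsilon> n *\<^sub>R z) \<partial>lborel) \<longlonglongrightarrow> (sqrt (2 * pi) ^ DIM(real^'d)) *\<^sub>R \<phi> x"
      by (rule gauss_average_tendsto[OF schwartz_continuous[OF assms] B \<epsilon>0])
    then have "(\<lambda>n. \<integral>z. \<phi> (x + \<epsilon> n *\<^sub>R z) * of_real (gauss z) \<partial>lborel) \<longlonglongrightarrow> ?s *\<^sub>R \<phi> x"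
      by (simp add: scaleR_conv_of_real mult.commute)
    then show ?thesis
      unfolding gauss_regularised_inversion[OF assms \<epsilon>] by (rule tendsto_mult_left)
  qed
  ultimately have "(\<integral>\<xi>. cis (x \<bullet> \<xi>) * fourier \<phi> \<xi> \<partial>lborel) = of_real ?s * (?s *\<^sub>R \<phi> x)" by (rule LIMSEQ_unique)
  also have "\<dots> = of_real (?s * ?s) * \<phi> x" by (simp only: scaleR_conv_of_real of_real_mult mult.assoc)
  also have "?s * ?s = (2 * pi) ^ CARD('d)" unfolding power_mult_distrib[symmetric] by simp
  finally show "inv_fourier (fourier \<phi>) x = \<phi> x" by (simp add: inv_fourier_def)
qed

lemma inv_fourier_eq:
  fixes \<phi> :: "real^'d::finite \<Rightarrow> complex"
  shows "inv_fourier \<phi> x = of_real (1 / (2 * pi) ^ CARD('d)) * fourier \<phi> (- x)"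
  by (simp add: inv_fourier_def fourier_def inner_commute)

lemma inv_fourier_schwartz:
  fixes \<phi> :: "real^'d::finite \<Rightarrow> complex"
  assumes "\<phi> \<in> schwartz" shows "inv_fourier \<phi> \<in> schwartz"
proof -
  have "inv_fourier \<phi> = (\<lambda>x. of_real (1 / (2 * pi) ^ CARD('d)) * fourier \<phi> (- x))"
    by (rule ext) (rule inv_fourier_eq)
  then show ?thesis by (simp only:) (intro schwartz_cmult schwartz_reflect fourier_schwartz assms)
qed

text \<open>The reflection x to - x exchanges the two transforms up to the normalising constant,
  which reduces the claim to the inversion just proved.\<close>

lemma fourier_inv_fourier:
  fixes \<phi> :: "real^'d::finite \<Rightarrow> complex"
  assumes "\<phi> \<in> schwartz"
  shows "fourier (inv_fourier \<phi>) = \<phi>"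
proof
  fix \<xi>
  let ?c = "complex_of_real (1 / (2 * pi) ^ CARD('d))"
  let ?h = "\<lambda>x. cis (x \<bullet> \<xi>) * fourier \<phi> x"
  have h: "?h \<in> borel_measurable borel"
    by (intro borel_measurable_continuous_onI continuous_intros schwartz_continuous fourier_schwartz assms)
  have "fourier (inv_fourier \<phi>) \<xi> = ?c * (\<integral>x. ?h (0 + (- 1) *\<^sub>R x) \<partial>lborel)"
    unfolding fourier_def[of "inv_fourier \<phi>"] inv_fourier_eq by (simp add: mult.left_commute)
  also have "(\<integral>x. ?h (0 + (- 1) *\<^sub>R x) \<partial>lborel) = (\<integral>x. ?h x \<partial>lborel)"
    using integral_lborel_scale_shift[OF h, of "-1" 0] by simp
  also have "?c * (\<integral>x. ?h x \<partial>lborel) = inv_fourier (fourier \<phi>) \<xi>"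
    by (simp add: inv_fourier_def inner_commute)
  finally show "fourier (inv_fourier \<phi>) \<xi> = \<phi> \<xi>" by (simp add: inv_fourier_fourier[OF assms])
qed

lemma inv_fourier_decay:
  "\<exists>C\<ge>0. \<exists>N. \<forall>\<phi>\<in>(schwartz :: (real^'d::finite \<Rightarrow> complex) set). \<forall>x. (1 + norm x) ^ k * cmod (inv_fourier \<phi> x) \<le> C * schwartz_norm N \<phi>"
proof -
  obtain C N where C: "C \<ge> 0" "\<And>\<phi> \<xi>. \<phi> \<in> schwartz \<Longrightarrow> (1 + norm \<xi>) ^ k * cmod (fourier \<phi> \<xi>) \<le> C * schwartz_norm N (\<phi> :: real^'d \<Rightarrow> complex)"
    using fourier_decay[of k, where 'd='d] by blast
  let ?c = "1 / (2 * pi) ^ CARD('d)"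
  show ?thesis
  proof (intro exI[of _ "?c * C"] exI[of _ N] conjI ballI allI)
    show "0 \<le> ?c * C" using C by simp
    fix \<phi> :: "real^'d \<Rightarrow> complex" and x assume \<phi>: "\<phi> \<in> schwartz"
    have "(1 + norm x) ^ k * cmod (inv_fourier \<phi> x) = ?c * ((1 + norm (- x)) ^ k * cmod (fourier \<phi> (- x)))"
      unfolding inv_fourier_eq norm_mult norm_of_real norm_minus_cancel by simp
    also have "\<dots> \<le> ?c * (C * schwartz_norm N \<phi>)" by (intro mult_left_mono C \<phi>) simp
    finally show "(1 + norm x) ^ k * cmod (inv_fourier \<phi> x) \<le> ?c * C * schwartz_norm N \<phi>" by simp
  qed
qed

section \<open>Testing against Schwartz functions\<close>

text \<open>From |x|^2 \<le> 2 |x - y|^2 + 2 |y|^2: recentring a Gaussian at the origin costs a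
  constant and half of its rate.\<close>

lemma gauss_weight_compare:
  fixes x y :: "'a::euclidean_space"
  assumes "norm y \<le> R" "c \<ge> 0"
  shows "exp (- c * (norm (x - y))\<^sup>2) \<le> exp (c * R\<^sup>2) * exp (- (c / 2) * (norm x)\<^sup>2)"
proof -
  have "norm x \<le> norm (x - y) + norm y" using norm_triangle_ineq[of "x - y" y] by simp
  then have "(norm x)\<^sup>2 \<le> (norm (x - y) + norm y)\<^sup>2" by (rule power_mono) simp
  also have "\<dots> \<le> 2 * (norm (x - y))\<^sup>2 + 2 * (norm y)\<^sup>2"
    using sum_squares_bound[of "norm (x - y)" "norm y"] by (simp add: power2_sum)
  also have "(norm y)\<^sup>2 \<le> R\<^sup>2" using assms by (intro power_mono) auto
  finally have "(c / 2) * (norm x)\<^sup>2 \<le> (c / 2) * (2 * (norm (x - y))\<^sup>2 + 2 * R\<^sup>2)"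
    using assms(2) by (intro mult_left_mono) auto
  then have "- c * (norm (x - y))\<^sup>2 \<le> c * R\<^sup>2 + - (c / 2) * (norm x)\<^sup>2"
    by (simp add: algebra_simps)
  then show ?thesis unfolding exp_add[symmetric] by simp
qed

text \<open>Averaging the hypothesis \<open>pos\<close> over the centres \<open>y\<close> with density \<open>f\<close> and letting the Gaussians concentrate
  replaces them by \<open>f\<close>.\<close>

lemma continuous_test_nonneg:
  fixes k :: "'a::euclidean_space \<Rightarrow> real"
  assumes k: "k \<in> borel_measurable borel"
    and ki: "\<And>c. c > 0 \<Longrightarrow> integrable lborel (\<lambda>x. k x * exp (- c * (norm x)\<^sup>2))"
    and pos: "\<And>c y. c > 0 \<Longrightarrow> 0 \<le> (\<integral>x. k x * exp (- c * (norm (x - y))\<^sup>2) \<partial>lborel)"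
    and f: "continuous_on UNIV f" "\<And>x. 0 \<le> f x" "\<And>x. f x \<le> 1" "\<And>x. norm x > R \<Longrightarrow> f x = 0"
  shows "0 \<le> (\<integral>x. k x * f x \<partial>lborel)"
proof -
  note k [measurable]
  have [measurable]: "f \<in> borel_measurable borel" by (intro borel_measurable_continuous_onI f)
  have fR: "f y \<noteq> 0 \<Longrightarrow> norm y \<le> R" for y using f(4)[of y] by force
  have fi: "integrable lborel f"
  proof (rule Bochner_Integration.integrable_bound)
    show "integrable lborel (indicator (cball 0 R) :: 'a \<Rightarrow> real)"
      using emeasure_lborel_cball_finite[of "0 :: 'a" R] by (auto intro!: integrable_real_indicator)
    show "AE x in lborel. norm (f x) \<le> norm (indicator (cball 0 R) x :: real)"
      by (intro AE_I2) (use f fR in \<open>auto simp: indicator_def\<close>)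
  qed simp
  define \<epsilon> where "\<epsilon> n = 1 / real (Suc n)" for n
  have \<epsilon>: "\<epsilon> n > 0" "\<epsilon> n \<le> 1" for n by (auto simp: \<epsilon>_def)
  have \<epsilon>0: "\<epsilon> \<longlonglongrightarrow> 0" unfolding \<epsilon>_def by (rule lim_1_over_n[THEN LIMSEQ_Suc])
  define F where "F n x = (\<integral>z. gauss z *\<^sub>R f (x + \<epsilon> n *\<^sub>R z) \<partial>lborel)" for n x
  have [measurable]: "F n \<in> borel_measurable borel" for n
    unfolding F_def by measurable
  have FJ: "0 \<le> (\<integral>x. k x * F n x \<partial>lborel)" for n
  proof -
    \<comment> \<open>With this rate the Gaussian at distance \<open>\<epsilon> n\<close> |z| from
      its centre equals \<open>gauss z\<close>.\<close>
    define c where "c = 1 / (2 * (\<epsilon> n)\<^sup>2)"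
    have c: "c > 0" using \<epsilon>(1)[of n] by (simp add: c_def)
    let ?K = "\<lambda>x y. k x * (f y * exp (- c * (norm (x - y))\<^sup>2))"
    have K: "integrable (lborel \<Otimes>\<^sub>M lborel) (case_prod ?K)"
    proof (rule Bochner_Integration.integrable_bound)
      show "integrable (lborel \<Otimes>\<^sub>M lborel) (\<lambda>(x, y). (k x * exp (- (c / 2) * (norm x)\<^sup>2)) * (exp (c * R\<^sup>2) * f y))"
        using c by (intro integrable_pair_mult ki integrable_mult_right fi) auto
      show "case_prod ?K \<in> borel_measurable (lborel \<Otimes>\<^sub>M lborel)" by measurable
      have "norm (?K x y) \<le> norm ((k x * exp (- (c / 2) * (norm x)\<^sup>2)) * (exp (c * R\<^sup>2) * f y))" for x y
      proof (cases "f y = 0")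
        case False
        have "\<bar>k x\<bar> * f y * exp (- c * (norm (x - y))\<^sup>2) \<le> \<bar>k x\<bar> * f y * (exp (c * R\<^sup>2) * exp (- (c / 2) * (norm x)\<^sup>2))"
          using gauss_weight_compare[OF fR[OF False], of c x] c f(2)[of y] by (intro mult_left_mono) auto
        then show ?thesis using f(2)[of y] by (simp add: abs_mult mult_ac)
      qed simp
      then show "AE z in lborel \<Otimes>\<^sub>M lborel. norm (case_prod ?K z) \<le> norm (case z of (x, y) \<Rightarrow> (k x * exp (- (c / 2) * (norm x)\<^sup>2)) * (exp (c * R\<^sup>2) * f y))"
        by (intro AE_I2) (simp add: case_prod_beta)
    qed
    have "0 \<le> (\<integral>y. f y * (\<integral>x. k x * exp (- c * (norm (x - y))\<^sup>2) \<partial>lborel) \<partial>lborel)"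
      by (intro integral_nonneg_AE AE_I2 mult_nonneg_nonneg pos f c)
    also have "\<dots> = (\<integral>y. (\<integral>x. ?K x y \<partial>lborel) \<partial>lborel)"
      by (simp add: mult.left_commute)
    also have "\<dots> = (\<integral>x. (\<integral>y. ?K x y \<partial>lborel) \<partial>lborel)"
      by (rule lborel_pair.Fubini_integral[OF K])
    also have "\<dots> = (\<integral>x. k x * (\<epsilon> n ^ DIM('a) * F n x) \<partial>lborel)"
    proof (rule Bochner_Integration.integral_cong[OF refl])
      fix x
      let ?h = "\<lambda>y. f y * exp (- c * (norm (x - y))\<^sup>2)"
      have "(\<integral>y. ?h y \<partial>lborel) = \<epsilon> n ^ DIM('a) * (\<integral>z. ?h (x + \<epsilon> n *\<^sub>R z) \<partial>lborel)"
        by (subst integral_lborel_scale_shift[where c = "\<epsilon> n" and t = x]) (use \<epsilon>(1)[of n] in auto)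
      also have "(\<integral>z. ?h (x + \<epsilon> n *\<^sub>R z) \<partial>lborel) = F n x"
        unfolding F_def using \<epsilon>(1)[of n]
        by (intro Bochner_Integration.integral_cong refl) (simp add: c_def gauss_def power_mult_distrib)
      finally show "(\<integral>y. ?K x y \<partial>lborel) = k x * (\<epsilon> n ^ DIM('a) * F n x)" by simp
    qed
    also have "\<dots> = \<epsilon> n ^ DIM('a) * (\<integral>x. k x * F n x \<partial>lborel)"
      unfolding integral_mult_right_zero[symmetric] by (simp only: mult.left_commute[of "\<epsilon> n ^ DIM('a)"])
    finally have "0 \<le> \<epsilon> n ^ DIM('a) * (\<integral>x. k x * F n x \<partial>lborel)" .
    moreover have "0 < \<epsilon> n ^ DIM('a)" using \<epsilon>(1)[of n] by simp
    ultimately show ?thesis by (simp only: zero_le_mult_iff) auto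
  qed
  let ?s = "sqrt (2 * pi) ^ DIM('a)"
  \<comment> \<open>A majorant independent of n: one half of the Gaussian in z pays for decay in x,
    because f lives in the ball of radius R and thus exp (- |z|^2/4) is at most a constant times exp
    (- |x|^2/8). The other half is integrated and gives \<open>B\<close>.\<close>
  have g4: "integrable lborel (\<lambda>z::'a. exp (- (norm z)\<^sup>2 / 4))"
  proof -
    have "integrable lborel (\<lambda>z::'a. gauss ((1 / sqrt 2) *\<^sub>R z))" by (rule gauss_scaled_integrable) simp
    then show ?thesis by (simp add: gauss_def power_mult_distrib power_divide)
  qed
  define B where "B = (\<integral>z. exp (- (norm (z::'a))\<^sup>2 / 4) \<partial>lborel)"
  have Fb: "\<bar>F n x\<bar> \<le> exp (R\<^sup>2 / 4) * B * exp (- (1 / 8) * (norm x)\<^sup>2)" for n x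
  proof -
    have "norm (F n x) \<le> (\<integral>z. exp (R\<^sup>2 / 4) * exp (- (1 / 8) * (norm x)\<^sup>2) * exp (- (norm (z::'a))\<^sup>2 / 4) \<partial>lborel)"
      unfolding F_def
    proof (rule integral_norm_le)
      show "integrable lborel (\<lambda>z::'a. exp (R\<^sup>2 / 4) * exp (- (1 / 8) * (norm x)\<^sup>2) * exp (- (norm z)\<^sup>2 / 4))"
        by (intro integrable_mult_right g4)
      fix z
      show "norm (gauss z *\<^sub>R f (x + \<epsilon> n *\<^sub>R z)) \<le> exp (R\<^sup>2 / 4) * exp (- (1 / 8) * (norm x)\<^sup>2) * exp (- (norm z)\<^sup>2 / 4)"
      proof (cases "f (x + \<epsilon> n *\<^sub>R z) = 0")
        case False
        have "norm (x - (x + \<epsilon> n *\<^sub>R z)) = \<epsilon> n * norm z" using \<epsilon>(1)[of n] by simp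
        also have "\<dots> \<le> norm z" using \<epsilon>[of n] by (intro mult_left_le_one_le) auto
        finally have "(norm (x - (x + \<epsilon> n *\<^sub>R z)))\<^sup>2 \<le> (norm z)\<^sup>2" by (intro power_mono) auto
        then have "exp (- (1/4) * (norm z)\<^sup>2) \<le> exp (- (1/4) * (norm (x - (x + \<epsilon> n *\<^sub>R z)))\<^sup>2)" by simp
        also have "\<dots> \<le> exp ((1/4) * R\<^sup>2) * exp (- ((1/4) / 2) * (norm x)\<^sup>2)"
          by (rule gauss_weight_compare[OF fR[OF False]]) simp
        finally have e: "exp (- (1/4) * (norm z)\<^sup>2) \<le> exp ((1/4) * R\<^sup>2) * exp (- ((1/4) / 2) * (norm x)\<^sup>2)" .
        have "norm (gauss z *\<^sub>R f (x + \<epsilon> n *\<^sub>R z)) \<le> gauss z"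
          using f(2,3)[of "x + \<epsilon> n *\<^sub>R z"] gauss_bounds[of z] by (simp add: mult_left_le)
        also have "gauss z = exp (- (1/4) * (norm z)\<^sup>2) * exp (- (1/4) * (norm z)\<^sup>2)"
          unfolding gauss_def exp_add[symmetric] by simp
        also have "\<dots> \<le> exp ((1/4) * R\<^sup>2) * exp (- ((1/4) / 2) * (norm x)\<^sup>2) * exp (- (1/4) * (norm z)\<^sup>2)"
          by (intro mult_right_mono e) simp
        finally show ?thesis by simp
      qed simp
    qed
    then show ?thesis by (simp add: B_def mult_ac)
  qed
  have "(\<lambda>n. \<integral>x. k x * F n x \<partial>lborel) \<longlonglongrightarrow> (\<integral>x. k x * (?s * f x) \<partial>lborel)"
  proof (rule integral_dominated_convergence[where w = "\<lambda>x. (exp (R\<^sup>2 / 4) * B) * norm (k x * exp (- (1 / 8) * (norm x)\<^sup>2))"])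
    show "integrable lborel (\<lambda>x. (exp (R\<^sup>2 / 4) * B) * norm (k x * exp (- (1 / 8) * (norm x)\<^sup>2)))"
      by (intro integrable_mult_right integrable_norm ki) simp
    show "AE x in lborel. (\<lambda>n. k x * F n x) \<longlonglongrightarrow> k x * (?s * f x)"
    proof (intro AE_I2 tendsto_mult_left)
      fix x
      show "(\<lambda>n. F n x) \<longlonglongrightarrow> ?s * f x"
        using gauss_average_tendsto[OF f(1) _ \<epsilon>0, of 1 x] f(2,3) unfolding F_def by simp
    qed
    show "AE x in lborel. norm (k x * F n x) \<le> (exp (R\<^sup>2 / 4) * B) * norm (k x * exp (- (1 / 8) * (norm x)\<^sup>2))" for n
    proof (rule AE_I2)
      fix x
      have "\<bar>k x\<bar> * \<bar>F n x\<bar> \<le> \<bar>k x\<bar> * (exp (R\<^sup>2 / 4) * B * exp (- (1 / 8) * (norm x)\<^sup>2))"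
        by (intro mult_left_mono Fb) simp
      then show "norm (k x * F n x) \<le> (exp (R\<^sup>2 / 4) * B) * norm (k x * exp (- (1 / 8) * (norm x)\<^sup>2))"
        by (simp add: abs_mult mult_ac)
    qed
  qed measurable
  then have "0 \<le> (\<integral>x. k x * (?s * f x) \<partial>lborel)"
    by (rule LIMSEQ_le_const) (use FJ in blast)
  also have "\<dots> = ?s * (\<integral>x. k x * f x \<partial>lborel)"
    unfolding integral_mult_right_zero[symmetric] by (simp only: mult.left_commute[of ?s])
  finally have "0 \<le> ?s * (\<integral>x. k x * f x \<partial>lborel)" .
  moreover have "0 < ?s" by simp
  ultimately show ?thesis by (simp only: zero_le_mult_iff) auto
qed

text \<open>The cut-offs max 0 (1 - (n + 1) dist(x, K)) are continuous and converge to the indicator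
  of K. The hypothesis \<open>ki\<close> bounds k on a fixed ball by an integrable function, so
  dominated convergence applies.\<close>

lemma compact_test_nonneg:
  fixes k :: "'a::euclidean_space \<Rightarrow> real"
  assumes k: "k \<in> borel_measurable borel"
    and ki: "\<And>c. c > 0 \<Longrightarrow> integrable lborel (\<lambda>x. k x * exp (- c * (norm x)\<^sup>2))"
    and pos: "\<And>c y. c > 0 \<Longrightarrow> 0 \<le> (\<integral>x. k x * exp (- c * (norm (x - y))\<^sup>2) \<partial>lborel)"
    and K: "compact K" "K \<noteq> {}"
  shows "integrable lborel (\<lambda>x. k x * indicator K x)" "0 \<le> (\<integral>x. k x * indicator K x \<partial>lborel)"
proof -
  note k [measurable]
  have [measurable]: "K \<in> sets borel" using K(1) by (simp add: borel_compact)
  obtain R0 where R0: "\<And>x. x \<in> K \<Longrightarrow> norm x \<le> R0" using compact_imp_bounded[OF K(1)] by (auto simp: bounded_iff)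
  \<comment> \<open>Every cut-off, already the one for n = 0, vanishes at distance at least 1 from
    K, so a single ball contains all supports.\<close>
  define R where "R = R0 + 1"
  define f where "f n x = max 0 (1 - real (Suc n) * infdist x K)" for n x
  have fc: "continuous_on UNIV (f n)" for n unfolding f_def by (intro continuous_intros)
  have f01: "0 \<le> f n x" "f n x \<le> 1" for n x using infdist_nonneg[of x K] by (auto simp: f_def)
  have fR: "f n x = 0" if "norm x > R" for n x
  proof -
    obtain y where y: "y \<in> K" "infdist x K = dist x y"
      using infdist_attains_inf[OF compact_imp_closed[OF K(1)] K(2)] by metis
    have "1 \<le> dist x y" using R0[OF y(1)] that norm_triangle_ineq2[of x y] by (simp add: R_def dist_norm)
    then have "1 * 1 \<le> real (Suc n) * infdist x K" unfolding y by (intro mult_mono) auto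
    then show ?thesis by (simp add: f_def)
  qed
  have [measurable]: "f n \<in> borel_measurable borel" for n by (intro borel_measurable_continuous_onI fc)
  let ?w = "\<lambda>x. exp (R\<^sup>2) * norm (k x * exp (- 1 * (norm x)\<^sup>2))"
  have wi: "integrable lborel ?w" by (intro integrable_mult_right integrable_norm ki) simp
  have wb: "norm (k x) \<le> ?w x" if "norm x \<le> R" for x
  proof -
    have "(norm x)\<^sup>2 \<le> R\<^sup>2" using that by (intro power_mono) auto
    then have "1 \<le> exp (R\<^sup>2) * exp (- 1 * (norm x)\<^sup>2)" unfolding exp_add[symmetric] by simp
    from mult_left_mono[OF this, of "\<bar>k x\<bar>"] show ?thesis by (simp add: abs_mult mult_ac)
  qed
  have lim: "(\<lambda>n. f n x) \<longlonglongrightarrow> indicator K x" for x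
  proof (cases "x \<in> K")
    case True
    then show ?thesis by (simp add: f_def)
  next
    case False
    then have d: "infdist x K > 0"
      using in_closed_iff_infdist_zero[OF compact_imp_closed[OF K(1)] K(2)] infdist_nonneg[of x K] by (metis less_eq_real_def)
    obtain N where N: "1 / infdist x K < real N" using reals_Archimedean2 by blast
    have "f n x = 0" if "n \<ge> N" for n
    proof -
      have "1 / infdist x K \<le> real (Suc n)" using N that by linarith
      then have "1 \<le> real (Suc n) * infdist x K" using d by (simp add: pos_divide_le_eq)
      then show ?thesis by (simp add: f_def)
    qed
    then show ?thesis using False by (intro tendsto_eventually) (auto simp: eventually_sequentially)
  qed
  have b: "norm (k x * f n x) \<le> ?w x" for n x
  proof (cases "norm x \<le> R")
    case True
    have "norm (k x * f n x) \<le> norm (k x)" using f01[of n x] by (simp add: abs_mult mult_left_le)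
    with wb[OF True] show ?thesis by linarith
  qed (use fR in auto)
  have bK: "norm (k x * indicator K x) \<le> ?w x" for x
    using wb[of x] R0[of x] by (cases "x \<in> K") (auto simp: R_def intro: order_trans)
  show "integrable lborel (\<lambda>x. k x * indicator K x)"
    by (rule Bochner_Integration.integrable_bound[OF wi]) (use bK in \<open>auto intro!: AE_I2\<close>)
  have "(\<lambda>n. \<integral>x. k x * f n x \<partial>lborel) \<longlonglongrightarrow> (\<integral>x. k x * indicator K x \<partial>lborel)"
  proof (rule integral_dominated_convergence[OF _ _ wi])
    show "AE x in lborel. (\<lambda>n. k x * f n x) \<longlonglongrightarrow> k x * indicator K x"
      by (intro AE_I2 tendsto_mult_left lim)
    show "AE x in lborel. norm (k x * f n x) \<le> ?w x" for n by (intro AE_I2 b)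
  qed measurable
  then show "0 \<le> (\<integral>x. k x * indicator K x \<partial>lborel)"
    by (rule LIMSEQ_le_const) (use continuous_test_nonneg[OF k ki pos fc f01 fR] in blast)
qed

text \<open>If k were negative on a set of positive measure, inner regularity would give a compact
  set of positive measure inside it. The integral of k over that set is nonnegative by testing and
  its integrand is negative there, a contradiction. The balls make the measures finite.\<close>

lemma gaussian_test_nonneg_AE:
  fixes k :: "'a::euclidean_space \<Rightarrow> real"
  assumes k: "k \<in> borel_measurable borel"
    and ki: "\<And>c. c > 0 \<Longrightarrow> integrable lborel (\<lambda>x. k x * exp (- c * (norm x)\<^sup>2))"
    and pos: "\<And>c y. c > 0 \<Longrightarrow> 0 \<le> (\<integral>x. k x * exp (- c * (norm (x - y))\<^sup>2) \<partial>lborel)"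
  shows "AE x in lborel. 0 \<le> k x"
proof -
  note k [measurable]
  have null: "emeasure lborel ({x. k x < 0} \<inter> cball 0 (real n)) = 0" for n
  proof (rule ccontr)
    let ?A = "{x. k x < 0} \<inter> cball 0 (real n)"
    assume "emeasure lborel ?A \<noteq> 0"
    moreover have Am: "?A \<in> sets borel" by measurable
    have fin: "emeasure lborel ?A < \<infinity>"
      by (rule le_less_trans[OF emeasure_mono emeasure_lborel_cball_finite[of 0 "real n"]]) auto
    ultimately have mpos: "0 < measure lborel ?A"
      by (simp add: measure_def enn2real_positive_iff zero_less_iff_neq_zero)
    obtain T where T: "closed T" "T \<subseteq> ?A" "?A - T \<in> lmeasurable" "emeasure lebesgue (?A - T) < ennreal (measure lborel ?A)"
      using sets_lebesgue_inner_closed[of ?A "measure lborel ?A"] Am mpos by auto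
    have Tm[measurable]: "T \<in> sets borel" using T(1) by auto
    have Tc: "compact T" using T(1,2) bounded_subset[OF bounded_cball[of "0 :: 'a" "real n"]] by (auto simp: compact_eq_bounded_closed)
    \<comment> \<open>The remainder is strictly smaller than the whole set, so \<open>T\<close> is
      neither empty nor null.\<close>
    have "emeasure lborel (?A - T) < emeasure lborel ?A"
      using T(4) Am Tm fin by (simp add: emeasure_eq_ennreal_measure[of lborel ?A] less_top)
    then have Tn: "T \<noteq> {}" by auto
    have T0: "emeasure lborel T \<noteq> 0"
    proof
      assume "emeasure lborel T = 0"
      then have "T \<in> null_sets lborel" using Tm by (auto simp: null_sets_def)
      then have "emeasure lborel (?A - T) = emeasure lborel ?A"
        using Am by (intro emeasure_Diff_null_set) auto
      with \<open>emeasure lborel (?A - T) < emeasure lborel ?A\<close> show False by simp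
    qed
    note ct = compact_test_nonneg[OF k ki pos Tc Tn]
    have i: "integrable lborel (\<lambda>x. - (k x * indicator T x))" using ct(1) by simp
    have nn: "AE x in lborel. 0 \<le> - (k x * indicator T x)"
      using T(2) by (intro AE_I2) (auto simp: indicator_def less_imp_le split: if_splits)
    have "(\<integral>x. - (k x * indicator T x) \<partial>lborel) = 0"
      using ct(2) integral_nonneg_AE[OF nn] by simp
    then have "AE x in lborel. - (k x * indicator T x) = 0"
      using integral_nonneg_eq_0_iff_AE[OF i nn] by simp
    then have "AE x in lborel. x \<notin> T"
      by (rule AE_mp) (use T(2) in \<open>auto intro!: AE_I2\<close>)
    then have "emeasure lborel T = 0"
      using AE_iff_measurable[of T lborel "\<lambda>x. x \<notin> T"] Tm by simp
    with T0 show False by simp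
  qed
  have "AE x in lborel. \<forall>n. x \<notin> {x. k x < 0} \<inter> cball 0 (real n)"
  proof (subst AE_all_countable, intro allI)
    fix n
    have "{x. k x < 0} \<inter> cball 0 (real n) \<in> null_sets lborel"
      using null[of n] by (auto simp: null_sets_def)
    then show "AE x in lborel. x \<notin> {x. k x < 0} \<inter> cball 0 (real n)" by (rule AE_not_in)
  qed
  then show ?thesis
  proof (rule AE_mp, intro AE_I2 impI)
    fix x assume a: "\<forall>n. x \<notin> {x. k x < 0} \<inter> cball 0 (real n)"
    obtain n where "norm x \<le> real n" using real_arch_simple by blast
    then show "0 \<le> k x" using a[rule_format, of n] by auto
  qed
qed

lemma one_plus_norm_neq_0 [simp]: "1 + norm x \<noteq> 0"
  using norm_ge_zero[of x] by linarith

lemma norm_divide_weight: "norm (z / complex_of_real ((1 + norm x) ^ N)) = norm z / (1 + norm x) ^ N"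
  by (subst norm_divide, subst norm_of_real, subst abs_of_pos) auto

lemma Re_mult_of_real: "Re (z * (w * complex_of_real r)) = Re (z * w) * r"
  by (simp add: algebra_simps)

text \<open>Converse of the triangle inequality for integrals. For each fixed angle \<theta> the
  real function M - Re (cis \<theta> \<delta>) has nonnegative pairings with all Gaussians, hence is
  nonnegative almost everywhere; the best angle gives |\<delta>|. It yields uniqueness of Fourier
  transforms with M = 0 and later the comparison of two solutions.\<close>

lemma weak_bound_AE:
  fixes \<delta> :: "real^'d::finite \<Rightarrow> complex" and M :: "real^'d \<Rightarrow> real"
  assumes \<delta>: "\<delta> \<in> borel_measurable borel" "\<And>\<phi>. \<phi> \<in> schwartz \<Longrightarrow> integrable lborel (\<lambda>\<xi>. \<delta> \<xi> * \<phi> \<xi>)"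
    and M: "M \<in> borel_measurable borel" "\<And>\<phi>. \<phi> \<in> schwartz \<Longrightarrow> integrable lborel (\<lambda>\<xi>. of_real (M \<xi>) * \<phi> \<xi>)"
    and le: "\<And>\<phi>. \<phi> \<in> schwartz \<Longrightarrow> cmod (\<integral>\<xi>. \<delta> \<xi> * \<phi> \<xi> \<partial>lborel) \<le> (\<integral>\<xi>. M \<xi> * cmod (\<phi> \<xi>) \<partial>lborel)"
  shows "AE \<xi> in lborel. cmod (\<delta> \<xi>) \<le> M \<xi>"
proof -
  note [measurable] = \<delta>(1) M(1)
  have *: "AE \<xi> in lborel. 0 \<le> M \<xi> - Re (cis \<theta> * \<delta> \<xi>)" for \<theta>
  proof (rule gaussian_test_nonneg_AE)
    show "(\<lambda>\<xi>. M \<xi> - Re (cis \<theta> * \<delta> \<xi>)) \<in> borel_measurable borel" by measurable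
    have i: "integrable lborel (\<lambda>\<xi>. (M \<xi> - Re (cis \<theta> * \<delta> \<xi>)) * exp (- c * (norm (\<xi> - y))\<^sup>2))"
      and p: "0 \<le> (\<integral>\<xi>. (M \<xi> - Re (cis \<theta> * \<delta> \<xi>)) * exp (- c * (norm (\<xi> - y))\<^sup>2) \<partial>lborel)"
      if c: "c > 0" for c and y :: "real^'d"
    proof -
      let ?g = "\<lambda>\<xi>. exp (- c * (norm (\<xi> - y))\<^sup>2)"
      have S: "(\<lambda>\<xi>. complex_of_real (?g \<xi>)) \<in> schwartz" by (rule gaussian_schwartz[OF c])
      have iM: "integrable lborel (\<lambda>\<xi>. M \<xi> * ?g \<xi>)" using integrable_Re[OF M(2)[OF S]] by simp
      have id: "integrable lborel (\<lambda>\<xi>. Re (cis \<theta> * (\<delta> \<xi> * complex_of_real (?g \<xi>))))"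
        by (intro integrable_Re integrable_mult_right \<delta>(2) S)
      have e: "(\<lambda>\<xi>. (M \<xi> - Re (cis \<theta> * \<delta> \<xi>)) * ?g \<xi>) = (\<lambda>\<xi>. M \<xi> * ?g \<xi> - Re (cis \<theta> * (\<delta> \<xi> * complex_of_real (?g \<xi>))))"
        by (rule ext) (simp only: left_diff_distrib Re_mult_of_real)
      show "integrable lborel (\<lambda>\<xi>. (M \<xi> - Re (cis \<theta> * \<delta> \<xi>)) * ?g \<xi>)"
        unfolding e by (rule Bochner_Integration.integrable_diff[OF iM id])
      have "Re (cis \<theta> * (\<integral>\<xi>. \<delta> \<xi> * complex_of_real (?g \<xi>) \<partial>lborel)) \<le> cmod (cis \<theta> * (\<integral>\<xi>. \<delta> \<xi> * complex_of_real (?g \<xi>) \<partial>lborel))"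
        by (rule complex_Re_le_cmod)
      also have "\<dots> \<le> (\<integral>\<xi>. M \<xi> * cmod (complex_of_real (?g \<xi>)) \<partial>lborel)"
        unfolding norm_mult norm_cis mult_1 by (rule le[OF S])
      also have "\<dots> = (\<integral>\<xi>. M \<xi> * ?g \<xi> \<partial>lborel)" by simp
      also have "Re (cis \<theta> * (\<integral>\<xi>. \<delta> \<xi> * complex_of_real (?g \<xi>) \<partial>lborel)) = (\<integral>\<xi>. Re (cis \<theta> * (\<delta> \<xi> * complex_of_real (?g \<xi>))) \<partial>lborel)"
        unfolding integral_mult_right_zero[symmetric] by (rule integral_Re[symmetric]) (intro integrable_mult_right \<delta>(2) S)
      finally show "0 \<le> (\<integral>\<xi>. (M \<xi> - Re (cis \<theta> * \<delta> \<xi>)) * ?g \<xi> \<partial>lborel)"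
        unfolding e Bochner_Integration.integral_diff[OF iM id] by simp
    qed
    show "integrable lborel (\<lambda>\<xi>. (M \<xi> - Re (cis \<theta> * \<delta> \<xi>)) * exp (- c * (norm \<xi>)\<^sup>2))" if "c > 0" for c
      using i[OF that, of 0] by simp
    show "0 \<le> (\<integral>\<xi>. (M \<xi> - Re (cis \<theta> * \<delta> \<xi>)) * exp (- c * (norm (\<xi> - y))\<^sup>2) \<partial>lborel)" if "c > 0" for c y
      by (rule p[OF that])
  qed
  \<comment> \<open>The maximising angle depends on \<xi>, so one null set must serve all angles.
    Countably many rational angles suffice by continuity in the angle.\<close>
  have "AE \<xi> in lborel. \<forall>q::rat. 0 \<le> M \<xi> - Re (cis (of_rat q) * \<delta> \<xi>)"
    unfolding AE_all_countable using * by blast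
  then show ?thesis
  proof (rule AE_mp, intro AE_I2 impI)
    fix \<xi> assume a: "\<forall>q::rat. 0 \<le> M \<xi> - Re (cis (of_rat q) * \<delta> \<xi>)"
    have "Re (cis (- Arg (\<delta> \<xi>)) * \<delta> \<xi>) \<le> M \<xi>"
    proof (rule continuous_le_on_closure[of \<rat> "\<lambda>\<theta>. Re (cis \<theta> * \<delta> \<xi>)"])
      show "continuous_on (closure \<rat>) (\<lambda>\<theta>. Re (cis \<theta> * \<delta> \<xi>))" by (intro continuous_intros)
      show "- Arg (\<delta> \<xi>) \<in> closure \<rat>" by (simp add: Rats_closure_real)
      show "Re (cis x * \<delta> \<xi>) \<le> M \<xi>" if "x \<in> \<rat>" for x
        using that a by (auto elim!: Rats_cases)
    qed
    also have "cis (- Arg (\<delta> \<xi>)) * \<delta> \<xi> = cis (- Arg (\<delta> \<xi>)) * rcis (cmod (\<delta> \<xi>)) (Arg (\<delta> \<xi>))"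
      by (simp only: rcis_cmod_Arg)
    also have "\<dots> = of_real (cmod (\<delta> \<xi>)) * (cis (- Arg (\<delta> \<xi>)) * cis (Arg (\<delta> \<xi>)))"
      by (simp only: rcis_def mult.left_commute)
    also have "\<dots> = of_real (cmod (\<delta> \<xi>))" by (simp add: cis_mult)
    finally show "cmod (\<delta> \<xi>) \<le> M \<xi>" by simp
  qed
qed

section \<open>Distributions given by their Fourier transform\<close>

text \<open>Integrability against some polynomial weight: enough to pair with Schwartz functions and
  to define a tempered distribution, and stable under sums and under factors of polynomial
  growth.\<close>

definition tame :: "(real^'d::finite \<Rightarrow> complex) \<Rightarrow> bool" where
  "tame h \<longleftrightarrow> h \<in> borel_measurable borel \<and> (\<exists>N. integrable lborel (\<lambda>\<xi>. h \<xi> / of_real ((1 + norm \<xi>) ^ N)))"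

lemma tame_measurable: "tame h \<Longrightarrow> h \<in> borel_measurable borel"
  by (simp add: tame_def)

lemma tame_mult_bound:
  assumes h: "tame h" and g: "g \<in> borel_measurable borel" "\<And>\<xi>. cmod (g \<xi>) \<le> B * (1 + norm \<xi>) ^ n"
  shows "tame (\<lambda>\<xi>. g \<xi> * h \<xi>)"
proof -
  obtain N where N: "integrable lborel (\<lambda>\<xi>. h \<xi> / of_real ((1 + norm \<xi>) ^ N))" using h by (auto simp: tame_def)
  have [measurable]: "h \<in> borel_measurable borel" "g \<in> borel_measurable borel" using h g by (auto simp: tame_def)
  have "integrable lborel (\<lambda>\<xi>. g \<xi> * h \<xi> / of_real ((1 + norm \<xi>) ^ (n + N)))"
  proof (rule Bochner_Integration.integrable_bound)
    show "integrable lborel (\<lambda>\<xi>. of_real B * (h \<xi> / of_real ((1 + norm \<xi>) ^ N)))"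
      by (intro integrable_mult_right N)
    show "AE \<xi> in lborel. norm (g \<xi> * h \<xi> / of_real ((1 + norm \<xi>) ^ (n + N))) \<le> norm (of_real B * (h \<xi> / of_real ((1 + norm \<xi>) ^ N)))"
    proof (rule AE_I2)
      fix \<xi> :: "real^'a"
      let ?w = "1 + norm \<xi>"
      have "norm (g \<xi> * h \<xi> / of_real (?w ^ (n + N))) = (cmod (g \<xi>) / ?w ^ n) * (cmod (h \<xi>) / ?w ^ N)"
        by (simp add: norm_mult norm_divide norm_power power_add del: of_real_add of_real_power)
      also have "\<dots> \<le> \<bar>B\<bar> * (cmod (h \<xi>) / ?w ^ N)"
      proof (rule mult_right_mono)
        have "cmod (g \<xi>) \<le> \<bar>B\<bar> * ?w ^ n"
          by (rule order_trans[OF g(2)]) (simp add: mult_right_mono)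
        then show "cmod (g \<xi>) / ?w ^ n \<le> \<bar>B\<bar>" by (simp add: pos_divide_le_eq)
      qed simp
      also have "\<dots> = norm (of_real B * (h \<xi> / of_real (?w ^ N)))"
        by (simp add: norm_mult norm_divide del: of_real_add of_real_power)
      finally show "norm (g \<xi> * h \<xi> / of_real (?w ^ (n + N))) \<le> norm (of_real B * (h \<xi> / of_real (?w ^ N)))" .
    qed
  qed measurable
  then show ?thesis unfolding tame_def by auto
qed

lemma tame_cmult: "tame h \<Longrightarrow> tame (\<lambda>\<xi>. c * h \<xi>)"
  by (rule tame_mult_bound[where B = "cmod c" and n = 0]) auto

lemma tame_coord: "tame h \<Longrightarrow> tame (\<lambda>\<xi>. of_real (\<xi> $ j) * h \<xi>)"
proof (rule tame_mult_bound[where B = 1 and n = 1])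
  show "(\<lambda>\<xi>::real^'a. complex_of_real (\<xi> $ j)) \<in> borel_measurable borel"
    by (intro borel_measurable_continuous_onI continuous_intros)
  show "cmod (complex_of_real (\<xi> $ j)) \<le> 1 * (1 + norm \<xi>) ^ 1" for \<xi> :: "real^'a"
    using component_le_norm_cart[of \<xi> j] by simp
qed

lemma tame_add:
  assumes "tame h" "tame g"
  shows "tame (\<lambda>\<xi>. h \<xi> + g \<xi>)"
proof -
  have [measurable]: "h \<in> borel_measurable borel" "g \<in> borel_measurable borel" using assms by (auto simp: tame_def)
  have up: "integrable lborel (\<lambda>\<xi>. h \<xi> / of_real ((1 + norm \<xi>) ^ (N + n)))"
    if N: "integrable lborel (\<lambda>\<xi>. h \<xi> / of_real ((1 + norm \<xi>) ^ N))" and m[measurable]: "h \<in> borel_measurable borel"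
    for h :: "real^'a \<Rightarrow> complex" and N n
  proof (rule Bochner_Integration.integrable_bound[OF N])
    show "AE \<xi> in lborel. norm (h \<xi> / of_real ((1 + norm \<xi>) ^ (N + n))) \<le> norm (h \<xi> / of_real ((1 + norm \<xi>) ^ N))"
    proof (rule AE_I2)
      fix \<xi> :: "real^'a"
      have "(1 + norm \<xi>) ^ N \<le> (1 + norm \<xi>) ^ (N + n)" by (intro power_increasing) auto
      then show "norm (h \<xi> / of_real ((1 + norm \<xi>) ^ (N + n))) \<le> norm (h \<xi> / of_real ((1 + norm \<xi>) ^ N))"
        unfolding norm_divide norm_of_real by (intro divide_left_mono) auto
    qed
  qed measurable
  obtain N where N: "integrable lborel (\<lambda>\<xi>. h \<xi> / of_real ((1 + norm \<xi>) ^ N))" using assms by (auto simp: tame_def)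
  obtain n where n: "integrable lborel (\<lambda>\<xi>. g \<xi> / of_real ((1 + norm \<xi>) ^ n))" using assms by (auto simp: tame_def)
  have "integrable lborel (\<lambda>\<xi>. h \<xi> / of_real ((1 + norm \<xi>) ^ (N + n)) + g \<xi> / of_real ((1 + norm \<xi>) ^ (n + N)))"
    by (intro Bochner_Integration.integrable_add up N n) auto
  then have "integrable lborel (\<lambda>\<xi>. (h \<xi> + g \<xi>) / of_real ((1 + norm \<xi>) ^ (N + n)))"
    by (simp only: add.commute[of n N] add_divide_distrib)
  then show ?thesis unfolding tame_def by auto
qed

lemma tame_zero: "tame (\<lambda>_. 0)"
  by (simp add: tame_def)

lemma tame_sum: "(\<And>i. i \<in> I \<Longrightarrow> tame (h i)) \<Longrightarrow> tame (\<lambda>\<xi>. \<Sum>i\<in>I. h i \<xi>)"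
  by (induction I rule: infinite_finite_induct) (auto intro: tame_add tame_zero)

lemma tame_power_bound:
  fixes h :: "real^'d::finite \<Rightarrow> complex"
  assumes h: "h \<in> borel_measurable borel" and b: "AE \<xi> in lborel. cmod (h \<xi>) \<le> C * norm \<xi> powr - r"
    and r: "0 \<le> r" "r < real CARD('d)"
  shows "tame h"
proof -
  note h [measurable]
  have "integrable lborel (\<lambda>\<xi>. h \<xi> / of_real ((1 + norm \<xi>) ^ Suc DIM(real^'d)))"
  proof (rule Bochner_Integration.integrable_bound)
    show "integrable lborel (\<lambda>\<xi>::real^'d. C * (norm \<xi> powr - r / (1 + norm \<xi>) ^ Suc DIM(real^'d)))"
      using r by (intro integrable_mult_right integrable_power_decay) auto
    show "AE \<xi> in lborel. norm (h \<xi> / of_real ((1 + norm \<xi>) ^ Suc DIM(real^'d))) \<le> norm (C * (norm \<xi> powr - r / (1 + norm \<xi>) ^ Suc DIM(real^'d)))"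
      using b
    proof (rule AE_mp, intro AE_I2 impI)
      fix \<xi> :: "real^'d"
      let ?w = "(1 + norm \<xi>) ^ Suc DIM(real^'d)"
      have w: "?w > 0" by (rule one_plus_norm_power_pos)
      assume "cmod (h \<xi>) \<le> C * norm \<xi> powr - r"
      then have "cmod (h \<xi>) / ?w \<le> C * norm \<xi> powr - r / ?w"
        using w by (intro divide_right_mono) auto
      also have "\<dots> = C * (norm \<xi> powr - r / ?w)" by (rule times_divide_eq_right[symmetric])
      also have "\<dots> \<le> norm (C * (norm \<xi> powr - r / ?w))" unfolding real_norm_def by (rule abs_ge_self)
      finally show "norm (h \<xi> / of_real ?w) \<le> norm (C * (norm \<xi> powr - r / ?w))"
        unfolding norm_divide_weight .
    qed
  qed measurable
  then show ?thesis unfolding tame_def using h by blast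
qed

lemma tame_test_integrable:
  assumes "tame h" "\<phi> \<in> schwartz"
  shows "integrable lborel (\<lambda>\<xi>. h \<xi> * \<phi> \<xi>)"
proof -
  obtain N where N: "integrable lborel (\<lambda>\<xi>. h \<xi> / of_real ((1 + norm \<xi>) ^ N))" using assms by (auto simp: tame_def)
  have [measurable]: "h \<in> borel_measurable borel" "\<phi> \<in> borel_measurable borel"
    using assms schwartz_measurable by (auto simp: tame_def)
  obtain C where C: "\<And>x. (1 + norm x) ^ N * cmod (\<phi> x) \<le> C" using schwartz_decay[OF assms(2)] by metis
  show ?thesis
  proof (rule Bochner_Integration.integrable_bound)
    show "integrable lborel (\<lambda>\<xi>. C * norm (h \<xi> / of_real ((1 + norm \<xi>) ^ N)))"
      by (intro integrable_mult_right integrable_norm N)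
    show "AE \<xi> in lborel. norm (h \<xi> * \<phi> \<xi>) \<le> norm (C * norm (h \<xi> / of_real ((1 + norm \<xi>) ^ N)))"
    proof (rule AE_I2)
      fix \<xi> :: "real^'a"
      let ?w = "(1 + norm \<xi>) ^ N"
      have w: "?w > 0" by (rule one_plus_norm_power_pos)
      have "norm (h \<xi> * \<phi> \<xi>) = (?w * cmod (\<phi> \<xi>)) * (cmod (h \<xi>) / ?w)" using w by (simp add: norm_mult)
      also have "\<dots> \<le> C * (cmod (h \<xi>) / ?w)" using w by (intro mult_right_mono C) auto
      also have "\<dots> \<le> norm (C * norm (h \<xi> / of_real ?w))"
        unfolding norm_divide_weight real_norm_def by (rule abs_ge_self)
      finally show "norm (h \<xi> * \<phi> \<xi>) \<le> norm (C * norm (h \<xi> / of_real ?w))" .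
    qed
  qed measurable
qed

lemma tame_L1_loc:
  assumes "tame h" shows "h \<in> L1_loc"
  unfolding L1_loc_def
proof (intro CollectI allI impI)
  fix K :: "(real^'a) set" assume K: "compact K"
  obtain N where N: "integrable lborel (\<lambda>\<xi>. h \<xi> / of_real ((1 + norm \<xi>) ^ N))" using assms by (auto simp: tame_def)
  have [measurable]: "h \<in> borel_measurable borel" "K \<in> sets borel"
    using assms K by (auto simp: tame_def borel_compact)
  obtain R where R: "\<And>x. x \<in> K \<Longrightarrow> norm x \<le> R" using compact_imp_bounded[OF K] by (auto simp: bounded_iff)
  show "set_integrable lborel K h" unfolding set_integrable_def
  proof (rule Bochner_Integration.integrable_bound)
    show "integrable lborel (\<lambda>\<xi>. (1 + R) ^ N * norm (h \<xi> / of_real ((1 + norm \<xi>) ^ N)))"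
      by (intro integrable_mult_right integrable_norm N)
    show "AE \<xi> in lborel. norm (indicator K \<xi> *\<^sub>R h \<xi>) \<le> norm ((1 + R) ^ N * norm (h \<xi> / of_real ((1 + norm \<xi>) ^ N)))"
    proof (rule AE_I2)
      fix \<xi> :: "real^'a"
      let ?w = "(1 + norm \<xi>) ^ N"
      have w: "?w > 0" by (rule one_plus_norm_power_pos)
      show "norm (indicator K \<xi> *\<^sub>R h \<xi>) \<le> norm ((1 + R) ^ N * norm (h \<xi> / of_real ?w))"
      proof (cases "\<xi> \<in> K")
        case True
        have "cmod (h \<xi>) = ?w * (cmod (h \<xi>) / ?w)" using w by simp
        also have "\<dots> \<le> (1 + R) ^ N * (cmod (h \<xi>) / ?w)"
          using w R[OF True] by (intro mult_right_mono power_mono) auto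
        also have "\<dots> \<le> norm ((1 + R) ^ N * norm (h \<xi> / of_real ?w))"
          unfolding norm_divide_weight real_norm_def by (rule abs_ge_self)
        finally show ?thesis using True by simp
      qed simp
    qed
  qed measurable
qed

lemma L1_loc_measurable:
  assumes "h \<in> L1_loc" shows "h \<in> borel_measurable borel"
proof -
  have "(\<lambda>\<xi>. indicator (cball 0 (real n)) \<xi> *\<^sub>R h \<xi>) \<in> borel_measurable borel" for n
    using assms borel_measurable_integrable[of lborel "\<lambda>\<xi>. indicator (cball 0 (real n)) \<xi> *\<^sub>R h \<xi>"]
    by (auto simp: L1_loc_def set_integrable_def)
  then show ?thesis
  proof (rule borel_measurable_LIMSEQ_metric)
    fix \<xi> :: "real^'a"
    obtain N where N: "norm \<xi> \<le> real N" using real_arch_simple by blast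
    have "indicator (cball 0 (real n)) \<xi> *\<^sub>R h \<xi> = h \<xi>" if "n \<ge> N" for n
      using N that by simp
    then show "(\<lambda>n. indicator (cball 0 (real n)) \<xi> *\<^sub>R h \<xi>) \<longlonglongrightarrow> h \<xi>"
      by (intro tendsto_eventually) (auto simp: eventually_sequentially)
  qed
qed

lemma has_fourier_fun_measurable: "has_fourier_fun T h \<Longrightarrow> h \<in> borel_measurable borel"
  by (simp add: has_fourier_fun_def L1_loc_measurable)

lemma has_fourier_funI: "tame h \<Longrightarrow> (\<And>\<phi>. \<phi> \<in> schwartz \<Longrightarrow> T (fourier \<phi>) = (\<integral>\<xi>. h \<xi> * \<phi> \<xi> \<partial>lborel)) \<Longrightarrow> has_fourier_fun T h"
  by (auto simp: has_fourier_fun_def tame_L1_loc tame_test_integrable dist_fourier_def dist_of_fun_def)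

lemma has_fourier_funD:
  assumes "has_fourier_fun T h" "\<phi> \<in> schwartz"
  shows "T (fourier \<phi>) = (\<integral>\<xi>. h \<xi> * \<phi> \<xi> \<partial>lborel)" "integrable lborel (\<lambda>\<xi>. h \<xi> * \<phi> \<xi>)"
  using assms by (auto simp: has_fourier_fun_def dist_fourier_def dist_of_fun_def fun_eq_iff split: if_splits)

text \<open>Both functions have the same pairing with each \<phi>, namely T at
  \<open>fourier \<phi>\<close>; apply \<open>weak_bound_AE\<close> to their difference with
  majorant 0.\<close>

lemma has_fourier_fun_unique:
  assumes "has_fourier_fun T g" "has_fourier_fun T h"
  shows "AE \<xi> in lborel. g \<xi> = h \<xi>"
proof -
  have "AE \<xi> in lborel. cmod (g \<xi> - h \<xi>) \<le> 0"
  proof (rule weak_bound_AE)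
    show "(\<lambda>\<xi>. g \<xi> - h \<xi>) \<in> borel_measurable borel"
      using has_fourier_fun_measurable[OF assms(1)] has_fourier_fun_measurable[OF assms(2)] by measurable
    fix \<phi> :: "real^'a \<Rightarrow> complex" assume \<phi>: "\<phi> \<in> schwartz"
    note I = has_fourier_funD[OF assms(1) \<phi>] has_fourier_funD[OF assms(2) \<phi>]
    show "integrable lborel (\<lambda>\<xi>. (g \<xi> - h \<xi>) * \<phi> \<xi>)"
      using Bochner_Integration.integrable_diff[OF I(2,4)] by (simp add: left_diff_distrib)
    show "cmod (\<integral>\<xi>. (g \<xi> - h \<xi>) * \<phi> \<xi> \<partial>lborel) \<le> (\<integral>\<xi>. 0 * cmod (\<phi> \<xi>) \<partial>lborel)"
      unfolding left_diff_distrib Bochner_Integration.integral_diff[OF I(2,4)] using I(1,3) by simp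
  qed auto
  then show ?thesis by (rule AE_mp) (auto intro!: AE_I2)
qed

text \<open>\<open>SOME\<close> returns a genuine Fourier transform as soon as one exists, and
  uniqueness makes the choice immaterial up to null sets.\<close>

lemma fourier_fun_AE:
  assumes "has_fourier_fun T h"
  shows "AE \<xi> in lborel. fourier_fun T \<xi> = h \<xi>" "has_fourier_fun T (fourier_fun T)"
proof -
  show "has_fourier_fun T (fourier_fun T)" unfolding fourier_fun_def using assms by (rule someI[where P = "has_fourier_fun T"])
  from has_fourier_fun_unique[OF this assms] show "AE \<xi> in lborel. fourier_fun T \<xi> = h \<xi>" .
qed

lemma dist_with_fourier_fourier:
  "tame h \<Longrightarrow> has_fourier_fun (dist_with_fourier h) h"
  by (rule has_fourier_funI) (auto simp: dist_with_fourier_def fourier_schwartz dist_of_fun_def inv_fourier_fourier)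

lemma dist_with_fourier_apply:
  "\<phi> \<in> schwartz \<Longrightarrow> dist_with_fourier h \<phi> = (\<integral>\<xi>. h \<xi> * inv_fourier \<phi> \<xi> \<partial>lborel)"
  by (simp add: dist_with_fourier_def dist_of_fun_def inv_fourier_schwartz)

lemma dist_with_fourier_cong_AE:
  assumes [measurable]: "g \<in> borel_measurable borel" "h \<in> borel_measurable borel" and "AE \<xi> in lborel. g \<xi> = h \<xi>"
  shows "dist_with_fourier g = dist_with_fourier h"
proof
  fix \<phi> :: "real^'a \<Rightarrow> complex"
  show "dist_with_fourier g \<phi> = dist_with_fourier h \<phi>"
  proof (cases "\<phi> \<in> schwartz")
    case True
    have [measurable]: "inv_fourier \<phi> \<in> borel_measurable borel"
      by (intro schwartz_measurable inv_fourier_schwartz True)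
    show ?thesis unfolding dist_with_fourier_apply[OF True]
    proof (rule integral_cong_AE)
      show "AE \<xi> in lborel. g \<xi> * inv_fourier \<phi> \<xi> = h \<xi> * inv_fourier \<phi> \<xi>"
        using assms(3) by (rule AE_mp) (auto intro!: AE_I2)
    qed measurable
  qed (simp add: dist_with_fourier_def)
qed

text \<open>On Schwartz functions this is Fourier inversion; elsewhere both sides vanish by
  convention. It turns almost everywhere equality of Fourier transforms into equality of
  distributions as functions.\<close>

lemma tempered_eq_dist_with_fourier:
  assumes "T \<in> tempered" "has_fourier_fun T h"
  shows "T = dist_with_fourier h"
proof
  fix \<phi> :: "real^'a \<Rightarrow> complex"
  show "T \<phi> = dist_with_fourier h \<phi>"
  proof (cases "\<phi> \<in> schwartz")
    case True
    then show ?thesis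
      using has_fourier_funD(1)[OF assms(2) inv_fourier_schwartz[OF True]]
      by (simp add: fourier_inv_fourier dist_with_fourier_apply)
  next
    case False
    then show ?thesis using assms(1) by (simp add: tempered_def dist_with_fourier_def)
  qed
qed

lemma inv_fourier_lin_comb:
  assumes "\<phi> \<in> schwartz" "\<psi> \<in> schwartz"
  shows "inv_fourier (\<lambda>x. a * \<phi> x + b * \<psi> x) x = a * inv_fourier \<phi> x + b * inv_fourier \<psi> x"
proof -
  have "fourier (\<lambda>x. a * \<phi> x + b * \<psi> x) y = a * fourier \<phi> y + b * fourier \<psi> y" for y
  proof -
    have "fourier (\<lambda>x. a * \<phi> x + b * \<psi> x) y = (\<integral>x. a * (cis (- (x \<bullet> y)) * \<phi> x) + b * (cis (- (x \<bullet> y)) * \<psi> x) \<partial>lborel)"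
      unfolding fourier_def by (simp add: algebra_simps)
    also have "\<dots> = a * fourier \<phi> y + b * fourier \<psi> y"
      unfolding fourier_def by (subst Bochner_Integration.integral_add) (auto intro!: integrable_mult_right fourier_integrand assms)
    finally show ?thesis .
  qed
  then show ?thesis by (simp add: inv_fourier_eq algebra_simps add_divide_distrib)
qed

text \<open>Continuity holds because the weight of order N that makes h integrable is matched by the
  decay of order N of \<open>inv_fourier \<phi>\<close>, which a single Schwartz seminorm of \<phi>
  controls.\<close>

lemma dist_with_fourier_tempered:
  assumes "tame h" shows "dist_with_fourier h \<in> tempered"
proof -
  have lin: "dist_with_fourier h (\<lambda>x. a * \<phi> x + b * \<psi> x) = a * dist_with_fourier h \<phi> + b * dist_with_fourier h \<psi>"
    if "\<phi> \<in> schwartz" "\<psi> \<in> schwartz" for a b \<phi> \<psi>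
  proof -
    have "dist_with_fourier h (\<lambda>x. a * \<phi> x + b * \<psi> x)
      = (\<integral>\<xi>. a * (h \<xi> * inv_fourier \<phi> \<xi>) + b * (h \<xi> * inv_fourier \<psi> \<xi>) \<partial>lborel)"
      unfolding dist_with_fourier_apply[OF schwartz_lin_comb[OF that]] inv_fourier_lin_comb[OF that]
      by (simp add: algebra_simps)
    also have "\<dots> = a * dist_with_fourier h \<phi> + b * dist_with_fourier h \<psi>"
      unfolding dist_with_fourier_apply[OF that(1)] dist_with_fourier_apply[OF that(2)]
      by (subst Bochner_Integration.integral_add)
        (auto intro!: integrable_mult_right tame_test_integrable assms inv_fourier_schwartz that)
    finally show ?thesis .
  qed
  obtain N where N: "integrable lborel (\<lambda>\<xi>. h \<xi> / of_real ((1 + norm \<xi>) ^ N))" using assms by (auto simp: tame_def)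
  obtain C n where C: "\<And>\<phi> x. \<phi> \<in> schwartz \<Longrightarrow> (1 + norm x) ^ N * cmod (inv_fourier \<phi> x) \<le> C * schwartz_norm n (\<phi> :: real^'a \<Rightarrow> complex)"
    using inv_fourier_decay[of N, where 'd='a] by blast
  define A where "A = (\<integral>\<xi>. norm (h \<xi> / of_real ((1 + norm \<xi>) ^ N)) \<partial>lborel)"
  have bnd: "cmod (dist_with_fourier h \<phi>) \<le> (A * C) * schwartz_norm n \<phi>" if "\<phi> \<in> schwartz" for \<phi>
  proof -
    have "cmod (dist_with_fourier h \<phi>) \<le> (\<integral>\<xi>. norm (h \<xi> / of_real ((1 + norm \<xi>) ^ N)) * (C * schwartz_norm n \<phi>) \<partial>lborel)"
      unfolding dist_with_fourier_apply[OF that]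
    proof (rule integral_norm_le)
      show "integrable lborel (\<lambda>\<xi>. norm (h \<xi> / of_real ((1 + norm \<xi>) ^ N)) * (C * schwartz_norm n \<phi>))"
        by (intro integrable_mult_left integrable_norm N)
      fix \<xi> :: "real^'a"
      let ?w = "(1 + norm \<xi>) ^ N"
      have w: "?w > 0" by (rule one_plus_norm_power_pos)
      have "norm (h \<xi> * inv_fourier \<phi> \<xi>) = cmod (h \<xi>) / ?w * (?w * cmod (inv_fourier \<phi> \<xi>))" using w by (simp add: norm_mult)
      also have "\<dots> \<le> cmod (h \<xi>) / ?w * (C * schwartz_norm n \<phi>)" using w by (intro mult_left_mono C that) auto
      also have "cmod (h \<xi>) / ?w = norm (h \<xi> / of_real ?w)" unfolding norm_divide norm_of_real using w by simp
      finally show "norm (h \<xi> * inv_fourier \<phi> \<xi>) \<le> norm (h \<xi> / of_real ?w) * (C * schwartz_norm n \<phi>)" .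
    qed
    also have "\<dots> = (A * C) * schwartz_norm n \<phi>" by (simp only: integral_mult_left_zero A_def mult.assoc)
    finally show ?thesis .
  qed
  show ?thesis unfolding tempered_def
  proof (intro CollectI conjI ballI allI impI)
    show "dist_with_fourier h \<phi> = 0" if "\<phi> \<notin> schwartz" for \<phi> using that by (simp add: dist_with_fourier_def)
    show "dist_with_fourier h (\<lambda>x. \<phi> x + \<psi> x) = dist_with_fourier h \<phi> + dist_with_fourier h \<psi>"
      if "\<phi> \<in> schwartz" "\<psi> \<in> schwartz" for \<phi> \<psi> using lin[OF that, of 1 1] by simp
    show "dist_with_fourier h (\<lambda>x. c * \<phi> x) = c * dist_with_fourier h \<phi>" if "\<phi> \<in> schwartz" for c \<phi>
      using lin[OF that that, of c 0] by simp
    show "\<exists>C N. \<forall>\<phi>\<in>schwartz. cmod (dist_with_fourier h \<phi>) \<le> C * schwartz_norm N \<phi>" using bnd by blast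
  qed
qed

section \<open>Derivatives, linear combinations and products on the Fourier side\<close>

lemma has_fourier_fun_partial:
  assumes T: "has_fourier_fun T h" and h: "tame h"
  shows "has_fourier_fun (dist_partial j T) (\<lambda>\<xi>. \<i> * (of_real (\<xi> $ j) * h \<xi>))"
proof (rule has_fourier_funI)
  show "tame (\<lambda>\<xi>. \<i> * (of_real (\<xi> $ j) * h \<xi>))" by (intro tame_cmult tame_coord h)
  fix \<phi> :: "real^'a \<Rightarrow> complex" assume \<phi>: "\<phi> \<in> schwartz"
  have S: "(\<lambda>x. - \<i> * (of_real (x $ j) * \<phi> x)) \<in> schwartz" by (intro schwartz_cmult schwartz_coord_mult \<phi>)
  have "dist_partial j T (fourier \<phi>) = - T (partial_deriv j (fourier \<phi>))"
    by (simp add: dist_partial_def fourier_schwartz[OF \<phi>])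
  also have "T (partial_deriv j (fourier \<phi>)) = (\<integral>\<xi>. h \<xi> * (- \<i> * (of_real (\<xi> $ j) * \<phi> \<xi>)) \<partial>lborel)"
    unfolding partial_deriv_fourier[OF \<phi>] by (rule has_fourier_funD(1)[OF T S])
  also have "- (\<integral>\<xi>. h \<xi> * (- \<i> * (of_real (\<xi> $ j) * \<phi> \<xi>)) \<partial>lborel) = (\<integral>\<xi>. - (h \<xi> * (- \<i> * (of_real (\<xi> $ j) * \<phi> \<xi>))) \<partial>lborel)" by (rule integral_minus[symmetric])
  also have "\<dots> = (\<integral>\<xi>. \<i> * (of_real (\<xi> $ j) * h \<xi>) * \<phi> \<xi> \<partial>lborel)"
    by (rule Bochner_Integration.integral_cong) (auto simp: mult_ac)
  finally show "dist_partial j T (fourier \<phi>) = (\<integral>\<xi>. \<i> * (of_real (\<xi> $ j) * h \<xi>) * \<phi> \<xi> \<partial>lborel)" .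
qed

lemma has_fourier_fun_cmult:
  assumes T: "has_fourier_fun T h" and h: "tame h"
  shows "has_fourier_fun (\<lambda>\<phi>. c * T \<phi>) (\<lambda>\<xi>. c * h \<xi>)"
proof (rule has_fourier_funI)
  show "tame (\<lambda>\<xi>. c * h \<xi>)" by (intro tame_cmult h)
qed (simp add: has_fourier_funD(1)[OF T] mult.assoc)

lemma has_fourier_fun_add:
  assumes S: "has_fourier_fun S g" "tame g" and T: "has_fourier_fun T h" "tame h"
  shows "has_fourier_fun (\<lambda>\<phi>. S \<phi> + T \<phi>) (\<lambda>\<xi>. g \<xi> + h \<xi>)"
proof (rule has_fourier_funI)
  show "tame (\<lambda>\<xi>. g \<xi> + h \<xi>)" by (intro tame_add S T)
  fix \<phi> :: "real^'a \<Rightarrow> complex" assume \<phi>: "\<phi> \<in> schwartz"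
  show "S (fourier \<phi>) + T (fourier \<phi>) = (\<integral>\<xi>. (g \<xi> + h \<xi>) * \<phi> \<xi> \<partial>lborel)"
    unfolding distrib_right has_fourier_funD(1)[OF S(1) \<phi>] has_fourier_funD(1)[OF T(1) \<phi>]
    by (rule Bochner_Integration.integral_add[symmetric]) (intro tame_test_integrable S T \<phi>)+
qed

lemma has_fourier_fun_diff:
  assumes S: "has_fourier_fun S g" and T: "has_fourier_fun T h"
  shows "has_fourier_fun (dist_diff S T) (\<lambda>\<xi>. g \<xi> - h \<xi>)"
proof -
  have "set_integrable lborel K (\<lambda>\<xi>. g \<xi> - h \<xi>)" if "compact K" for K
    using S T that by (auto simp: has_fourier_fun_def L1_loc_def intro!: set_integral_diff(1))
  moreover have "integrable lborel (\<lambda>\<xi>. (g \<xi> - h \<xi>) * \<phi> \<xi>)"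
    "dist_diff S T (fourier \<phi>) = (\<integral>\<xi>. (g \<xi> - h \<xi>) * \<phi> \<xi> \<partial>lborel)" if \<phi>: "\<phi> \<in> schwartz" for \<phi>
    using Bochner_Integration.integrable_diff[OF has_fourier_funD(2)[OF S \<phi>] has_fourier_funD(2)[OF T \<phi>]]
      Bochner_Integration.integral_diff[OF has_fourier_funD(2)[OF S \<phi>] has_fourier_funD(2)[OF T \<phi>]]
    by (auto simp: dist_diff_def left_diff_distrib has_fourier_funD(1)[OF S \<phi>] has_fourier_funD(1)[OF T \<phi>])
  ultimately show ?thesis
    by (auto simp: has_fourier_fun_def L1_loc_def dist_fourier_def dist_of_fun_def)
qed

lemma has_fourier_fun_zero: "has_fourier_fun (\<lambda>_. 0) (\<lambda>_. 0)"
  by (rule has_fourier_funI) (auto simp: tame_zero)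

lemma has_fourier_fun_sum:
  assumes "\<And>i. i \<in> I \<Longrightarrow> has_fourier_fun (T i) (h i)" "\<And>i. i \<in> I \<Longrightarrow> tame (h i)"
  shows "has_fourier_fun (\<lambda>\<phi>. \<Sum>i\<in>I. T i \<phi>) (\<lambda>\<xi>. \<Sum>i\<in>I. h i \<xi>)"
  using assms
proof (induction I rule: infinite_finite_induct)
  case (insert x F)
  show ?case unfolding sum.insert[OF insert.hyps]
    by (rule has_fourier_fun_add) (use insert in \<open>auto intro!: tame_sum\<close>)
qed (simp_all add: has_fourier_fun_zero)

text \<open>Convolution with the normalisation of \<open>dist_prod\<close>, so that it is the
  Fourier transform of a product.\<close>

definition fconv :: "(real^'d::finite \<Rightarrow> complex) \<Rightarrow> (real^'d \<Rightarrow> complex) \<Rightarrow> real^'d \<Rightarrow> complex" where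
  "fconv g h \<xi> = of_real (1 / (2 * pi) ^ CARD('d)) * (\<integral>\<eta>. g (\<xi> - \<eta>) * h \<eta> \<partial>lborel)"

lemma AE_lborel_reflect:
  assumes "AE \<eta> in lborel. P (\<eta> :: 'a::euclidean_space)"
  shows "AE \<eta> in lborel. P (\<xi> - \<eta>)"
proof -
  obtain N where N: "{\<eta>. \<not> P \<eta>} \<subseteq> N" "N \<in> sets borel" "emeasure lborel N = 0"
    using assms by (auto elim!: AE_E)
  have [measurable]: "N \<in> sets borel" by (rule N)
  have s: "(\<lambda>\<eta>. \<xi> - \<eta>) -` N \<in> sets borel"
    using measurable_sets[of "\<lambda>\<eta>. \<xi> - \<eta>" borel borel N] by simp
  have "emeasure lborel ((\<lambda>\<eta>. \<xi> - \<eta>) -` N) = (\<integral>\<^sup>+\<eta>. indicator ((\<lambda>\<eta>. \<xi> - \<eta>) -` N) \<eta> \<partial>lborel)"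
    using s by (intro nn_integral_indicator[symmetric]) simp
  also have "\<dots> = (\<integral>\<^sup>+\<eta>. indicator N (\<xi> - \<eta>) \<partial>lborel)"
    by (intro nn_integral_cong) (simp only: indicator_def vimage_def mem_Collect_eq)
  also have "\<dots> = emeasure lborel N" by (subst nn_integral_lborel_reflect) simp_all
  finally have "(\<lambda>\<eta>. \<xi> - \<eta>) -` N \<in> null_sets lborel" using s N(3) by (auto simp: null_sets_def)
  then show ?thesis by (rule AE_I') (use N(1) in auto)
qed

lemma fconv_cong_AE:
  assumes [measurable]: "g \<in> borel_measurable borel" "g' \<in> borel_measurable borel" "h \<in> borel_measurable borel" "h' \<in> borel_measurable borel"
    and "AE \<eta> in lborel. g \<eta> = g' \<eta>" "AE \<eta> in lborel. h \<eta> = h' \<eta>"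
  shows "fconv g h \<xi> = fconv g' h' \<xi>"
proof -
  have "AE \<eta> in lborel. g (\<xi> - \<eta>) * h \<eta> = g' (\<xi> - \<eta>) * h' \<eta>"
    using AE_lborel_reflect[OF assms(5), of \<xi>] assms(6) by eventually_elim simp
  then have "(\<integral>\<eta>. g (\<xi> - \<eta>) * h \<eta> \<partial>lborel) = (\<integral>\<eta>. g' (\<xi> - \<eta>) * h' \<eta> \<partial>lborel)"
    by (intro integral_cong_AE) measurable
  then show ?thesis by (simp add: fconv_def)
qed

lemma fconv_measurable [measurable]:
  assumes [measurable]: "g \<in> borel_measurable borel" "h \<in> borel_measurable borel"
  shows "fconv g h \<in> borel_measurable borel"
  unfolding fconv_def by measurable

text \<open>\<open>dist_prod\<close> convolves the chosen representatives. Changing either factor on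
  a null set leaves the convolution unchanged at every frequency, so any representatives may be
  used.\<close>

lemma has_fourier_fun_prod:
  assumes S: "has_fourier_fun S g" and T: "has_fourier_fun T h" and c: "tame (fconv g h)"
  shows "has_fourier_fun (dist_prod S T) (fconv g h)"
proof -
  have "fconv (fourier_fun S) (fourier_fun T) = fconv g h"
    by (rule ext, rule fconv_cong_AE)
      (use has_fourier_fun_measurable[OF S] has_fourier_fun_measurable[OF T] fourier_fun_AE[OF S] fourier_fun_AE[OF T]
        has_fourier_fun_measurable in auto)
  then have "dist_prod S T = dist_with_fourier (fconv g h)"
    unfolding dist_prod_def by (metis (no_types, lifting) fconv_def ext)
  then show ?thesis using dist_with_fourier_fourier[OF c] by simp
qed

lemma weighted_sup_le_iff:
  fixes h :: "real^'d::finite \<Rightarrow> 'b::{real_normed_vector, second_countable_topology}"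
  assumes [measurable]: "h \<in> borel_measurable borel" and "0 \<le> C"
  shows "weighted_sup r h \<le> ennreal C \<longleftrightarrow> (AE \<xi> in lborel. norm \<xi> powr r * norm (h \<xi>) \<le> C)"
proof
  assume ws: "weighted_sup r h \<le> ennreal C"
  have "AE \<xi> in lborel. ennreal (norm \<xi> powr r * norm (h \<xi>)) \<le> weighted_sup r h"
    unfolding weighted_sup_def by (rule esssup_AE)
  then have "AE \<xi> in lborel. ennreal (norm \<xi> powr r * norm (h \<xi>)) \<le> ennreal C"
    by eventually_elim (rule order_trans[OF _ ws])
  then show "AE \<xi> in lborel. norm \<xi> powr r * norm (h \<xi>) \<le> C"
    by (rule AE_mp) (use assms(2) in \<open>auto intro!: AE_I2\<close>)
next
  assume "AE \<xi> in lborel. norm \<xi> powr r * norm (h \<xi>) \<le> C"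
  then have "AE \<xi> in lborel. ennreal (norm \<xi> powr r * norm (h \<xi>)) \<le> ennreal C"
    by (rule AE_mp) (auto intro!: AE_I2 ennreal_leI)
  then show "weighted_sup r h \<le> ennreal C" unfolding weighted_sup_def by (intro esssup_I) measurable
qed

section \<open>The exponential of the symbol\<close>

text \<open>The exponential series applied to a vector, for a plain function \<open>A\<close>. With
  the argument \<open>- t\<close> and the symbol as \<open>A\<close> it is
  \<open>exp_nsk_symbol\<close>.\<close>

definition oexp :: "('a::banach \<Rightarrow> 'a) \<Rightarrow> real \<Rightarrow> 'a \<Rightarrow> 'a" where
  "oexp A t z = (\<Sum>n. (t ^ n / fact n) *\<^sub>R (A ^^ n) z)"

context
  fixes A :: "'a::banach \<Rightarrow> 'a" and K :: real
  assumes A: "bounded_linear A" and K: "\<And>z. norm (A z) \<le> norm z * K" "K \<ge> 0"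
begin

lemma oexp_iterate_bound: "norm ((A ^^ n) z) \<le> norm z * K ^ n"
proof (induction n)
  case (Suc n)
  have "norm ((A ^^ Suc n) z) \<le> norm ((A ^^ n) z) * K" using K(1) by simp
  also have "\<dots> \<le> (norm z * K ^ n) * K" using Suc K(2) by (rule mult_right_mono)
  finally show ?case by (simp add: mult_ac)
qed simp

lemma oexp_summable_norm: "summable (\<lambda>n. norm ((t ^ n / fact n) *\<^sub>R (A ^^ n) z))"
proof (rule summable_comparison_test', rule summable_mult)
  show "summable (\<lambda>n. inverse (fact n) * (\<bar>t\<bar> * K) ^ n)" by (rule summable_exp)
  show "norm (norm ((t ^ n / fact n) *\<^sub>R (A ^^ n) z)) \<le> norm z * (inverse (fact n) * (\<bar>t\<bar> * K) ^ n)" if "n \<ge> 0" for n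
  proof -
    have "norm ((t ^ n / fact n) *\<^sub>R (A ^^ n) z) = \<bar>t\<bar> ^ n / fact n * norm ((A ^^ n) z)" by (simp add: power_abs)
    also have "\<dots> \<le> \<bar>t\<bar> ^ n / fact n * (norm z * K ^ n)" by (intro mult_left_mono oexp_iterate_bound) simp
    finally show ?thesis by (simp add: power_mult_distrib divide_inverse mult_ac)
  qed
qed

lemma oexp_summable: "summable (\<lambda>n. (t ^ n / fact n) *\<^sub>R (A ^^ n) z)"
  by (rule summable_norm_cancel[OF oexp_summable_norm])

lemma oexp_0: "oexp A 0 z = z"
proof -
  have "oexp A 0 z = (\<Sum>n\<in>{0}. ((0::real) ^ n / fact n) *\<^sub>R (A ^^ n) z)"
    unfolding oexp_def by (rule suminf_finite) auto
  then show ?thesis by simp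
qed

lemma iterate_linear: "(A ^^ n) (x *\<^sub>R a + y *\<^sub>R b) = x *\<^sub>R (A ^^ n) a + y *\<^sub>R (A ^^ n) b"
  by (induction n) (simp_all add: linear_simps[OF A])

lemma oexp_lin: "oexp A t (x *\<^sub>R a + y *\<^sub>R b) = x *\<^sub>R oexp A t a + y *\<^sub>R oexp A t b"
proof -
  have "(\<lambda>n. x *\<^sub>R ((t ^ n / fact n) *\<^sub>R (A ^^ n) a) + y *\<^sub>R ((t ^ n / fact n) *\<^sub>R (A ^^ n) b)) sums (x *\<^sub>R oexp A t a + y *\<^sub>R oexp A t b)"
    unfolding oexp_def by (intro sums_add sums_scaleR_right summable_sums oexp_summable)
  from sums_unique[OF this] show ?thesis
    unfolding oexp_def[of A t "x *\<^sub>R a + y *\<^sub>R b"] iterate_linear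
    by (simp add: scaleR_add_right mult.commute)
qed

text \<open>Termwise differentiation on a ball containing t, where the differentiated series
  converges uniformly by the Weierstrass test; shifting the index pulls out one application of
  \<open>A\<close>.\<close>

lemma oexp_has_vector_derivative: "((\<lambda>t. oexp A t z) has_vector_derivative A (oexp A t z)) (at t)"
proof -
  define R where "R = \<bar>t\<bar> + 1"
  have R: "R > 0" by (simp add: R_def)
  \<comment> \<open>The derivative of x^n / n!. The case n = 0 is separate because
    \<open>n - 1\<close> truncates to 0.\<close>
  define D where "D n x = (if n = 0 then 0 else x ^ (n - 1) / fact (n - 1))" for n :: nat and x :: real
  define f where "f n x = (x ^ n / fact n) *\<^sub>R (A ^^ n) z" for n x
  define G where "G x = (\<Sum>n. D n x *\<^sub>R (A ^^ n) z)" for x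
  have Dabs: "\<bar>D n x\<bar> \<le> D n R" if "\<bar>x\<bar> \<le> R" for n x
    using that by (auto simp: D_def power_abs intro!: divide_right_mono power_mono)
  have Mb: "norm (D n x *\<^sub>R (A ^^ n) z) \<le> D n R * (norm z * K ^ n)" if "\<bar>x\<bar> \<le> R" for n x
    unfolding norm_scaleR using Dabs[OF that] by (intro mult_mono oexp_iterate_bound order_trans[OF abs_ge_zero Dabs[OF that]]) auto
  have Ms: "summable (\<lambda>n. D n R * (norm z * K ^ n))"
  \<comment> \<open>The term for n = 0 vanishes, and after the shift the bounds form an exponential
    series.\<close>
  proof (subst summable_Suc_iff[symmetric])
    have "summable (\<lambda>n. norm z * K * (inverse (fact n) * (R * K) ^ n))" by (rule summable_mult[OF summable_exp])
    then show "summable (\<lambda>n. D (Suc n) R * (norm z * K ^ Suc n))"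
      by (simp add: D_def power_mult_distrib divide_inverse mult_ac)
  qed
  have unif: "uniform_limit (ball 0 R) (\<lambda>n x. \<Sum>i<n. D i x *\<^sub>R (A ^^ i) z) G sequentially"
    unfolding G_def by (rule Weierstrass_m_test[OF _ Ms]) (rule Mb, simp)
  have der: "(f n has_derivative (\<lambda>h. h *\<^sub>R (D n x *\<^sub>R (A ^^ n) z))) (at x within ball 0 R)" for n x
    proof -
      have "((\<lambda>x. x ^ n / fact n) has_real_derivative D n x) (at x within ball 0 R)"
      proof (cases n)
        case (Suc m)
        have "((\<lambda>x. x ^ n / fact n) has_real_derivative real n * x ^ (n - Suc 0) / fact n) (at x within ball 0 R)"
          by (rule DERIV_cdivide[OF DERIV_pow])
        also have "real n * x ^ (n - Suc 0) / fact n = D n x"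
          using Suc by (simp add: D_def fact_Suc del: of_nat_Suc)
        finally show ?thesis .
      qed (simp add: D_def)
      then have "((\<lambda>x. (x ^ n / fact n) *\<^sub>R (A ^^ n) z) has_derivative (\<lambda>h. (D n x * h) *\<^sub>R (A ^^ n) z)) (at x within ball 0 R)"
        unfolding has_field_derivative_def by (rule has_derivative_scaleR_left)
      then show ?thesis by (simp add: f_def[abs_def] mult.commute)
    qed
  have lim: "\<forall>\<^sub>F n in sequentially. \<forall>x\<in>ball 0 R. \<forall>h. norm ((\<Sum>i<n. h *\<^sub>R (D i x *\<^sub>R (A ^^ i) z)) - h *\<^sub>R G x) \<le> e * norm h" if e: "e > 0" for e
    using uniform_limitD[OF unif e]
    proof eventually_elim
      case (elim n)
      show ?case
      proof (intro ballI allI)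
        fix x h :: real assume x: "x \<in> ball 0 R"
        have "norm ((\<Sum>i<n. h *\<^sub>R (D i x *\<^sub>R (A ^^ i) z)) - h *\<^sub>R G x) = \<bar>h\<bar> * dist (\<Sum>i<n. D i x *\<^sub>R (A ^^ i) z) (G x)"
          by (simp only: scaleR_sum_right[symmetric] scaleR_diff_right[symmetric] norm_scaleR dist_norm)
        also have "\<dots> \<le> \<bar>h\<bar> * e" by (intro mult_left_mono less_imp_le[OF bspec[OF elim x]]) simp
        finally show "norm ((\<Sum>i<n. h *\<^sub>R (D i x *\<^sub>R (A ^^ i) z)) - h *\<^sub>R G x) \<le> e * norm h" by (simp add: mult.commute)
      qed
    qed
  have z: "(0::real) \<in> ball 0 R" using R by simp
  have s0: "(\<lambda>n. f n 0) sums (\<Sum>n. f n 0)" unfolding f_def by (rule summable_sums[OF oexp_summable])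
  have "\<exists>g. \<forall>x\<in>ball 0 R. (\<lambda>n. f n x) sums (g x) \<and> (g has_derivative (\<lambda>h. h *\<^sub>R G x)) (at x within ball 0 R)"
    by (rule has_derivative_series[OF convex_ball der lim z s0])
  then obtain g where g: "\<And>x. x \<in> ball 0 R \<Longrightarrow> (\<lambda>n. f n x) sums (g x)"
    "\<And>x. x \<in> ball 0 R \<Longrightarrow> (g has_derivative (\<lambda>h. h *\<^sub>R G x)) (at x within ball 0 R)" by blast
  have t: "t \<in> ball 0 R" by (simp add: R_def)
  have ge: "g x = oexp A x z" if "x \<in> ball 0 R" for x
    using sums_unique[OF g(1)[OF that]] by (simp add: oexp_def f_def)
  have "G t = (\<Sum>n. D (Suc n) t *\<^sub>R (A ^^ Suc n) z)"
  proof -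
    have "summable (\<lambda>n. D n t *\<^sub>R (A ^^ n) z)"
      by (rule summable_comparison_test'[OF Ms, of 0]) (rule Mb, simp add: R_def)
    from suminf_split_head[OF this] show ?thesis by (simp add: G_def D_def)
  qed
  also have "\<dots> = (\<Sum>n. A ((t ^ n / fact n) *\<^sub>R (A ^^ n) z))"
    by (simp add: D_def linear_simps[OF A])
  also have "\<dots> = A (oexp A t z)"
    unfolding oexp_def by (rule bounded_linear.suminf[OF A oexp_summable, symmetric])
  finally have Gt: "G t = A (oexp A t z)" .
  have "(g has_derivative (\<lambda>h. h *\<^sub>R G t)) (at t)"
    using g(2)[OF t] at_within_open[OF t open_ball] by simp
  then have "((\<lambda>t. oexp A t z) has_derivative (\<lambda>h. h *\<^sub>R G t)) (at t)"
    by (rule has_derivative_transform_within_open[OF _ open_ball t ge])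
  then show ?thesis by (simp add: has_vector_derivative_def Gt)
qed

end

section \<open>The symbol and the weighted norm of a state\<close>

lemma cdot_add: "cdot \<xi> (v + w) = cdot \<xi> v + cdot \<xi> w"
  by (simp add: cdot_def algebra_simps sum.distrib)

lemma cdot_scaleR: "cdot \<xi> (c *\<^sub>R v) = c *\<^sub>R cdot \<xi> v"
  by (simp add: cdot_def scaleR_sum_right)

lemma norm_cdot_le: "cmod (cdot \<xi> w) \<le> norm \<xi> * norm w"
proof -
  have "cmod (cdot \<xi> w) \<le> (\<Sum>i\<in>UNIV. \<bar>\<xi> $ i\<bar> * \<bar>cmod (w $ i)\<bar>)"
    unfolding cdot_def by (rule order_trans[OF norm_sum]) (simp add: norm_mult)
  also have "\<dots> \<le> L2_set (\<lambda>i. \<xi> $ i) UNIV * L2_set (\<lambda>i. cmod (w $ i)) UNIV"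
    by (rule L2_set_mult_ineq)
  also have "\<dots> = norm \<xi> * norm w" by (simp add: norm_vec_def L2_set_def)
  finally show ?thesis .
qed

lemma bounded_linear_cdot: "bounded_linear (cdot \<xi>)"
  by (rule bounded_linear_intro[of _ "norm \<xi>"]) (auto simp: cdot_add cdot_scaleR mult.commute[of _ "norm \<xi>"] norm_cdot_le)

type_synonym 'd state = "complex \<times> (complex^'d)"

text \<open>The sum of |b|, |\<xi>| |b| and |w|: one power bound on it controls the density in both
  of its spaces and the velocity at once.\<close>

definition qnorm :: "real^'d::finite \<Rightarrow> 'd state \<Rightarrow> real" where
  "qnorm \<xi> z = (1 + norm \<xi>) * cmod (fst z) + norm (snd z)"

lemma qnorm_nonneg: "0 \<le> qnorm \<xi> z"
  by (simp add: qnorm_def)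

lemma qnorm_zero [simp]: "qnorm \<xi> 0 = 0"
  by (simp add: qnorm_def)

lemma qnorm_triangle: "qnorm \<xi> (y + z) \<le> qnorm \<xi> y + qnorm \<xi> z"
proof -
  have "(1 + norm \<xi>) * cmod (fst y + fst z) \<le> (1 + norm \<xi>) * (cmod (fst y) + cmod (fst z))"
    by (intro mult_left_mono norm_triangle_ineq) simp
  then show ?thesis using norm_triangle_ineq[of "snd y" "snd z"] by (simp add: qnorm_def algebra_simps)
qed

lemma qnorm_minus: "qnorm \<xi> (- z) = qnorm \<xi> z"
  by (simp add: qnorm_def)

lemma qnorm_diff: "qnorm \<xi> (y - z) \<le> qnorm \<xi> y + qnorm \<xi> z"
  using qnorm_triangle[of \<xi> y "- z"] by (simp add: qnorm_minus)

lemma qnorm_fst: "(1 + norm \<xi>) * cmod (fst z) \<le> qnorm \<xi> z" and qnorm_snd: "norm (snd z) \<le> qnorm \<xi> z"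
  by (auto simp: qnorm_def)

lemma norm_le_qnorm: "norm z \<le> qnorm \<xi> z"
proof -
  have "norm z \<le> norm (fst z) + norm (snd z)" using norm_Pair_le[of "fst z" "snd z"] by simp
  moreover have "1 * cmod (fst z) \<le> (1 + norm \<xi>) * cmod (fst z)" by (rule mult_right_mono) auto
  ultimately show ?thesis by (simp add: qnorm_def)
qed

lemma qnorm_le_norm: "qnorm \<xi> z \<le> (2 + norm \<xi>) * norm z"
proof -
  have "(1 + norm \<xi>) * norm (fst z) \<le> (1 + norm \<xi>) * norm z"
    using norm_fst_le[of "fst z" "snd z"] by (intro mult_left_mono) auto
  then show ?thesis using norm_snd_le[of "snd z" "fst z"] by (simp add: qnorm_def algebra_simps)
qed

locale nsk =
  fixes \<mu> \<nu> \<kappa> \<alpha> :: real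
  assumes pos: "\<mu> > 0" "\<mu> + \<nu> > 0" "\<kappa> > 0" "\<alpha> > 0"
begin

abbreviation sym :: "real^'d::finite \<Rightarrow> 'd state \<Rightarrow> 'd state" where
  "sym \<equiv> nsk_symbol \<mu> \<nu> \<kappa> \<alpha>"

lemma sym_fst: "fst (sym \<xi> z) = \<i> * cdot \<xi> (snd z)"
  by (simp add: nsk_symbol_def case_prod_beta)

lemma sym_snd: "snd (sym \<xi> z) $ j = \<i> * of_real (\<alpha> + \<kappa> * (norm \<xi>)\<^sup>2) * fst z * of_real (\<xi> $ j)
  + of_real (\<mu> * (norm \<xi>)\<^sup>2) * snd z $ j + of_real (\<mu> + \<nu>) * cdot \<xi> (snd z) * of_real (\<xi> $ j)"
  by (simp add: nsk_symbol_def case_prod_beta)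

definition Ks :: real where "Ks = (\<alpha> + \<kappa>) + 2 * \<mu> + \<bar>\<nu>\<bar> + 1"

lemma Ks_pos: "Ks > 0" using pos by (simp add: Ks_def)

lemma norm_sym_snd: "norm (snd (sym \<xi> z)) \<le> (\<alpha> + \<kappa> * (norm \<xi>)\<^sup>2) * norm \<xi> * cmod (fst z) + (2 * \<mu> + \<bar>\<nu>\<bar>) * (norm \<xi>)\<^sup>2 * norm (snd z)"
proof -
  define x where "x = (\<chi> j. complex_of_real (\<xi> $ j))"
  have nx: "norm x = norm \<xi>" by (simp add: x_def norm_vec_def)
  define c where "c = \<i> * of_real (\<alpha> + \<kappa> * (norm \<xi>)\<^sup>2) * fst z + of_real (\<mu> + \<nu>) * cdot \<xi> (snd z)"
  have e: "snd (sym \<xi> z) = (\<chi> j. c * x $ j) + (\<mu> * (norm \<xi>)\<^sup>2) *\<^sub>R snd z"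
    unfolding vec_eq_iff vector_add_component vector_scaleR_component
    by (simp add: sym_snd c_def x_def algebra_simps) (simp add: scaleR_conv_of_real)
  have nc: "norm (\<chi> j. c * x $ j) = cmod c * norm x"
    by (simp add: norm_vec_def norm_mult L2_set_right_distrib)
  have "cmod c \<le> (\<alpha> + \<kappa> * (norm \<xi>)\<^sup>2) * cmod (fst z) + (\<mu> + \<nu>) * cmod (cdot \<xi> (snd z))"
    unfolding c_def by (rule order_trans[OF norm_triangle_ineq]) (use pos in \<open>simp add: norm_mult del: of_real_add\<close>)
  also have "\<dots> \<le> (\<alpha> + \<kappa> * (norm \<xi>)\<^sup>2) * cmod (fst z) + (\<mu> + \<bar>\<nu>\<bar>) * (norm \<xi> * norm (snd z))"
    using pos by (intro add_left_mono mult_mono norm_cdot_le) auto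
  finally have c: "cmod c \<le> (\<alpha> + \<kappa> * (norm \<xi>)\<^sup>2) * cmod (fst z) + (\<mu> + \<bar>\<nu>\<bar>) * (norm \<xi> * norm (snd z))" .
  have "norm (snd (sym \<xi> z)) \<le> cmod c * norm \<xi> + \<mu> * (norm \<xi>)\<^sup>2 * norm (snd z)"
    unfolding e by (rule order_trans[OF norm_triangle_ineq]) (use pos in \<open>simp add: nc nx\<close>)
  also have "\<dots> \<le> ((\<alpha> + \<kappa> * (norm \<xi>)\<^sup>2) * cmod (fst z) + (\<mu> + \<bar>\<nu>\<bar>) * (norm \<xi> * norm (snd z))) * norm \<xi> + \<mu> * (norm \<xi>)\<^sup>2 * norm (snd z)"
    by (intro add_right_mono mult_right_mono c) simp
  finally show ?thesis by (simp add: algebra_simps power2_eq_square)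
qed

text \<open>Since b carries the weight 1 + |\<xi>|, the capillary term of order |\<xi>|^3 b costs
  only |\<xi>| (1 + |\<xi>|). This factor governs increments of the semigroup in time.\<close>

lemma qnorm_sym: "qnorm \<xi> (sym \<xi> z) \<le> Ks * (norm \<xi> * (1 + norm \<xi>)) * qnorm \<xi> z"
proof -
  define r where "r = norm \<xi>"
  have r: "r \<ge> 0" by (simp add: r_def)
  have 1: "(1 + r) * cmod (fst (sym \<xi> z)) \<le> (1 + r) * (r * norm (snd z))"
    unfolding sym_fst norm_mult r_def using norm_cdot_le[of \<xi> "snd z"] by (intro mult_left_mono) auto
  have "\<alpha> + \<kappa> * r\<^sup>2 \<le> (\<alpha> + \<kappa>) * (1 + r)\<^sup>2" using pos r by (simp add: power2_eq_square algebra_simps)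
  then have 2: "(\<alpha> + \<kappa> * r\<^sup>2) * r * cmod (fst z) \<le> (\<alpha> + \<kappa>) * (1 + r)\<^sup>2 * r * cmod (fst z)"
    using r by (intro mult_right_mono) auto
  have 3: "(2 * \<mu> + \<bar>\<nu>\<bar>) * r\<^sup>2 * norm (snd z) \<le> (2 * \<mu> + \<bar>\<nu>\<bar>) * (r * (1 + r)) * norm (snd z)"
    using r pos by (intro mult_right_mono mult_left_mono) (auto simp: power2_eq_square algebra_simps)
  have "qnorm \<xi> (sym \<xi> z) \<le> (1 + r) * (r * norm (snd z)) + ((\<alpha> + \<kappa>) * (1 + r)\<^sup>2 * r * cmod (fst z) + (2 * \<mu> + \<bar>\<nu>\<bar>) * (r * (1 + r)) * norm (snd z))"
    using 1 2 3 norm_sym_snd[of \<xi> z] unfolding qnorm_def r_def by linarith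
  also have "\<dots> = (r * (1 + r)) * ((\<alpha> + \<kappa>) * ((1 + r) * cmod (fst z)) + (2 * \<mu> + \<bar>\<nu>\<bar> + 1) * norm (snd z))"
    by (simp add: algebra_simps power2_eq_square)
  also have "\<dots> \<le> (r * (1 + r)) * (Ks * ((1 + r) * cmod (fst z)) + Ks * norm (snd z))"
    using r pos by (intro mult_left_mono add_mono mult_right_mono) (auto simp: Ks_def)
  finally show ?thesis unfolding qnorm_def r_def by (simp add: algebra_simps)
qed

lemma bounded_linear_sym: "bounded_linear (sym \<xi>)"
proof (rule bounded_linear_intro)
  show "sym \<xi> (x + y) = sym \<xi> x + sym \<xi> y" for x y
    by (auto simp: prod_eq_iff vec_eq_iff sym_fst sym_snd cdot_add algebra_simps)
  show "sym \<xi> (c *\<^sub>R x) = c *\<^sub>R sym \<xi> x" for c x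
    unfolding prod_eq_iff vec_eq_iff sym_fst sym_snd fst_scaleR snd_scaleR cdot_scaleR vector_scaleR_component
    by (simp add: sym_snd cdot_scaleR algebra_simps)
  show "norm (sym \<xi> z) \<le> norm z * (Ks * (norm \<xi> * (1 + norm \<xi>)) * (2 + norm \<xi>))" for z
  proof -
    have "norm (sym \<xi> z) \<le> Ks * (norm \<xi> * (1 + norm \<xi>)) * qnorm \<xi> z"
      by (rule order_trans[OF norm_le_qnorm qnorm_sym])
    also have "\<dots> \<le> Ks * (norm \<xi> * (1 + norm \<xi>)) * ((2 + norm \<xi>) * norm z)"
      using Ks_pos by (intro mult_left_mono qnorm_le_norm) auto
    finally show ?thesis by (simp add: mult_ac)
  qed
qed

abbreviation sg :: "real \<Rightarrow> real^'d::finite \<Rightarrow> 'd state \<Rightarrow> 'd state" where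
  "sg \<equiv> exp_nsk_symbol \<mu> \<nu> \<kappa> \<alpha>"

lemma sg_oexp: "sg t \<xi> z = oexp (sym \<xi>) (- t) z"
  by (simp add: exp_nsk_symbol_def oexp_def)

lemma sym_op_bound: obtains K where "\<And>z. norm (sym \<xi> z) \<le> norm z * K" "K \<ge> 0"
  using bounded_linear.nonneg_bounded[OF bounded_linear_sym[of \<xi>]] by blast

lemma sg_0: "sg 0 \<xi> z = z"
  unfolding sg_oexp minus_zero by (rule sym_op_bound[of \<xi>], rule oexp_0[OF bounded_linear_sym])

lemma sg_lin: "sg t \<xi> (x *\<^sub>R a + y *\<^sub>R b) = x *\<^sub>R sg t \<xi> a + y *\<^sub>R sg t \<xi> b"
  unfolding sg_oexp by (rule sym_op_bound[of \<xi>], rule oexp_lin[OF bounded_linear_sym])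

lemma sg_diff: "sg t \<xi> (a - b) = sg t \<xi> a - sg t \<xi> b"
  using sg_lin[of t \<xi> 1 a "-1" b] by simp

lemma sg_has_vector_derivative: "((\<lambda>t. sg t \<xi> z) has_vector_derivative - sym \<xi> (sg t \<xi> z)) (at t within S)"
proof (rule sym_op_bound[of \<xi>])
  fix K assume K: "\<And>z. norm (sym \<xi> z) \<le> norm z * K" "K \<ge> 0"
  have "((\<lambda>t. oexp (sym \<xi>) t z) has_vector_derivative sym \<xi> (oexp (sym \<xi>) (- t) z)) (at (- t))"
    by (rule oexp_has_vector_derivative[OF bounded_linear_sym K])
  from has_vector_derivative_at_within[OF this] have "((\<lambda>t. oexp (sym \<xi>) t z) \<circ> uminus has_vector_derivative (- 1) *\<^sub>R sym \<xi> (oexp (sym \<xi>) (- t) z)) (at t within S)"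
    by (intro vector_diff_chain_within) (auto intro!: derivative_eq_intros)
  then show ?thesis unfolding sg_oexp o_def by simp
qed

section \<open>The Lyapunov functional and exponential decay\<close>

definition P :: "real^'d::finite \<Rightarrow> real" where "P \<xi> = \<alpha> + \<kappa> * (norm \<xi>)\<^sup>2"

text \<open>The symbol damps the first component only through its coupling with \<open>\<xi> \<cdot> w\<close>. The cross term makes
  this visible: its derivative contributes \<open>- \<eta> P \<xi> |\<xi>|\<^sup>2 |b|\<^sup>2\<close>.\<close>

definition lyapunov :: "real \<Rightarrow> real^'d::finite \<Rightarrow> 'd state \<Rightarrow> real" where
  "lyapunov \<eta> \<xi> z = P \<xi> * (fst z \<bullet> fst z) + snd z \<bullet> snd z + \<eta> * ((\<i> * fst z) \<bullet> cdot \<xi> (snd z))"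

text \<open>The derivative of \<open>lyapunov\<close> along the flow, expanded. The factor
  \<open>P \<xi>\<close> in front of |b|^2 there makes the contributions of |b|^2 and |w|^2 that
  couple b with \<xi> \<cdot> w cancel, so only the viscous terms and the derivative of the cross
  term remain.\<close>

definition lyapunov_rate :: "real \<Rightarrow> real^'d::finite \<Rightarrow> 'd state \<Rightarrow> real" where
  "lyapunov_rate \<eta> \<xi> z = - 2 * \<mu> * (norm \<xi>)\<^sup>2 * (snd z \<bullet> snd z) - 2 * (\<mu> + \<nu>) * (cdot \<xi> (snd z) \<bullet> cdot \<xi> (snd z))
    + \<eta> * (cdot \<xi> (snd z) \<bullet> cdot \<xi> (snd z) - P \<xi> * (norm \<xi>)\<^sup>2 * (fst z \<bullet> fst z)
        - (2 * \<mu> + \<nu>) * (norm \<xi>)\<^sup>2 * ((\<i> * fst z) \<bullet> cdot \<xi> (snd z)))"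

lemma sum_inner_coord: "(\<Sum>j\<in>UNIV. w $ j \<bullet> (y * of_real (\<xi> $ j))) = cdot \<xi> w \<bullet> y"
  unfolding cdot_def inner_sum_left by (rule sum.cong) (auto simp: inner_complex_def algebra_simps)

lemma sum_coord_sq: "(\<Sum>j\<in>UNIV. complex_of_real (\<xi> $ j) * of_real (\<xi> $ j)) = of_real ((norm \<xi>)\<^sup>2)"
  by (simp add: power2_norm_eq_inner inner_vec_def)

text \<open>The longitudinal part \<xi> \<cdot> w and b form a closed system; its coefficients give
  the derivative of the cross term.\<close>

lemma cdot_sym: "cdot \<xi> (snd (sym \<xi> z)) = of_real (P \<xi> * (norm \<xi>)\<^sup>2) * (\<i> * fst z) + of_real ((2 * \<mu> + \<nu>) * (norm \<xi>)\<^sup>2) * cdot \<xi> (snd z)"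
proof -
  have "cdot \<xi> (snd (sym \<xi> z)) = (\<Sum>j\<in>UNIV. (\<i> * of_real (P \<xi>) * fst z + of_real (\<mu> + \<nu>) * cdot \<xi> (snd z)) * (of_real (\<xi> $ j) * of_real (\<xi> $ j))
     + of_real (\<mu> * (norm \<xi>)\<^sup>2) * (of_real (\<xi> $ j) * snd z $ j))"
    unfolding cdot_def[of \<xi> "snd (sym \<xi> z)"] by (rule sum.cong) (simp_all add: sym_snd P_def algebra_simps)
  also have "\<dots> = (\<i> * of_real (P \<xi>) * fst z + of_real (\<mu> + \<nu>) * cdot \<xi> (snd z)) * of_real ((norm \<xi>)\<^sup>2)
     + of_real (\<mu> * (norm \<xi>)\<^sup>2) * cdot \<xi> (snd z)"
    unfolding sum.distrib sum_distrib_left[symmetric] sum_coord_sq cdot_def[symmetric] ..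
  finally show ?thesis by (simp add: algebra_simps)
qed

lemma lyapunov_derivative:
  "((\<lambda>t. lyapunov \<eta> \<xi> (sg t \<xi> z)) has_real_derivative lyapunov_rate \<eta> \<xi> (sg t \<xi> z)) (at t)"
proof -
  define Z where "Z t = sg t \<xi> z" for t
  define b w v where "b t = fst (Z t)" and "w t = snd (Z t)" and "v t = cdot \<xi> (snd (Z t))" for t
  have Z: "(Z has_vector_derivative - sym \<xi> (Z t)) (at t)"
    using sg_has_vector_derivative[of \<xi> z t UNIV] by (simp add: Z_def[abs_def])
  have b: "(b has_vector_derivative - (\<i> * v t)) (at t)"
    using bounded_linear.has_vector_derivative[OF bounded_linear_fst Z] by (simp add: b_def[abs_def] v_def sym_fst)
  have w: "(w has_vector_derivative - snd (sym \<xi> (Z t))) (at t)"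
    using bounded_linear.has_vector_derivative[OF bounded_linear_snd Z] by (simp add: w_def[abs_def])
  have cm: "cdot \<xi> (- x) = - cdot \<xi> x" for x using cdot_scaleR[of \<xi> "-1" x] by simp
  have v: "(v has_vector_derivative - cdot \<xi> (snd (sym \<xi> (Z t)))) (at t)"
    using bounded_linear.has_vector_derivative[OF bounded_linear_cdot[of \<xi>] w] by (simp add: v_def[abs_def] w_def cm)
  have ib: "((\<lambda>t. \<i> * b t) has_vector_derivative \<i> * (- (\<i> * v t))) (at t)"
    by (rule has_vector_derivative_mult_right[OF b])
  have D: "((\<lambda>t. P \<xi> * (b t \<bullet> b t) + w t \<bullet> w t + \<eta> * ((\<i> * b t) \<bullet> v t)) has_vector_derivative
      P \<xi> * (b t \<bullet> (- (\<i> * v t)) + (- (\<i> * v t)) \<bullet> b t)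
      + (w t \<bullet> (- snd (sym \<xi> (Z t))) + (- snd (sym \<xi> (Z t))) \<bullet> w t)
      + \<eta> * ((\<i> * b t) \<bullet> (- cdot \<xi> (snd (sym \<xi> (Z t)))) + (\<i> * (- (\<i> * v t))) \<bullet> v t)) (at t)"
    by (intro has_vector_derivative_add has_vector_derivative_mult_right
        bounded_bilinear.has_vector_derivative[OF bounded_bilinear_inner] b w v ib)
  have ws: "w t \<bullet> snd (sym \<xi> (Z t)) = v t \<bullet> (\<i> * of_real (P \<xi>) * b t) + (\<mu> * (norm \<xi>)\<^sup>2) * (w t \<bullet> w t) + (\<mu> + \<nu>) * (v t \<bullet> v t)"
  proof -
    have "w t \<bullet> snd (sym \<xi> (Z t)) = (\<Sum>j\<in>UNIV. w t $ j \<bullet> ((\<i> * of_real (P \<xi>) * b t) * of_real (\<xi> $ j))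
      + (\<mu> * (norm \<xi>)\<^sup>2) * (w t $ j \<bullet> w t $ j) + (\<mu> + \<nu>) * (w t $ j \<bullet> (v t * of_real (\<xi> $ j))))"
      unfolding inner_vec_def by (rule sum.cong) (simp_all add: sym_snd P_def b_def w_def v_def inner_complex_def algebra_simps)
    then show ?thesis unfolding sum.distrib sum_distrib_left[symmetric] sum_inner_coord
      by (simp add: v_def w_def inner_vec_def)
  qed
  have vw: "cdot \<xi> (w t) = v t" by (simp add: v_def w_def)
  have i1: "b t \<bullet> (- (\<i> * v t)) = (\<i> * b t) \<bullet> v t" by (simp add: inner_complex_def)
  have i2: "v t \<bullet> (\<i> * of_real (P \<xi>) * b t) = P \<xi> * ((\<i> * b t) \<bullet> v t)" by (simp add: inner_complex_def algebra_simps)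
  have i3: "(\<i> * b t) \<bullet> cdot \<xi> (snd (sym \<xi> (Z t))) = P \<xi> * (norm \<xi>)\<^sup>2 * (b t \<bullet> b t) + (2 * \<mu> + \<nu>) * (norm \<xi>)\<^sup>2 * ((\<i> * b t) \<bullet> v t)"
  proof -
    have "(\<i> * b t) \<bullet> cdot \<xi> (snd (sym \<xi> (Z t))) = (P \<xi> * (norm \<xi>)\<^sup>2) * ((\<i> * b t) \<bullet> (\<i> * b t)) + ((2 * \<mu> + \<nu>) * (norm \<xi>)\<^sup>2) * ((\<i> * b t) \<bullet> v t)"
      unfolding cdot_sym inner_add_right by (simp only: b_def v_def scaleR_conv_of_real[symmetric] inner_scaleR_right)
    also have "(\<i> * b t) \<bullet> (\<i> * b t) = b t \<bullet> b t" by (simp add: inner_complex_def)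
    finally show ?thesis by simp
  qed
  have "P \<xi> * (b t \<bullet> (- (\<i> * v t)) + (- (\<i> * v t)) \<bullet> b t)
      + (w t \<bullet> (- snd (sym \<xi> (Z t))) + (- snd (sym \<xi> (Z t))) \<bullet> w t)
      + \<eta> * ((\<i> * b t) \<bullet> (- cdot \<xi> (snd (sym \<xi> (Z t)))) + (\<i> * (- (\<i> * v t))) \<bullet> v t) = lyapunov_rate \<eta> \<xi> (Z t)"
    unfolding inner_commute[of "- (\<i> * v t)" "b t"] inner_commute[of "- snd (sym \<xi> (Z t))" "w t"] i1
    unfolding inner_minus_right ws i2 i3 lyapunov_rate_def b_def[symmetric] w_def[symmetric] vw
    by (simp add: algebra_simps)
  with D show ?thesis
    unfolding has_real_derivative_iff_has_vector_derivative lyapunov_def b_def w_def v_def Z_def by simp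
qed

text \<open>The size of the cross term. The bound 2(\<mu> + \<nu>) lets the longitudinal viscosity
  absorb its positive contribution, the second bound is what Young's inequality asks of the mixed
  term, and \<open>min 1 \<kappa>\<close> gives \<open>\<eta>0\<^sup>2 \<le> \<kappa>\<close>, which
  keeps the functional comparable with the energy.\<close>

definition \<eta>0 :: real where "\<eta>0 = min (2 * (\<mu> + \<nu>)) (min (2 * \<mu> * \<kappa> / (2 * \<mu> + \<nu>)\<^sup>2) (min 1 \<kappa>))"

lemma \<eta>0: "\<eta>0 > 0" "\<eta>0 \<le> 2 * (\<mu> + \<nu>)" "\<eta>0 * (2 * \<mu> + \<nu>)\<^sup>2 \<le> 2 * \<mu> * \<kappa>" "\<eta>0\<^sup>2 \<le> \<kappa>"
proof -
  have m: "2 * \<mu> + \<nu> > 0" using pos by linarith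
  then have m2: "(2 * \<mu> + \<nu>)\<^sup>2 > 0" by simp
  show p: "\<eta>0 > 0" using pos m2 by (auto simp: \<eta>0_def)
  show "\<eta>0 \<le> 2 * (\<mu> + \<nu>)" by (simp add: \<eta>0_def)
  have "\<eta>0 \<le> 2 * \<mu> * \<kappa> / (2 * \<mu> + \<nu>)\<^sup>2" by (simp add: \<eta>0_def)
  then show "\<eta>0 * (2 * \<mu> + \<nu>)\<^sup>2 \<le> 2 * \<mu> * \<kappa>" using m2 by (simp only: pos_le_divide_eq)
  have "\<eta>0 * \<eta>0 \<le> 1 * \<kappa>" using p pos by (intro mult_mono) (auto simp: \<eta>0_def)
  then show "\<eta>0\<^sup>2 \<le> \<kappa>" by (simp add: power2_eq_square)
qed

definition energy :: "real^'d::finite \<Rightarrow> 'd state \<Rightarrow> real" where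
  "energy \<xi> z = P \<xi> * (cmod (fst z))\<^sup>2 + (norm (snd z))\<^sup>2"

text \<open>What is left of the damping 2\<mu> of the velocity and \<open>\<eta>0\<close> of the
  density after the mixed term has taken half of each.\<close>

definition c1 :: real where "c1 = min \<mu> (\<eta>0 / 2)"

lemma c1_pos: "c1 > 0" using pos \<eta>0(1) by (simp add: c1_def)

lemma cross_bound: "\<bar>(\<i> * fst z) \<bullet> cdot \<xi> (snd z)\<bar> \<le> (norm \<xi> * cmod (fst z)) * norm (snd z)"
proof -
  have "\<bar>(\<i> * fst z) \<bullet> cdot \<xi> (snd z)\<bar> \<le> norm (\<i> * fst z) * norm (cdot \<xi> (snd z))" by (rule Cauchy_Schwarz_ineq2)
  also have "\<dots> \<le> cmod (fst z) * (norm \<xi> * norm (snd z))"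
    unfolding norm_mult norm_ii mult_1 by (intro mult_left_mono norm_cdot_le) simp
  finally show ?thesis by (simp add: mult_ac)
qed

text \<open>Two applications of Young's inequality to |\<xi>| |b| |w|. The first uses
  \<open>\<eta>0\<^sup>2 \<le> \<kappa>\<close> and
  \<open>\<kappa> (|\<xi>| |b|)\<^sup>2 \<le> P \<xi> |b|\<^sup>2\<close> to compare with the
  energy; the second absorbs the mixed term of the rate into the damping.\<close>

lemma lyapunov_bounds: "\<bar>lyapunov \<eta>0 \<xi> z - energy \<xi> z\<bar> \<le> energy \<xi> z / 2" "lyapunov_rate \<eta>0 \<xi> z \<le> - (c1 * (norm \<xi>)\<^sup>2 * energy \<xi> z)"
proof -
  define B where "B = cmod (fst z)"
  define X where "X = norm \<xi> * B"
  define Y where "Y = norm (snd z)"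
  define I where "I = (\<i> * fst z) \<bullet> cdot \<xi> (snd z)"
  define V where "V = (cmod (cdot \<xi> (snd z)))\<^sup>2"
  define r2 where "r2 = (norm \<xi>)\<^sup>2"
  have nn: "0 \<le> X" "0 \<le> Y" "0 \<le> r2" "0 \<le> V" by (auto simp: X_def B_def Y_def r2_def V_def)
  have I: "\<bar>I\<bar> \<le> X * Y" using cross_bound[of z \<xi>] by (simp add: I_def X_def Y_def B_def)
  have X2: "\<kappa> * X\<^sup>2 \<le> P \<xi> * B\<^sup>2"
    using pos by (simp add: X_def P_def power_mult_distrib algebra_simps)
  have E: "energy \<xi> z = P \<xi> * B\<^sup>2 + Y\<^sup>2" by (simp add: energy_def B_def Y_def)
  have L: "lyapunov \<eta>0 \<xi> z = energy \<xi> z + \<eta>0 * I" by (simp add: lyapunov_def energy_def I_def power2_norm_eq_inner)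
  have "\<bar>\<eta>0 * I\<bar> \<le> \<eta>0 * (X * Y)" using \<eta>0(1) I by (simp add: abs_mult)
  also have "\<dots> \<le> (\<eta>0\<^sup>2 * X\<^sup>2 + Y\<^sup>2) / 2" using sum_squares_bound[of "\<eta>0 * X" Y] by (simp add: power_mult_distrib)
  also have "\<dots> \<le> (\<kappa> * X\<^sup>2 + Y\<^sup>2) / 2" using mult_right_mono[OF \<eta>0(4), of "X\<^sup>2"] by simp
  also have "\<dots> \<le> energy \<xi> z / 2" using X2 E by simp
  finally show "\<bar>lyapunov \<eta>0 \<xi> z - energy \<xi> z\<bar> \<le> energy \<xi> z / 2" by (simp add: L)
  let ?m = "2 * \<mu> + \<nu>"
  have m: "?m > 0" using pos by linarith
  have dL: "lyapunov_rate \<eta>0 \<xi> z = - 2 * \<mu> * r2 * Y\<^sup>2 - 2 * (\<mu> + \<nu>) * V + \<eta>0 * V - \<eta>0 * (P \<xi> * r2 * B\<^sup>2) - \<eta>0 * (?m * r2 * I)"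
    by (simp add: lyapunov_rate_def r2_def Y_def V_def B_def I_def power2_norm_eq_inner algebra_simps)
  have v: "\<eta>0 * V \<le> 2 * (\<mu> + \<nu>) * V" using \<eta>0(2) nn(4) by (rule mult_right_mono)
  have "- (\<eta>0 * (?m * r2 * I)) \<le> \<eta>0 * ?m * r2 * \<bar>I\<bar>"
  proof -
    have "(\<eta>0 * ?m * r2) * (- I) \<le> (\<eta>0 * ?m * r2) * \<bar>I\<bar>"
      using \<eta>0(1) m nn(3) by (intro mult_left_mono abs_ge_minus_self) auto
    then show ?thesis by (simp only: mult_minus_right mult.assoc)
  qed
  also have "\<dots> \<le> \<eta>0 * ?m * r2 * (X * Y)" using \<eta>0(1) m nn(3) I by (intro mult_left_mono) auto
  also have "\<dots> = r2 * (\<eta>0 * (X * (?m * Y)))" by (simp add: mult_ac)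
  \<comment> \<open>Young's inequality with weight \<kappa>: the X part will use half of the density
    damping, and \<eta>0 (2\<mu> + \<nu>)^2 \<le> 2 \<mu> \<kappa> limits the Y part to half of the
    velocity damping.\<close>
  also have "\<dots> \<le> r2 * (\<eta>0 * (\<kappa> * X\<^sup>2 / 2 + (?m * Y)\<^sup>2 / (2 * \<kappa>)))"
  proof (intro mult_left_mono)
    have "2 * (\<kappa> * X) * (?m * Y) \<le> (\<kappa> * X)\<^sup>2 + (?m * Y)\<^sup>2" by (rule sum_squares_bound)
    then have "(2 * (\<kappa> * X) * (?m * Y)) / (2 * \<kappa>) \<le> ((\<kappa> * X)\<^sup>2 + (?m * Y)\<^sup>2) / (2 * \<kappa>)"
      using pos by (intro divide_right_mono) auto
    moreover have "(2 * (\<kappa> * X) * (?m * Y)) / (2 * \<kappa>) = X * (?m * Y)" using pos by simp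
    moreover have "((\<kappa> * X)\<^sup>2 + (?m * Y)\<^sup>2) / (2 * \<kappa>) = \<kappa> * X\<^sup>2 / 2 + (?m * Y)\<^sup>2 / (2 * \<kappa>)"
      using pos by (simp add: power2_eq_square add_divide_distrib)
    ultimately show "X * (?m * Y) \<le> \<kappa> * X\<^sup>2 / 2 + (?m * Y)\<^sup>2 / (2 * \<kappa>)" by simp
  qed (use nn \<eta>0(1) in auto)
  also have "\<dots> \<le> r2 * (\<eta>0 / 2 * (P \<xi> * B\<^sup>2) + \<mu> * Y\<^sup>2)"
  proof (intro mult_left_mono nn)
    have 1: "\<eta>0 / 2 * (\<kappa> * X\<^sup>2) \<le> \<eta>0 / 2 * (P \<xi> * B\<^sup>2)" using X2 \<eta>0(1) by (intro mult_left_mono) auto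
    have "(\<eta>0 * ?m\<^sup>2) * Y\<^sup>2 / (2 * \<kappa>) \<le> (2 * \<mu> * \<kappa>) * Y\<^sup>2 / (2 * \<kappa>)"
      using pos by (intro divide_right_mono mult_right_mono \<eta>0(3)) auto
    then have 2: "\<eta>0 * ((?m * Y)\<^sup>2 / (2 * \<kappa>)) \<le> \<mu> * Y\<^sup>2"
      using pos by (simp add: power_mult_distrib)
    have "\<eta>0 * (\<kappa> * X\<^sup>2 / 2 + (?m * Y)\<^sup>2 / (2 * \<kappa>)) = \<eta>0 / 2 * (\<kappa> * X\<^sup>2) + \<eta>0 * ((?m * Y)\<^sup>2 / (2 * \<kappa>))"
      by (simp add: distrib_left)
    also have "\<dots> \<le> \<eta>0 / 2 * (P \<xi> * B\<^sup>2) + \<mu> * Y\<^sup>2" by (rule add_mono[OF 1 2])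
    finally show "\<eta>0 * (\<kappa> * X\<^sup>2 / 2 + (?m * Y)\<^sup>2 / (2 * \<kappa>)) \<le> \<eta>0 / 2 * (P \<xi> * B\<^sup>2) + \<mu> * Y\<^sup>2" .
  qed
  finally have i: "- (\<eta>0 * (?m * r2 * I)) \<le> r2 * (\<eta>0 / 2 * (P \<xi> * B\<^sup>2) + \<mu> * Y\<^sup>2)" .
  have "lyapunov_rate \<eta>0 \<xi> z \<le> - 2 * \<mu> * r2 * Y\<^sup>2 - \<eta>0 * (P \<xi> * r2 * B\<^sup>2) + r2 * (\<eta>0 / 2 * (P \<xi> * B\<^sup>2) + \<mu> * Y\<^sup>2)"
    using v i unfolding dL by linarith
  also have "\<dots> = - (r2 * (\<eta>0 / 2 * (P \<xi> * B\<^sup>2) + \<mu> * Y\<^sup>2))" by (simp add: algebra_simps)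
  also have "\<dots> \<le> - (r2 * (c1 * (P \<xi> * B\<^sup>2) + c1 * Y\<^sup>2))"
  proof -
    have "0 \<le> P \<xi> * B\<^sup>2" using pos by (auto simp: P_def)
    then have "r2 * (c1 * (P \<xi> * B\<^sup>2) + c1 * Y\<^sup>2) \<le> r2 * (\<eta>0 / 2 * (P \<xi> * B\<^sup>2) + \<mu> * Y\<^sup>2)"
      using nn by (intro mult_left_mono add_mono mult_right_mono) (auto simp: c1_def)
    then show ?thesis by simp
  qed
  finally show "lyapunov_rate \<eta>0 \<xi> z \<le> - (c1 * (norm \<xi>)\<^sup>2 * energy \<xi> z)" by (simp add: E r2_def algebra_simps)
qed

text \<open>The factor 2/3 compensates that the functional may reach 3/2 of the energy:
  \<open>c2\<close> times the functional is then at most \<open>c1\<close> times the energy.\<close>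

definition c2 :: real where "c2 = 2 / 3 * c1"

lemma lyapunov_decay:
  assumes "t \<ge> 0"
  shows "lyapunov \<eta>0 \<xi> (sg t \<xi> z) * exp (c2 * (norm \<xi>)\<^sup>2 * t) \<le> lyapunov \<eta>0 \<xi> z"
proof -
  let ?k = "c2 * (norm \<xi>)\<^sup>2"
  let ?g = "\<lambda>t. lyapunov \<eta>0 \<xi> (sg t \<xi> z) * exp (?k * t)"
  have "?g t \<le> ?g 0"
  proof (rule DERIV_nonpos_imp_nonincreasing[OF assms])
    fix s
    let ?z = "sg s \<xi> z"
    have "(?g has_real_derivative lyapunov_rate \<eta>0 \<xi> ?z * exp (?k * s) + exp (?k * s) * ?k * lyapunov \<eta>0 \<xi> ?z) (at s)"
      by (auto intro!: derivative_eq_intros lyapunov_derivative)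
    moreover have "lyapunov_rate \<eta>0 \<xi> ?z + ?k * lyapunov \<eta>0 \<xi> ?z \<le> 0"
    proof -
      have "lyapunov \<eta>0 \<xi> ?z \<le> 3 / 2 * energy \<xi> ?z" using lyapunov_bounds(1)[of \<xi> ?z] by linarith
      then have "?k * lyapunov \<eta>0 \<xi> ?z \<le> ?k * (3 / 2 * energy \<xi> ?z)" using c1_pos by (intro mult_left_mono) (auto simp: c2_def)
      also have "\<dots> = c1 * (norm \<xi>)\<^sup>2 * energy \<xi> ?z" by (simp add: c2_def)
      finally show ?thesis using lyapunov_bounds(2)[of \<xi> ?z] by linarith
    qed
    then have "exp (?k * s) * (lyapunov_rate \<eta>0 \<xi> ?z + ?k * lyapunov \<eta>0 \<xi> ?z) \<le> 0" by (simp add: mult_nonneg_nonpos)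
    ultimately show "\<exists>y. (?g has_real_derivative y) (at s) \<and> y \<le> 0"
      by (intro exI conjI) (assumption, simp add: algebra_simps)
  qed
  then show ?thesis by (simp add: sg_0)
qed

text \<open>Both directions compare \<alpha> + \<kappa> |\<xi>|^2 with (1 + |\<xi>|)^2. The lower
  bound rests on \<alpha> > 0 at low and on \<kappa> > 0 at high frequency.\<close>

lemma energy_qnorm:
  "\<exists>C>0. \<forall>\<xi> :: real^'d::finite. \<forall>z. (qnorm \<xi> z)\<^sup>2 \<le> C * energy \<xi> z \<and> energy \<xi> z \<le> C * (qnorm \<xi> z)\<^sup>2"
proof -
  define C where "C = max (2 * max 1 (2 / min \<alpha> \<kappa>)) (max 1 (\<alpha> + \<kappa>))"
  have lo: "min \<alpha> \<kappa> > 0" using pos by simp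
  have "(qnorm \<xi> z)\<^sup>2 \<le> C * energy \<xi> z \<and> energy \<xi> z \<le> C * (qnorm \<xi> z)\<^sup>2" for \<xi> :: "real^'d" and z
  proof
    define B where "B = cmod (fst z)"
    define Y where "Y = norm (snd z)"
    define r where "r = norm \<xi>"
    have r: "r \<ge> 0" "B \<ge> 0" "Y \<ge> 0" by (auto simp: r_def B_def Y_def)
    have q: "qnorm \<xi> z = (1 + r) * B + Y" by (simp add: qnorm_def r_def B_def Y_def)
    have e: "energy \<xi> z = (\<alpha> + \<kappa> * r\<^sup>2) * B\<^sup>2 + Y\<^sup>2" by (simp add: energy_def P_def r_def B_def Y_def)
    have Ennn: "0 \<le> energy \<xi> z" using pos by (simp add: e)
    have "(1 + r)\<^sup>2 \<le> 2 * (1 + r\<^sup>2)" using sum_squares_bound[of 1 r] by (simp add: power2_sum)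
    also have "\<dots> \<le> 2 / min \<alpha> \<kappa> * (\<alpha> + \<kappa> * r\<^sup>2)"
    proof -
      have "min \<alpha> \<kappa> * (1 + r\<^sup>2) \<le> \<alpha> + \<kappa> * r\<^sup>2"
        unfolding distrib_left by (intro add_mono mult_right_mono) auto
      then have "2 * (min \<alpha> \<kappa> * (1 + r\<^sup>2)) \<le> 2 * (\<alpha> + \<kappa> * r\<^sup>2)" by simp
      then have "2 * (1 + r\<^sup>2) * min \<alpha> \<kappa> \<le> 2 * (\<alpha> + \<kappa> * r\<^sup>2)" by (simp only: mult_ac)
      then show ?thesis using lo by (simp only: pos_le_divide_eq[symmetric] times_divide_eq_left)
    qed
    finally have "(1 + r)\<^sup>2 * B\<^sup>2 \<le> (2 / min \<alpha> \<kappa> * (\<alpha> + \<kappa> * r\<^sup>2)) * B\<^sup>2"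
      by (rule mult_right_mono) simp
    also have "\<dots> = 2 / min \<alpha> \<kappa> * ((\<alpha> + \<kappa> * r\<^sup>2) * B\<^sup>2)" by (rule mult.assoc)
    also have "\<dots> \<le> max 1 (2 / min \<alpha> \<kappa>) * ((\<alpha> + \<kappa> * r\<^sup>2) * B\<^sup>2)"
      using pos by (intro mult_right_mono) auto
    finally have 1: "(1 + r)\<^sup>2 * B\<^sup>2 \<le> max 1 (2 / min \<alpha> \<kappa>) * ((\<alpha> + \<kappa> * r\<^sup>2) * B\<^sup>2)" .
    have 2: "Y\<^sup>2 \<le> max 1 (2 / min \<alpha> \<kappa>) * Y\<^sup>2" using mult_right_mono[of 1 "max 1 (2 / min \<alpha> \<kappa>)" "Y\<^sup>2"] by simp
    have "(x + y)\<^sup>2 \<le> 2 * (x\<^sup>2 + y\<^sup>2)" for x y :: real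
      using sum_squares_bound[of x y] by (simp add: power2_sum)
    then have "(qnorm \<xi> z)\<^sup>2 \<le> 2 * ((1 + r)\<^sup>2 * B\<^sup>2 + Y\<^sup>2)"
      unfolding q power_mult_distrib[symmetric] .
    also have "\<dots> \<le> 2 * (max 1 (2 / min \<alpha> \<kappa>) * ((\<alpha> + \<kappa> * r\<^sup>2) * B\<^sup>2) + max 1 (2 / min \<alpha> \<kappa>) * Y\<^sup>2)"
      using 1 2 by simp
    also have "\<dots> = 2 * max 1 (2 / min \<alpha> \<kappa>) * energy \<xi> z" by (simp add: e distrib_left)
    also have "\<dots> \<le> C * energy \<xi> z" using Ennn by (intro mult_right_mono) (auto simp: C_def)
    finally show "(qnorm \<xi> z)\<^sup>2 \<le> C * energy \<xi> z" .
    have "\<alpha> + \<kappa> * r\<^sup>2 \<le> (\<alpha> + \<kappa>) * (1 + r)\<^sup>2" using pos r by (simp add: power2_eq_square algebra_simps)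
    then have "energy \<xi> z \<le> (\<alpha> + \<kappa>) * (1 + r)\<^sup>2 * B\<^sup>2 + 1 * Y\<^sup>2" unfolding e by (intro add_mono mult_right_mono) auto
    also have "\<dots> \<le> C * ((1 + r)\<^sup>2 * B\<^sup>2) + C * Y\<^sup>2"
      unfolding mult.assoc by (intro add_mono mult_right_mono) (auto simp: C_def)
    also have "\<dots> = C * (((1 + r) * B)\<^sup>2 + Y\<^sup>2)" by (simp add: power_mult_distrib distrib_left)
    also have "\<dots> \<le> C * (qnorm \<xi> z)\<^sup>2"
      using r by (intro mult_left_mono) (auto simp: q power2_sum C_def)
    finally show "energy \<xi> z \<le> C * (qnorm \<xi> z)\<^sup>2" .
  qed
  moreover have "C > 0" by (simp add: C_def)
  ultimately show ?thesis by blast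
qed

lemma sg_decay:
  "\<exists>C>0. \<exists>c>0. \<forall>\<xi> :: real^'d::finite. \<forall>z. \<forall>t\<ge>0. qnorm \<xi> (sg t \<xi> z) \<le> C * exp (- c * t * (norm \<xi>)\<^sup>2) * qnorm \<xi> z"
proof -
  obtain C where C: "C > 0" and Cq: "\<And>\<xi> :: real^'d. \<And>z. (qnorm \<xi> z)\<^sup>2 \<le> C * energy \<xi> z" "\<And>\<xi> :: real^'d. \<And>z. energy \<xi> z \<le> C * (qnorm \<xi> z)\<^sup>2"
    using energy_qnorm[where 'd='d] by blast
  have c2: "c2 > 0" using c1_pos by (simp add: c2_def)
  \<comment> \<open>The comparison with the energy enters twice with the constant C, the one with
    the functional twice with the constant 2. After the square root this is 2 C, and the rate is
    halved.\<close>
  have "qnorm \<xi> (sg t \<xi> z) \<le> (2 * C) * exp (- (c2 / 2) * t * (norm \<xi>)\<^sup>2) * qnorm \<xi> z" if t: "t \<ge> 0" for \<xi> :: "real^'d" and z t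
  proof (rule power2_le_imp_le)
    let ?k = "c2 * (norm \<xi>)\<^sup>2"
    let ?z = "sg t \<xi> z"
    have "lyapunov \<eta>0 \<xi> ?z = lyapunov \<eta>0 \<xi> ?z * exp (?k * t) * exp (- (?k * t))"
      by (simp add: mult.assoc flip: exp_add)
    also have "\<dots> \<le> lyapunov \<eta>0 \<xi> z * exp (- (?k * t))" by (intro mult_right_mono lyapunov_decay t) simp
    finally have 1: "lyapunov \<eta>0 \<xi> ?z \<le> lyapunov \<eta>0 \<xi> z * exp (- (?k * t))" .
    have "energy \<xi> ?z \<le> 2 * lyapunov \<eta>0 \<xi> ?z" using lyapunov_bounds(1)[of \<xi> ?z] by linarith
    also have "\<dots> \<le> 2 * (lyapunov \<eta>0 \<xi> z * exp (- (?k * t)))" using 1 by simp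
    also have "\<dots> \<le> 2 * ((2 * energy \<xi> z) * exp (- (?k * t)))"
    proof -
      have "lyapunov \<eta>0 \<xi> z \<le> 2 * energy \<xi> z" using lyapunov_bounds(1)[of \<xi> z] by linarith
      then show ?thesis by (intro mult_left_mono mult_right_mono) auto
    qed
    also have "\<dots> \<le> 2 * ((2 * (C * (qnorm \<xi> z)\<^sup>2)) * exp (- (?k * t)))" by (intro mult_left_mono mult_right_mono Cq) auto
    finally have "C * energy \<xi> ?z \<le> C * (2 * ((2 * (C * (qnorm \<xi> z)\<^sup>2)) * exp (- (?k * t))))" using C by (intro mult_left_mono) auto
    then have "(qnorm \<xi> ?z)\<^sup>2 \<le> C * (2 * ((2 * (C * (qnorm \<xi> z)\<^sup>2)) * exp (- (?k * t))))" using Cq(1)[of \<xi> ?z] by linarith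
    also have "exp (- (?k * t)) = (exp (- (c2 / 2) * t * (norm \<xi>)\<^sup>2))\<^sup>2" by (simp add: mult_ac flip: exp_double)
    finally show "(qnorm \<xi> ?z)\<^sup>2 \<le> ((2 * C) * exp (- (c2 / 2) * t * (norm \<xi>)\<^sup>2) * qnorm \<xi> z)\<^sup>2"
      by (simp add: power_mult_distrib power2_eq_square[of C] mult_ac)
    show "0 \<le> (2 * C) * exp (- (c2 / 2) * t * (norm \<xi>)\<^sup>2) * qnorm \<xi> z" using C qnorm_nonneg[of \<xi> z] by (intro mult_nonneg_nonneg) auto
  qed
  moreover have "0 < 2 * C" "0 < c2 / 2" using C c2 by auto
  ultimately show ?thesis by blast
qed

end

text \<open>\<open>qnorm\<close> is not the norm of the product type and depends on \<xi>, so the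
  integral inequality is applied to each component and recombined.\<close>

lemma qnorm_integral_le:
  fixes F :: "'a \<Rightarrow> complex \<times> (complex^'d::finite)"
  assumes F: "integrable M F" and g: "integrable M g" "\<And>x. qnorm \<xi> (F x) \<le> g x"
  shows "qnorm \<xi> (\<integral>x. F x \<partial>M) \<le> (\<integral>x. g x \<partial>M)"
proof -
  have 1: "integrable M (\<lambda>x. fst (F x))" "integrable M (\<lambda>x. snd (F x))"
    using integrable_bounded_linear[OF bounded_linear_fst F] integrable_bounded_linear[OF bounded_linear_snd F] by auto
  have i: "integrable M (\<lambda>x. (1 + norm \<xi>) * cmod (fst (F x)))" "integrable M (\<lambda>x. norm (snd (F x)))"
    by (intro integrable_mult_right integrable_norm 1)+
  have "(1 + norm \<xi>) * cmod (\<integral>x. fst (F x) \<partial>M) \<le> (1 + norm \<xi>) * (\<integral>x. cmod (fst (F x)) \<partial>M)"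
    by (intro mult_left_mono integral_norm_bound) simp
  moreover have "norm (\<integral>x. snd (F x) \<partial>M) \<le> (\<integral>x. norm (snd (F x)) \<partial>M)" by (rule integral_norm_bound)
  ultimately have "qnorm \<xi> (\<integral>x. F x \<partial>M) \<le> (1 + norm \<xi>) * (\<integral>x. cmod (fst (F x)) \<partial>M) + (\<integral>x. norm (snd (F x)) \<partial>M)"
    unfolding qnorm_def integral_bounded_linear[OF bounded_linear_fst F, symmetric] integral_bounded_linear[OF bounded_linear_snd F, symmetric]
    by (rule add_mono)
  also have "\<dots> = (\<integral>x. (1 + norm \<xi>) * cmod (fst (F x)) + norm (snd (F x)) \<partial>M)"
    unfolding Bochner_Integration.integral_add[OF i] by simp
  also have "\<dots> \<le> (\<integral>x. g x \<partial>M)"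
  proof (rule integral_mono'[OF g(1)])
    show "(1 + norm \<xi>) * cmod (fst (F x)) + norm (snd (F x)) \<le> g x" for x using g(2)[of x] by (simp add: qnorm_def)
    show "0 \<le> g x" for x by (rule order_trans[OF qnorm_nonneg g(2)])
  qed
  finally show ?thesis .
qed

lemma integrable_of_qnorm:
  fixes F :: "'a \<Rightarrow> complex \<times> (complex^'d::finite)"
  assumes "F \<in> borel_measurable M" "integrable M g" "\<And>x. qnorm \<xi> (F x) \<le> g x"
  shows "integrable M F"
proof (rule Bochner_Integration.integrable_bound[OF assms(2,1)])
  show "AE x in M. norm (F x) \<le> norm (g x)"
  proof (rule AE_I2)
    fix x
    have "norm (F x) \<le> g x" by (rule order_trans[OF norm_le_qnorm assms(3)])
    then show "norm (F x) \<le> norm (g x)" by simp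
  qed
qed

section \<open>Heat-type bounds and beta integrals in time\<close>

lemma powr_exp_bound:
  fixes a c :: real
  assumes "c > 0" "a \<ge> 0"
  shows "\<exists>C>0. \<forall>x\<ge>0. x powr a * exp (- c * x\<^sup>2) \<le> C"
proof -
  obtain n :: nat where n: "a \<le> real n" using real_arch_simple by blast
  have "x powr a * exp (- c * x\<^sup>2) \<le> 1 + fact n / c ^ n" if x: "x \<ge> 0" for x :: real
  proof (cases "x \<le> 1")
    case True
    have "x powr a \<le> 1" using powr_mono2[of a x 1] True x assms by simp
    moreover have "exp (- c * x\<^sup>2) \<le> 1" using assms by simp
    ultimately have "x powr a * exp (- c * x\<^sup>2) \<le> 1 * 1" by (intro mult_mono) auto
    moreover have "0 \<le> fact n / c ^ n" using assms by simp
    ultimately show ?thesis by linarith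
  next
    case False
    have "x powr a \<le> x powr real (2 * n)" using False n by (intro powr_mono) auto
    also have "\<dots> = x ^ (2 * n)" using False by (intro powr_realpow) simp
    also have "\<dots> = (c * x\<^sup>2) ^ n / c ^ n" using assms by (simp add: power_mult_distrib power_mult)
    also have "\<dots> \<le> fact n * exp (c * x\<^sup>2) / c ^ n"
      using assms by (intro divide_right_mono power_le_fact_exp) auto
    finally have "x powr a * exp (- c * x\<^sup>2) \<le> fact n * exp (c * x\<^sup>2) / c ^ n * exp (- c * x\<^sup>2)"
      by (rule mult_right_mono) simp
    also have "\<dots> = fact n / c ^ n * (exp (c * x\<^sup>2) * exp (- c * x\<^sup>2))" by simp
    also have "exp (c * x\<^sup>2) * exp (- c * x\<^sup>2) = 1" by (simp flip: exp_add)
    finally show ?thesis by simp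
  qed
  moreover have "0 < 1 + fact n / c ^ n" using assms by (intro add_pos_nonneg) auto
  ultimately show ?thesis by blast
qed

text \<open>The substitution x = sqrt \<tau> r reduces it to \<tau> = 1.\<close>

lemma heat_power_bound:
  fixes a c :: real
  assumes "c > 0" "a \<ge> 0"
  shows "\<exists>C>0. \<forall>r\<ge>0. \<forall>\<tau>>0. r powr a * exp (- c * \<tau> * r\<^sup>2) \<le> C * \<tau> powr (- (a / 2))"
proof -
  obtain C where C: "C > 0" "\<And>x. x \<ge> 0 \<Longrightarrow> x powr a * exp (- c * x\<^sup>2) \<le> C"
    using powr_exp_bound[OF assms] by blast
  have "r powr a * exp (- c * \<tau> * r\<^sup>2) \<le> C * \<tau> powr (- (a / 2))" if "r \<ge> 0" "\<tau> > 0" for r \<tau> :: real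
  proof -
    have "(sqrt \<tau> * r) powr a * exp (- c * (sqrt \<tau> * r)\<^sup>2) \<le> C" using that by (intro C) auto
    moreover have "(sqrt \<tau> * r) powr a = \<tau> powr (a / 2) * r powr a"
      using that by (simp add: powr_mult powr_half_sqrt[symmetric] powr_powr)
    moreover have "- c * (sqrt \<tau> * r)\<^sup>2 = - c * \<tau> * r\<^sup>2" using that by (simp add: power_mult_distrib)
    ultimately have "\<tau> powr (a / 2) * (r powr a * exp (- c * \<tau> * r\<^sup>2)) \<le> C" by (simp only: mult.assoc)
    then have "\<tau> powr (- (a / 2)) * (\<tau> powr (a / 2) * (r powr a * exp (- c * \<tau> * r\<^sup>2))) \<le> \<tau> powr (- (a / 2)) * C"
      by (rule mult_left_mono) simp
    moreover have "\<tau> powr (- (a / 2)) * (\<tau> powr (a / 2) * X) = X" for X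
      using that by (simp add: powr_minus)
    ultimately show ?thesis by (simp only: mult.commute)
  qed
  then show ?thesis using C(1) by blast
qed

text \<open>The integrand of Euler's beta integral, rescaled to (0, t) and extended by zero; every
  Duhamel integral below is dominated by a multiple of it.\<close>

definition beta_kernel :: "real \<Rightarrow> real \<Rightarrow> real \<Rightarrow> real \<Rightarrow> real" where
  "beta_kernel x y t s = indicator {0<..<t} s * ((t - s) powr (x - 1) * s powr (y - 1))"

definition beta_const :: "real \<Rightarrow> real \<Rightarrow> real" where
  "beta_const x y = (\<integral>s. beta_kernel x y 1 s \<partial>lborel)"

lemma beta_kernel_measurable [measurable]: "beta_kernel x y t \<in> borel_measurable borel"
  unfolding beta_kernel_def by measurable

lemma beta_kernel_nonneg: "0 \<le> beta_kernel x y t s"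
  by (simp add: beta_kernel_def)

lemma beta_const_nonneg: "0 \<le> beta_const x y"
  unfolding beta_const_def by (intro integral_nonneg_AE AE_I2 beta_kernel_nonneg)

text \<open>Scaling s by t reduces to t = 1 and produces the power of t.\<close>

lemma beta_kernel_integral:
  assumes "x > 0" "y > 0" "t > 0"
  shows "integrable lborel (beta_kernel x y t)" "(\<integral>s. beta_kernel x y t s \<partial>lborel) = beta_const x y * t powr (x + y - 1)"
proof -
  have e: "beta_kernel x y 1 = (\<lambda>s. indicator {0..1} s *\<^sub>R (s powr (y - 1) * (1 - s) powr (x - 1)))"
    by (auto simp: beta_kernel_def fun_eq_iff indicator_def)
  have i1: "integrable lborel (beta_kernel x y 1)"
    using integrable_Beta[OF assms(2,1)] unfolding e set_integrable_def .
  have sc: "beta_kernel x y t (0 + t *\<^sub>R s) = t powr (x + y - 2) * beta_kernel x y 1 s" for s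
  proof (cases "0 < s \<and> s < 1")
    case True
    have "t - t * s = t * (1 - s)" by (simp add: algebra_simps)
    then have "(t - t * s) powr (x - 1) * (t * s) powr (y - 1) = (t powr (x - 1) * t powr (y - 1)) * ((1 - s) powr (x - 1) * s powr (y - 1))"
      using True assms by (simp add: powr_mult)
    also have "t powr (x - 1) * t powr (y - 1) = t powr (x + y - 2)" by (simp add: powr_add[symmetric])
    finally show ?thesis using True assms by (simp add: beta_kernel_def)
  next
    case False
    then have "\<not> (0 < t * s \<and> t * s < t)" using assms by (simp add: zero_less_mult_iff mult_less_cancel_left1)
    then show ?thesis using False by (auto simp: beta_kernel_def indicator_def)
  qed
  have "integrable lborel (\<lambda>s. beta_kernel x y t (0 + t *\<^sub>R s))" unfolding sc by (intro integrable_mult_right i1)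
  from integrable_lborel_scale_shift[OF this, of "1 / t" 0]
  show "integrable lborel (beta_kernel x y t)" using assms by simp
  have "(\<integral>s. beta_kernel x y t s \<partial>lborel) = t * (\<integral>s. beta_kernel x y t (0 + t *\<^sub>R s) \<partial>lborel)"
    by (subst integral_lborel_scale_shift[where c = t and t = 0]) (use assms in auto)
  also have "\<dots> = t powr 1 * t powr (x + y - 2) * beta_const x y" using assms unfolding sc by (simp add: beta_const_def)
  also have "t powr 1 * t powr (x + y - 2) = t powr (x + y - 1)" by (simp only: powr_add[symmetric]) (simp add: algebra_simps)
  finally show "(\<integral>s. beta_kernel x y t s \<partial>lborel) = beta_const x y * t powr (x + y - 1)" by (simp add: mult.commute)
qed

context nsk
begin

section \<open>Measurability and smoothing of the semigroup\<close>

lemma sym_continuous: "continuous_on UNIV (\<lambda>(\<xi>, z). sym \<xi> z)"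
  unfolding nsk_symbol_def cdot_def case_prod_beta by (intro continuous_intros)

lemma sym_measurable:
  assumes "g \<in> borel_measurable M" "h \<in> borel_measurable M"
  shows "(\<lambda>x. sym (g x) (h x)) \<in> borel_measurable M"
proof -
  have "(\<lambda>x. (g x, h x)) \<in> borel_measurable M" using assms by (rule borel_measurable_Pair)
  from measurable_compose[OF this borel_measurable_continuous_onI[OF sym_continuous]] show ?thesis by simp
qed

lemma sg_measurable:
  assumes "f \<in> borel_measurable M" "g \<in> borel_measurable M" "h \<in> borel_measurable M"
  shows "(\<lambda>x. sg (f x) (g x) (h x)) \<in> borel_measurable M"
proof -
  have it: "(\<lambda>x. (sym (g x) ^^ n) (h x)) \<in> borel_measurable M" for n
    by (induction n) (auto intro: sym_measurable assms)
  note assms(1)[measurable]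
  have c: "(\<lambda>x. (- f x) ^ n / fact n) \<in> borel_measurable M" for n by measurable
  show ?thesis unfolding exp_nsk_symbol_def
    by (intro borel_measurable_suminf borel_measurable_scaleR c it)
qed

lemma vector_mvt:
  fixes f :: "real \<Rightarrow> 'a::real_normed_vector"
  assumes "\<And>s. s \<in> {a..b} \<Longrightarrow> (f has_vector_derivative f' s) (at s within {a..b})" "\<And>s. s \<in> {a..b} \<Longrightarrow> norm (f' s) \<le> B" "a \<le> b"
  shows "norm (f b - f a) \<le> B * (b - a)"
proof -
  have "norm (f b - f a) \<le> B * norm (b - a)"
  proof (rule differentiable_bound[of "{a..b}" f "\<lambda>s h. h *\<^sub>R f' s"])
    fix s assume s: "s \<in> {a..b}"
    show "onorm (\<lambda>h. h *\<^sub>R f' s) \<le> B"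
      by (rule onorm_le, simp, subst mult.commute[of B], rule mult_left_mono[OF assms(2)[OF s]], simp)
  qed (use assms in \<open>auto simp: has_vector_derivative_def\<close>)
  then show ?thesis using assms(3) by simp
qed

text \<open>The increment bound is the mean value inequality: the derivative in time is -
  \<open>sym\<close>, which costs |\<xi>| (1 + |\<xi>|). It is applied separately to the weighted
  first and to the second component, whence the factor 2; a common constant then serves both
  estimates.\<close>

lemma sg_estimates:
  obtains C c where "C > 0" "c > 0"
    "\<And>\<xi> :: real^'d::finite. \<And>z t. t \<ge> 0 \<Longrightarrow> qnorm \<xi> (sg t \<xi> z) \<le> C * exp (- c * t * (norm \<xi>)\<^sup>2) * qnorm \<xi> z"
    "\<And>\<xi> :: real^'d. \<And>z t \<delta>. t \<ge> 0 \<Longrightarrow> \<delta> \<ge> 0 \<Longrightarrow>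
       qnorm \<xi> (sg (t + \<delta>) \<xi> z - sg t \<xi> z) \<le> \<delta> * (C * (norm \<xi> * (1 + norm \<xi>)) * exp (- c * t * (norm \<xi>)\<^sup>2) * qnorm \<xi> z)"
proof -
  obtain C c where C: "C > 0" "c > 0"
    "\<And>\<xi> :: real^'d. \<And>z t. t \<ge> 0 \<Longrightarrow> qnorm \<xi> (sg t \<xi> z) \<le> C * exp (- c * t * (norm \<xi>)\<^sup>2) * qnorm \<xi> z"
    using sg_decay[where 'd='d] by blast
  have D: "qnorm \<xi> (sg (t + \<delta>) \<xi> z - sg t \<xi> z) \<le> \<delta> * ((2 * Ks * C) * (norm \<xi> * (1 + norm \<xi>)) * exp (- c * t * (norm \<xi>)\<^sup>2) * qnorm \<xi> z)"
    if t: "t \<ge> 0" "\<delta> \<ge> 0" for \<xi> :: "real^'d" and z t \<delta>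
  proof -
    define B where "B = Ks * (norm \<xi> * (1 + norm \<xi>)) * (C * exp (- c * t * (norm \<xi>)\<^sup>2) * qnorm \<xi> z)"
    have b: "qnorm \<xi> (sym \<xi> (sg s \<xi> z)) \<le> B" if "s \<in> {t..t + \<delta>}" for s
    proof -
      have "qnorm \<xi> (sym \<xi> (sg s \<xi> z)) \<le> Ks * (norm \<xi> * (1 + norm \<xi>)) * qnorm \<xi> (sg s \<xi> z)" by (rule qnorm_sym)
      also have "\<dots> \<le> Ks * (norm \<xi> * (1 + norm \<xi>)) * (C * exp (- c * s * (norm \<xi>)\<^sup>2) * qnorm \<xi> z)"
        using Ks_pos that t by (intro mult_left_mono C) auto
      also have "\<dots> \<le> B" unfolding B_def
        using Ks_pos C(1,2) that by (intro mult_left_mono mult_right_mono qnorm_nonneg) (auto intro!: mult_right_mono)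
      finally show ?thesis .
    qed
    have d: "((\<lambda>s. sg s \<xi> z) has_vector_derivative - sym \<xi> (sg s \<xi> z)) (at s within {t..t + \<delta>})" for s
      by (rule sg_has_vector_derivative)
    have "norm ((1 + norm \<xi>) *\<^sub>R fst (sg (t + \<delta>) \<xi> z) - (1 + norm \<xi>) *\<^sub>R fst (sg t \<xi> z)) \<le> B * (t + \<delta> - t)"
    proof (rule vector_mvt[where f' = "\<lambda>s. (1 + norm \<xi>) *\<^sub>R fst (- sym \<xi> (sg s \<xi> z))"])
      fix s assume s: "s \<in> {t..t + \<delta>}"
      show "((\<lambda>s. (1 + norm \<xi>) *\<^sub>R fst (sg s \<xi> z)) has_vector_derivative (1 + norm \<xi>) *\<^sub>R fst (- sym \<xi> (sg s \<xi> z))) (at s within {t..t + \<delta>})"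
        by (intro bounded_linear.has_vector_derivative[OF bounded_linear_scaleR_right] bounded_linear.has_vector_derivative[OF bounded_linear_fst] d)
      show "norm ((1 + norm \<xi>) *\<^sub>R fst (- sym \<xi> (sg s \<xi> z))) \<le> B"
        using order_trans[OF qnorm_fst b[OF s]] by simp
    qed (use t in simp)
    then have 1: "(1 + norm \<xi>) * cmod (fst (sg (t + \<delta>) \<xi> z - sg t \<xi> z)) \<le> B * \<delta>"
      by (simp only: scaleR_diff_right[symmetric] norm_scaleR fst_diff) simp
    have "norm (snd (sg (t + \<delta>) \<xi> z) - snd (sg t \<xi> z)) \<le> B * (t + \<delta> - t)"
    proof (rule vector_mvt[where f' = "\<lambda>s. snd (- sym \<xi> (sg s \<xi> z))"])
      fix s assume s: "s \<in> {t..t + \<delta>}"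
      show "((\<lambda>s. snd (sg s \<xi> z)) has_vector_derivative snd (- sym \<xi> (sg s \<xi> z))) (at s within {t..t + \<delta>})"
        by (intro bounded_linear.has_vector_derivative[OF bounded_linear_snd] d)
      show "norm (snd (- sym \<xi> (sg s \<xi> z))) \<le> B"
        using order_trans[OF qnorm_snd b[OF s]] by simp
    qed (use t in simp)
    then have 2: "norm (snd (sg (t + \<delta>) \<xi> z - sg t \<xi> z)) \<le> B * \<delta>" by simp
    have "qnorm \<xi> (sg (t + \<delta>) \<xi> z - sg t \<xi> z) \<le> B * \<delta> + B * \<delta>"
      using add_mono[OF 1 2] by (simp only: qnorm_def)
    then show ?thesis by (simp add: B_def mult_ac)
  qed
  show thesis
  proof (rule that)
    let ?C = "C + 2 * Ks * C"
    show "?C > 0" using C(1) Ks_pos by (intro add_pos_pos) auto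
    show "c > 0" by (rule C)
    show "qnorm \<xi> (sg t \<xi> z) \<le> ?C * exp (- c * t * (norm \<xi>)\<^sup>2) * qnorm \<xi> z" if "t \<ge> 0" for \<xi> :: "real^'d" and z t
      by (rule order_trans[OF C(3)[OF that]]) (use C(1) Ks_pos qnorm_nonneg[of \<xi> z] in \<open>auto intro!: mult_right_mono\<close>)
    show "qnorm \<xi> (sg (t + \<delta>) \<xi> z - sg t \<xi> z) \<le> \<delta> * (?C * (norm \<xi> * (1 + norm \<xi>)) * exp (- c * t * (norm \<xi>)\<^sup>2) * qnorm \<xi> z)"
      if "t \<ge> 0" "\<delta> \<ge> 0" for \<xi> :: "real^'d" and z t \<delta>
      by (rule order_trans[OF D[OF that]]) (use C(1) Ks_pos that qnorm_nonneg[of \<xi> z] in \<open>auto intro!: mult_left_mono mult_right_mono\<close>)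
  qed
qed

lemma sg_smoothing:
  assumes "a \<ge> 0"
  shows "\<exists>C>0. \<forall>\<xi> :: real^'d::finite. \<forall>z. \<forall>t>0. norm \<xi> powr a * qnorm \<xi> (sg t \<xi> z) \<le> C * t powr (- (a / 2)) * qnorm \<xi> z"
proof (rule sg_estimates[where 'd='d])
  fix C c assume C: "C > 0" "c > 0"
    "\<And>\<xi> :: real^'d. \<And>z t. t \<ge> 0 \<Longrightarrow> qnorm \<xi> (sg t \<xi> z) \<le> C * exp (- c * t * (norm \<xi>)\<^sup>2) * qnorm \<xi> z"
  obtain K where K: "K > 0" "\<And>r \<tau>. r \<ge> 0 \<Longrightarrow> \<tau> > 0 \<Longrightarrow> r powr a * exp (- c * \<tau> * r\<^sup>2) \<le> K * \<tau> powr (- (a / 2))"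
    using heat_power_bound[OF C(2) assms] by blast
  have "norm \<xi> powr a * qnorm \<xi> (sg t \<xi> z) \<le> (C * K) * t powr (- (a / 2)) * qnorm \<xi> z" if "t > 0" for \<xi> :: "real^'d" and z t
  proof -
    have "norm \<xi> powr a * qnorm \<xi> (sg t \<xi> z) \<le> norm \<xi> powr a * (C * exp (- c * t * (norm \<xi>)\<^sup>2) * qnorm \<xi> z)"
      using that by (intro mult_left_mono C) auto
    also have "\<dots> = C * (norm \<xi> powr a * exp (- c * t * (norm \<xi>)\<^sup>2)) * qnorm \<xi> z" by (simp only: mult_ac)
    also have "\<dots> \<le> C * (K * t powr (- (a / 2))) * qnorm \<xi> z"
      using C(1) that by (intro mult_right_mono mult_left_mono K qnorm_nonneg) auto
    finally show ?thesis by (simp only: mult_ac)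
  qed
  moreover have "C * K > 0" using C K by simp
  ultimately show ?thesis by blast
qed

lemma min_one_le_powr:
  assumes "0 \<le> x" "0 \<le> b" "b \<le> 1"
  shows "min 1 x \<le> x powr (b::real)"
proof (cases "x \<le> 1")
  case True
  show ?thesis
  proof (cases "x = 0")
    case False
    then have "x powr 1 \<le> x powr b" using True assms by (intro powr_mono') auto
    then show ?thesis using True assms by simp
  qed simp
next
  case False
  then have "1 \<le> x powr b" using assms by (intro ge_one_powr_ge_zero) auto
  then show ?thesis by simp
qed

text \<open>Interpolation. Up to half of the heat factor, the increment is bounded by a constant,
  crudely, and by \<delta>/t, through the mean value inequality; min 1 x \<le> x^b for 0 \<le> b
  \<le> 1 joins the two.\<close>

lemma sg_smoothing_hoelder:
  assumes a: "a \<ge> 0" and b: "0 \<le> b" "b \<le> 1" and T: "T > 0"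
  shows "\<exists>C>0. \<forall>\<xi> :: real^'d::finite. \<forall>z. \<forall>t>0. \<forall>\<delta>\<ge>0. t + \<delta> \<le> T \<longrightarrow>
    norm \<xi> powr a * qnorm \<xi> (sg (t + \<delta>) \<xi> z - sg t \<xi> z) \<le> C * \<delta> powr b * t powr (- b - a / 2) * qnorm \<xi> z"
proof (rule sg_estimates[where 'd='d])
  fix C c assume C: "C > 0" "c > 0"
    "\<And>\<xi> :: real^'d. \<And>z t. t \<ge> 0 \<Longrightarrow> qnorm \<xi> (sg t \<xi> z) \<le> C * exp (- c * t * (norm \<xi>)\<^sup>2) * qnorm \<xi> z"
    "\<And>\<xi> :: real^'d. \<And>z t \<delta>. t \<ge> 0 \<Longrightarrow> \<delta> \<ge> 0 \<Longrightarrow>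
       qnorm \<xi> (sg (t + \<delta>) \<xi> z - sg t \<xi> z) \<le> \<delta> * (C * (norm \<xi> * (1 + norm \<xi>)) * exp (- c * t * (norm \<xi>)\<^sup>2) * qnorm \<xi> z)"
  have c2: "c / 2 > 0" using C by simp
  obtain K where K: "K > 0" "\<And>r \<tau>. r \<ge> 0 \<Longrightarrow> \<tau> > 0 \<Longrightarrow> r powr a * exp (- (c / 2) * \<tau> * r\<^sup>2) \<le> K * \<tau> powr (- (a / 2))"
    using heat_power_bound[OF c2 a] by blast
  obtain K1 where K1: "K1 > 0" "\<And>r \<tau>. r \<ge> 0 \<Longrightarrow> \<tau> > 0 \<Longrightarrow> r powr 1 * exp (- (c / 2) * \<tau> * r\<^sup>2) \<le> K1 * \<tau> powr (- (1 / 2))"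
    using heat_power_bound[OF c2, of 1] by auto
  obtain K2 where K2: "K2 > 0" "\<And>r \<tau>. r \<ge> 0 \<Longrightarrow> \<tau> > 0 \<Longrightarrow> r powr 2 * exp (- (c / 2) * \<tau> * r\<^sup>2) \<le> K2 * \<tau> powr (- (2 / 2))"
    using heat_power_bound[OF c2, of 2] by auto
  define A where "A = max (2 * C) (C * (K1 * sqrt T + K2))"
  have A: "A > 0" using C(1) by (simp add: A_def)
  have "norm \<xi> powr a * qnorm \<xi> (sg (t + \<delta>) \<xi> z - sg t \<xi> z) \<le> (A * K) * \<delta> powr b * t powr (- b - a / 2) * qnorm \<xi> z"
    if t: "t > 0" "\<delta> \<ge> 0" "t + \<delta> \<le> T" for \<xi> :: "real^'d" and z t \<delta>
  proof -
    let ?r = "norm \<xi>"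
    let ?e = "exp (- (c / 2) * t * ?r\<^sup>2)"
    let ?D = "qnorm \<xi> (sg (t + \<delta>) \<xi> z - sg t \<xi> z)"
    have q: "0 \<le> qnorm \<xi> z" by (rule qnorm_nonneg)
    \<comment> \<open>The heat factor is split into halves: one is consumed by the increment, the
      other by the weight |\<xi>|^a.\<close>
    have ee: "exp (- c * t * ?r\<^sup>2) = ?e * ?e" by (simp flip: exp_add)
    have e1: "?e \<le> 1" using C t by simp
    have "?D \<le> qnorm \<xi> (sg (t + \<delta>) \<xi> z) + qnorm \<xi> (sg t \<xi> z)" by (rule qnorm_diff)
    also have "\<dots> \<le> C * exp (- c * (t + \<delta>) * ?r\<^sup>2) * qnorm \<xi> z + C * exp (- c * t * ?r\<^sup>2) * qnorm \<xi> z"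
      using t by (intro add_mono C) auto
    also have "\<dots> \<le> C * exp (- c * t * ?r\<^sup>2) * qnorm \<xi> z + C * exp (- c * t * ?r\<^sup>2) * qnorm \<xi> z"
      using C t q by (intro add_mono mult_right_mono mult_left_mono) (auto intro!: mult_right_mono mult_left_mono)
    also have "\<dots> = 2 * C * (?e * ?e) * qnorm \<xi> z" unfolding ee by simp
    also have "\<dots> \<le> A * (1 * ?e) * qnorm \<xi> z"
      using q e1 C(1) by (intro mult_right_mono mult_mono) (auto simp: A_def)
    finally have D1: "?D \<le> A * ?e * qnorm \<xi> z * 1" by simp
    \<comment> \<open>The linear part of |\<xi>| (1 + |\<xi>|) only yields t^(-1/2); this is where
      the time horizon enters, since sqrt t \<le> sqrt T brings it to the form of a constant over
      t.\<close>
    have x: "(?r * (1 + ?r)) * ?e \<le> (K1 * sqrt T + K2) / t"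
    proof -
      have "?r powr 1 * ?e \<le> K1 * t powr (- (1 / 2))" using t by (intro K1) auto
      also have "t powr (- (1 / 2)) = sqrt t / t"
      proof -
        have "t powr (- (1 / 2)) = t powr (1 / 2 + (- 1))" by simp
        also have "\<dots> = sqrt t / t" using t unfolding powr_add by (simp add: powr_half_sqrt powr_minus_divide)
        finally show ?thesis .
      qed
      also have "K1 * (sqrt t / t) \<le> K1 * (sqrt T / t)"
        using t K1(1) by (intro mult_left_mono divide_right_mono) auto
      finally have 1: "?r * ?e \<le> K1 * sqrt T / t" by simp
      have "?r powr 2 * ?e \<le> K2 * t powr (- (2 / 2))" using t by (intro K2) auto
      then have 2: "?r\<^sup>2 * ?e \<le> K2 / t" using t by (simp add: powr_minus_divide)
      have "(?r * (1 + ?r)) * ?e = ?r * ?e + ?r\<^sup>2 * ?e" by (simp add: algebra_simps power2_eq_square)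
      also have "\<dots> \<le> K1 * sqrt T / t + K2 / t" by (rule add_mono[OF 1 2])
      finally show ?thesis by (simp add: add_divide_distrib)
    qed
    have "?D \<le> \<delta> * (C * (?r * (1 + ?r)) * exp (- c * t * ?r\<^sup>2) * qnorm \<xi> z)" using t by (intro C) auto
    also have "\<dots> = (\<delta> * C * ?e * qnorm \<xi> z) * ((?r * (1 + ?r)) * ?e)" unfolding ee by (simp only: mult_ac)
    also have "\<dots> \<le> (\<delta> * C * ?e * qnorm \<xi> z) * ((K1 * sqrt T + K2) / t)"
      using t C q by (intro mult_left_mono x) auto
    also have "\<dots> = (C * (K1 * sqrt T + K2)) * ?e * qnorm \<xi> z * (\<delta> / t)" by (simp add: mult_ac)
    also have "\<dots> \<le> A * ?e * qnorm \<xi> z * (\<delta> / t)"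
      using t q by (intro mult_right_mono) (auto simp: A_def)
    finally have D2: "?D \<le> A * ?e * qnorm \<xi> z * (\<delta> / t)" .
    have "?D \<le> A * ?e * qnorm \<xi> z * min 1 (\<delta> / t)" using D1 D2 by (auto simp: min_def)
    also have "\<dots> \<le> A * ?e * qnorm \<xi> z * (\<delta> / t) powr b"
      using A q t b by (intro mult_left_mono min_one_le_powr) auto
    finally have "?r powr a * ?D \<le> ?r powr a * (A * ?e * qnorm \<xi> z * (\<delta> / t) powr b)" by (rule mult_left_mono) simp
    also have "\<dots> = A * (?r powr a * ?e) * qnorm \<xi> z * (\<delta> / t) powr b" by (simp only: mult_ac)
    also have "\<dots> \<le> A * (K * t powr (- (a / 2))) * qnorm \<xi> z * (\<delta> / t) powr b"
      using A q t by (intro mult_right_mono mult_left_mono K) auto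
    also have "\<dots> = (A * K) * \<delta> powr b * (t powr (- b) * t powr (- (a / 2))) * qnorm \<xi> z"
      using t by (simp add: powr_divide powr_minus divide_simps)
    also have "t powr (- b) * t powr (- (a / 2)) = t powr (- b - a / 2)" by (simp add: powr_add[symmetric])
    finally show ?thesis .
  qed
  moreover have "A * K > 0" using A K by simp
  ultimately show ?thesis by blast
qed

end

section \<open>The quadratic terms on the Fourier side\<close>

text \<open>Stated as a property of the constant, so that one constant can be fixed independently of
  the functions to be convolved. The exponents have the form \<theta> - d of Riesz kernels, for
  which orders add under convolution.\<close>

definition conv_bound :: "'d::finite itself \<Rightarrow> real \<Rightarrow> real \<Rightarrow> real \<Rightarrow> bool" where
  "conv_bound _ \<theta>1 \<theta>2 C \<longleftrightarrow> (\<forall>(g :: real^'d \<Rightarrow> complex) h G K \<xi>.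
    g \<in> borel_measurable borel \<longrightarrow> h \<in> borel_measurable borel \<longrightarrow> 0 \<le> G \<longrightarrow> 0 \<le> K \<longrightarrow>
    (AE \<eta> in lborel. cmod (g \<eta>) \<le> G * norm \<eta> powr (\<theta>1 - CARD('d))) \<longrightarrow>
    (AE \<eta> in lborel. cmod (h \<eta>) \<le> K * norm \<eta> powr (\<theta>2 - CARD('d))) \<longrightarrow> \<xi> \<noteq> 0 \<longrightarrow>
    integrable lborel (\<lambda>\<eta>. g (\<xi> - \<eta>) * h \<eta>) \<and> cmod (fconv g h \<xi>) \<le> C * G * K * norm \<xi> powr (\<theta>1 + \<theta>2 - CARD('d)))"

lemma conv_boundD:
  fixes g h :: "real^'d::finite \<Rightarrow> complex"
  assumes "conv_bound TYPE('d) \<theta>1 \<theta>2 C" "g \<in> borel_measurable borel" "h \<in> borel_measurable borel" "0 \<le> G" "0 \<le> K"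
    "AE \<eta> in lborel. cmod (g \<eta>) \<le> G * norm \<eta> powr (\<theta>1 - CARD('d))"
    "AE \<eta> in lborel. cmod (h \<eta>) \<le> K * norm \<eta> powr (\<theta>2 - CARD('d))" "\<xi> \<noteq> 0"
  shows "integrable lborel (\<lambda>\<eta>. g (\<xi> - \<eta>) * h \<eta>)" "cmod (fconv g h \<xi>) \<le> C * G * K * norm \<xi> powr (\<theta>1 + \<theta>2 - CARD('d))"
  using assms unfolding conv_bound_def by blast+

lemma conv_bound_mono:
  assumes "conv_bound TYPE('d::finite) \<theta>1 \<theta>2 C" "C \<le> D"
  shows "conv_bound TYPE('d) \<theta>1 \<theta>2 D"
  unfolding conv_bound_def
proof (intro allI impI)
  fix g h :: "real^'d \<Rightarrow> complex" and G K :: real and \<xi> :: "real^'d"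
  assume a: "g \<in> borel_measurable borel" "h \<in> borel_measurable borel" "0 \<le> G" "0 \<le> K"
    "AE \<eta> in lborel. cmod (g \<eta>) \<le> G * norm \<eta> powr (\<theta>1 - CARD('d))"
    "AE \<eta> in lborel. cmod (h \<eta>) \<le> K * norm \<eta> powr (\<theta>2 - CARD('d))" "\<xi> \<noteq> 0"
  have "C * G * K * norm \<xi> powr (\<theta>1 + \<theta>2 - CARD('d)) \<le> D * G * K * norm \<xi> powr (\<theta>1 + \<theta>2 - CARD('d))"
    using a assms(2) by (intro mult_right_mono) auto
  then show "integrable lborel (\<lambda>\<eta>. g (\<xi> - \<eta>) * h \<eta>) \<and> cmod (fconv g h \<xi>) \<le> D * G * K * norm \<xi> powr (\<theta>1 + \<theta>2 - CARD('d))"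
    using conv_boundD[OF assms(1) a] by (blast intro: order_trans)
qed

lemma fconv_estimate:
  assumes "0 < \<theta>1" "0 < \<theta>2" "\<theta>1 + \<theta>2 < real CARD('d::finite)"
  shows "\<exists>C\<ge>0. conv_bound TYPE('d) \<theta>1 \<theta>2 C"
proof -
  let ?d = "real CARD('d)"
  obtain C where C: "C \<ge> 0" "\<And>\<xi>::real^'d. \<xi> \<noteq> 0 \<Longrightarrow>
    (\<integral>\<^sup>+\<eta>. ennreal (norm (\<xi> - \<eta>) powr (\<theta>1 - ?d) * norm \<eta> powr (\<theta>2 - ?d)) \<partial>lborel) \<le> ennreal (C * norm \<xi> powr (\<theta>1 + \<theta>2 - ?d))"
    using riesz_convolution[where 'a="real^'d", of \<theta>1 \<theta>2] assms by auto
  let ?c = "1 / (2 * pi) ^ CARD('d)"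
  show ?thesis unfolding conv_bound_def
  proof (intro exI[of _ "?c * C"] conjI[of "0 \<le> ?c * C"] allI impI)
    show "?c * C \<ge> 0" using C(1) by simp
    fix g h :: "real^'d \<Rightarrow> complex" and G K :: real and \<xi> :: "real^'d"
    assume m[measurable]: "g \<in> borel_measurable borel" "h \<in> borel_measurable borel" and GK: "0 \<le> G" "0 \<le> K"
      and g: "AE \<eta> in lborel. cmod (g \<eta>) \<le> G * norm \<eta> powr (\<theta>1 - ?d)"
      and h: "AE \<eta> in lborel. cmod (h \<eta>) \<le> K * norm \<eta> powr (\<theta>2 - ?d)" and \<xi>: "\<xi> \<noteq> 0"
    have "(\<integral>\<^sup>+\<eta>. ennreal (norm (g (\<xi> - \<eta>) * h \<eta>)) \<partial>lborel)
      \<le> (\<integral>\<^sup>+\<eta>. ennreal (G * K) * ennreal (norm (\<xi> - \<eta>) powr (\<theta>1 - ?d) * norm \<eta> powr (\<theta>2 - ?d)) \<partial>lborel)"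
    proof (rule nn_integral_mono_AE)
      show "AE \<eta> in lborel. ennreal (norm (g (\<xi> - \<eta>) * h \<eta>)) \<le> ennreal (G * K) * ennreal (norm (\<xi> - \<eta>) powr (\<theta>1 - ?d) * norm \<eta> powr (\<theta>2 - ?d))"
        using AE_lborel_reflect[OF g, of \<xi>] h
      proof eventually_elim
        case (elim \<eta>)
        have "norm (g (\<xi> - \<eta>) * h \<eta>) \<le> (G * norm (\<xi> - \<eta>) powr (\<theta>1 - ?d)) * (K * norm \<eta> powr (\<theta>2 - ?d))"
          unfolding norm_mult using elim GK by (intro mult_mono) auto
        then show ?case using GK by (simp add: ennreal_mult[symmetric] mult_ac ennreal_leI)
      qed
    qed
    also have "\<dots> = ennreal (G * K) * (\<integral>\<^sup>+\<eta>. ennreal (norm (\<xi> - \<eta>) powr (\<theta>1 - ?d) * norm \<eta> powr (\<theta>2 - ?d)) \<partial>lborel)"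
      by (rule nn_integral_cmult) measurable
    also have "\<dots> \<le> ennreal (G * K) * ennreal (C * norm \<xi> powr (\<theta>1 + \<theta>2 - ?d))"
      by (intro mult_left_mono C \<xi>) simp
    also have "\<dots> = ennreal (G * K * (C * norm \<xi> powr (\<theta>1 + \<theta>2 - ?d)))"
      using GK C(1) by (intro ennreal_mult[symmetric]) auto
    finally have nn: "(\<integral>\<^sup>+\<eta>. ennreal (norm (g (\<xi> - \<eta>) * h \<eta>)) \<partial>lborel) \<le> ennreal (G * K * (C * norm \<xi> powr (\<theta>1 + \<theta>2 - ?d)))" .
    have i: "integrable lborel (\<lambda>\<eta>. g (\<xi> - \<eta>) * h \<eta>)"
    proof (rule integrableI_bounded)
      show "(\<integral>\<^sup>+\<eta>. ennreal (norm (g (\<xi> - \<eta>) * h \<eta>)) \<partial>lborel) < \<infinity>" using nn by (rule le_less_trans) simp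
    qed measurable
    have "ennreal (norm (\<integral>\<eta>. g (\<xi> - \<eta>) * h \<eta> \<partial>lborel)) \<le> ennreal (G * K * (C * norm \<xi> powr (\<theta>1 + \<theta>2 - ?d)))"
      using integral_norm_bound_ennreal[OF i] nn by (rule order_trans)
    then have "norm (\<integral>\<eta>. g (\<xi> - \<eta>) * h \<eta> \<partial>lborel) \<le> G * K * (C * norm \<xi> powr (\<theta>1 + \<theta>2 - ?d))"
      using GK C(1) by (subst (asm) ennreal_le_iff) auto
    then have "?c * norm (\<integral>\<eta>. g (\<xi> - \<eta>) * h \<eta> \<partial>lborel) \<le> ?c * (G * K * (C * norm \<xi> powr (\<theta>1 + \<theta>2 - ?d)))"
      by (rule mult_left_mono) simp
    then have "cmod (fconv g h \<xi>) \<le> ?c * C * G * K * norm \<xi> powr (\<theta>1 + \<theta>2 - ?d)"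
      unfolding fconv_def norm_mult norm_of_real by (simp add: mult_ac)
    with i show "integrable lborel (\<lambda>\<eta>. g (\<xi> - \<eta>) * h \<eta>) \<and> cmod (fconv g h \<xi>) \<le> ?c * C * G * K * norm \<xi> powr (\<theta>1 + \<theta>2 - ?d)" ..
  qed
qed

text \<open>The mixed convolution of g2 with h1 is inserted between the two; the three integrability
  hypotheses are what splitting the integrals needs.\<close>

lemma fconv_split:
  assumes "integrable lborel (\<lambda>\<eta>. g1 (\<xi> - \<eta>) * h1 \<eta>)" "integrable lborel (\<lambda>\<eta>. g2 (\<xi> - \<eta>) * h1 \<eta>)" "integrable lborel (\<lambda>\<eta>. g2 (\<xi> - \<eta>) * h2 \<eta>)"
  shows "fconv g1 h1 \<xi> - fconv g2 h2 \<xi> = fconv (\<lambda>\<eta>. g1 \<eta> - g2 \<eta>) h1 \<xi> + fconv g2 (\<lambda>\<eta>. h1 \<eta> - h2 \<eta>) \<xi>"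
  unfolding fconv_def left_diff_distrib right_diff_distrib Bochner_Integration.integral_diff[OF assms(1,2)] Bochner_Integration.integral_diff[OF assms(2,3)]
  by (simp add: algebra_simps diff_divide_distrib)

definition ixi :: "'d::finite \<Rightarrow> (real^'d \<Rightarrow> complex) \<Rightarrow> real^'d \<Rightarrow> complex" where
  "ixi j h \<xi> = \<i> * (of_real (\<xi> $ j) * h \<xi>)"

lemma coord_measurable [measurable]: "(\<lambda>\<xi>::real^'d::finite. \<xi> $ j) \<in> borel_measurable borel"
  by (intro borel_measurable_continuous_onI continuous_intros)

lemma ccoord_measurable [measurable]: "(\<lambda>w::complex^'d::finite. w $ j) \<in> borel_measurable borel"
  by (intro borel_measurable_continuous_onI continuous_intros)

lemma ixi_measurable [measurable]: "h \<in> borel_measurable borel \<Longrightarrow> ixi j h \<in> borel_measurable borel"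
  unfolding ixi_def by measurable

lemma ixi_diff: "ixi j (\<lambda>\<eta>. g \<eta> - h \<eta>) = (\<lambda>\<eta>. ixi j g \<eta> - ixi j h \<eta>)"
  by (auto simp: ixi_def algebra_simps)

lemma ixi_sum: "ixi j (\<lambda>\<zeta>. \<Sum>i\<in>I. F i \<zeta>) \<xi> = \<i> * (of_real (\<xi> $ j) * (\<Sum>i\<in>I. F i \<xi>))"
  by (simp add: ixi_def)

lemma norm_ixi_le: "cmod (ixi j h \<eta>) \<le> norm \<eta> * cmod (h \<eta>)"
  unfolding ixi_def norm_mult norm_of_real norm_ii mult_1
  by (intro mult_right_mono component_le_norm_cart) simp

lemma vec_lambda_measurable:
  fixes f :: "'d::finite \<Rightarrow> 'a \<Rightarrow> complex"
  assumes "\<And>j. f j \<in> borel_measurable M"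
  shows "(\<lambda>x. \<chi> j. f j x) \<in> borel_measurable M"
proof -
  have e: "(\<lambda>x. \<chi> j. f j x) = (\<lambda>x. \<Sum>j\<in>UNIV. (Re (f j x) *\<^sub>R axis j 1 + Im (f j x) *\<^sub>R axis j \<i>))"
    by (rule ext) (auto simp: vec_eq_iff axis_def if_distrib[of "\<lambda>c. _ *\<^sub>R c"] sum.distrib complex_eq_iff cong: if_cong)
  have r: "(\<lambda>x. Re (f j x)) \<in> borel_measurable M" "(\<lambda>x. Im (f j x)) \<in> borel_measurable M" for j
    using measurable_compose[OF assms(1) borel_measurable_Re] measurable_compose[OF assms(1) borel_measurable_Im] by auto
  show ?thesis unfolding e by (intro borel_measurable_sum borel_measurable_add borel_measurable_scaleR r borel_measurable_const)
qed

lemma norm_vec_le_sum: "norm (w :: complex^'d::finite) \<le> (\<Sum>j\<in>UNIV. cmod (w $ j))"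
  unfolding norm_vec_def by (rule L2_set_le_sum) simp

text \<open>The parameter \<open>dt\<close> fixes the dimension, so that constants depending on it
  can be named inside the locale.\<close>

locale nsk_crit = nsk \<mu> \<nu> \<kappa> \<alpha> for \<mu> \<nu> \<kappa> \<alpha> +
  fixes p :: real and dt :: "'d::finite itself"
  assumes p2: "p > 2" and dim: "CARD('d) \<ge> 2" "real CARD('d) - 3 + 4 / p > 0"
begin

text \<open>The weight of the solution spaces for fixed time, and below it the weight of the
  quadratic terms. Their difference 2 - 2/p is the number of derivatives that the semigroup has to
  regain.\<close>

definition r1 :: real where "r1 = real CARD('d) - 1 + 2 / p"
definition r2 :: real where "r2 = real CARD('d) - 3 + 4 / p"

lemma p_facts: "0 < 2 / p" "2 / p < 1" "0 < 1 / p" "1 / p < 1 / 2" "4 / p = 2 * (2 / p)" "2 / p = 2 * (1 / p)"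
  using p2 by (auto simp: field_simps)

lemma r_facts: "0 < r1" "r1 < real CARD('d)" "0 < r2" "r2 < real CARD('d)" "r2 + 1 < real CARD('d)" "r1 - r2 = 2 - 2 / p"
  unfolding r1_def r2_def using p_facts(1,2,5) dim by linarith+

text \<open>The Fourier transform of the transport term, polarised: two separate arguments make
  differences of quadratic terms accessible.\<close>

definition Bf :: "(real^'d \<Rightarrow> 'd state) \<Rightarrow> (real^'d \<Rightarrow> 'd state) \<Rightarrow> real^'d \<Rightarrow> complex" where
  "Bf H H' \<xi> = - (\<Sum>i\<in>UNIV. fconv (\<lambda>\<eta>. snd (H \<eta>) $ i) (ixi i (\<lambda>\<eta>. fst (H' \<eta>))) \<xi>)"

definition Bg :: "'d \<Rightarrow> (real^'d \<Rightarrow> 'd state) \<Rightarrow> (real^'d \<Rightarrow> 'd state) \<Rightarrow> real^'d \<Rightarrow> complex" where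
  "Bg j H H' \<xi> =
     - (\<Sum>i\<in>UNIV. fconv (\<lambda>\<eta>. snd (H \<eta>) $ i) (ixi i (\<lambda>\<eta>. snd (H' \<eta>) $ j)) \<xi>)
     + of_real \<mu> * (\<Sum>i\<in>UNIV. fconv (ixi i (\<lambda>\<eta>. fst (H \<eta>))) (ixi i (\<lambda>\<eta>. snd (H' \<eta>) $ j)) \<xi>)
     + of_real (\<mu> + \<nu>) * (\<Sum>i\<in>UNIV. fconv (ixi i (\<lambda>\<eta>. fst (H \<eta>))) (ixi j (\<lambda>\<eta>. snd (H' \<eta>) $ i)) \<xi>)
     + of_real (\<kappa> / 2) * ixi j (\<lambda>\<zeta>. \<Sum>i\<in>UNIV. fconv (ixi i (\<lambda>\<eta>. fst (H \<eta>))) (ixi i (\<lambda>\<eta>. fst (H' \<eta>))) \<zeta>) \<xi>"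

definition B :: "(real^'d \<Rightarrow> 'd state) \<Rightarrow> (real^'d \<Rightarrow> 'd state) \<Rightarrow> real^'d \<Rightarrow> 'd state" where
  "B H H' \<xi> = (Bf H H' \<xi>, \<chi> j. Bg j H H' \<xi>)"

definition freq_bound :: "real \<Rightarrow> (real^'d \<Rightarrow> 'd state) \<Rightarrow> bool" where
  "freq_bound M H \<longleftrightarrow> 0 \<le> M \<and> H \<in> borel_measurable borel \<and> (AE \<xi> in lborel. qnorm \<xi> (H \<xi>) \<le> M * norm \<xi> powr - r1)"

lemma freq_bound_measurable:
  assumes "freq_bound M H"
  shows "H \<in> borel_measurable borel" "(\<lambda>\<eta>. fst (H \<eta>)) \<in> borel_measurable borel" "(\<lambda>\<eta>. snd (H \<eta>) $ i) \<in> borel_measurable borel"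
proof -
  show H[measurable]: "H \<in> borel_measurable borel" using assms by (simp add: freq_bound_def)
  show "(\<lambda>\<eta>. fst (H \<eta>)) \<in> borel_measurable borel"
    by (rule measurable_compose[OF H borel_measurable_continuous_onI]) (intro continuous_intros)
  show "(\<lambda>\<eta>. snd (H \<eta>) $ i) \<in> borel_measurable borel"
    by (rule measurable_compose[OF H borel_measurable_continuous_onI[where f = "\<lambda>z. snd z $ i"]]) (intro continuous_intros)
qed

lemma freq_bound_mono: "freq_bound M H \<Longrightarrow> M \<le> M' \<Longrightarrow> freq_bound M' H"
  unfolding freq_bound_def by (auto elim!: eventually_mono intro: order_trans[OF _ mult_right_mono])

lemma freq_bound_diff:
  assumes "freq_bound M H" "freq_bound M' H'" shows "freq_bound (M + M') (\<lambda>\<eta>. H \<eta> - H' \<eta>)"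
  unfolding freq_bound_def
proof (intro conjI)
  show "0 \<le> M + M'" using assms by (simp add: freq_bound_def)
  show "(\<lambda>\<eta>. H \<eta> - H' \<eta>) \<in> borel_measurable borel" using assms by (intro borel_measurable_diff) (auto simp: freq_bound_def)
  have "AE \<xi> in lborel. qnorm \<xi> (H \<xi>) \<le> M * norm \<xi> powr - r1" "AE \<xi> in lborel. qnorm \<xi> (H' \<xi>) \<le> M' * norm \<xi> powr - r1"
    using assms by (auto simp: freq_bound_def)
  then show "AE \<xi> in lborel. qnorm \<xi> (H \<xi> - H' \<xi>) \<le> (M + M') * norm \<xi> powr - r1"
  proof eventually_elim
    case (elim \<xi>)
    then show ?case using qnorm_diff[of \<xi> "H \<xi>" "H' \<xi>"] by (simp add: distrib_right)
  qed
qed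

text \<open>In Riesz form, order \<open>\<theta>a\<close> is the size |\<xi>|^-\<open>r1\<close> of
  the velocity and of the density gradient, and \<open>\<theta>b\<close> is the size after one more
  factor |\<xi>|.\<close>

abbreviation \<theta>a :: real where "\<theta>a \<equiv> 1 - 2 / p"
abbreviation \<theta>b :: real where "\<theta>b \<equiv> 2 - 2 / p"

lemma kernel_exponents: "\<theta>a - real CARD('d) = - r1" "\<theta>b - real CARD('d) = 1 + - r1" "\<theta>a + \<theta>b - real CARD('d) = - r2" "\<theta>a + \<theta>a - real CARD('d) = - (r2 + 1)"
  unfolding r1_def r2_def using p_facts(5) by linarith+

lemma powr_succ: "norm \<eta> * norm \<eta> powr a = norm \<eta> powr (1 + a)" for \<eta> :: "real^'d"
  by (cases "\<eta> = 0") (simp_all add: powr_add)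

text \<open>The density gradient occurs with two exponents: the weight |\<xi>| |b| in
  \<open>qnorm\<close> gives the order \<open>\<theta>a\<close>, and |b| alone gives the order
  \<open>\<theta>b\<close>. The quadratic terms choose between them.\<close>

lemma freq_bound_components:
  assumes "freq_bound M H"
  shows "AE \<eta> in lborel. cmod (snd (H \<eta>) $ i) \<le> M * norm \<eta> powr (\<theta>a - CARD('d))"
    "AE \<eta> in lborel. cmod (ixi i (\<lambda>\<eta>. fst (H \<eta>)) \<eta>) \<le> M * norm \<eta> powr (\<theta>a - CARD('d))"
    "AE \<eta> in lborel. cmod (ixi i (\<lambda>\<eta>. fst (H \<eta>)) \<eta>) \<le> M * norm \<eta> powr (\<theta>b - CARD('d))"
    "AE \<eta> in lborel. cmod (ixi i (\<lambda>\<eta>. snd (H \<eta>) $ j) \<eta>) \<le> M * norm \<eta> powr (\<theta>b - CARD('d))"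
    "AE \<eta> in lborel. cmod (fst (H \<eta>)) \<le> M * norm \<eta> powr - r1"
proof -
  have K: "AE \<eta> in lborel. qnorm \<eta> (H \<eta>) \<le> M * norm \<eta> powr - r1" using assms by (simp add: freq_bound_def)
  have s: "cmod (snd (H \<eta>) $ i) \<le> qnorm \<eta> (H \<eta>)" for \<eta> i
    by (rule order_trans[OF Finite_Cartesian_Product.norm_nth_le qnorm_snd])
  have f0: "cmod (fst (H \<eta>)) \<le> qnorm \<eta> (H \<eta>)" for \<eta>
    by (rule order_trans[OF _ qnorm_fst]) (simp add: mult_left_le distrib_right)
  have f1: "norm \<eta> * cmod (fst (H \<eta>)) \<le> qnorm \<eta> (H \<eta>)" for \<eta>
    by (rule order_trans[OF _ qnorm_fst]) (simp add: distrib_right)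
  show "AE \<eta> in lborel. cmod (snd (H \<eta>) $ i) \<le> M * norm \<eta> powr (\<theta>a - CARD('d))"
    using K unfolding kernel_exponents by eventually_elim (rule order_trans[OF s])
  show "AE \<eta> in lborel. cmod (fst (H \<eta>)) \<le> M * norm \<eta> powr - r1"
    using K by eventually_elim (rule order_trans[OF f0])
  show "AE \<eta> in lborel. cmod (ixi i (\<lambda>\<eta>. fst (H \<eta>)) \<eta>) \<le> M * norm \<eta> powr (\<theta>a - CARD('d))"
    using K unfolding kernel_exponents by eventually_elim (rule order_trans[OF order_trans[OF norm_ixi_le f1]])
  have up: "x \<le> norm \<eta> * y \<Longrightarrow> y \<le> M * norm \<eta> powr - r1 \<Longrightarrow> x \<le> M * norm \<eta> powr (1 + - r1)" for x y and \<eta> :: "real^'d"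
    unfolding powr_succ[symmetric] using mult_left_mono[of y "M * norm \<eta> powr - r1" "norm \<eta>"] by (simp add: mult.left_commute)
  show "AE \<eta> in lborel. cmod (ixi i (\<lambda>\<eta>. fst (H \<eta>)) \<eta>) \<le> M * norm \<eta> powr (\<theta>b - CARD('d))"
    using K unfolding kernel_exponents by eventually_elim (rule up[OF norm_ixi_le order_trans[OF f0]])
  show "AE \<eta> in lborel. cmod (ixi i (\<lambda>\<eta>. snd (H \<eta>) $ j) \<eta>) \<le> M * norm \<eta> powr (\<theta>b - CARD('d))"
    using K unfolding kernel_exponents by eventually_elim (rule up[OF norm_ixi_le order_trans[OF s]])
qed

text \<open>Chosen once for both pairs of orders that occur in the nonlinearity.\<close>

definition cC :: real where
  "cC = (SOME C. 0 \<le> C \<and> conv_bound TYPE('d) \<theta>a \<theta>b C \<and> conv_bound TYPE('d) \<theta>a \<theta>a C)"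

lemma cC: "0 \<le> cC" "conv_bound TYPE('d) \<theta>a \<theta>b cC" "conv_bound TYPE('d) \<theta>a \<theta>a cC"
proof -
  have t: "0 < \<theta>a" "0 < \<theta>b" "\<theta>a + \<theta>b < CARD('d)" "\<theta>a + \<theta>a < CARD('d)" using p_facts(1,2,5) dim by linarith+
  obtain C1 where C1: "C1 \<ge> 0" "conv_bound TYPE('d) \<theta>a \<theta>b C1" using fconv_estimate[OF t(1,2,3)] by blast
  obtain C2 where C2: "C2 \<ge> 0" "conv_bound TYPE('d) \<theta>a \<theta>a C2" using fconv_estimate[OF t(1,1,4)] by blast
  have "\<exists>C. 0 \<le> C \<and> conv_bound TYPE('d) \<theta>a \<theta>b C \<and> conv_bound TYPE('d) \<theta>a \<theta>a C"
    using C1 C2 by (intro exI[of _ "C1 + C2"]) (auto intro: conv_bound_mono)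
  from someI_ex[OF this] show "0 \<le> cC" "conv_bound TYPE('d) \<theta>a \<theta>b cC" "conv_bound TYPE('d) \<theta>a \<theta>a cC"
    unfolding cC_def by blast+
qed

context
  fixes M M' :: real and H H' :: "real^'d \<Rightarrow> 'd state"
  assumes K: "freq_bound M H" "freq_bound M' H'"
begin

lemma M_nonneg: "0 \<le> M" "0 \<le> M'" using K by (auto simp: freq_bound_def)

text \<open>Two kinds of bound. The pair (\<open>\<theta>a\<close>, \<open>\<theta>b\<close>) gives
  |\<xi>|^-\<open>r2\<close>. The pair (\<open>\<theta>a\<close>, \<open>\<theta>a\<close>) gives
  one power more, for the terms that meet a further factor |\<xi>|: the transport term in the weight
  of the density, and the square of the density gradient under its outer gradient.\<close>

lemma conv_terms:
  assumes "\<xi> \<noteq> 0"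
  shows "integrable lborel (\<lambda>\<eta>. snd (H (\<xi> - \<eta>)) $ i * ixi i (\<lambda>\<eta>. fst (H' \<eta>)) \<eta>)"
    "cmod (fconv (\<lambda>\<eta>. snd (H \<eta>) $ i) (ixi i (\<lambda>\<eta>. fst (H' \<eta>))) \<xi>) \<le> cC * M * M' * norm \<xi> powr - r2"
    "cmod (fconv (\<lambda>\<eta>. snd (H \<eta>) $ i) (ixi i (\<lambda>\<eta>. fst (H' \<eta>))) \<xi>) \<le> cC * M * M' * norm \<xi> powr - (r2 + 1)"
    "integrable lborel (\<lambda>\<eta>. snd (H (\<xi> - \<eta>)) $ i * ixi i (\<lambda>\<eta>. snd (H' \<eta>) $ j) \<eta>)"
    "cmod (fconv (\<lambda>\<eta>. snd (H \<eta>) $ i) (ixi i (\<lambda>\<eta>. snd (H' \<eta>) $ j)) \<xi>) \<le> cC * M * M' * norm \<xi> powr - r2"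
    "integrable lborel (\<lambda>\<eta>. ixi i (\<lambda>\<eta>. fst (H \<eta>)) (\<xi> - \<eta>) * ixi k (\<lambda>\<eta>. snd (H' \<eta>) $ j) \<eta>)"
    "cmod (fconv (ixi i (\<lambda>\<eta>. fst (H \<eta>))) (ixi k (\<lambda>\<eta>. snd (H' \<eta>) $ j)) \<xi>) \<le> cC * M * M' * norm \<xi> powr - r2"
    "integrable lborel (\<lambda>\<eta>. ixi i (\<lambda>\<eta>. fst (H \<eta>)) (\<xi> - \<eta>) * ixi i (\<lambda>\<eta>. fst (H' \<eta>)) \<eta>)"
    "cmod (fconv (ixi i (\<lambda>\<eta>. fst (H \<eta>))) (ixi i (\<lambda>\<eta>. fst (H' \<eta>))) \<xi>) \<le> cC * M * M' * norm \<xi> powr - (r2 + 1)"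
proof -
  note m = freq_bound_measurable[OF K(1)] freq_bound_measurable[OF K(2)] ixi_measurable
  note c = freq_bound_components[OF K(1)] freq_bound_components[OF K(2)]
  note D1 = conv_boundD[OF cC(2) _ _ M_nonneg _ _ assms] and D2 = conv_boundD[OF cC(3) _ _ M_nonneg _ _ assms]
  show "integrable lborel (\<lambda>\<eta>. snd (H (\<xi> - \<eta>)) $ i * ixi i (\<lambda>\<eta>. fst (H' \<eta>)) \<eta>)"
    by (rule D1(1)) (intro m c)+
  show "cmod (fconv (\<lambda>\<eta>. snd (H \<eta>) $ i) (ixi i (\<lambda>\<eta>. fst (H' \<eta>))) \<xi>) \<le> cC * M * M' * norm \<xi> powr - r2"
    unfolding kernel_exponents(3)[symmetric] by (rule D1(2)) (intro m c)+
  show "cmod (fconv (\<lambda>\<eta>. snd (H \<eta>) $ i) (ixi i (\<lambda>\<eta>. fst (H' \<eta>))) \<xi>) \<le> cC * M * M' * norm \<xi> powr - (r2 + 1)"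
    unfolding kernel_exponents(4)[symmetric] by (rule D2(2)) (intro m c)+
  show "integrable lborel (\<lambda>\<eta>. snd (H (\<xi> - \<eta>)) $ i * ixi i (\<lambda>\<eta>. snd (H' \<eta>) $ j) \<eta>)"
    by (rule D1(1)) (intro m c)+
  show "cmod (fconv (\<lambda>\<eta>. snd (H \<eta>) $ i) (ixi i (\<lambda>\<eta>. snd (H' \<eta>) $ j)) \<xi>) \<le> cC * M * M' * norm \<xi> powr - r2"
    unfolding kernel_exponents(3)[symmetric] by (rule D1(2)) (intro m c)+
  show "integrable lborel (\<lambda>\<eta>. ixi i (\<lambda>\<eta>. fst (H \<eta>)) (\<xi> - \<eta>) * ixi k (\<lambda>\<eta>. snd (H' \<eta>) $ j) \<eta>)"
    by (rule D1(1)) (intro m c)+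
  show "cmod (fconv (ixi i (\<lambda>\<eta>. fst (H \<eta>))) (ixi k (\<lambda>\<eta>. snd (H' \<eta>) $ j)) \<xi>) \<le> cC * M * M' * norm \<xi> powr - r2"
    unfolding kernel_exponents(3)[symmetric] by (rule D1(2)) (intro m c)+
  show "integrable lborel (\<lambda>\<eta>. ixi i (\<lambda>\<eta>. fst (H \<eta>)) (\<xi> - \<eta>) * ixi i (\<lambda>\<eta>. fst (H' \<eta>)) \<eta>)"
    by (rule D1(1)) (intro m c)+
  show "cmod (fconv (ixi i (\<lambda>\<eta>. fst (H \<eta>))) (ixi i (\<lambda>\<eta>. fst (H' \<eta>))) \<xi>) \<le> cC * M * M' * norm \<xi> powr - (r2 + 1)"
    unfolding kernel_exponents(4)[symmetric] by (rule D2(2)) (intro m c)+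
qed

end

text \<open>Every term is a sum over d indices. The 2 counts the density component with its weights
  1 and |\<xi>|; the rest counts d velocity components, each with the coefficients of the four terms
  of g.\<close>

definition cB :: real where
  "cB = real CARD('d) * cC * (2 + real CARD('d) * (1 + \<mu> + (\<mu> + \<nu>) + \<kappa> / 2))"

lemma cB_nonneg: "0 \<le> cB"
proof -
  have "0 \<le> 1 + \<mu> + (\<mu> + \<nu>) + \<kappa> / 2" using pos by linarith
  then show ?thesis unfolding cB_def using cC(1) by (intro mult_nonneg_nonneg add_nonneg_nonneg[of 2]) auto
qed

lemma sum_norm_bound: "(\<And>i. cmod (f i) \<le> X) \<Longrightarrow> cmod (\<Sum>i\<in>(UNIV :: 'd set). f i) \<le> real CARD('d) * X"
  by (rule order_trans[OF norm_sum]) (use sum_bounded_above[of "UNIV :: 'd set" "\<lambda>i. cmod (f i)" X] in simp)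

lemma B_estimate:
  assumes K: "freq_bound M H" "freq_bound M' H'" and \<xi>: "\<xi> \<noteq> 0"
  shows "qnorm \<xi> (B H H' \<xi>) \<le> cB * M * M' * norm \<xi> powr - r2"
proof -
  note T = conv_terms[OF K \<xi>]
  define X where "X = real CARD('d) * (cC * M * M' * norm \<xi> powr - r2)"
  have X: "0 \<le> X" unfolding X_def using cC(1) M_nonneg[OF K] by (intro mult_nonneg_nonneg) auto
  have e: "norm \<xi> * norm \<xi> powr - (r2 + 1) = norm \<xi> powr - r2" using powr_succ[of \<xi> "- (r2 + 1)"] by simp
  have f0: "cmod (Bf H H' \<xi>) \<le> X"
    unfolding Bf_def norm_minus_cancel X_def by (rule sum_norm_bound[OF T(2)])
  have "cmod (Bf H H' \<xi>) \<le> real CARD('d) * (cC * M * M' * norm \<xi> powr - (r2 + 1))"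
    unfolding Bf_def norm_minus_cancel by (rule sum_norm_bound[OF T(3)])
  then have "norm \<xi> * cmod (Bf H H' \<xi>) \<le> norm \<xi> * (real CARD('d) * (cC * M * M' * norm \<xi> powr - (r2 + 1)))"
    by (rule mult_left_mono) simp
  also have "\<dots> = real CARD('d) * (cC * M * M' * (norm \<xi> * norm \<xi> powr - (r2 + 1)))" by (simp only: mult_ac)
  finally have f1: "norm \<xi> * cmod (Bf H H' \<xi>) \<le> X" unfolding e X_def .
  have g: "cmod (Bg j H H' \<xi>) \<le> (1 + \<mu> + (\<mu> + \<nu>) + \<kappa> / 2) * X" for j
  proof -
    let ?a = "\<Sum>i\<in>UNIV. fconv (\<lambda>\<eta>. snd (H \<eta>) $ i) (ixi i (\<lambda>\<eta>. snd (H' \<eta>) $ j)) \<xi>"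
    let ?b = "\<Sum>i\<in>UNIV. fconv (ixi i (\<lambda>\<eta>. fst (H \<eta>))) (ixi i (\<lambda>\<eta>. snd (H' \<eta>) $ j)) \<xi>"
    let ?c = "\<Sum>i\<in>UNIV. fconv (ixi i (\<lambda>\<eta>. fst (H \<eta>))) (ixi j (\<lambda>\<eta>. snd (H' \<eta>) $ i)) \<xi>"
    let ?e = "\<lambda>\<zeta>. \<Sum>i\<in>UNIV. fconv (ixi i (\<lambda>\<eta>. fst (H \<eta>))) (ixi i (\<lambda>\<eta>. fst (H' \<eta>))) \<zeta>"
    have a: "cmod ?a \<le> X" unfolding X_def by (rule sum_norm_bound[OF T(5)])
    have b: "cmod ?b \<le> X" unfolding X_def by (rule sum_norm_bound[OF T(7)])
    have c: "cmod ?c \<le> X" unfolding X_def by (rule sum_norm_bound[OF T(7)])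
    have "cmod (?e \<xi>) \<le> real CARD('d) * (cC * M * M' * norm \<xi> powr - (r2 + 1))" by (rule sum_norm_bound[OF T(9)])
    then have "norm \<xi> * cmod (?e \<xi>) \<le> norm \<xi> * (real CARD('d) * (cC * M * M' * norm \<xi> powr - (r2 + 1)))"
      by (rule mult_left_mono) simp
    also have "\<dots> = real CARD('d) * (cC * M * M' * (norm \<xi> * norm \<xi> powr - (r2 + 1)))" by (simp only: mult_ac)
    finally have "norm \<xi> * cmod (?e \<xi>) \<le> X" unfolding e X_def .
    with norm_ixi_le[of j ?e \<xi>] have ee: "cmod (ixi j ?e \<xi>) \<le> X" by (rule order_trans)
    have "cmod (Bg j H H' \<xi>) \<le> cmod ?a + cmod (of_real \<mu> * ?b) + cmod (of_real (\<mu> + \<nu>) * ?c) + cmod (of_real (\<kappa> / 2) * ixi j ?e \<xi>)"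
      unfolding Bg_def by (intro order_trans[OF norm_triangle_ineq] add_mono order_refl) simp
    also have "\<dots> = cmod ?a + \<mu> * cmod ?b + (\<mu> + \<nu>) * cmod ?c + \<kappa> / 2 * cmod (ixi j ?e \<xi>)"
      unfolding norm_mult norm_of_real using pos by simp
    also have "\<dots> \<le> X + \<mu> * X + (\<mu> + \<nu>) * X + \<kappa> / 2 * X"
      using pos by (intro add_mono mult_left_mono a b c ee) auto
    finally show ?thesis by (simp add: algebra_simps)
  qed
  have "norm (snd (B H H' \<xi>)) \<le> (\<Sum>j\<in>UNIV. cmod (snd (B H H' \<xi>) $ j))" by (rule norm_vec_le_sum)
  also have "\<dots> \<le> real CARD('d) * ((1 + \<mu> + (\<mu> + \<nu>) + \<kappa> / 2) * X)"
    using sum_bounded_above[of "UNIV :: 'd set" "\<lambda>j. cmod (Bg j H H' \<xi>)", OF g] by (simp add: B_def)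
  finally have "qnorm \<xi> (B H H' \<xi>) \<le> (X + X) + real CARD('d) * ((1 + \<mu> + (\<mu> + \<nu>) + \<kappa> / 2) * X)"
    unfolding qnorm_def using f0 f1 by (simp add: B_def distrib_right)
  also have "\<dots> = cB * M * M' * norm \<xi> powr - r2" by (simp add: cB_def X_def algebra_simps)
  finally show ?thesis .
qed

text \<open>B(H, H) - B(H', H') = B(H - H', H) + B(H', H - H'), as for any bilinear form. Linearity
  of the convolution integrals needs the pairs (H, H), (H', H) and (H', H') to converge at \<xi>,
  which \<open>conv_terms\<close> provides away from the origin.\<close>

lemma B_split:
  assumes K: "freq_bound M H" "freq_bound M' H'" and \<xi>: "\<xi> \<noteq> 0"
  shows "B H H \<xi> - B H' H' \<xi> = B (\<lambda>\<eta>. H \<eta> - H' \<eta>) H \<xi> + B H' (\<lambda>\<eta>. H \<eta> - H' \<eta>) \<xi>"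
proof -
  note T1 = conv_terms[OF K(1,1) \<xi>] and T2 = conv_terms[OF K(2,1) \<xi>] and T3 = conv_terms[OF K(2,2) \<xi>]
  note s1 = fconv_split[where \<xi> = \<xi>, OF T1(1) T2(1) T3(1)]
  note s2 = fconv_split[where \<xi> = \<xi>, OF T1(4) T2(4) T3(4)]
  note s3 = fconv_split[where \<xi> = \<xi>, OF T1(6) T2(6) T3(6)]
  note s4 = fconv_split[where \<xi> = \<xi>, OF T1(8) T2(8) T3(8)]
  have f: "Bf H H \<xi> - Bf H' H' \<xi> = Bf (\<lambda>\<eta>. H \<eta> - H' \<eta>) H \<xi> + Bf H' (\<lambda>\<eta>. H \<eta> - H' \<eta>) \<xi>"
  proof -
    have "Bf H H \<xi> - Bf H' H' \<xi> = - (\<Sum>i\<in>UNIV. fconv (\<lambda>\<eta>. snd (H \<eta>) $ i) (ixi i (\<lambda>\<eta>. fst (H \<eta>))) \<xi> - fconv (\<lambda>\<eta>. snd (H' \<eta>) $ i) (ixi i (\<lambda>\<eta>. fst (H' \<eta>))) \<xi>)"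
      unfolding Bf_def sum_subtractf by simp
    also have "\<dots> = Bf (\<lambda>\<eta>. H \<eta> - H' \<eta>) H \<xi> + Bf H' (\<lambda>\<eta>. H \<eta> - H' \<eta>) \<xi>"
      unfolding s1 Bf_def sum.distrib fst_diff snd_diff vector_minus_component ixi_diff by simp
    finally show ?thesis .
  qed
  have g: "Bg j H H \<xi> - Bg j H' H' \<xi> = Bg j (\<lambda>\<eta>. H \<eta> - H' \<eta>) H \<xi> + Bg j H' (\<lambda>\<eta>. H \<eta> - H' \<eta>) \<xi>" for j
  proof -
    have "Bg j H H \<xi> - Bg j H' H' \<xi> =
     - (\<Sum>i\<in>UNIV. fconv (\<lambda>\<eta>. snd (H \<eta>) $ i) (ixi i (\<lambda>\<eta>. snd (H \<eta>) $ j)) \<xi> - fconv (\<lambda>\<eta>. snd (H' \<eta>) $ i) (ixi i (\<lambda>\<eta>. snd (H' \<eta>) $ j)) \<xi>)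
     + of_real \<mu> * (\<Sum>i\<in>UNIV. fconv (ixi i (\<lambda>\<eta>. fst (H \<eta>))) (ixi i (\<lambda>\<eta>. snd (H \<eta>) $ j)) \<xi> - fconv (ixi i (\<lambda>\<eta>. fst (H' \<eta>))) (ixi i (\<lambda>\<eta>. snd (H' \<eta>) $ j)) \<xi>)
     + of_real (\<mu> + \<nu>) * (\<Sum>i\<in>UNIV. fconv (ixi i (\<lambda>\<eta>. fst (H \<eta>))) (ixi j (\<lambda>\<eta>. snd (H \<eta>) $ i)) \<xi> - fconv (ixi i (\<lambda>\<eta>. fst (H' \<eta>))) (ixi j (\<lambda>\<eta>. snd (H' \<eta>) $ i)) \<xi>)
     + of_real (\<kappa> / 2) * (\<i> * (of_real (\<xi> $ j) * (\<Sum>i\<in>UNIV. fconv (ixi i (\<lambda>\<eta>. fst (H \<eta>))) (ixi i (\<lambda>\<eta>. fst (H \<eta>))) \<xi> - fconv (ixi i (\<lambda>\<eta>. fst (H' \<eta>))) (ixi i (\<lambda>\<eta>. fst (H' \<eta>))) \<xi>)))"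
      unfolding Bg_def ixi_sum sum_subtractf right_diff_distrib by (simp add: algebra_simps)
    also have "\<dots> = Bg j (\<lambda>\<eta>. H \<eta> - H' \<eta>) H \<xi> + Bg j H' (\<lambda>\<eta>. H \<eta> - H' \<eta>) \<xi>"
      unfolding s2 s3 s4 Bg_def ixi_sum sum.distrib fst_diff snd_diff vector_minus_component ixi_diff distrib_left
      by (simp add: algebra_simps)
    finally show ?thesis .
  qed
  show ?thesis unfolding B_def by (simp add: prod_eq_iff vec_eq_iff f g)
qed

lemma B_lipschitz:
  assumes K: "freq_bound M H" "freq_bound M H'" "freq_bound D (\<lambda>\<eta>. H \<eta> - H' \<eta>)" and \<xi>: "\<xi> \<noteq> 0"
  shows "qnorm \<xi> (B H H \<xi> - B H' H' \<xi>) \<le> 2 * cB * M * D * norm \<xi> powr - r2"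
  unfolding B_split[OF K(1,2) \<xi>]
  using qnorm_triangle[of \<xi> "B (\<lambda>\<eta>. H \<eta> - H' \<eta>) H \<xi>" "B H' (\<lambda>\<eta>. H \<eta> - H' \<eta>) \<xi>"] B_estimate[OF K(3,1) \<xi>] B_estimate[OF K(2,3) \<xi>]
  by (simp add: algebra_simps)

end

section \<open>From the bilinear form back to distributions\<close>

lemma has_fourier_fun_uminus:
  assumes "has_fourier_fun T h" "tame h"
  shows "has_fourier_fun (\<lambda>\<phi>. - T \<phi>) (\<lambda>\<xi>. - h \<xi>)"
  using has_fourier_fun_cmult[OF assms, of "-1"] by simp

context nsk
begin

lemma sg_component_measurable:
  assumes "h \<in> borel_measurable borel"
  shows "(\<lambda>\<xi>. fst (sg t \<xi> (h \<xi>))) \<in> borel_measurable borel" "(\<lambda>\<xi>. snd (sg t \<xi> (h \<xi>)) $ j) \<in> borel_measurable borel"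
proof -
  have m: "(\<lambda>\<xi>. sg t \<xi> (h \<xi>)) \<in> borel_measurable borel" by (intro sg_measurable assms) auto
  show "(\<lambda>\<xi>. fst (sg t \<xi> (h \<xi>))) \<in> borel_measurable borel"
    by (rule measurable_compose[OF m borel_measurable_continuous_onI]) (intro continuous_intros)
  show "(\<lambda>\<xi>. snd (sg t \<xi> (h \<xi>)) $ j) \<in> borel_measurable borel"
    by (rule measurable_compose[OF m borel_measurable_continuous_onI[where f = "\<lambda>z. snd z $ j"]]) (intro continuous_intros)
qed

text \<open>The semigroup is defined through chosen representatives; it acts on each frequency
  separately, so any other measurable representative gives the same distributions.\<close>

lemma nsk_semigroup_eq:
  fixes h :: "real^'d::finite \<Rightarrow> 'd state"
  assumes h: "h \<in> borel_measurable borel" and b: "has_fourier_fun b (\<lambda>\<xi>. fst (h \<xi>))" and w: "\<And>j. has_fourier_fun (w $ j) (\<lambda>\<xi>. snd (h \<xi>) $ j)"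
  shows "nsk_semigroup \<mu> \<nu> \<kappa> \<alpha> t (b, w) = (dist_with_fourier (\<lambda>\<xi>. fst (sg t \<xi> (h \<xi>))), \<chi> j. dist_with_fourier (\<lambda>\<xi>. snd (sg t \<xi> (h \<xi>)) $ j))"
proof -
  define k where "k \<xi> = (fourier_fun b \<xi>, fourier_fun_vec w \<xi>)" for \<xi>
  have km: "k \<in> borel_measurable borel" unfolding k_def fourier_fun_vec_def
    by (intro borel_measurable_Pair vec_lambda_measurable has_fourier_fun_measurable[OF fourier_fun_AE(2)[OF b]] has_fourier_fun_measurable[OF fourier_fun_AE(2)[OF w]])
  have "AE \<xi> in lborel. \<forall>j\<in>UNIV. fourier_fun (w $ j) \<xi> = snd (h \<xi>) $ j"
    by (rule AE_finite_allI) (auto intro: fourier_fun_AE(1) w)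
  with fourier_fun_AE(1)[OF b] have kh: "AE \<xi> in lborel. k \<xi> = h \<xi>"
    by eventually_elim (auto simp: k_def fourier_fun_vec_def prod_eq_iff vec_eq_iff)
  have "dist_with_fourier (\<lambda>\<xi>. fst (sg t \<xi> (k \<xi>))) = dist_with_fourier (\<lambda>\<xi>. fst (sg t \<xi> (h \<xi>)))"
    by (rule dist_with_fourier_cong_AE) (use kh in \<open>auto intro!: sg_component_measurable km h elim: eventually_mono\<close>)
  moreover have "dist_with_fourier (\<lambda>\<xi>. snd (sg t \<xi> (k \<xi>)) $ j) = dist_with_fourier (\<lambda>\<xi>. snd (sg t \<xi> (h \<xi>)) $ j)" for j
    by (rule dist_with_fourier_cong_AE) (use kh in \<open>auto intro!: sg_component_measurable km h elim: eventually_mono\<close>)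
  ultimately show ?thesis by (simp add: nsk_semigroup_def Let_def k_def)
qed

end

context nsk_crit
begin

definition fourier_pair :: "'d dist \<Rightarrow> 'd dist ^ 'd \<Rightarrow> (real^'d \<Rightarrow> 'd state) \<Rightarrow> bool" where
  "fourier_pair a u H \<longleftrightarrow> has_fourier_fun a (\<lambda>\<xi>. fst (H \<xi>)) \<and> (\<forall>j. has_fourier_fun (u $ j) (\<lambda>\<xi>. snd (H \<xi>) $ j))"

lemma freq_bound_tame:
  assumes "freq_bound M H" shows "tame (\<lambda>\<xi>. fst (H \<xi>))" "tame (\<lambda>\<xi>. snd (H \<xi>) $ j)"
proof -
  show "tame (\<lambda>\<xi>. fst (H \<xi>))"
    by (rule tame_power_bound[OF freq_bound_measurable(2)[OF assms] freq_bound_components(5)[OF assms]]) (use r_facts in auto)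
  show "tame (\<lambda>\<xi>. snd (H \<xi>) $ j)"
    by (rule tame_power_bound[OF freq_bound_measurable(3)[OF assms] freq_bound_components(1)[OF assms, unfolded kernel_exponents]]) (use r_facts in auto)
qed

lemma tame_of_bound:
  assumes "h \<in> borel_measurable borel" "\<And>\<xi>. \<xi> \<noteq> 0 \<Longrightarrow> cmod (h \<xi>) \<le> C * norm \<xi> powr - r" "0 \<le> r" "r < real CARD('d)"
  shows "tame (h :: real^'d \<Rightarrow> complex)"
proof (rule tame_power_bound[OF assms(1) _ assms(3,4)])
  show "AE \<xi> in lborel. cmod (h \<xi>) \<le> C * norm \<xi> powr - r"
    using AE_lborel_singleton[of 0] by eventually_elim (rule assms(2))
qed

text \<open>Identifies the nonlinearity of the system with the bilinear form. The convolution bounds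
  make every product tame, which is what allows derivatives and products of distributions to be
  computed on the Fourier side.\<close>

lemma nsk_terms_fourier:
  assumes K: "freq_bound M H" and au: "fourier_pair a u H"
  shows "has_fourier_fun (nsk_f u a) (\<lambda>\<xi>. fst (B H H \<xi>))" "has_fourier_fun (nsk_g \<mu> \<nu> \<kappa> u a $ j) (\<lambda>\<xi>. snd (B H H \<xi>) $ j)"
proof -
  note m = freq_bound_measurable[OF K]
  note T = conv_terms[OF K K]
  have a: "has_fourier_fun a (\<lambda>\<xi>. fst (H \<xi>))" and u: "has_fourier_fun (u $ i) (\<lambda>\<xi>. snd (H \<xi>) $ i)" for i
    using au by (auto simp: fourier_pair_def)
  have da: "has_fourier_fun (dist_partial i a) (ixi i (\<lambda>\<xi>. fst (H \<xi>)))" for i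
    unfolding ixi_def[abs_def] by (rule has_fourier_fun_partial[OF a freq_bound_tame(1)[OF K]])
  have du: "has_fourier_fun (dist_partial i (u $ k)) (ixi i (\<lambda>\<xi>. snd (H \<xi>) $ k))" for i k
    unfolding ixi_def[abs_def] by (rule has_fourier_fun_partial[OF u freq_bound_tame(2)[OF K]])
  have t1: "tame (fconv (\<lambda>\<eta>. snd (H \<eta>) $ i) (ixi i (\<lambda>\<eta>. fst (H \<eta>))))" for i
    by (rule tame_of_bound[OF _ T(2)]) (use r_facts m in auto)
  have t2: "tame (fconv (\<lambda>\<eta>. snd (H \<eta>) $ i) (ixi i (\<lambda>\<eta>. snd (H \<eta>) $ k)))" for i k
    by (rule tame_of_bound[OF _ T(5)]) (use r_facts m in auto)
  have t3: "tame (fconv (ixi i (\<lambda>\<eta>. fst (H \<eta>))) (ixi l (\<lambda>\<eta>. snd (H \<eta>) $ k)))" for i l k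
    by (rule tame_of_bound[OF _ T(7)]) (use r_facts m in auto)
  have t4: "tame (fconv (ixi i (\<lambda>\<eta>. fst (H \<eta>))) (ixi i (\<lambda>\<eta>. fst (H \<eta>))))" for i
    by (rule tame_of_bound[OF _ T(9)]) (use r_facts m in auto)
  have "has_fourier_fun (nsk_f u a) (Bf H H)"
    unfolding nsk_f_def Bf_def[abs_def]
    by (intro has_fourier_fun_uminus has_fourier_fun_sum has_fourier_fun_prod u da t1 tame_sum)
  then show "has_fourier_fun (nsk_f u a) (\<lambda>\<xi>. fst (B H H \<xi>))" by (simp add: B_def)
  have dsum: "has_fourier_fun (dist_partial j (\<lambda>\<psi>. \<Sum>i\<in>UNIV. dist_prod (dist_partial i a) (dist_partial i a) \<psi>))
      (ixi j (\<lambda>\<zeta>. \<Sum>i\<in>UNIV. fconv (ixi i (\<lambda>\<eta>. fst (H \<eta>))) (ixi i (\<lambda>\<eta>. fst (H \<eta>))) \<zeta>))"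
    unfolding ixi_def[of j, abs_def]
    by (rule has_fourier_fun_partial) (intro has_fourier_fun_sum has_fourier_fun_prod da t4 tame_sum)+
  have tsum: "tame (ixi j (\<lambda>\<zeta>. \<Sum>i\<in>UNIV. fconv (ixi i (\<lambda>\<eta>. fst (H \<eta>))) (ixi i (\<lambda>\<eta>. fst (H \<eta>))) \<zeta>))"
    unfolding ixi_def[of j, abs_def] by (intro tame_cmult tame_coord tame_sum t4)
  have tneg: "tame (\<lambda>\<xi>. - (\<Sum>i\<in>UNIV. fconv (\<lambda>\<eta>. snd (H \<eta>) $ i) (ixi i (\<lambda>\<eta>. snd (H \<eta>) $ j)) \<xi>))"
    using tame_cmult[OF tame_sum[OF t2], where c = "-1"] by simp
  have "has_fourier_fun (nsk_g \<mu> \<nu> \<kappa> u a $ j) (Bg j H H)"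
    unfolding nsk_g_def Bg_def[abs_def] vec_lambda_beta
    by (intro has_fourier_fun_add has_fourier_fun_uminus has_fourier_fun_cmult has_fourier_fun_sum has_fourier_fun_prod
        u da du dsum t2 t3 tneg tsum tame_sum tame_cmult tame_add)
  then show "has_fourier_fun (nsk_g \<mu> \<nu> \<kappa> u a $ j) (\<lambda>\<xi>. snd (B H H \<xi>) $ j)" by (simp add: B_def)
qed

text \<open>For curves, both factors and the frequency depend on a parameter such as (t, \<xi>);
  measurability in it follows from that of parametrised integrals.\<close>

lemma fconv_param_measurable:
  assumes g: "case_prod g \<in> borel_measurable (M \<Otimes>\<^sub>M borel)" and h: "case_prod h \<in> borel_measurable (M \<Otimes>\<^sub>M borel)"
    and z: "\<zeta> \<in> borel_measurable M"
  shows "(\<lambda>x. fconv (g x) (h x) (\<zeta> x :: real^'d)) \<in> borel_measurable M"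
proof -
  have z': "(\<lambda>y. \<zeta> (fst y) - snd y) \<in> borel_measurable (M \<Otimes>\<^sub>M borel)"
    using z by measurable
  have "(\<lambda>y. (fst y, \<zeta> (fst y) - snd y)) \<in> (M \<Otimes>\<^sub>M borel) \<rightarrow>\<^sub>M (M \<Otimes>\<^sub>M borel)"
    by (intro measurable_Pair measurable_fst z')
  from measurable_compose[OF this g] have "(\<lambda>y. g (fst y) (\<zeta> (fst y) - snd y)) \<in> borel_measurable (M \<Otimes>\<^sub>M borel)" by simp
  moreover have "(\<lambda>y. h (fst y) (snd y)) \<in> borel_measurable (M \<Otimes>\<^sub>M borel)" using h by (simp add: case_prod_beta')
  ultimately have "(\<lambda>y. g (fst y) (\<zeta> (fst y) - snd y) * h (fst y) (snd y)) \<in> borel_measurable (M \<Otimes>\<^sub>M borel)"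
    by (rule borel_measurable_times)
  then have "case_prod (\<lambda>x \<eta>. g x (\<zeta> x - \<eta>) * h x \<eta>) \<in> borel_measurable (M \<Otimes>\<^sub>M lborel)"
    by (simp add: case_prod_beta' cong: measurable_cong_sets)
  then have "(\<lambda>x. \<integral>\<eta>. g x (\<zeta> x - \<eta>) * h x \<eta> \<partial>lborel) \<in> borel_measurable M"
    by (rule lborel.borel_measurable_lebesgue_integral)
  then show ?thesis unfolding fconv_def by measurable
qed

lemma B_param_measurable:
  assumes H: "case_prod H \<in> borel_measurable (M \<Otimes>\<^sub>M borel)" and z: "\<zeta> \<in> borel_measurable M"
  shows "(\<lambda>x. B (H x) (H x) (\<zeta> x)) \<in> borel_measurable M"
proof -
  have f: "case_prod (\<lambda>x \<eta>. fst (H x \<eta>)) \<in> borel_measurable (M \<Otimes>\<^sub>M borel)"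
    using measurable_compose[OF H borel_measurable_continuous_onI[where f = fst]] by (simp add: case_prod_beta' continuous_on_fst continuous_on_id)
  have s: "case_prod (\<lambda>x \<eta>. snd (H x \<eta>) $ i) \<in> borel_measurable (M \<Otimes>\<^sub>M borel)" for i
    using measurable_compose[OF H borel_measurable_continuous_onI[where f = "\<lambda>z. snd z $ i"]]
    by (simp add: case_prod_beta' continuous_on_snd continuous_on_component continuous_on_id)
  have ix: "case_prod (\<lambda>x. ixi i (F x)) \<in> borel_measurable (M \<Otimes>\<^sub>M borel)" if F: "case_prod F \<in> borel_measurable (M \<Otimes>\<^sub>M borel)" for i F
  proof -
    have [measurable]: "(\<lambda>y. F (fst y) (snd y)) \<in> borel_measurable (M \<Otimes>\<^sub>M borel)" using F by (simp add: case_prod_beta')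
    show ?thesis unfolding ixi_def case_prod_beta' by measurable
  qed
  have zj: "(\<lambda>x. complex_of_real (\<zeta> x $ j)) \<in> borel_measurable M" for j using z by measurable
  have Bf: "(\<lambda>x. Bf (H x) (H x) (\<zeta> x)) \<in> borel_measurable M"
    unfolding Bf_def by (intro borel_measurable_uminus borel_measurable_sum fconv_param_measurable f s ix z)
  have Bg: "(\<lambda>x. Bg j (H x) (H x) (\<zeta> x)) \<in> borel_measurable M" for j
    unfolding Bg_def ixi_sum
    by (intro borel_measurable_add borel_measurable_times borel_measurable_const zj borel_measurable_uminus borel_measurable_sum fconv_param_measurable f s ix z)
  show ?thesis unfolding B_def by (intro borel_measurable_Pair vec_lambda_measurable Bf Bg)
qed

section \<open>Duhamel estimates\<close>

text \<open>The smoothing constant for the gap \<open>r1 - r2\<close> = 2 - 2/p.\<close>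

definition cS :: real where
  "cS = (SOME C. C > 0 \<and> (\<forall>\<xi> :: real^'d. \<forall>z. \<forall>t>0. norm \<xi> powr (2 - 2 / p) * qnorm \<xi> (sg t \<xi> z) \<le> C * t powr (- ((2 - 2 / p) / 2)) * qnorm \<xi> z))"

lemma cS: "cS > 0" "\<And>\<xi> :: real^'d. \<And>z t. t > 0 \<Longrightarrow> norm \<xi> powr (2 - 2 / p) * qnorm \<xi> (sg t \<xi> z) \<le> cS * t powr (- ((2 - 2 / p) / 2)) * qnorm \<xi> z"
proof -
  have "0 \<le> 2 - 2 / p" using p_facts(1,2) by linarith
  from someI_ex[OF sg_smoothing[OF this, where 'd='d]] show "cS > 0"
    "\<And>\<xi> :: real^'d. \<And>z t. t > 0 \<Longrightarrow> norm \<xi> powr (2 - 2 / p) * qnorm \<xi> (sg t \<xi> z) \<le> cS * t powr (- ((2 - 2 / p) / 2)) * qnorm \<xi> z"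
    unfolding cS_def by blast+
qed

abbreviation bk :: "real \<Rightarrow> real \<Rightarrow> real \<Rightarrow> real" where "bk x \<equiv> beta_kernel x (1 - 2 / p)"

lemma divide_weight:
  fixes \<xi> :: "real^'d"
  assumes "norm \<xi> powr (2 - 2 / p) * X \<le> Y * (Q * norm \<xi> powr - r2)" "\<xi> \<noteq> 0"
  shows "X \<le> Y * Q * norm \<xi> powr - r1"
proof -
  have "X = norm \<xi> powr - (2 - 2 / p) * (norm \<xi> powr (2 - 2 / p) * X)"
    using assms(2) by (simp add: mult.assoc[symmetric] powr_add[symmetric])
  also have "\<dots> \<le> norm \<xi> powr - (2 - 2 / p) * (Y * (Q * norm \<xi> powr - r2))"
    by (intro mult_left_mono assms) simp
  also have "\<dots> = Y * Q * (norm \<xi> powr - (2 - 2 / p) * norm \<xi> powr - r2)" by (simp only: mult_ac)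
  also have "norm \<xi> powr - (2 - 2 / p) * norm \<xi> powr - r2 = norm \<xi> powr - r1"
    unfolding powr_add[symmetric] using r_facts(6) by (intro arg_cong[where f = "\<lambda>x. norm \<xi> powr x"]) linarith
  finally show ?thesis .
qed

text \<open>The smoothing costs (t - s)^(-(2 - 2/p)/2) = (t - s)^(1/p - 1). With the s^(-2/p) of the
  source this is the beta kernel with parameters 1/p and 1 - 2/p, both positive because p >
  2.\<close>

lemma sg_pointwise:
  fixes \<xi> :: "real^'d"
  assumes s: "0 < s" "s < t" and \<xi>: "\<xi> \<noteq> 0" and z: "qnorm \<xi> z \<le> Q * s powr - (2 / p) * norm \<xi> powr - r2"
  shows "qnorm \<xi> (sg (t - s) \<xi> z) \<le> cS * Q * norm \<xi> powr - r1 * bk (1 / p) t s"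
proof -
  have "norm \<xi> powr (2 - 2 / p) * qnorm \<xi> (sg (t - s) \<xi> z) \<le> cS * (t - s) powr (- ((2 - 2 / p) / 2)) * qnorm \<xi> z"
    using s by (intro cS) simp
  also have "\<dots> \<le> cS * (t - s) powr (- ((2 - 2 / p) / 2)) * (Q * s powr - (2 / p) * norm \<xi> powr - r2)"
    using cS(1) by (intro mult_left_mono z) auto
  finally have "qnorm \<xi> (sg (t - s) \<xi> z) \<le> cS * (t - s) powr (- ((2 - 2 / p) / 2)) * (Q * s powr - (2 / p)) * norm \<xi> powr - r1"
    using \<xi> by (rule divide_weight)
  also have "- ((2 - 2 / p) / 2) = 1 / p - 1" by (simp add: diff_divide_distrib)
  finally show ?thesis using s by (simp add: beta_kernel_def mult_ac)
qed

definition duhamel :: "(real \<Rightarrow> real^'d \<Rightarrow> 'd state) \<Rightarrow> real \<Rightarrow> real^'d \<Rightarrow> 'd state" where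
  "duhamel N t \<xi> = (LINT s:{0<..<t}|lborel. sg (t - s) \<xi> (N s \<xi>))"

definition source_bound :: "real \<Rightarrow> (real \<Rightarrow> real^'d \<Rightarrow> 'd state) \<Rightarrow> bool" where
  "source_bound Q N \<longleftrightarrow> 0 \<le> Q \<and> case_prod N \<in> borel_measurable (borel \<Otimes>\<^sub>M borel) \<and>
     (\<forall>s>0. \<forall>\<xi>. \<xi> \<noteq> 0 \<longrightarrow> qnorm \<xi> (N s \<xi>) \<le> Q * s powr - (2 / p) * norm \<xi> powr - r2)"

lemma source_bound_slice:
  assumes "source_bound Q N" shows "(\<lambda>s. N s \<xi>) \<in> borel_measurable borel" "N s \<in> borel_measurable borel"
proof -
  have N: "case_prod N \<in> borel_measurable (borel \<Otimes>\<^sub>M borel)" using assms by (simp add: source_bound_def)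
  have "(\<lambda>s. (s, \<xi>)) \<in> borel \<rightarrow>\<^sub>M borel \<Otimes>\<^sub>M borel" by measurable
  from measurable_compose[OF this N] show "(\<lambda>s. N s \<xi>) \<in> borel_measurable borel" by simp
  have "(\<lambda>\<xi>. (s, \<xi>)) \<in> borel \<rightarrow>\<^sub>M borel \<Otimes>\<^sub>M borel" by measurable
  from measurable_compose[OF this N] show "N s \<in> borel_measurable borel" by simp
qed

lemma duhamel_integrand_measurable:
  assumes "source_bound Q N"
  shows "(\<lambda>s. indicator {0<..<t} s *\<^sub>R sg (t - s) \<xi> (N s \<xi>)) \<in> borel_measurable borel"
  by (intro borel_measurable_scaleR borel_measurable_indicator sg_measurable source_bound_slice[OF assms]) auto

lemma duhamel_integrand_bound:
  assumes N: "source_bound Q N" and \<xi>: "\<xi> \<noteq> 0"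
  shows "qnorm \<xi> (indicator {0<..<t} s *\<^sub>R sg (t - s) \<xi> (N s \<xi>)) \<le> cS * Q * norm \<xi> powr - r1 * bk (1 / p) t s"
proof (cases "0 < s \<and> s < t")
  case True
  then have "qnorm \<xi> (sg (t - s) \<xi> (N s \<xi>)) \<le> cS * Q * norm \<xi> powr - r1 * bk (1 / p) t s"
    using N \<xi> by (intro sg_pointwise) (auto simp: source_bound_def)
  then show ?thesis using True by simp
next
  case False
  then show ?thesis by (auto simp: beta_kernel_def indicator_def)
qed

lemma bk_integrable: "0 < x \<Longrightarrow> 0 < t \<Longrightarrow> integrable lborel (bk x t)"
  using p_facts(1-4) by (intro beta_kernel_integral) auto

lemma duhamel_integrable:
  assumes N: "source_bound Q N" and \<xi>: "\<xi> \<noteq> 0" and t: "t > 0"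
  shows "integrable lborel (\<lambda>s. indicator {0<..<t} s *\<^sub>R sg (t - s) \<xi> (N s \<xi>))"
proof (rule integrable_of_qnorm[OF _ _ duhamel_integrand_bound[OF N \<xi>]])
  show "(\<lambda>s. indicator {0<..<t} s *\<^sub>R sg (t - s) \<xi> (N s \<xi>)) \<in> borel_measurable lborel"
    using duhamel_integrand_measurable[OF N] by simp
  show "integrable lborel (\<lambda>s. cS * Q * norm \<xi> powr - r1 * bk (1 / p) t s)"
    using p_facts(1-4) t by (intro integrable_mult_right bk_integrable) auto
qed

definition cD :: real where "cD = cS * beta_const (1 / p) (1 - 2 / p)"

lemma cD_nonneg: "0 \<le> cD" using cS(1) beta_const_nonneg by (simp add: cD_def)

lemma bk_integral: "0 < t \<Longrightarrow> (\<integral>s. bk (1 / p) t s \<partial>lborel) = beta_const (1 / p) (1 - 2 / p) * t powr - (1 / p)"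
proof -
  assume t: "0 < t"
  have "1 / p + (1 - 2 / p) - 1 = - (1 / p)" using p_facts(6) by linarith
  then show ?thesis using beta_kernel_integral(2)[of "1 / p" "1 - 2 / p" t] p_facts(2,3) t by simp
qed

lemma duhamel_bound:
  assumes N: "source_bound Q N" and \<xi>: "\<xi> \<noteq> 0" and t: "t > 0"
  shows "qnorm \<xi> (duhamel N t \<xi>) \<le> cD * Q * t powr - (1 / p) * norm \<xi> powr - r1"
proof -
  have "qnorm \<xi> (duhamel N t \<xi>) \<le> (\<integral>s. cS * Q * norm \<xi> powr - r1 * bk (1 / p) t s \<partial>lborel)"
    unfolding duhamel_def set_lebesgue_integral_def
    by (rule qnorm_integral_le[OF duhamel_integrable[OF assms] _ duhamel_integrand_bound[OF N \<xi>]])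
      (use p_facts(1-4) t in \<open>intro integrable_mult_right bk_integrable, auto\<close>)
  also have "\<dots> = cS * Q * norm \<xi> powr - r1 * (beta_const (1 / p) (1 - 2 / p) * t powr - (1 / p))"
    unfolding integral_mult_right_zero bk_integral[OF t] ..
  finally show ?thesis by (simp add: cD_def mult_ac)
qed

lemma duhamel_measurable:
  assumes N: "source_bound Q N" shows "case_prod (duhamel N) \<in> borel_measurable (borel \<Otimes>\<^sub>M borel)"
proof -
  have N': "(\<lambda>y. N (snd y) (snd (fst y))) \<in> borel_measurable ((borel \<Otimes>\<^sub>M borel) \<Otimes>\<^sub>M borel)"
  proof -
    have "(\<lambda>y. (snd y, snd (fst y))) \<in> ((borel \<Otimes>\<^sub>M borel) \<Otimes>\<^sub>M borel) \<rightarrow>\<^sub>M (borel \<Otimes>\<^sub>M borel)" by measurable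
    moreover have "case_prod N \<in> borel_measurable (borel \<Otimes>\<^sub>M borel)" using N by (simp only: source_bound_def)
    ultimately have "(\<lambda>y. case_prod N (snd y, snd (fst y))) \<in> borel_measurable ((borel \<Otimes>\<^sub>M borel) \<Otimes>\<^sub>M borel)"
      by (rule measurable_compose)
    then show ?thesis by simp
  qed
  have i: "(\<lambda>y :: (real \<times> (real^'d)) \<times> real. indicator {0<..<fst (fst y)} (snd y) :: real) \<in> borel_measurable ((borel \<Otimes>\<^sub>M (borel :: (real^'d) measure)) \<Otimes>\<^sub>M borel)"
  proof -
    have "(\<lambda>y :: (real \<times> (real^'d)) \<times> real. if 0 < snd y \<and> snd y < fst (fst y) then 1 else 0 :: real) \<in> borel_measurable ((borel \<Otimes>\<^sub>M (borel :: (real^'d) measure)) \<Otimes>\<^sub>M borel)"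
      by measurable
    then show ?thesis by (simp add: indicator_def of_bool_def)
  qed
  have "(\<lambda>y. indicator {0<..<fst (fst y)} (snd y) *\<^sub>R sg (fst (fst y) - snd y) (snd (fst y)) (N (snd y) (snd (fst y)))) \<in> borel_measurable ((borel \<Otimes>\<^sub>M borel) \<Otimes>\<^sub>M borel)"
    by (intro borel_measurable_scaleR i sg_measurable N') measurable
  then have "case_prod (\<lambda>x s. indicator {0<..<fst x} s *\<^sub>R sg (fst x - s) (snd x) (N s (snd x))) \<in> borel_measurable ((borel \<Otimes>\<^sub>M borel) \<Otimes>\<^sub>M lborel)"
    by (simp add: case_prod_beta' cong: measurable_cong_sets)
  then have "(\<lambda>x. \<integral>s. indicator {0<..<fst x} s *\<^sub>R sg (fst x - s) (snd x) (N s (snd x)) \<partial>lborel) \<in> borel_measurable (borel \<Otimes>\<^sub>M borel)"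
    by (rule lborel.borel_measurable_lebesgue_integral)
  then show ?thesis unfolding duhamel_def set_lebesgue_integral_def case_prod_beta' .
qed

text \<open>Half of the exponent 1/p is spent on continuity, b = 1/(2p), and the other half keeps
  the kernel integrable. On (0, t1) the increment of the semigroup is used, on [t1, t2) the
  shortness of the interval. The time power left over is b + (1 - 2/p) - 1 = - 3/(2p).\<close>

lemma duhamel_hoelder:
  assumes T: "T > 0"
  shows "\<exists>C\<ge>0. \<forall>Q N \<xi> t1 t2. source_bound Q N \<longrightarrow> \<xi> \<noteq> 0 \<longrightarrow> 0 < t1 \<longrightarrow> t1 < t2 \<longrightarrow> t2 \<le> T \<longrightarrow>
    qnorm \<xi> (duhamel N t2 \<xi> - duhamel N t1 \<xi>) \<le> C * Q * (t2 - t1) powr (1 / (2 * p)) * (t1 powr - (3 / (2 * p)) + t2 powr - (3 / (2 * p))) * norm \<xi> powr - r1"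
proof -
  define b where "b = 1 / (2 * p)"
  have b: "0 < b" "b \<le> 1" "1 / p = 2 * b" using p2 by (auto simp: b_def field_simps)
  have a0: "0 \<le> 2 - 2 / p" using p_facts(1,2) by linarith
  obtain C where C: "C > 0" "\<And>\<xi> :: real^'d. \<And>z t \<delta>. t > 0 \<Longrightarrow> \<delta> \<ge> 0 \<Longrightarrow> t + \<delta> \<le> T \<Longrightarrow>
    norm \<xi> powr (2 - 2 / p) * qnorm \<xi> (sg (t + \<delta>) \<xi> z - sg t \<xi> z) \<le> C * \<delta> powr b * t powr (- b - (2 - 2 / p) / 2) * qnorm \<xi> z"
    using sg_smoothing_hoelder[OF a0 less_imp_le[OF b(1)] b(2) T, where 'd='d] by blast
  define A where "A = C + cS"
  have A: "0 \<le> A" using C cS(1) by (simp add: A_def)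
  have pt: "qnorm \<xi> (indicator {0<..<t2} s *\<^sub>R sg (t2 - s) \<xi> (N s \<xi>) - indicator {0<..<t1} s *\<^sub>R sg (t1 - s) \<xi> (N s \<xi>))
     \<le> A * Q * (t2 - t1) powr b * norm \<xi> powr - r1 * (bk b t1 s + bk b t2 s)"
    if N: "source_bound Q N" and \<xi>: "\<xi> \<noteq> 0" and t: "0 < t1" "t1 < t2" "t2 \<le> T" for Q N t1 t2 s and \<xi> :: "real^'d"
  proof -
    have Q: "0 \<le> Q" using N by (simp add: source_bound_def)
    have nn: "0 \<le> bk b t1 s" "0 \<le> bk b t2 s" by (rule beta_kernel_nonneg)+
    consider "s \<le> 0 \<or> t2 \<le> s" | "0 < s" "s < t1" | "t1 \<le> s" "s < t2" by linarith
    then show ?thesis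
    proof cases
      case 1
      then have "indicator {0<..<t2} s = (0::real)" "indicator {0<..<t1} s = (0::real)" using t by auto
      then show ?thesis using A Q nn by simp
    next
      case 2
      have z: "qnorm \<xi> (N s \<xi>) \<le> Q * s powr - (2 / p) * norm \<xi> powr - r2" using N \<xi> 2 by (auto simp: source_bound_def)
      have "norm \<xi> powr (2 - 2 / p) * qnorm \<xi> (sg ((t1 - s) + (t2 - t1)) \<xi> (N s \<xi>) - sg (t1 - s) \<xi> (N s \<xi>))
        \<le> C * (t2 - t1) powr b * (t1 - s) powr (- b - (2 - 2 / p) / 2) * qnorm \<xi> (N s \<xi>)"
        using 2 t by (intro C) auto
      also have "\<dots> \<le> C * (t2 - t1) powr b * (t1 - s) powr (- b - (2 - 2 / p) / 2) * (Q * s powr - (2 / p) * norm \<xi> powr - r2)"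
        using C(1) by (intro mult_left_mono z) auto
      finally have "qnorm \<xi> (sg ((t1 - s) + (t2 - t1)) \<xi> (N s \<xi>) - sg (t1 - s) \<xi> (N s \<xi>))
        \<le> C * (t2 - t1) powr b * (t1 - s) powr (- b - (2 - 2 / p) / 2) * (Q * s powr - (2 / p)) * norm \<xi> powr - r1"
        using \<xi> by (rule divide_weight)
      also have "- b - (2 - 2 / p) / 2 = b - 1" using b(3) by (simp add: diff_divide_distrib)
      also have "C * (t2 - t1) powr b * (t1 - s) powr (b - 1) * (Q * s powr - (2 / p)) * norm \<xi> powr - r1
        = C * (Q * (t2 - t1) powr b * norm \<xi> powr - r1 * bk b t1 s)" using 2 by (simp add: beta_kernel_def mult_ac)
      also have "\<dots> \<le> A * (Q * (t2 - t1) powr b * norm \<xi> powr - r1 * (bk b t1 s + bk b t2 s))"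
        using Q nn cS(1) A by (intro mult_mono mult_left_mono) (auto simp: A_def)
      finally show ?thesis using 2 t by (simp add: mult.assoc)
    next
      case 3
      have s: "0 < s" using 3 t by linarith
      have z: "qnorm \<xi> (N s \<xi>) \<le> Q * s powr - (2 / p) * norm \<xi> powr - r2" using N \<xi> s by (auto simp: source_bound_def)
      have "qnorm \<xi> (sg (t2 - s) \<xi> (N s \<xi>)) \<le> cS * Q * norm \<xi> powr - r1 * bk (1 / p) t2 s"
        by (rule sg_pointwise[OF s 3(2) \<xi> z])
      \<comment> \<open>On the short interval (t2 - s)^(2b - 1) splits into (t2 - s)^b, at most (t2
        - t1)^b, and the integrable (t2 - s)^(b - 1).\<close>
      also have "bk (1 / p) t2 s \<le> (t2 - t1) powr b * bk b t2 s"
      proof -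
        have "(t2 - s) powr (1 / p - 1) = (t2 - s) powr b * (t2 - s) powr (b - 1)" unfolding powr_add[symmetric] b(3) by simp
        also have "\<dots> \<le> (t2 - t1) powr b * (t2 - s) powr (b - 1)" using 3 b by (intro mult_right_mono powr_mono2) auto
        finally have "(t2 - s) powr (1 / p - 1) * s powr (1 - 2 / p - 1) \<le> (t2 - t1) powr b * (t2 - s) powr (b - 1) * s powr (1 - 2 / p - 1)"
          by (rule mult_right_mono) simp
        then show ?thesis using s 3 by (simp add: beta_kernel_def mult_ac)
      qed
      then have "cS * Q * norm \<xi> powr - r1 * bk (1 / p) t2 s \<le> cS * Q * norm \<xi> powr - r1 * ((t2 - t1) powr b * bk b t2 s)"
        using cS(1) Q by (intro mult_left_mono) auto
      also have "\<dots> = cS * (Q * (t2 - t1) powr b * norm \<xi> powr - r1 * bk b t2 s)" by (simp only: mult_ac)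
      also have "\<dots> \<le> A * (Q * (t2 - t1) powr b * norm \<xi> powr - r1 * (bk b t1 s + bk b t2 s))"
        using Q nn C(1) A by (intro mult_mono mult_left_mono) (auto simp: A_def)
      finally show ?thesis using 3 s by (simp add: mult.assoc)
    qed
  qed
  define D where "D = A * beta_const b (1 - 2 / p)"
  have D: "0 \<le> D" using A beta_const_nonneg by (simp add: D_def)
  have "qnorm \<xi> (duhamel N t2 \<xi> - duhamel N t1 \<xi>) \<le> D * Q * (t2 - t1) powr b * (t1 powr - (3 * b) + t2 powr - (3 * b)) * norm \<xi> powr - r1"
    if N: "source_bound Q N" and \<xi>: "\<xi> \<noteq> 0" and t: "0 < t1" "t1 < t2" "t2 \<le> T" for Q N t1 t2 and \<xi> :: "real^'d"
  proof -
    have t2: "0 < t2" using t by linarith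
    note i1 = duhamel_integrable[OF N \<xi> t(1)] and i2 = duhamel_integrable[OF N \<xi> t2]
    have bi: "integrable lborel (bk b t1)" "integrable lborel (bk b t2)" using b(1) t t2 by (auto intro: bk_integrable)
    have be: "(\<integral>s. bk b \<tau> s \<partial>lborel) = beta_const b (1 - 2 / p) * \<tau> powr - (3 * b)" if "0 < \<tau>" for \<tau>
    proof -
      have "b + (1 - 2 / p) - 1 = - (3 * b)" using b(3) p_facts(6) by linarith
      then show ?thesis using beta_kernel_integral(2)[OF b(1) _ that, of "1 - 2 / p"] p_facts(2) unfolding \<open>b + (1 - 2 / p) - 1 = - (3 * b)\<close> by simp
    qed
    have "qnorm \<xi> (duhamel N t2 \<xi> - duhamel N t1 \<xi>) \<le> (\<integral>s. A * Q * (t2 - t1) powr b * norm \<xi> powr - r1 * (bk b t1 s + bk b t2 s) \<partial>lborel)"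
      unfolding duhamel_def set_lebesgue_integral_def Bochner_Integration.integral_diff[OF i2 i1, symmetric]
      by (rule qnorm_integral_le[OF Bochner_Integration.integrable_diff[OF i2 i1] _ pt[OF N \<xi> t]])
        (intro integrable_mult_right Bochner_Integration.integrable_add bi)
    also have "\<dots> = A * Q * (t2 - t1) powr b * norm \<xi> powr - r1 * (beta_const b (1 - 2 / p) * t1 powr - (3 * b) + beta_const b (1 - 2 / p) * t2 powr - (3 * b))"
      unfolding integral_mult_right_zero Bochner_Integration.integral_add[OF bi] be[OF t(1)] be[OF t2] ..
    finally show ?thesis by (simp add: D_def algebra_simps)
  qed
  moreover have "3 * b = 3 / (2 * p)" by (simp add: b_def)
  ultimately show ?thesis using D unfolding b_def by auto
qed

section \<open>The fixed point\<close>

definition wt :: "real \<Rightarrow> real^'d \<Rightarrow> real" where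
  "wt t \<xi> = t powr - (1 / p) * norm \<xi> powr - r1"

lemma wt_nonneg: "0 \<le> wt t \<xi>" by (simp add: wt_def)

text \<open>The fixed point is sought among jointly measurable curves that obey the bound at every nonzero
  frequency, so that Fubini and pointwise limits apply. An arbitrary solution only satisfies
  \<^const>\<open>freq_bound\<close> at each time.\<close>

definition curve_bound :: "real \<Rightarrow> (real \<Rightarrow> real^'d \<Rightarrow> 'd state) \<Rightarrow> bool" where
  "curve_bound M H \<longleftrightarrow> 0 \<le> M \<and> case_prod H \<in> borel_measurable (borel \<Otimes>\<^sub>M borel) \<and>
     (\<forall>t>0. \<forall>\<xi>. \<xi> \<noteq> 0 \<longrightarrow> qnorm \<xi> (H t \<xi>) \<le> M * wt t \<xi>)"

lemma slice_measurable:
  assumes "case_prod H \<in> borel_measurable (borel \<Otimes>\<^sub>M borel)" shows "H t \<in> borel_measurable borel"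
proof -
  have "(\<lambda>\<xi>. (t, \<xi>)) \<in> borel \<rightarrow>\<^sub>M borel \<Otimes>\<^sub>M borel" by measurable
  from measurable_compose[OF this assms] show ?thesis by simp
qed

lemma curve_bound_freq_bound:
  assumes H: "curve_bound M H" and t: "t > 0" shows "freq_bound (M * t powr - (1 / p)) (H t)"
  unfolding freq_bound_def
proof (intro conjI)
  show "0 \<le> M * t powr - (1 / p)" using H by (simp add: curve_bound_def)
  show "H t \<in> borel_measurable borel" using H by (intro slice_measurable) (simp add: curve_bound_def)
  show "AE \<xi> in lborel. qnorm \<xi> (H t \<xi>) \<le> M * t powr - (1 / p) * norm \<xi> powr - r1"
    using AE_lborel_singleton[of 0] by eventually_elim (use H t in \<open>auto simp: curve_bound_def wt_def mult.assoc\<close>)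
qed

lemma curve_bound_mono:
  assumes "curve_bound M H" "M \<le> M'" shows "curve_bound M' H"
  unfolding curve_bound_def
proof (intro conjI allI impI)
  show "0 \<le> M'" using assms by (simp add: curve_bound_def)
  show "case_prod H \<in> borel_measurable (borel \<Otimes>\<^sub>M borel)" using assms by (simp only: curve_bound_def)
  fix t :: real and \<xi> :: "real^'d" assume "t > 0" "\<xi> \<noteq> 0"
  then have "qnorm \<xi> (H t \<xi>) \<le> M * wt t \<xi>" using assms(1) by (auto simp: curve_bound_def)
  also have "\<dots> \<le> M' * wt t \<xi>" using assms(2) wt_nonneg by (rule mult_right_mono)
  finally show "qnorm \<xi> (H t \<xi>) \<le> M' * wt t \<xi>" .
qed

definition nonlin :: "(real \<Rightarrow> real^'d \<Rightarrow> 'd state) \<Rightarrow> real \<Rightarrow> real^'d \<Rightarrow> 'd state" where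
  "nonlin H s \<xi> = B (H s) (H s) \<xi>"

lemma nonlin_measurable:
  assumes H: "case_prod H \<in> borel_measurable (borel \<Otimes>\<^sub>M borel)"
  shows "case_prod (nonlin H) \<in> borel_measurable (borel \<Otimes>\<^sub>M borel)"
proof -
  have "case_prod (\<lambda>x. H (fst x)) \<in> borel_measurable ((borel \<Otimes>\<^sub>M (borel :: (real^'d) measure)) \<Otimes>\<^sub>M borel)"
  proof -
    have "(\<lambda>y. (fst (fst y), snd y)) \<in> ((borel \<Otimes>\<^sub>M (borel :: (real^'d) measure)) \<Otimes>\<^sub>M borel) \<rightarrow>\<^sub>M (borel \<Otimes>\<^sub>M borel)" by measurable
    from measurable_compose[OF this H] show ?thesis by (simp add: case_prod_beta')
  qed
  from B_param_measurable[OF this, of snd] show ?thesis by (simp add: nonlin_def case_prod_beta')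
qed

lemma powr_sq: "t powr - (1 / p) * t powr - (1 / p) = t powr - (2 / p)"
  unfolding powr_add[symmetric] by simp

lemma nonlin_source_bound:
  assumes H: "curve_bound M H" shows "source_bound (cB * M * M) (nonlin H)"
  unfolding source_bound_def
proof (intro conjI allI impI)
  show "0 \<le> cB * M * M" using cB_nonneg H by (simp add: curve_bound_def)
  show "case_prod (nonlin H) \<in> borel_measurable (borel \<Otimes>\<^sub>M borel)" using H by (intro nonlin_measurable) (simp add: curve_bound_def)
  fix s :: real and \<xi> :: "real^'d" assume s: "s > 0" "\<xi> \<noteq> 0"
  have "qnorm \<xi> (nonlin H s \<xi>) \<le> cB * (M * s powr - (1 / p)) * (M * s powr - (1 / p)) * norm \<xi> powr - r2"
    unfolding nonlin_def by (rule B_estimate[OF curve_bound_freq_bound[OF H s(1)] curve_bound_freq_bound[OF H s(1)] s(2)])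
  also have "\<dots> = cB * M * M * s powr - (2 / p) * norm \<xi> powr - r2" unfolding powr_sq[symmetric] by (simp only: mult_ac)
  finally show "qnorm \<xi> (nonlin H s \<xi>) \<le> cB * M * M * s powr - (2 / p) * norm \<xi> powr - r2" .
qed

lemma nonlin_diff_source_bound:
  assumes H: "curve_bound M H" "curve_bound M H'" and D: "curve_bound D (\<lambda>t \<xi>. H t \<xi> - H' t \<xi>)"
  shows "source_bound (2 * cB * M * D) (\<lambda>s \<xi>. nonlin H s \<xi> - nonlin H' s \<xi>)"
  unfolding source_bound_def
proof (intro conjI allI impI)
  show "0 \<le> 2 * cB * M * D" using cB_nonneg H D by (simp add: curve_bound_def)
  have "case_prod (nonlin H) \<in> borel_measurable (borel \<Otimes>\<^sub>M borel)" "case_prod (nonlin H') \<in> borel_measurable (borel \<Otimes>\<^sub>M borel)"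
    using H by (auto intro!: nonlin_measurable simp: curve_bound_def simp del: case_prod_eta)
  then show "(\<lambda>(t, \<xi>). nonlin H t \<xi> - nonlin H' t \<xi>) \<in> borel_measurable (borel \<Otimes>\<^sub>M borel)"
    unfolding case_prod_beta' by (rule borel_measurable_diff)
  fix s :: real and \<xi> :: "real^'d" assume s: "s > 0" "\<xi> \<noteq> 0"
  have "qnorm \<xi> (nonlin H s \<xi> - nonlin H' s \<xi>) \<le> 2 * cB * (M * s powr - (1 / p)) * (D * s powr - (1 / p)) * norm \<xi> powr - r2"
    unfolding nonlin_def by (rule B_lipschitz[OF curve_bound_freq_bound[OF H(1) s(1)] curve_bound_freq_bound[OF H(2) s(1)] curve_bound_freq_bound[OF D s(1)] s(2)])
  also have "\<dots> = 2 * cB * M * D * s powr - (2 / p) * norm \<xi> powr - r2" unfolding powr_sq[symmetric] by (simp only: mult_ac)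
  finally show "qnorm \<xi> (nonlin H s \<xi> - nonlin H' s \<xi>) \<le> 2 * cB * M * D * s powr - (2 / p) * norm \<xi> powr - r2" .
qed

lemma duhamel_diff:
  assumes "source_bound Q N" "source_bound Q' N'" "\<xi> \<noteq> 0" "t > 0"
  shows "duhamel N t \<xi> - duhamel N' t \<xi> = duhamel (\<lambda>s \<xi>. N s \<xi> - N' s \<xi>) t \<xi>"
  unfolding duhamel_def set_lebesgue_integral_def
  by (subst Bochner_Integration.integral_diff[symmetric])
    (use duhamel_integrable[OF assms(1,3,4)] duhamel_integrable[OF assms(2,3,4)] in \<open>auto simp: sg_diff scaleR_diff_right\<close>)

text \<open>The smoothing constant for the step of 2/p from the weight d - 1 of the data to
  \<open>r1\<close>.\<close>

definition cL :: real where
  "cL = (SOME C. C > 0 \<and> (\<forall>\<xi> :: real^'d. \<forall>z. \<forall>t>0. norm \<xi> powr (2 / p) * qnorm \<xi> (sg t \<xi> z) \<le> C * t powr (- ((2 / p) / 2)) * qnorm \<xi> z))"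

lemma cL: "cL > 0" "\<And>\<xi> :: real^'d. \<And>z t. t > 0 \<Longrightarrow> norm \<xi> powr (2 / p) * qnorm \<xi> (sg t \<xi> z) \<le> cL * t powr (- ((2 / p) / 2)) * qnorm \<xi> z"
proof -
  have "0 \<le> 2 / p" using p_facts(1) by linarith
  from someI_ex[OF sg_smoothing[OF this, where 'd='d]] show "cL > 0"
    "\<And>\<xi> :: real^'d. \<And>z t. t > 0 \<Longrightarrow> norm \<xi> powr (2 / p) * qnorm \<xi> (sg t \<xi> z) \<le> cL * t powr (- ((2 / p) / 2)) * qnorm \<xi> z"
    unfolding cL_def by blast+
qed

lemma divide_weight':
  fixes \<xi> :: "real^'d"
  assumes "norm \<xi> powr (2 / p) * X \<le> Y * (Q * norm \<xi> powr - (real CARD('d) - 1))" "\<xi> \<noteq> 0"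
  shows "X \<le> Y * Q * norm \<xi> powr - r1"
proof -
  have "X = norm \<xi> powr - (2 / p) * (norm \<xi> powr (2 / p) * X)"
    using assms(2) by (simp add: mult.assoc[symmetric] powr_add[symmetric])
  also have "\<dots> \<le> norm \<xi> powr - (2 / p) * (Y * (Q * norm \<xi> powr - (real CARD('d) - 1)))"
    by (intro mult_left_mono assms) simp
  also have "\<dots> = Y * Q * (norm \<xi> powr - (2 / p) * norm \<xi> powr - (real CARD('d) - 1))" by (simp only: mult_ac)
  also have "norm \<xi> powr - (2 / p) * norm \<xi> powr - (real CARD('d) - 1) = norm \<xi> powr - r1"
    unfolding powr_add[symmetric] r1_def by (intro arg_cong[where f = "\<lambda>x. norm \<xi> powr x"]) linarith
  finally show ?thesis .
qed

text \<open>Required at every nonzero frequency and not only almost everywhere, to match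
  \<open>curve_bound\<close>.\<close>

definition data_bound :: "real \<Rightarrow> (real^'d \<Rightarrow> 'd state) \<Rightarrow> bool" where
  "data_bound \<rho> h \<longleftrightarrow> 0 \<le> \<rho> \<and> h \<in> borel_measurable borel \<and> (\<forall>\<xi>. \<xi> \<noteq> 0 \<longrightarrow> qnorm \<xi> (h \<xi>) \<le> \<rho> * norm \<xi> powr - (real CARD('d) - 1))"

lemma Lin_curve_bound:
  assumes h: "data_bound \<rho> h" shows "curve_bound (cL * \<rho>) (\<lambda>t \<xi>. sg t \<xi> (h \<xi>))"
  unfolding curve_bound_def
proof (intro conjI allI impI)
  show "0 \<le> cL * \<rho>" using h cL(1) by (simp add: data_bound_def)
  have hm: "h \<in> borel_measurable borel" using h by (simp add: data_bound_def)
  show "(\<lambda>(t, \<xi>). sg t \<xi> (h \<xi>)) \<in> borel_measurable (borel \<Otimes>\<^sub>M borel)"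
    unfolding case_prod_beta' by (intro sg_measurable measurable_compose[OF _ hm]) auto
  fix t :: real and \<xi> :: "real^'d" assume t: "t > 0" "\<xi> \<noteq> 0"
  have "norm \<xi> powr (2 / p) * qnorm \<xi> (sg t \<xi> (h \<xi>)) \<le> cL * t powr (- ((2 / p) / 2)) * qnorm \<xi> (h \<xi>)" by (rule cL(2)[OF t(1)])
  also have "\<dots> \<le> cL * t powr (- ((2 / p) / 2)) * (\<rho> * norm \<xi> powr - (real CARD('d) - 1))"
    using h t cL(1) by (intro mult_left_mono) (auto simp: data_bound_def)
  finally have "qnorm \<xi> (sg t \<xi> (h \<xi>)) \<le> cL * t powr (- ((2 / p) / 2)) * \<rho> * norm \<xi> powr - r1" using t(2) by (rule divide_weight')
  then show "qnorm \<xi> (sg t \<xi> (h \<xi>)) \<le> cL * \<rho> * wt t \<xi>" by (simp add: wt_def mult_ac)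
qed

definition Phi :: "(real^'d \<Rightarrow> 'd state) \<Rightarrow> (real \<Rightarrow> real^'d \<Rightarrow> 'd state) \<Rightarrow> real \<Rightarrow> real^'d \<Rightarrow> 'd state" where
  "Phi h H t \<xi> = sg t \<xi> (h \<xi>) + duhamel (nonlin H) t \<xi>"

lemma Phi_curve_bound:
  assumes h: "data_bound \<rho> h" and H: "curve_bound M H"
  shows "curve_bound (cL * \<rho> + cD * (cB * M * M)) (Phi h H)"
  unfolding curve_bound_def
proof (intro conjI allI impI)
  note L = Lin_curve_bound[OF h] and N = nonlin_source_bound[OF H]
  have Q: "0 \<le> cB * M * M" using N by (simp add: source_bound_def)
  show "0 \<le> cL * \<rho> + cD * (cB * M * M)" using L Q cD_nonneg by (simp add: curve_bound_def)
  have "(\<lambda>(t, \<xi>). sg t \<xi> (h \<xi>)) \<in> borel_measurable (borel \<Otimes>\<^sub>M borel)" using L by (simp add: curve_bound_def)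
  then show "case_prod (Phi h H) \<in> borel_measurable (borel \<Otimes>\<^sub>M borel)"
    using duhamel_measurable[OF N] unfolding Phi_def case_prod_beta' by (rule borel_measurable_add)
  fix t :: real and \<xi> :: "real^'d" assume t: "t > 0" "\<xi> \<noteq> 0"
  have "qnorm \<xi> (sg t \<xi> (h \<xi>)) \<le> cL * \<rho> * wt t \<xi>" using L t by (auto simp: curve_bound_def)
  moreover have "qnorm \<xi> (duhamel (nonlin H) t \<xi>) \<le> cD * (cB * M * M) * wt t \<xi>"
    using duhamel_bound[OF N t(2,1)] by (simp add: wt_def mult_ac)
  ultimately show "qnorm \<xi> (Phi h H t \<xi>) \<le> (cL * \<rho> + cD * (cB * M * M)) * wt t \<xi>"
    unfolding Phi_def distrib_right using qnorm_triangle[of \<xi> "sg t \<xi> (h \<xi>)" "duhamel (nonlin H) t \<xi>"] by linarith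
qed

lemma Phi_contraction:
  assumes H: "curve_bound M H" "curve_bound M H'" and D: "curve_bound D (\<lambda>t \<xi>. H t \<xi> - H' t \<xi>)" and t: "t > 0" "\<xi> \<noteq> 0"
  shows "qnorm \<xi> (Phi h H t \<xi> - Phi h H' t \<xi>) \<le> cD * (2 * cB * M * D) * wt t \<xi>"
proof -
  have "Phi h H t \<xi> - Phi h H' t \<xi> = duhamel (\<lambda>s \<xi>. nonlin H s \<xi> - nonlin H' s \<xi>) t \<xi>"
    using duhamel_diff[OF nonlin_source_bound[OF H(1)] nonlin_source_bound[OF H(2)] t(2,1)] by (simp add: Phi_def)
  then show ?thesis using duhamel_bound[OF nonlin_diff_source_bound[OF H D] t(2,1)] by (simp add: wt_def mult_ac)
qed

primrec picard :: "(real^'d \<Rightarrow> 'd state) \<Rightarrow> nat \<Rightarrow> real \<Rightarrow> real^'d \<Rightarrow> 'd state" where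
  "picard h 0 = (\<lambda>_ _. 0)"
| "picard h (Suc n) = Phi h (picard h n)"

lemma qnorm_limit_le:
  assumes "X \<longlonglongrightarrow> x" "\<And>n. n \<ge> N \<Longrightarrow> qnorm \<xi> (X n) \<le> C"
  shows "qnorm \<xi> x \<le> C"
proof (rule LIMSEQ_le_const2)
  show "(\<lambda>n. qnorm \<xi> (X n)) \<longlonglongrightarrow> qnorm \<xi> x" unfolding qnorm_def by (intro tendsto_intros assms)
qed (use assms(2) in blast)

text \<open>The iteration is carried out pointwise in (t, \<xi>): successive iterates differ by at
  most M 2^-n \<open>wt t \<xi>\<close>, so each value is a Cauchy sequence, and joint measurability
  survives as a property of pointwise limits.\<close>

lemma Phi_fixed_point:
  assumes h: "data_bound \<rho> h" and M: "M \<ge> 0" "cL * \<rho> \<le> M / 2" "cD * (2 * cB * M) \<le> 1 / 2"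
  shows "\<exists>H. curve_bound M H \<and> (\<forall>t>0. \<forall>\<xi>. \<xi> \<noteq> 0 \<longrightarrow> Phi h H t \<xi> = H t \<xi>)"
proof -
  have iM: "curve_bound M (picard h n)" for n
  proof (induction n)
    case 0
    have "(\<lambda>(t::real, \<xi>::real^'d). 0 :: 'd state) \<in> borel_measurable (borel \<Otimes>\<^sub>M borel)" by simp
    then show ?case using M(1) wt_nonneg by (auto simp: curve_bound_def)
  next
    case (Suc n)
    have "cL * \<rho> + cD * (cB * M * M) \<le> M"
    proof -
      have "cD * (cB * M * M) = cD * (2 * cB * M) * (M / 2)" by simp
      also have "\<dots> \<le> 1 / 2 * (M / 2)" using M by (intro mult_right_mono) auto
      finally show ?thesis using M by simp
    qed
    moreover have "curve_bound (cL * \<rho> + cD * (cB * M * M)) (picard h (Suc n))" using Phi_curve_bound[OF h Suc] by simp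
    ultimately show ?case by (metis curve_bound_mono)
  qed
  have m: "case_prod (picard h n) \<in> borel_measurable (borel \<Otimes>\<^sub>M borel)" for n using iM[of n] by (simp only: curve_bound_def)
  have step: "qnorm \<xi> (picard h (Suc n) t \<xi> - picard h n t \<xi>) \<le> (M * (1/2) ^ n) * wt t \<xi>" if "t > 0" "\<xi> \<noteq> 0" for n t \<xi>
    using that
  proof (induction n arbitrary: t \<xi>)
    case 0
    then show ?case using iM[of "Suc 0"] by (auto simp: curve_bound_def)
  next
    case (Suc n)
    have D: "curve_bound (M * (1/2) ^ n) (\<lambda>t \<xi>. picard h (Suc n) t \<xi> - picard h n t \<xi>)"
      unfolding curve_bound_def
    proof (intro conjI allI impI Suc.IH)
      show "0 \<le> M * (1/2) ^ n" using M(1) by simp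
      show "(\<lambda>(t, \<xi>). picard h (Suc n) t \<xi> - picard h n t \<xi>) \<in> borel_measurable (borel \<Otimes>\<^sub>M borel)"
        using m[of "Suc n"] m[of n] unfolding case_prod_beta' by (rule borel_measurable_diff)
    qed
    have "qnorm \<xi> (picard h (Suc (Suc n)) t \<xi> - picard h (Suc n) t \<xi>) \<le> cD * (2 * cB * M * (M * (1/2) ^ n)) * wt t \<xi>"
      unfolding picard.simps(2)[of h "Suc n"] picard.simps(2)[of h n, symmetric]
      using Phi_contraction[OF iM iM D Suc.prems, of h] by simp
    also have "\<dots> = (cD * (2 * cB * M)) * ((M * (1/2) ^ n) * wt t \<xi>)" by (simp only: mult_ac)
    also have "\<dots> \<le> 1 / 2 * ((M * (1/2) ^ n) * wt t \<xi>)" using M wt_nonneg by (intro mult_right_mono) auto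
    finally show ?case by simp
  qed
  have tail: "qnorm \<xi> (picard h (n + k) t \<xi> - picard h n t \<xi>) \<le> (2 * M * (1/2) ^ n) * wt t \<xi>" if t: "t > 0" "\<xi> \<noteq> 0" for n k t \<xi>
  proof -
    \<comment> \<open>The exact partial sum of the geometric series lets the induction on k close;
      its factor is dropped afterwards.\<close>
    have "qnorm \<xi> (picard h (n + k) t \<xi> - picard h n t \<xi>) \<le> (2 * M * (1/2) ^ n) * (1 - (1/2) ^ k) * wt t \<xi>"
    proof (induction k)
      case (Suc k)
      have "picard h (n + Suc k) t \<xi> - picard h n t \<xi> = (picard h (Suc (n + k)) t \<xi> - picard h (n + k) t \<xi>) + (picard h (n + k) t \<xi> - picard h n t \<xi>)"
        by simp
      then have "qnorm \<xi> (picard h (n + Suc k) t \<xi> - picard h n t \<xi>) \<le> (M * (1/2) ^ (n + k)) * wt t \<xi> + (2 * M * (1/2) ^ n) * (1 - (1/2) ^ k) * wt t \<xi>"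
        using qnorm_triangle[of \<xi> "picard h (Suc (n + k)) t \<xi> - picard h (n + k) t \<xi>" "picard h (n + k) t \<xi> - picard h n t \<xi>"] step[OF t, of "n + k"] Suc
        by (simp del: picard.simps)
      also have "\<dots> = (2 * M * (1/2) ^ n) * (1 - (1/2) ^ Suc k) * wt t \<xi>" by (simp add: power_add algebra_simps)
      finally show ?case .
    qed simp
    also have "\<dots> \<le> (2 * M * (1/2) ^ n) * 1 * wt t \<xi>"
      using M(1) wt_nonneg by (intro mult_right_mono mult_left_mono) auto
    finally show ?thesis by simp
  qed
  \<comment> \<open>\<open>lim\<close> has an unspecified value where the iterates do not converge.
    Convergence is shown for t > 0 and \<xi> \<noteq> 0, while measurability of \<open>lim\<close>
    holds everywhere.\<close>
  define H where "H t \<xi> = lim (\<lambda>n. picard h n t \<xi>)" for t \<xi>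
  have half: "(\<lambda>n. C * (1/2) ^ n) \<longlonglongrightarrow> 0" for C :: real
    using tendsto_mult_right_zero[OF LIMSEQ_realpow_zero[of "1/2 :: real"]] by simp
  have conv: "(\<lambda>n. picard h n t \<xi>) \<longlonglongrightarrow> H t \<xi>" if t: "t > 0" "\<xi> \<noteq> 0" for t \<xi>
  proof -
    have "Cauchy (\<lambda>n. picard h n t \<xi>)"
    proof (rule CauchyI')
      fix e :: real assume e: "e > 0"
      have "\<forall>\<^sub>F n in sequentially. (2 * M * wt t \<xi>) * (1/2) ^ n < e" by (rule order_tendstoD(2)[OF half e])
      then obtain N where N: "\<And>n. n \<ge> N \<Longrightarrow> (2 * M * wt t \<xi>) * (1/2) ^ n < e"
        by (auto simp: eventually_sequentially)
      show "\<exists>M. \<forall>m\<ge>M. \<forall>n>m. dist (picard h m t \<xi>) (picard h n t \<xi>) < e"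
      proof (intro exI[of _ N] allI impI)
        fix m n assume mn: "N \<le> m" "m < n"
        then obtain k where k: "n = m + k" using less_imp_add_positive by blast
        have "dist (picard h m t \<xi>) (picard h n t \<xi>) \<le> qnorm \<xi> (picard h n t \<xi> - picard h m t \<xi>)"
          unfolding dist_norm norm_minus_commute[of "picard h m t \<xi>"] by (rule norm_le_qnorm)
        also have "\<dots> \<le> (2 * M * (1/2) ^ m) * wt t \<xi>" unfolding k by (rule tail[OF t])
        also have "\<dots> < e" using N[OF mn(1)] by (simp add: mult_ac)
        finally show "dist (picard h m t \<xi>) (picard h n t \<xi>) < e" .
      qed
    qed
    then have "convergent (\<lambda>n. picard h n t \<xi>)" by (rule Cauchy_convergent)
    then show ?thesis unfolding H_def by (simp add: convergent_LIMSEQ_iff)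
  qed
  have Hm: "case_prod H \<in> borel_measurable (borel \<Otimes>\<^sub>M borel)"
  proof -
    have "(\<lambda>x. lim (\<lambda>n. case_prod (picard h n) x)) \<in> borel_measurable (borel \<Otimes>\<^sub>M borel)"
      by (rule borel_measurable_lim_metric) (rule m)
    then show ?thesis by (simp add: H_def case_prod_beta')
  qed
  have HM: "curve_bound M H" unfolding curve_bound_def
  proof (intro conjI allI impI M(1) Hm)
    fix t :: real and \<xi> :: "real^'d" assume t: "t > 0" "\<xi> \<noteq> 0"
    show "qnorm \<xi> (H t \<xi>) \<le> M * wt t \<xi>"
      by (rule qnorm_limit_le[OF conv[OF t], of 0]) (use iM t in \<open>auto simp: curve_bound_def\<close>)
  qed
  have HD: "qnorm \<xi> (H t \<xi> - picard h n t \<xi>) \<le> (2 * M * (1/2) ^ n) * wt t \<xi>" if t: "t > 0" "\<xi> \<noteq> 0" for n t \<xi>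
  proof (rule qnorm_limit_le[OF tendsto_diff[OF conv[OF t] tendsto_const], of n])
    fix m assume "m \<ge> n"
    then obtain k where "m = n + k" using le_Suc_ex by blast
    then show "qnorm \<xi> (picard h m t \<xi> - picard h n t \<xi>) \<le> (2 * M * (1/2) ^ n) * wt t \<xi>" using tail[OF t] by simp
  qed
  have HDb: "curve_bound (2 * M * (1/2) ^ n) (\<lambda>t \<xi>. H t \<xi> - picard h n t \<xi>)" for n unfolding curve_bound_def
  proof (intro conjI allI impI HD)
    show "0 \<le> 2 * M * (1/2) ^ n" using M(1) by simp
    show "(\<lambda>(t, \<xi>). H t \<xi> - picard h n t \<xi>) \<in> borel_measurable (borel \<Otimes>\<^sub>M borel)"
      using Hm m[of n] unfolding case_prod_beta' by (rule borel_measurable_diff)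
  qed
  have "Phi h H t \<xi> = H t \<xi>" if t: "t > 0" "\<xi> \<noteq> 0" for t \<xi>
  proof -
    \<comment> \<open>The iterate n + 1 is close to \<open>Phi h H\<close> by the contraction and
      close to \<open>H\<close> by the tail bound.\<close>
    have b: "qnorm \<xi> (Phi h H t \<xi> - H t \<xi>) \<le> (2 * M * wt t \<xi>) * (1/2) ^ n" for n
    proof -
      have "qnorm \<xi> (Phi h H t \<xi> - Phi h (picard h n) t \<xi>) \<le> cD * (2 * cB * M * (2 * M * (1/2) ^ n)) * wt t \<xi>"
        by (rule Phi_contraction[OF HM iM HDb t])
      also have "\<dots> = (cD * (2 * cB * M)) * ((2 * M * (1/2) ^ n) * wt t \<xi>)" by (simp only: mult_ac)
      also have "\<dots> \<le> 1 / 2 * ((2 * M * (1/2) ^ n) * wt t \<xi>)" using M wt_nonneg by (intro mult_right_mono) auto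
      finally have 1: "qnorm \<xi> (Phi h H t \<xi> - picard h (Suc n) t \<xi>) \<le> M * (1/2) ^ n * wt t \<xi>" by simp
      have 2: "qnorm \<xi> (H t \<xi> - picard h (Suc n) t \<xi>) \<le> (2 * M * (1/2) ^ Suc n) * wt t \<xi>" by (rule HD[OF t])
      have "qnorm \<xi> (Phi h H t \<xi> - H t \<xi>) = qnorm \<xi> ((Phi h H t \<xi> - picard h (Suc n) t \<xi>) - (H t \<xi> - picard h (Suc n) t \<xi>))" by simp
      also have "\<dots> \<le> M * (1/2) ^ n * wt t \<xi> + (2 * M * (1/2) ^ Suc n) * wt t \<xi>"
        by (rule order_trans[OF qnorm_diff add_mono[OF 1 2]])
      also have "\<dots> = (2 * M * wt t \<xi>) * (1/2) ^ n" by (simp add: algebra_simps)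
      finally show ?thesis .
    qed
    have "qnorm \<xi> (Phi h H t \<xi> - H t \<xi>) \<le> 0"
      by (rule LIMSEQ_le_const[OF half[of "2 * M * wt t \<xi>"]]) (use b in blast)
    then have "norm (Phi h H t \<xi> - H t \<xi>) \<le> 0" using norm_le_qnorm order_trans by blast
    then show ?thesis by simp
  qed
  with HM show ?thesis by blast
qed

text \<open>Both the linear and the Duhamel part are Hoelder continuous with exponent 1/(2p) and a
  time singularity of order - 3/(2p), which on (t/2, 2t) is bounded by its value at t/2. Continuity
  in time is part of membership in the solution space.\<close>

lemma fixed_point_continuous:
  assumes h: "data_bound \<rho> h" and H: "curve_bound M H" and fp: "\<And>t \<xi>. t > 0 \<Longrightarrow> \<xi> \<noteq> 0 \<Longrightarrow> Phi h H t \<xi> = H t \<xi>" and t: "t > 0"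
  shows "\<exists>C\<ge>0. \<forall>s. t / 2 < s \<and> s < 2 * t \<longrightarrow> (\<forall>\<xi>. \<xi> \<noteq> 0 \<longrightarrow>
    qnorm \<xi> (H s \<xi> - H t \<xi>) \<le> C * \<bar>s - t\<bar> powr (1 / (2 * p)) * norm \<xi> powr - r1)"
proof -
  define b where "b = 1 / (2 * p)"
  have b: "0 < b" "b \<le> 1" "1 / p = 2 * b" using p2 by (auto simp: b_def field_simps)
  have T: "0 < 2 * t" using t by simp
  define N where "N = nonlin H"
  define Q where "Q = cB * M * M"
  have N: "source_bound Q N" unfolding N_def Q_def by (rule nonlin_source_bound[OF H])
  have Q0: "0 \<le> Q" using N by (simp add: source_bound_def)
  have \<rho>: "0 \<le> \<rho>" using h by (simp add: data_bound_def)
  obtain C1 where C1: "C1 \<ge> 0" "\<And>\<xi> t1 t2. \<xi> \<noteq> 0 \<Longrightarrow> 0 < t1 \<Longrightarrow> t1 < t2 \<Longrightarrow> t2 \<le> 2 * t \<Longrightarrow>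
    qnorm \<xi> (duhamel N t2 \<xi> - duhamel N t1 \<xi>) \<le> C1 * Q * (t2 - t1) powr b * (t1 powr - (3 / (2 * p)) + t2 powr - (3 / (2 * p))) * norm \<xi> powr - r1"
    using duhamel_hoelder[OF T] N unfolding b_def by blast
  have a0: "0 \<le> 2 / p" using p_facts(1) by linarith
  obtain C2 where C2: "C2 > 0" "\<And>\<xi> :: real^'d. \<And>z s \<delta>. s > 0 \<Longrightarrow> \<delta> \<ge> 0 \<Longrightarrow> s + \<delta> \<le> 2 * t \<Longrightarrow>
    norm \<xi> powr (2 / p) * qnorm \<xi> (sg (s + \<delta>) \<xi> z - sg s \<xi> z) \<le> C2 * \<delta> powr b * s powr (- b - (2 / p) / 2) * qnorm \<xi> z"
    using sg_smoothing_hoelder[OF a0 less_imp_le[OF b(1)] b(2) T, where 'd='d] by blast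
  define w where "w = (t / 2) powr - (3 / (2 * p))"
  have w0: "0 \<le> w" by (simp add: w_def)
  have e3: "- b - (2 / p) / 2 = - (3 / (2 * p))" using p2 by (simp add: b_def field_simps)
  have ww: "s powr - (3 / (2 * p)) \<le> w" if "t / 2 \<le> s" for s
    unfolding w_def using that t p2 by (intro powr_mono2') auto
  define C where "C = C1 * Q * (w + w) + C2 * w * \<rho>"
  have key: "qnorm \<xi> (H t2 \<xi> - H t1 \<xi>) \<le> C * (t2 - t1) powr b * norm \<xi> powr - r1"
    if a: "t / 2 \<le> t1" "t1 < t2" "t2 \<le> 2 * t" and \<xi>: "\<xi> \<noteq> 0" for t1 t2 and \<xi> :: "real^'d"
  proof -
    have p1: "0 < t1" "0 < t2" using a t by auto
    have "qnorm \<xi> (duhamel N t2 \<xi> - duhamel N t1 \<xi>) \<le> C1 * Q * (t2 - t1) powr b * (t1 powr - (3 / (2 * p)) + t2 powr - (3 / (2 * p))) * norm \<xi> powr - r1"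
      using a p1 \<xi> by (intro C1) auto
    also have "\<dots> \<le> C1 * Q * (t2 - t1) powr b * (w + w) * norm \<xi> powr - r1"
      using C1(1) Q0 a by (intro mult_right_mono mult_left_mono add_mono ww) auto
    finally have 1: "qnorm \<xi> (duhamel N t2 \<xi> - duhamel N t1 \<xi>) \<le> C1 * Q * (w + w) * (t2 - t1) powr b * norm \<xi> powr - r1" by (simp only: mult_ac)
    have "norm \<xi> powr (2 / p) * qnorm \<xi> (sg (t1 + (t2 - t1)) \<xi> (h \<xi>) - sg t1 \<xi> (h \<xi>)) \<le> C2 * (t2 - t1) powr b * t1 powr (- b - (2 / p) / 2) * qnorm \<xi> (h \<xi>)"
      using a p1 by (intro C2) auto
    also have "\<dots> \<le> C2 * (t2 - t1) powr b * w * (\<rho> * norm \<xi> powr - (real CARD('d) - 1))"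
      unfolding e3 using C2(1) w0 a h \<xi> by (intro mult_mono mult_left_mono ww qnorm_nonneg) (auto simp: data_bound_def)
    finally have "qnorm \<xi> (sg (t1 + (t2 - t1)) \<xi> (h \<xi>) - sg t1 \<xi> (h \<xi>)) \<le> C2 * (t2 - t1) powr b * w * \<rho> * norm \<xi> powr - r1"
      using \<xi> by (rule divide_weight')
    then have 2: "qnorm \<xi> (sg t2 \<xi> (h \<xi>) - sg t1 \<xi> (h \<xi>)) \<le> C2 * w * \<rho> * (t2 - t1) powr b * norm \<xi> powr - r1" by (simp add: mult_ac)
    have "H t2 \<xi> - H t1 \<xi> = (duhamel N t2 \<xi> - duhamel N t1 \<xi>) + (sg t2 \<xi> (h \<xi>) - sg t1 \<xi> (h \<xi>))"
      unfolding fp[OF p1(1) \<xi>, symmetric] fp[OF p1(2) \<xi>, symmetric] by (simp add: Phi_def N_def)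
    then have "qnorm \<xi> (H t2 \<xi> - H t1 \<xi>) \<le> C1 * Q * (w + w) * (t2 - t1) powr b * norm \<xi> powr - r1 + C2 * w * \<rho> * (t2 - t1) powr b * norm \<xi> powr - r1"
      using order_trans[OF qnorm_triangle add_mono[OF 1 2]] by simp
    then show ?thesis by (simp only: C_def distrib_right)
  qed
  have C0: "0 \<le> C" using C1(1) C2(1) Q0 w0 \<rho> by (simp add: C_def)
  have "qnorm \<xi> (H s \<xi> - H t \<xi>) \<le> C * \<bar>s - t\<bar> powr b * norm \<xi> powr - r1" if s: "t / 2 < s" "s < 2 * t" and \<xi>: "\<xi> \<noteq> 0" for s \<xi>
  proof (cases s t rule: linorder_cases)
    case less
    have "qnorm \<xi> (H t \<xi> - H s \<xi>) \<le> C * (t - s) powr b * norm \<xi> powr - r1" using s less t by (intro key \<xi>) auto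
    then show ?thesis using less qnorm_minus[of \<xi> "H t \<xi> - H s \<xi>"] by simp
  next
    case equal
    then show ?thesis using C0 by simp
  next
    case greater
    have "qnorm \<xi> (H s \<xi> - H t \<xi>) \<le> C * (s - t) powr b * norm \<xi> powr - r1" using s greater t by (intro key \<xi>) auto
    then show ?thesis using greater by simp
  qed
  with C0 show ?thesis unfolding b_def by blast
qed

end

section \<open>Norms of distributions read off any Fourier representative\<close>

lemma PM_norm_le:
  assumes T: "has_fourier_fun T h" and "0 \<le> C" and "AE \<xi> in lborel. norm \<xi> powr r * cmod (h \<xi>) \<le> C"
  shows "PM_norm r T \<le> ennreal C"
  unfolding PM_norm_def
proof (subst weighted_sup_le_iff[OF has_fourier_fun_measurable[OF fourier_fun_AE(2)[OF T]] assms(2)])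
  show "AE \<xi> in lborel. norm \<xi> powr r * norm (fourier_fun T \<xi>) \<le> C"
    using fourier_fun_AE(1)[OF T] assms(3) by eventually_elim simp
qed

lemma fourier_fun_vec_AE:
  fixes u :: "'d::finite dist ^ 'd"
  assumes "\<And>j. has_fourier_fun (u $ j) (\<lambda>\<xi>. h \<xi> $ j)"
  shows "AE \<xi> in lborel. fourier_fun_vec u \<xi> = h \<xi>" "fourier_fun_vec u \<in> borel_measurable borel"
proof -
  have "AE \<xi> in lborel. \<forall>j\<in>UNIV. fourier_fun (u $ j) \<xi> = h \<xi> $ j"
    by (rule AE_finite_allI) (auto intro: fourier_fun_AE(1) assms)
  then show "AE \<xi> in lborel. fourier_fun_vec u \<xi> = h \<xi>"
    by eventually_elim (auto simp: fourier_fun_vec_def vec_eq_iff)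
  show "fourier_fun_vec u \<in> borel_measurable borel" unfolding fourier_fun_vec_def[abs_def]
    by (intro vec_lambda_measurable has_fourier_fun_measurable[OF fourier_fun_AE(2)[OF assms]])
qed

lemma PM_vec_norm_le:
  fixes u :: "'d::finite dist ^ 'd"
  assumes u: "\<And>j. has_fourier_fun (u $ j) (\<lambda>\<xi>. h \<xi> $ j)" and "0 \<le> C" and "AE \<xi> in lborel. norm \<xi> powr r * norm (h \<xi>) \<le> C"
  shows "PM_vec_norm r u \<le> ennreal C"
  unfolding PM_vec_norm_def
proof (subst weighted_sup_le_iff[OF fourier_fun_vec_AE(2)[OF u] assms(2)])
  show "AE \<xi> in lborel. norm \<xi> powr r * norm (fourier_fun_vec u \<xi>) \<le> C"
    using fourier_fun_vec_AE(1)[OF u] assms(3) by eventually_elim simp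
qed

lemma component_bounded_linear: "bounded_linear (\<lambda>z::complex \<times> (complex^'d::finite). snd z $ j)"
  by (rule bounded_linear_compose[OF bounded_linear_vec_nth bounded_linear_snd])

context nsk_crit
begin

section \<open>Existence\<close>

text \<open>Equations between distributions are tested one component \<open>l\<close> of the state at a time; \<open>\<omega>\<close> is the
  weight with which that component enters \<^const>\<open>qnorm\<close>.\<close>

definition test_functional :: "('d state \<Rightarrow> complex) \<Rightarrow> (real^'d \<Rightarrow> real) \<Rightarrow> bool" where
  "test_functional l \<omega> \<longleftrightarrow> bounded_linear l \<and> \<omega> \<in> borel_measurable borel \<and> (\<forall>\<xi>. 0 \<le> \<omega> \<xi> \<and> \<omega> \<xi> \<le> 1) \<and> (\<forall>\<xi> z. cmod (l z) \<le> \<omega> \<xi> * qnorm \<xi> z)"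

lemma test_functional_fst: "test_functional fst (\<lambda>\<xi>. 1 / (1 + norm \<xi>))"
  unfolding test_functional_def
proof (intro conjI allI bounded_linear_fst)
  fix \<xi> :: "real^'d" and z :: "'d state"
  have "0 < 1 + norm \<xi>" using norm_ge_zero[of \<xi>] by linarith
  then show "cmod (fst z) \<le> 1 / (1 + norm \<xi>) * qnorm \<xi> z" using qnorm_fst[of \<xi> z] by (simp add: pos_le_divide_eq mult.commute)
  show "1 / (1 + norm \<xi>) \<le> 1" using frac_le[of 1 1 1 "1 + norm \<xi>"] by simp
qed auto

lemma test_functional_snd: "test_functional (\<lambda>z. snd z $ j) (\<lambda>_. 1)"
  unfolding test_functional_def
proof (intro conjI allI component_bounded_linear)
  fix \<xi> :: "real^'d" and z :: "'d state"
  show "cmod (snd z $ j) \<le> 1 * qnorm \<xi> z"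
    unfolding mult_1 by (rule order_trans[OF Finite_Cartesian_Product.norm_nth_le qnorm_snd])
qed auto

lemma test_functional_measurable:
  assumes "test_functional l \<omega>" "f \<in> borel_measurable M" shows "(\<lambda>x. l (f x)) \<in> borel_measurable M"
proof -
  have "continuous_on UNIV l" using assms(1) by (auto simp: test_functional_def intro: linear_continuous_on)
  from measurable_compose[OF assms(2) borel_measurable_continuous_onI[OF this]] show ?thesis .
qed

lemma weight_test_integrable:
  assumes "\<psi> \<in> schwartz"
  shows "integrable lborel (\<lambda>\<xi>::real^'d. norm \<xi> powr - r1 * cmod (\<psi> \<xi>))"
proof -
  have "tame (\<lambda>\<xi>::real^'d. complex_of_real (norm \<xi> powr - r1))"
    by (rule tame_power_bound[where C = 1 and r = r1]) (use r_facts in \<open>auto intro!: AE_I2\<close>)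
  from integrable_norm[OF tame_test_integrable[OF this assms]] show ?thesis by (simp add: norm_mult)
qed

lemma curve_bound_duhamel:
  assumes N: "source_bound Q N" shows "curve_bound (cD * Q) (duhamel N)"
  unfolding curve_bound_def using duhamel_measurable[OF N] duhamel_bound[OF N] N cD_nonneg
  by (auto simp: source_bound_def wt_def mult_ac simp del: case_prod_eta)

text \<open>Fubini in (s, \<xi>), with the beta kernel times |\<xi>|^-\<open>r1\<close>
  |\<psi>(\<xi>)| as majorant: the weak time integral in the definition of a solution is the pairing
  with the pointwise Duhamel integral. Joint measurability of the source is used here.\<close>

lemma duhamel_test:
  assumes N: "source_bound Q N" and t: "t > 0" and \<phi>: "\<phi> \<in> schwartz" and l: "test_functional l \<omega>"
  shows "set_integrable lborel {0<..<t} (\<lambda>s. dist_with_fourier (\<lambda>\<xi>. l (sg (t - s) \<xi> (N s \<xi>))) \<phi>)"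
    and "(LBINT s:{0<..<t}. dist_with_fourier (\<lambda>\<xi>. l (sg (t - s) \<xi> (N s \<xi>))) \<phi>) = (\<integral>\<xi>. l (duhamel N t \<xi>) * inv_fourier \<phi> \<xi> \<partial>lborel)"
proof -
  define \<psi> where "\<psi> = inv_fourier \<phi>"
  have \<psi>: "\<psi> \<in> schwartz" unfolding \<psi>_def by (rule inv_fourier_schwartz[OF \<phi>])
  have [measurable]: "\<psi> \<in> borel_measurable borel" by (rule schwartz_measurable[OF \<psi>])
  have bl: "bounded_linear l" using l by (simp add: test_functional_def)
  have lq: "cmod (l z) \<le> qnorm \<xi> z" for \<xi> z
  proof -
    have "cmod (l z) \<le> \<omega> \<xi> * qnorm \<xi> z" using l unfolding test_functional_def by blast
    also have "\<dots> \<le> 1 * qnorm \<xi> z" using l by (intro mult_right_mono qnorm_nonneg) (auto simp: test_functional_def)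
    finally show ?thesis by simp
  qed
  have Q: "0 \<le> Q" using N by (simp add: source_bound_def)
  define G where "G s \<xi> = l (indicator {0<..<t} s *\<^sub>R sg (t - s) \<xi> (N s \<xi>)) * \<psi> \<xi>" for s \<xi>
  have Nm: "(\<lambda>y. N (fst y) (snd y)) \<in> borel_measurable (borel \<Otimes>\<^sub>M borel)"
    using N by (simp add: source_bound_def case_prod_beta' del: case_prod_eta)
  have i: "(\<lambda>y :: real \<times> (real^'d). indicator {0<..<t} (fst y) :: real) \<in> borel_measurable (borel \<Otimes>\<^sub>M borel)"
    by measurable
  have "(\<lambda>y. l (indicator {0<..<t} (fst y) *\<^sub>R sg (t - fst y) (snd y) (N (fst y) (snd y))) * \<psi> (snd y)) \<in> borel_measurable (borel \<Otimes>\<^sub>M borel)"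
    by (intro borel_measurable_times test_functional_measurable[OF l] borel_measurable_scaleR i sg_measurable Nm) measurable
  then have Gm: "case_prod G \<in> borel_measurable (lborel \<Otimes>\<^sub>M lborel)"
    by (simp add: G_def case_prod_beta' cong: measurable_cong_sets)
  have Gi: "integrable (lborel \<Otimes>\<^sub>M lborel) (case_prod G)"
  proof (rule Bochner_Integration.integrable_bound[OF _ Gm])
    show "integrable (lborel \<Otimes>\<^sub>M lborel) (\<lambda>(s, \<xi>). bk (1 / p) t s * (cS * Q * (norm (\<xi> :: real^'d) powr - r1 * cmod (\<psi> \<xi>))))"
      using p_facts(3) t by (intro integrable_pair_mult bk_integrable integrable_mult_right weight_test_integrable \<psi>)
    have "AE y in lborel \<Otimes>\<^sub>M lborel. snd y \<noteq> (0 :: real^'d)"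
    proof (rule lborel_pair.AE_pair_measure)
      show "{x \<in> space (lborel \<Otimes>\<^sub>M lborel). snd x \<noteq> (0 :: real^'d)} \<in> sets (lborel \<Otimes>\<^sub>M lborel)" by measurable
      show "AE x in lborel. AE y in lborel. snd (x, y) \<noteq> (0 :: real^'d)" using AE_lborel_singleton[of "0 :: real^'d"] by simp
    qed
    then show "AE y in lborel \<Otimes>\<^sub>M lborel. norm (case_prod G y) \<le> norm (case y of (s, \<xi>) \<Rightarrow> bk (1 / p) t s * (cS * Q * (norm (\<xi> :: real^'d) powr - r1 * cmod (\<psi> \<xi>))))"
    proof eventually_elim
      case (elim y)
      obtain s \<xi> where y: "y = (s, \<xi>)" by (cases y)
      have \<xi>: "\<xi> \<noteq> 0" using elim y by simp
      have "norm (G s \<xi>) \<le> qnorm \<xi> (indicator {0<..<t} s *\<^sub>R sg (t - s) \<xi> (N s \<xi>)) * cmod (\<psi> \<xi>)"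
        unfolding G_def norm_mult by (intro mult_right_mono lq) simp
      also have "\<dots> \<le> (cS * Q * norm \<xi> powr - r1 * bk (1 / p) t s) * cmod (\<psi> \<xi>)"
        by (intro mult_right_mono duhamel_integrand_bound[OF N \<xi>]) simp
      also have "\<dots> = bk (1 / p) t s * (cS * Q * (norm \<xi> powr - r1 * cmod (\<psi> \<xi>)))" by (simp only: mult_ac)
      also have "\<dots> \<le> norm (bk (1 / p) t s * (cS * Q * (norm \<xi> powr - r1 * cmod (\<psi> \<xi>))))" unfolding real_norm_def by (rule abs_ge_self)
      finally show ?case by (simp add: y)
    qed
  qed
  have e1: "(\<integral>\<xi>. G s \<xi> \<partial>lborel) = indicator {0<..<t} s *\<^sub>R dist_with_fourier (\<lambda>\<xi>. l (sg (t - s) \<xi> (N s \<xi>))) \<phi>" for s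
  proof (cases "s \<in> {0<..<t}")
    case True
    then show ?thesis by (simp add: G_def dist_with_fourier_apply[OF \<phi>] \<psi>_def)
  next
    case False
    then show ?thesis by (simp add: G_def linear_0[OF bounded_linear.linear[OF bl]])
  qed
  have si: "integrable lborel (\<lambda>s. indicator {0<..<t} s *\<^sub>R dist_with_fourier (\<lambda>\<xi>. l (sg (t - s) \<xi> (N s \<xi>))) \<phi>)"
    unfolding e1[symmetric] using lborel_pair.integrable_fst[OF Gi] .
  then show "set_integrable lborel {0<..<t} (\<lambda>s. dist_with_fourier (\<lambda>\<xi>. l (sg (t - s) \<xi> (N s \<xi>))) \<phi>)"
    unfolding set_integrable_def .
  have "(LBINT s:{0<..<t}. dist_with_fourier (\<lambda>\<xi>. l (sg (t - s) \<xi> (N s \<xi>))) \<phi>) = (\<integral>s. (\<integral>\<xi>. G s \<xi> \<partial>lborel) \<partial>lborel)"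
    unfolding set_lebesgue_integral_def e1 ..
  also have "\<dots> = (\<integral>\<xi>. (\<integral>s. G s \<xi> \<partial>lborel) \<partial>lborel)" by (rule lborel_pair.Fubini_integral[OF Gi, symmetric])
  also have "\<dots> = (\<integral>\<xi>. l (duhamel N t \<xi>) * \<psi> \<xi> \<partial>lborel)"
  proof (rule integral_cong_AE)
    show "(\<lambda>\<xi>. \<integral>s. G s \<xi> \<partial>lborel) \<in> borel_measurable lborel"
      using borel_measurable_integrable[OF lborel_pair.integrable_snd[OF Gi]] .
    have "duhamel N t \<in> borel_measurable borel" by (rule slice_measurable[OF duhamel_measurable[OF N]])
    from test_functional_measurable[OF l this] show "(\<lambda>\<xi>. l (duhamel N t \<xi>) * \<psi> \<xi>) \<in> borel_measurable lborel" by measurable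
    show "AE \<xi> in lborel. (\<integral>s. G s \<xi> \<partial>lborel) = l (duhamel N t \<xi>) * \<psi> \<xi>"
      using AE_lborel_singleton[of "0 :: real^'d"]
    proof eventually_elim
      case (elim \<xi>)
      show ?case unfolding G_def integral_mult_left_zero duhamel_def set_lebesgue_integral_def
        using integral_bounded_linear[OF bl duhamel_integrable[OF N elim t]] by simp
    qed
  qed
  finally show "(LBINT s:{0<..<t}. dist_with_fourier (\<lambda>\<xi>. l (sg (t - s) \<xi> (N s \<xi>))) \<phi>) = (\<integral>\<xi>. l (duhamel N t \<xi>) * inv_fourier \<phi> \<xi> \<partial>lborel)"
    by (simp add: \<psi>_def)
qed

lemma B_measurable:
  assumes "H \<in> borel_measurable borel" shows "B H H \<in> borel_measurable borel"
proof -
  have "case_prod (\<lambda>_::real^'d. H) \<in> borel_measurable (borel \<Otimes>\<^sub>M borel)"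
    using measurable_compose[OF measurable_snd assms] by (simp add: case_prod_beta')
  from B_param_measurable[OF this, of "\<lambda>x. x"] show ?thesis by simp
qed

lemma semigroup_nonlinearity:
  assumes K: "freq_bound M H" and au: "fourier_pair a u H"
  shows "nsk_semigroup \<mu> \<nu> \<kappa> \<alpha> \<tau> (nsk_f u a, nsk_g \<mu> \<nu> \<kappa> u a)
    = (dist_with_fourier (\<lambda>\<xi>. fst (sg \<tau> \<xi> (B H H \<xi>))), \<chi> j. dist_with_fourier (\<lambda>\<xi>. snd (sg \<tau> \<xi> (B H H \<xi>)) $ j))"
  by (rule nsk_semigroup_eq[OF B_measurable[OF freq_bound_measurable(1)[OF K]] nsk_terms_fourier[OF K au]])

lemma semigroup_data:
  assumes h: "data_bound \<rho> h" and au: "fourier_pair a0 u0 h"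
  shows "nsk_semigroup \<mu> \<nu> \<kappa> \<alpha> \<tau> (a0, u0) = (dist_with_fourier (\<lambda>\<xi>. fst (sg \<tau> \<xi> (h \<xi>))), \<chi> j. dist_with_fourier (\<lambda>\<xi>. snd (sg \<tau> \<xi> (h \<xi>)) $ j))"
  by (rule nsk_semigroup_eq) (use h au in \<open>auto simp: data_bound_def fourier_pair_def\<close>)

lemma qnorm_weight_components:
  assumes "qnorm \<xi> z \<le> C * norm \<xi> powr - r1" "\<xi> \<noteq> 0"
  shows "norm \<xi> powr r1 * cmod (fst z) \<le> C" "norm \<xi> powr (r1 + 1) * cmod (fst z) \<le> C" "norm \<xi> powr r1 * norm (snd z) \<le> C"
proof -
  have "norm \<xi> powr r1 * qnorm \<xi> z \<le> norm \<xi> powr r1 * (C * norm \<xi> powr - r1)" by (intro mult_left_mono assms) simp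
  also have "\<dots> = C" using assms(2) by (simp add: powr_minus)
  finally have q: "norm \<xi> powr r1 * qnorm \<xi> z \<le> C" .
  have 1: "cmod (fst z) \<le> qnorm \<xi> z" by (rule order_trans[OF _ qnorm_fst]) (simp add: distrib_right)
  have 2: "norm \<xi> * cmod (fst z) \<le> qnorm \<xi> z" by (rule order_trans[OF _ qnorm_fst]) (simp add: distrib_right)
  show "norm \<xi> powr r1 * cmod (fst z) \<le> C" by (rule order_trans[OF mult_left_mono[OF 1] q]) simp
  show "norm \<xi> powr r1 * norm (snd z) \<le> C" by (rule order_trans[OF mult_left_mono[OF qnorm_snd] q]) simp
  have "norm \<xi> powr (r1 + 1) = norm \<xi> powr r1 * norm \<xi>" using assms(2) by (simp add: powr_add)
  then show "norm \<xi> powr (r1 + 1) * cmod (fst z) \<le> C"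
    using order_trans[OF mult_left_mono[OF 2] q] by (simp add: mult.assoc)
qed

lemma r1_eqs: "real CARD('d) - 1 + 2 / p = r1" "real CARD('d) + 2 / p = r1 + 1"
  by (auto simp: r1_def)

lemma fourier_pair_norms:
  assumes au: "fourier_pair a u H" and C: "0 \<le> C" and b: "AE \<xi> in lborel. qnorm \<xi> (H \<xi>) \<le> C * norm \<xi> powr - r1"
  shows "PM_norm r1 a \<le> ennreal C" "PM_norm (r1 + 1) a \<le> ennreal C" "PM_vec_norm r1 u \<le> ennreal C"
proof -
  have a: "has_fourier_fun a (\<lambda>\<xi>. fst (H \<xi>))" and u: "\<And>j. has_fourier_fun (u $ j) (\<lambda>\<xi>. snd (H \<xi>) $ j)"
    using au by (auto simp: fourier_pair_def)
  note b' = AE_conjI[OF b AE_lborel_singleton[of "0 :: real^'d"]]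
  show "PM_norm r1 a \<le> ennreal C"
    by (rule PM_norm_le[OF a C]) (use b' in eventually_elim, use qnorm_weight_components(1) in blast)
  show "PM_norm (r1 + 1) a \<le> ennreal C"
    by (rule PM_norm_le[OF a C]) (use b' in eventually_elim, use qnorm_weight_components(2) in blast)
  show "PM_vec_norm r1 u \<le> ennreal C"
    by (rule PM_vec_norm_le[OF u C]) (use b' in eventually_elim, use qnorm_weight_components(3) in blast)
qed

lemma ennreal_time_weight:
  assumes "t > 0" "0 \<le> M" "X \<le> ennreal (M * t powr - (1 / p))"
  shows "ennreal (t powr (1 / p)) * X \<le> ennreal M"
proof -
  have "ennreal (t powr (1 / p)) * X \<le> ennreal (t powr (1 / p)) * ennreal (M * t powr - (1 / p))" by (intro mult_left_mono assms) simp
  also have "\<dots> = ennreal (t powr (1 / p) * (M * t powr - (1 / p)))" using assms by (simp add: ennreal_mult)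
  also have "t powr (1 / p) * (M * t powr - (1 / p)) = M" using assms by (simp add: powr_minus)
  finally show ?thesis .
qed

lemma tendsto_of_hoelder:
  assumes t: "t > 0" and C: "0 \<le> C" and X: "\<And>s. t / 2 < s \<Longrightarrow> s < 2 * t \<Longrightarrow> X s \<le> ennreal (C * \<bar>s - t\<bar> powr (1 / (2 * p)))"
  shows "(X \<longlongrightarrow> 0) (at t)"
proof (rule tendsto_sandwich[OF _ _ tendsto_const])
  show "\<forall>\<^sub>F s in at t. 0 \<le> X s" by simp
  have "\<forall>\<^sub>F s in at t. s \<in> {t/2<..<2*t}"
    by (rule eventually_at_in_open') (use t in auto)
  then show "\<forall>\<^sub>F s in at t. X s \<le> ennreal (C * \<bar>s - t\<bar> powr (1 / (2 * p)))"
    by eventually_elim (use X in auto)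
  have "((\<lambda>s. C * \<bar>s - t\<bar> powr (1 / (2 * p))) \<longlongrightarrow> C * \<bar>t - t\<bar> powr (1 / (2 * p))) (at t)"
    by (intro tendsto_intros tendsto_powr') (use p2 in auto)
  then have "((\<lambda>s. ennreal (C * \<bar>s - t\<bar> powr (1 / (2 * p)))) \<longlongrightarrow> ennreal (C * \<bar>t - t\<bar> powr (1 / (2 * p)))) (at t)"
    by (rule tendsto_ennrealI)
  then show "((\<lambda>s. ennreal (C * \<bar>s - t\<bar> powr (1 / (2 * p)))) \<longlongrightarrow> 0) (at t)" using p2 by simp
qed

text \<open>The distributions are defined from the fixed point by inverse transform. The norm is at
  most 2 M because \<open>X_norm\<close> adds a density part and a velocity part, each at most
  M.\<close>

lemma existence:
  assumes h: "data_bound \<rho> h" and au0: "fourier_pair a0 u0 h"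
    and M: "0 \<le> M" "cL * \<rho> \<le> M / 2" "cD * (2 * cB * M) \<le> 1 / 2"
  shows "\<exists>a u. nsk_mild_solution p \<mu> \<nu> \<kappa> \<alpha> (a0, u0) (a, u) \<and> X_norm p (a, u) \<le> ennreal (2 * M)"
proof -
  obtain H where H: "curve_bound M H" and fp: "\<And>t \<xi>. t > 0 \<Longrightarrow> \<xi> \<noteq> 0 \<Longrightarrow> Phi h H t \<xi> = H t \<xi>"
    using Phi_fixed_point[OF h M] by blast
  define a where "a t = dist_with_fourier (\<lambda>\<xi>. fst (H t \<xi>))" for t
  define u :: "real \<Rightarrow> 'd dist ^ 'd" where "u t = (\<chi> j. dist_with_fourier (\<lambda>\<xi>. snd (H t \<xi>) $ j))" for t
  have K: "freq_bound (M * t powr - (1 / p)) (H t)" if "t > 0" for t by (rule curve_bound_freq_bound[OF H that])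
  have fpair: "fourier_pair (a t) (u t) (H t)" if "t > 0" for t
    unfolding fourier_pair_def a_def u_def using freq_bound_tame[OF K[OF that]] by (auto intro: dist_with_fourier_fourier)
  have temp: "a t \<in> tempered" "u t $ j \<in> tempered" if "t > 0" for t j
    unfolding a_def u_def using freq_bound_tame[OF K[OF that]] by (auto intro: dist_with_fourier_tempered)
  have nrm: "PM_norm r1 (a t) \<le> ennreal (M * t powr - (1 / p))" "PM_norm (r1 + 1) (a t) \<le> ennreal (M * t powr - (1 / p))"
    "PM_vec_norm r1 (u t) \<le> ennreal (M * t powr - (1 / p))" if "t > 0" for t
    using fourier_pair_norms[OF fpair[OF that]] K[OF that] by (auto simp: freq_bound_def)
  have Kn: "K_norm p (real CARD('d) - 1) a \<le> ennreal M" "K_norm p (real CARD('d)) a \<le> ennreal M" "K_vec_norm p (real CARD('d) - 1) u \<le> ennreal M"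
    unfolding K_norm_def K_vec_norm_def r1_eqs by (intro SUP_least ennreal_time_weight M nrm; simp)+
  have cont: "((\<lambda>s. PM_norm r1 (dist_diff (a s) (a t))) \<longlongrightarrow> 0) (at t)" "((\<lambda>s. PM_norm (r1 + 1) (dist_diff (a s) (a t))) \<longlongrightarrow> 0) (at t)"
    "((\<lambda>s. PM_vec_norm r1 (\<chi> j. dist_diff (u s $ j) (u t $ j))) \<longlongrightarrow> 0) (at t)" if t: "t > 0" for t
  proof -
    obtain C where C: "C \<ge> 0" "\<And>s \<xi>. t / 2 < s \<Longrightarrow> s < 2 * t \<Longrightarrow> \<xi> \<noteq> 0 \<Longrightarrow>
      qnorm \<xi> (H s \<xi> - H t \<xi>) \<le> C * \<bar>s - t\<bar> powr (1 / (2 * p)) * norm \<xi> powr - r1"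
      using fixed_point_continuous[OF h H fp t] by blast
    have "PM_norm r1 (dist_diff (a s) (a t)) \<le> ennreal (C * \<bar>s - t\<bar> powr (1 / (2 * p)))
      \<and> PM_norm (r1 + 1) (dist_diff (a s) (a t)) \<le> ennreal (C * \<bar>s - t\<bar> powr (1 / (2 * p)))
      \<and> PM_vec_norm r1 (\<chi> j. dist_diff (u s $ j) (u t $ j)) \<le> ennreal (C * \<bar>s - t\<bar> powr (1 / (2 * p)))"
      if s: "t / 2 < s" "s < 2 * t" for s
    proof -
      have s0: "s > 0" using s t by linarith
      have "fourier_pair (dist_diff (a s) (a t)) (\<chi> j. dist_diff (u s $ j) (u t $ j)) (\<lambda>\<xi>. H s \<xi> - H t \<xi>)"
        using fpair[OF s0] fpair[OF t] by (auto simp: fourier_pair_def intro!: has_fourier_fun_diff)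
      moreover have "AE \<xi> in lborel. qnorm \<xi> (H s \<xi> - H t \<xi>) \<le> C * \<bar>s - t\<bar> powr (1 / (2 * p)) * norm \<xi> powr - r1"
        using AE_lborel_singleton[of "0 :: real^'d"] by eventually_elim (use C(2) s in blast)
      ultimately show ?thesis using C(1) by (intro conjI fourier_pair_norms) auto
    qed
    then show "((\<lambda>s. PM_norm r1 (dist_diff (a s) (a t))) \<longlongrightarrow> 0) (at t)" "((\<lambda>s. PM_norm (r1 + 1) (dist_diff (a s) (a t))) \<longlongrightarrow> 0) (at t)"
      "((\<lambda>s. PM_vec_norm r1 (\<chi> j. dist_diff (u s $ j) (u t $ j))) \<longlongrightarrow> 0) (at t)"
      by (intro tendsto_of_hoelder[OF t C(1)]; blast)+
  qed
  have hf: "\<exists>h. has_fourier_fun (a t) h" "\<exists>h. has_fourier_fun (u t $ j) h" if "t > 0" for t j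
    using fpair[OF that] by (auto simp: fourier_pair_def)
  have lt: "x \<le> ennreal c \<Longrightarrow> x < top" for x c by (rule le_less_trans[OF _ ennreal_less_top])
  have "a t \<in> PM r1" "a t \<in> PM (r1 + 1)" "u t \<in> PM_vec r1" if "t > 0" for t
    unfolding PM_def PM_vec_def infinity_ennreal_def using temp[OF that] hf[OF that] lt[OF nrm(1)[OF that]] lt[OF nrm(2)[OF that]] lt[OF nrm(3)[OF that]] by auto
  then have X: "(a, u) \<in> X_space p"
    unfolding X_space_def K_space_def K_vec_space_def r1_eqs infinity_ennreal_def
    using lt[OF Kn(1)] lt[OF Kn(2)] lt[OF Kn(3)] cont by simp
  have Xn: "X_norm p (a, u) \<le> ennreal (2 * M)"
  proof -
    have "X_norm p (a, u) \<le> ennreal M + ennreal M" unfolding X_norm_def using Kn by (auto intro!: add_mono)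
    also have "\<dots> = ennreal (2 * M)" using M(1) by (simp add: ennreal_plus[symmetric] del: ennreal_plus)
    finally show ?thesis .
  qed
  note N = nonlin_source_bound[OF H]
  \<comment> \<open>One computation for the density equation and for all velocity components, with
    the component \<open>l\<close> as a parameter.\<close>
  have main: "set_integrable lborel {0<..<t} (\<lambda>s. dist_with_fourier (\<lambda>\<xi>. l (sg (t - s) \<xi> (nonlin H s \<xi>))) \<phi>)"
    "dist_with_fourier (\<lambda>\<xi>. l (H t \<xi>)) \<phi> = dist_with_fourier (\<lambda>\<xi>. l (sg t \<xi> (h \<xi>))) \<phi>
      + (LBINT s:{0<..<t}. dist_with_fourier (\<lambda>\<xi>. l (sg (t - s) \<xi> (nonlin H s \<xi>))) \<phi>)"
    if t: "t > 0" and \<phi>: "\<phi> \<in> schwartz" and l: "test_functional l \<omega>" and tm: "\<And>M' H'. freq_bound M' H' \<Longrightarrow> tame (\<lambda>\<xi>. l (H' \<xi>))" for t \<phi> l \<omega>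
  proof -
    show "set_integrable lborel {0<..<t} (\<lambda>s. dist_with_fourier (\<lambda>\<xi>. l (sg (t - s) \<xi> (nonlin H s \<xi>))) \<phi>)"
      by (rule duhamel_test(1)[OF N t \<phi> l])
    have bl: "bounded_linear l" using l by (simp add: test_functional_def)
    have t1: "tame (\<lambda>\<xi>. l (sg t \<xi> (h \<xi>)))" by (rule tm[OF curve_bound_freq_bound[OF Lin_curve_bound[OF h] t]])
    have t2: "tame (\<lambda>\<xi>. l (duhamel (nonlin H) t \<xi>))" by (rule tm[OF curve_bound_freq_bound[OF curve_bound_duhamel[OF N] t]])
    have "AE \<xi> in lborel. l (H t \<xi>) = l (sg t \<xi> (h \<xi>)) + l (duhamel (nonlin H) t \<xi>)"
      using AE_lborel_singleton[of "0 :: real^'d"]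
    proof eventually_elim
      case (elim \<xi>)
      show ?case unfolding fp[OF t elim, symmetric] Phi_def by (rule linear_add[OF bounded_linear.linear[OF bl]])
    qed
    then have "dist_with_fourier (\<lambda>\<xi>. l (H t \<xi>)) = dist_with_fourier (\<lambda>\<xi>. l (sg t \<xi> (h \<xi>)) + l (duhamel (nonlin H) t \<xi>))"
      by (intro dist_with_fourier_cong_AE tame_measurable tame_add t1 t2 tm[OF K[OF t]])
    then have "dist_with_fourier (\<lambda>\<xi>. l (H t \<xi>)) \<phi> = (\<integral>\<xi>. l (sg t \<xi> (h \<xi>)) * inv_fourier \<phi> \<xi> + l (duhamel (nonlin H) t \<xi>) * inv_fourier \<phi> \<xi> \<partial>lborel)"
      by (simp add: dist_with_fourier_apply[OF \<phi>] distrib_right)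
    also have "\<dots> = dist_with_fourier (\<lambda>\<xi>. l (sg t \<xi> (h \<xi>))) \<phi> + (\<integral>\<xi>. l (duhamel (nonlin H) t \<xi>) * inv_fourier \<phi> \<xi> \<partial>lborel)"
      unfolding dist_with_fourier_apply[OF \<phi>] by (intro Bochner_Integration.integral_add tame_test_integrable t1 t2 inv_fourier_schwartz \<phi>)
    finally show "dist_with_fourier (\<lambda>\<xi>. l (H t \<xi>)) \<phi> = dist_with_fourier (\<lambda>\<xi>. l (sg t \<xi> (h \<xi>))) \<phi>
      + (LBINT s:{0<..<t}. dist_with_fourier (\<lambda>\<xi>. l (sg (t - s) \<xi> (nonlin H s \<xi>))) \<phi>)"
      unfolding duhamel_test(2)[OF N t \<phi> l] .
  qed
  have F: "nsk_semigroup \<mu> \<nu> \<kappa> \<alpha> (t - s) (nsk_f (u s) (a s), nsk_g \<mu> \<nu> \<kappa> (u s) (a s))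
      = (dist_with_fourier (\<lambda>\<xi>. fst (sg (t - s) \<xi> (nonlin H s \<xi>))), \<chi> j. dist_with_fourier (\<lambda>\<xi>. snd (sg (t - s) \<xi> (nonlin H s \<xi>)) $ j))"
    if "s > 0" for s t
    unfolding nonlin_def by (rule semigroup_nonlinearity[OF K[OF that] fpair[OF that]])
  have "nsk_mild_solution p \<mu> \<nu> \<kappa> \<alpha> (a0, u0) (a, u)"
    unfolding nsk_mild_solution_def Let_def prod.case
  proof (intro conjI X allI impI ballI)
    fix t :: real and \<phi> :: "real^'d \<Rightarrow> complex" assume t: "t > 0" and \<phi>: "\<phi> \<in> schwartz"
    let ?F = "\<lambda>s. nsk_semigroup \<mu> \<nu> \<kappa> \<alpha> (t - s) (nsk_f (u s) (a s), nsk_g \<mu> \<nu> \<kappa> (u s) (a s))"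
    note m1 = main[OF t \<phi> test_functional_fst freq_bound_tame(1)]
    note m2 = main[OF t \<phi> test_functional_snd freq_bound_tame(2)]
    \<comment> \<open>The time integrals only see s in (0, t), where the forcing has been identified
      on the Fourier side.\<close>
    have c1: "set_integrable lborel {0<..<t} (\<lambda>s. fst (?F s) \<phi>) = set_integrable lborel {0<..<t} (\<lambda>s. dist_with_fourier (\<lambda>\<xi>. fst (sg (t - s) \<xi> (nonlin H s \<xi>))) \<phi>)"
      by (rule set_integrable_cong) (auto simp: F)
    have c2: "(LBINT s:{0<..<t}. fst (?F s) \<phi>) = (LBINT s:{0<..<t}. dist_with_fourier (\<lambda>\<xi>. fst (sg (t - s) \<xi> (nonlin H s \<xi>))) \<phi>)"
      by (rule set_lebesgue_integral_cong) (auto simp: F)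
    have c3: "set_integrable lborel {0<..<t} (\<lambda>s. (snd (?F s) $ j) \<phi>) = set_integrable lborel {0<..<t} (\<lambda>s. dist_with_fourier (\<lambda>\<xi>. snd (sg (t - s) \<xi> (nonlin H s \<xi>)) $ j) \<phi>)" for j
      by (rule set_integrable_cong) (auto simp: F)
    have c4: "(LBINT s:{0<..<t}. (snd (?F s) $ j) \<phi>) = (LBINT s:{0<..<t}. dist_with_fourier (\<lambda>\<xi>. snd (sg (t - s) \<xi> (nonlin H s \<xi>)) $ j) \<phi>)" for j
      by (rule set_lebesgue_integral_cong) (auto simp: F)
    show "set_integrable lborel {0<..<t} (\<lambda>s. fst (?F s) \<phi>)" unfolding c1 by (rule m1(1))
    show "a t \<phi> = fst (nsk_semigroup \<mu> \<nu> \<kappa> \<alpha> t (a0, u0)) \<phi> + (LBINT s:{0<..<t}. fst (?F s) \<phi>)"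
      unfolding c2 semigroup_data[OF h au0] a_def[of t] fst_conv by (rule m1(2))
    show "set_integrable lborel {0<..<t} (\<lambda>s. (snd (?F s) $ j) \<phi>)" for j unfolding c3 by (rule m2(1))
    show "(u t $ j) \<phi> = (snd (nsk_semigroup \<mu> \<nu> \<kappa> \<alpha> t (a0, u0)) $ j) \<phi> + (LBINT s:{0<..<t}. (snd (?F s) $ j) \<phi>)" for j
      unfolding c4 semigroup_data[OF h au0] u_def[of t] snd_conv vec_lambda_beta by (rule m2(2))
  qed
  with Xn show ?thesis by blast
qed

end

section \<open>Uniqueness\<close>

lemma has_fourier_fun_cong_AE:
  assumes T: "has_fourier_fun T g" and h: "tame h" and gh: "AE \<xi> in lborel. g \<xi> = h \<xi>"
  shows "has_fourier_fun T h"
proof (rule has_fourier_funI[OF h])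
  fix \<phi> :: "real^'a \<Rightarrow> complex" assume \<phi>: "\<phi> \<in> schwartz"
  have [measurable]: "g \<in> borel_measurable borel" "h \<in> borel_measurable borel" "\<phi> \<in> borel_measurable borel"
    by (rule has_fourier_fun_measurable[OF T] tame_measurable[OF h] schwartz_measurable[OF \<phi>])+
  have "(\<integral>\<xi>. g \<xi> * \<phi> \<xi> \<partial>lborel) = (\<integral>\<xi>. h \<xi> * \<phi> \<xi> \<partial>lborel)"
    by (intro integral_cong_AE) (use gh in \<open>auto elim: eventually_mono\<close>)
  then show "T (fourier \<phi>) = (\<integral>\<xi>. h \<xi> * \<phi> \<xi> \<partial>lborel)" by (simp add: has_fourier_funD(1)[OF T \<phi>])
qed

context nsk_crit
begin

text \<open>The factor 3 counts the summands |a0|, |\<xi>| |a0| and |u0| of \<open>qnorm\<close>,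
  each at most the Euclidean norm of the triple in \<open>data_norm\<close>.\<close>

lemma data_representative:
  assumes a0: "a0 \<in> PM (real CARD('d) - 1)" and u0: "u0 \<in> PM_vec (real CARD('d) - 1)"
    and n: "data_norm (real CARD('d) - 1) a0 u0 \<le> ennreal \<rho>" and \<rho>: "0 \<le> \<rho>"
  shows "\<exists>h. data_bound (3 * \<rho>) h \<and> fourier_pair a0 (u0 :: 'd dist ^ 'd) h"
proof -
  let ?r = "real CARD('d) - 1"
  define k where "k \<xi> = (fourier_fun a0 \<xi>, fourier_fun_vec u0 \<xi>)" for \<xi>
  \<comment> \<open>Setting the function to 0 where the bound fails changes it only on a null set,
    and afterwards the bound holds at every frequency.\<close>
  define h where "h \<xi> = (if qnorm \<xi> (k \<xi>) \<le> 3 * \<rho> * norm \<xi> powr - ?r then k \<xi> else 0)" for \<xi>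
  obtain h0 where "has_fourier_fun a0 h0" using a0 by (auto simp: PM_def)
  note a = fourier_fun_AE(2)[OF this]
  have u: "has_fourier_fun (u0 $ j) (fourier_fun (u0 $ j))" for j
    using u0 by (auto simp: PM_vec_def intro: fourier_fun_AE(2))
  have am[measurable]: "fourier_fun a0 \<in> borel_measurable borel" by (rule has_fourier_fun_measurable[OF a])
  have um[measurable]: "fourier_fun_vec u0 \<in> borel_measurable borel"
    unfolding fourier_fun_vec_def[abs_def] by (intro vec_lambda_measurable has_fourier_fun_measurable[OF u])
  have km[measurable]: "k \<in> borel_measurable borel" unfolding k_def by measurable
  have "(\<lambda>\<xi>. (fourier_fun a0 \<xi>, norm \<xi> *\<^sub>R fourier_fun a0 \<xi>, fourier_fun_vec u0 \<xi>)) \<in> borel_measurable borel"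
    by measurable
  note n' = n[unfolded data_norm_def weighted_sup_le_iff[OF this \<rho>]]
  have kb: "AE \<xi> in lborel. qnorm \<xi> (k \<xi>) \<le> 3 * \<rho> * norm \<xi> powr - ?r"
    using n' AE_lborel_singleton[of "0 :: real^'d"]
  proof eventually_elim
    case (elim \<xi>)
    let ?n = "norm (fourier_fun a0 \<xi>, norm \<xi> *\<^sub>R fourier_fun a0 \<xi>, fourier_fun_vec u0 \<xi>)"
    have s: "norm (norm \<xi> *\<^sub>R fourier_fun a0 \<xi>, fourier_fun_vec u0 \<xi>) \<le> ?n" by (rule norm_snd_le)
    have "cmod (fourier_fun a0 \<xi>) \<le> ?n" by (rule norm_fst_le)
    moreover have "norm (norm \<xi> *\<^sub>R fourier_fun a0 \<xi>) \<le> ?n" by (rule order_trans[OF norm_fst_le s])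
    moreover have "norm (fourier_fun_vec u0 \<xi>) \<le> ?n" by (rule order_trans[OF norm_snd_le s])
    ultimately have "qnorm \<xi> (k \<xi>) \<le> 3 * ?n" unfolding qnorm_def k_def by (simp add: distrib_right)
    also have "?n = norm \<xi> powr - ?r * (norm \<xi> powr ?r * ?n)"
      unfolding mult.assoc[symmetric] powr_add[symmetric] using elim(2) by simp
    also have "\<dots> \<le> norm \<xi> powr - ?r * \<rho>" by (intro mult_left_mono elim) simp
    finally show ?case by (simp add: mult_ac)
  qed
  have hk: "AE \<xi> in lborel. k \<xi> = h \<xi>" using kb by eventually_elim (simp add: h_def)
  have qm: "(\<lambda>\<xi>. qnorm \<xi> (k \<xi>)) \<in> borel_measurable borel"
    unfolding qnorm_def k_def by (simp, measurable)
  have hm: "h \<in> borel_measurable borel" unfolding h_def using qm by measurable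
  have hb: "qnorm \<xi> (h \<xi>) \<le> 3 * \<rho> * norm \<xi> powr - ?r" for \<xi> using \<rho> by (auto simp: h_def)
  have h: "data_bound (3 * \<rho>) h" unfolding data_bound_def using \<rho> hm hb by auto
  have fm: "(\<lambda>\<eta>. fst (h \<eta>)) \<in> borel_measurable borel"
    by (rule measurable_compose[OF hm borel_measurable_continuous_onI]) (intro continuous_intros)
  have sm: "(\<lambda>\<eta>. snd (h \<eta>) $ j) \<in> borel_measurable borel" for j
    by (rule measurable_compose[OF hm borel_measurable_continuous_onI[where f = "\<lambda>z. snd z $ j"]]) (intro continuous_intros)
  have r: "0 \<le> ?r" "?r < real CARD('d)" using dim(1) by auto
  have "tame (\<lambda>\<xi>. fst (h \<xi>))"
  proof (rule tame_of_bound[OF fm _ r])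
    show "cmod (fst (h \<xi>)) \<le> 3 * \<rho> * norm \<xi> powr - ?r" for \<xi>
      by (rule order_trans[OF _ hb], rule order_trans[OF _ qnorm_fst]) (simp add: distrib_right)
  qed
  then have 1: "has_fourier_fun a0 (\<lambda>\<xi>. fst (h \<xi>))"
    by (rule has_fourier_fun_cong_AE[OF a]) (use hk in \<open>auto simp: k_def elim!: eventually_mono dest: arg_cong[where f = fst]\<close>)
  have "tame (\<lambda>\<xi>. snd (h \<xi>) $ j)" for j
  proof (rule tame_of_bound[OF sm _ r])
    show "cmod (snd (h \<xi>) $ j) \<le> 3 * \<rho> * norm \<xi> powr - ?r" for \<xi>
      by (rule order_trans[OF _ hb], rule order_trans[OF Finite_Cartesian_Product.norm_nth_le qnorm_snd])
  qed
  moreover have "AE \<xi> in lborel. fourier_fun (u0 $ j) \<xi> = snd (h \<xi>) $ j" for j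
    using hk
  proof eventually_elim
    case (elim \<xi>)
    show ?case unfolding elim[symmetric] by (simp add: k_def fourier_fun_vec_def)
  qed
  ultimately have "has_fourier_fun (u0 $ j) (\<lambda>\<xi>. snd (h \<xi>) $ j)" for j
    by (rule has_fourier_fun_cong_AE[OF u])
  with 1 h show ?thesis unfolding fourier_pair_def by blast
qed

lemma weighted_sup_le_time:
  fixes h :: "real^'d \<Rightarrow> 'b::{real_normed_vector, second_countable_topology}"
  assumes "h \<in> borel_measurable borel" "t > 0" "0 \<le> R" "ennreal (t powr (1 / p)) * weighted_sup r h \<le> ennreal R"
  shows "AE \<xi> in lborel. norm \<xi> powr r * norm (h \<xi>) \<le> R * t powr - (1 / p)"
proof -
  have "weighted_sup r h = ennreal (t powr - (1 / p)) * (ennreal (t powr (1 / p)) * weighted_sup r h)"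
    using assms(2) by (simp add: mult.assoc[symmetric] ennreal_mult[symmetric] powr_add[symmetric])
  also have "\<dots> \<le> ennreal (t powr - (1 / p)) * ennreal R" by (intro mult_left_mono assms) simp
  also have "\<dots> = ennreal (R * t powr - (1 / p))" using assms(3) by (simp add: ennreal_mult[symmetric] mult.commute)
  finally show ?thesis using weighted_sup_le_iff[OF assms(1)] assms(3) by simp
qed

text \<open>Three norms of at most R add up to 3 R in \<open>qnorm\<close>. The representative is
  selected separately at each time, so nothing is asserted about its dependence on t.\<close>

lemma X_norm_representative:
  assumes X: "(a, u) \<in> X_space p" "X_norm p (a, u) \<le> ennreal R" and R: "0 \<le> R"
  shows "\<exists>H. \<forall>t>0. fourier_pair (a t) (u t :: 'd dist ^ 'd) (H t) \<and> freq_bound (3 * R * t powr - (1 / p)) (H t)"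
proof (intro exI allI impI conjI)
  fix t :: real assume t: "t > 0"
  let ?H = "\<lambda>t \<xi>. (fourier_fun (a t) \<xi>, fourier_fun_vec (u t) \<xi>)"
  have "a t \<in> PM r1" "u t \<in> PM_vec r1" using X(1) t by (auto simp: X_space_def K_space_def K_vec_space_def r1_eqs)
  then have a: "has_fourier_fun (a t) (fourier_fun (a t))" and u: "has_fourier_fun (u t $ j) (fourier_fun (u t $ j))" for j
    by (auto simp: PM_def PM_vec_def intro: fourier_fun_AE(2))
  show fp: "fourier_pair (a t) (u t) (?H t)" unfolding fourier_pair_def using a u by (simp add: fourier_fun_vec_def)
  have am[measurable]: "fourier_fun (a t) \<in> borel_measurable borel" by (rule has_fourier_fun_measurable[OF a])
  have um[measurable]: "fourier_fun_vec (u t) \<in> borel_measurable borel"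
    unfolding fourier_fun_vec_def[abs_def] by (intro vec_lambda_measurable has_fourier_fun_measurable[OF u])
  have X': "max (K_norm p (real CARD('d) - 1) a) (K_norm p (real CARD('d)) a) + K_vec_norm p (real CARD('d) - 1) u \<le> ennreal R"
    using X(2) by (simp add: X_norm_def)
  have l: "x \<le> ennreal R" "y \<le> ennreal R" "z \<le> ennreal R" if "max x y + z \<le> ennreal R" for x y z :: ennreal
  proof -
    have "max x y \<le> ennreal R" "z \<le> ennreal R"
      by (rule order_trans[OF _ that], simp add: add_increasing2 add_increasing)+
    then show "x \<le> ennreal R" "y \<le> ennreal R" "z \<le> ennreal R" by auto
  qed
  have tm: "t \<in> {0<..}" using t by simp
  have 1: "AE \<xi> in lborel. norm \<xi> powr r1 * norm (fourier_fun (a t) \<xi>) \<le> R * t powr - (1 / p)"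
    by (rule weighted_sup_le_time[OF am t R])
      (rule order_trans[OF SUP_upper[OF tm] l(1)[OF X', unfolded K_norm_def r1_eqs PM_norm_def]])
  have 2: "AE \<xi> in lborel. norm \<xi> powr (r1 + 1) * norm (fourier_fun (a t) \<xi>) \<le> R * t powr - (1 / p)"
    by (rule weighted_sup_le_time[OF am t R])
      (rule order_trans[OF SUP_upper[OF tm] l(2)[OF X', unfolded K_norm_def r1_eqs PM_norm_def]])
  have 3: "AE \<xi> in lborel. norm \<xi> powr r1 * norm (fourier_fun_vec (u t) \<xi>) \<le> R * t powr - (1 / p)"
    by (rule weighted_sup_le_time[OF um t R])
      (rule order_trans[OF SUP_upper[OF tm] l(3)[OF X', unfolded K_vec_norm_def r1_eqs PM_vec_norm_def]])
  show "freq_bound (3 * R * t powr - (1 / p)) (?H t)" unfolding freq_bound_def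
  proof (intro conjI)
    show "0 \<le> 3 * R * t powr - (1 / p)" using R by simp
    show "?H t \<in> borel_measurable borel" by measurable
    show "AE \<xi> in lborel. qnorm \<xi> (?H t \<xi>) \<le> 3 * R * t powr - (1 / p) * norm \<xi> powr - r1"
      using 1 2 3 AE_lborel_singleton[of "0 :: real^'d"]
    proof eventually_elim
      case (elim \<xi>)
      have "norm \<xi> powr (r1 + 1) = norm \<xi> powr r1 * norm \<xi>" using elim(4) by (simp add: powr_add)
      then have "norm \<xi> powr r1 * qnorm \<xi> (?H t \<xi>) \<le> 3 * (R * t powr - (1 / p))"
        using elim(1-3) by (simp add: qnorm_def algebra_simps)
      then have "norm \<xi> powr - r1 * (norm \<xi> powr r1 * qnorm \<xi> (?H t \<xi>)) \<le> norm \<xi> powr - r1 * (3 * (R * t powr - (1 / p)))"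
        by (rule mult_left_mono) simp
      also have "norm \<xi> powr - r1 * (norm \<xi> powr r1 * qnorm \<xi> (?H t \<xi>)) = qnorm \<xi> (?H t \<xi>)"
        unfolding mult.assoc[symmetric] powr_add[symmetric] using elim(4) by simp
      finally show ?case by (simp add: mult_ac)
    qed
  qed
qed

text \<open>Replaces the distributional nonlinearity in the definition of a solution by the bilinear
  form of the given representatives, component by component.\<close>

lemma mild_solution_test:
  assumes sol: "nsk_mild_solution p \<mu> \<nu> \<kappa> \<alpha> (a0, u0) (a, u)"
    and fp: "\<And>s. s > 0 \<Longrightarrow> fourier_pair (a s) (u s :: 'd dist ^ 'd) (H s)" and K: "\<And>s. s > 0 \<Longrightarrow> freq_bound (M * s powr - (1 / p)) (H s)"
    and t: "t > 0" and \<phi>: "\<phi> \<in> schwartz"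
  shows "set_integrable lborel {0<..<t} (\<lambda>s. dist_with_fourier (\<lambda>\<xi>. fst (sg (t - s) \<xi> (B (H s) (H s) \<xi>))) \<phi>)"
    "a t \<phi> = fst (nsk_semigroup \<mu> \<nu> \<kappa> \<alpha> t (a0, u0)) \<phi>
      + (LBINT s:{0<..<t}. dist_with_fourier (\<lambda>\<xi>. fst (sg (t - s) \<xi> (B (H s) (H s) \<xi>))) \<phi>)"
    "set_integrable lborel {0<..<t} (\<lambda>s. dist_with_fourier (\<lambda>\<xi>. snd (sg (t - s) \<xi> (B (H s) (H s) \<xi>)) $ j) \<phi>)"
    "(u t $ j) \<phi> = (snd (nsk_semigroup \<mu> \<nu> \<kappa> \<alpha> t (a0, u0)) $ j) \<phi>
      + (LBINT s:{0<..<t}. dist_with_fourier (\<lambda>\<xi>. snd (sg (t - s) \<xi> (B (H s) (H s) \<xi>)) $ j) \<phi>)"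
proof -
  let ?F = "\<lambda>s. nsk_semigroup \<mu> \<nu> \<kappa> \<alpha> (t - s) (nsk_f (u s) (a s), nsk_g \<mu> \<nu> \<kappa> (u s) (a s))"
  have F: "?F s = (dist_with_fourier (\<lambda>\<xi>. fst (sg (t - s) \<xi> (B (H s) (H s) \<xi>))), \<chi> j. dist_with_fourier (\<lambda>\<xi>. snd (sg (t - s) \<xi> (B (H s) (H s) \<xi>)) $ j))"
    if "s \<in> {0<..<t}" for s
    by (rule semigroup_nonlinearity[OF K fp]) (use that in auto)
  have S: "set_integrable lborel {0<..<t} (\<lambda>s. fst (?F s) \<phi>)"
    "a t \<phi> = fst (nsk_semigroup \<mu> \<nu> \<kappa> \<alpha> t (a0, u0)) \<phi> + (LBINT s:{0<..<t}. fst (?F s) \<phi>)"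
    "set_integrable lborel {0<..<t} (\<lambda>s. (snd (?F s) $ j) \<phi>)"
    "(u t $ j) \<phi> = (snd (nsk_semigroup \<mu> \<nu> \<kappa> \<alpha> t (a0, u0)) $ j) \<phi> + (LBINT s:{0<..<t}. (snd (?F s) $ j) \<phi>)"
    using sol t \<phi> unfolding nsk_mild_solution_def Let_def by auto
  have c1: "set_integrable lborel {0<..<t} (\<lambda>s. fst (?F s) \<phi>) = set_integrable lborel {0<..<t} (\<lambda>s. dist_with_fourier (\<lambda>\<xi>. fst (sg (t - s) \<xi> (B (H s) (H s) \<xi>))) \<phi>)"
    by (rule set_integrable_cong) (auto simp: F)
  have c2: "(LBINT s:{0<..<t}. fst (?F s) \<phi>) = (LBINT s:{0<..<t}. dist_with_fourier (\<lambda>\<xi>. fst (sg (t - s) \<xi> (B (H s) (H s) \<xi>))) \<phi>)"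
    by (rule set_lebesgue_integral_cong) (auto simp: F)
  have c3: "set_integrable lborel {0<..<t} (\<lambda>s. (snd (?F s) $ j) \<phi>) = set_integrable lborel {0<..<t} (\<lambda>s. dist_with_fourier (\<lambda>\<xi>. snd (sg (t - s) \<xi> (B (H s) (H s) \<xi>)) $ j) \<phi>)"
    by (rule set_integrable_cong) (auto simp: F)
  have c4: "(LBINT s:{0<..<t}. (snd (?F s) $ j) \<phi>) = (LBINT s:{0<..<t}. dist_with_fourier (\<lambda>\<xi>. snd (sg (t - s) \<xi> (B (H s) (H s) \<xi>)) $ j) \<phi>)"
    by (rule set_lebesgue_integral_cong) (auto simp: F)
  from S show "set_integrable lborel {0<..<t} (\<lambda>s. dist_with_fourier (\<lambda>\<xi>. fst (sg (t - s) \<xi> (B (H s) (H s) \<xi>))) \<phi>)"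
    "a t \<phi> = fst (nsk_semigroup \<mu> \<nu> \<kappa> \<alpha> t (a0, u0)) \<phi>
      + (LBINT s:{0<..<t}. dist_with_fourier (\<lambda>\<xi>. fst (sg (t - s) \<xi> (B (H s) (H s) \<xi>))) \<phi>)"
    "set_integrable lborel {0<..<t} (\<lambda>s. dist_with_fourier (\<lambda>\<xi>. snd (sg (t - s) \<xi> (B (H s) (H s) \<xi>)) $ j) \<phi>)"
    "(u t $ j) \<phi> = (snd (nsk_semigroup \<mu> \<nu> \<kappa> \<alpha> t (a0, u0)) $ j) \<phi>
      + (LBINT s:{0<..<t}. dist_with_fourier (\<lambda>\<xi>. snd (sg (t - s) \<xi> (B (H s) (H s) \<xi>)) $ j) \<phi>)"
    unfolding c1 c2 c3 c4 by blast+
qed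

section \<open>Comparison of two mild solutions\<close>

context
  fixes H H' :: "real \<Rightarrow> real^'d \<Rightarrow> 'd state" and M D :: real
  assumes K: "\<And>s. s > 0 \<Longrightarrow> freq_bound (M * s powr - (1 / p)) (H s)" "\<And>s. s > 0 \<Longrightarrow> freq_bound (M * s powr - (1 / p)) (H' s)"
    and KD: "\<And>s. s > 0 \<Longrightarrow> freq_bound (D * s powr - (1 / p)) (\<lambda>\<xi>. H s \<xi> - H' s \<xi>)"
begin

lemma bounds_nonneg: "0 \<le> M" "0 \<le> D"
  using K(1)[of 1] KD[of 1] by (auto simp: freq_bound_def)

text \<open>At a fixed time the smoothed nonlinearity is again bounded by a multiple of
  |\<xi>|^-\<open>r1\<close>, so it may be paired with Schwartz functions.\<close>

lemma sg_B_tame: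
  assumes "test_functional l \<omega>" "0 < s" "s < t" and G: "freq_bound (M * s powr - (1 / p)) G"
  shows "tame (\<lambda>\<xi>. l (sg (t - s) \<xi> (B G G \<xi>)))"
proof (rule tame_of_bound)
  show "(\<lambda>\<xi>. l (sg (t - s) \<xi> (B G G \<xi>))) \<in> borel_measurable borel"
    by (intro test_functional_measurable[OF assms(1)] sg_measurable B_measurable freq_bound_measurable(1)[OF G]) auto
  fix \<xi> :: "real^'d" assume \<xi>: "\<xi> \<noteq> 0"
  have "qnorm \<xi> (B G G \<xi>) \<le> cB * (M * s powr - (1 / p)) * (M * s powr - (1 / p)) * norm \<xi> powr - r2"
    by (rule B_estimate[OF G G \<xi>])
  also have "\<dots> = cB * M * M * (s powr - (1 / p) * s powr - (1 / p)) * norm \<xi> powr - r2" by (simp only: mult_ac)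
  finally have q: "qnorm \<xi> (sg (t - s) \<xi> (B G G \<xi>)) \<le> cS * (cB * M * M) * norm \<xi> powr - r1 * bk (1 / p) t s"
    unfolding powr_sq by (rule sg_pointwise[OF assms(2,3) \<xi>])
  have "cmod (l (sg (t - s) \<xi> (B G G \<xi>))) \<le> \<omega> \<xi> * qnorm \<xi> (sg (t - s) \<xi> (B G G \<xi>))"
    using assms(1) unfolding test_functional_def by blast
  also have "\<dots> \<le> 1 * qnorm \<xi> (sg (t - s) \<xi> (B G G \<xi>))"
    using assms(1) by (intro mult_right_mono qnorm_nonneg) (auto simp: test_functional_def)
  finally show "cmod (l (sg (t - s) \<xi> (B G G \<xi>))) \<le> cS * (cB * M * M) * bk (1 / p) t s * norm \<xi> powr - r1"
    using q by (simp add: mult_ac)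
qed (use r_facts in auto)

lemma test_weight_integrable:
  assumes l: "test_functional l \<omega>" and \<psi>: "\<psi> \<in> schwartz"
  shows "integrable lborel (\<lambda>\<xi>::real^'d. \<omega> \<xi> * norm \<xi> powr - r1 * cmod (\<psi> \<xi>))"
proof (rule Bochner_Integration.integrable_bound[OF weight_test_integrable[OF \<psi>]])
  have [measurable]: "\<psi> \<in> borel_measurable borel" "\<omega> \<in> borel_measurable borel"
    using schwartz_measurable[OF \<psi>] l by (auto simp: test_functional_def)
  show "(\<lambda>\<xi>::real^'d. \<omega> \<xi> * norm \<xi> powr - r1 * cmod (\<psi> \<xi>)) \<in> borel_measurable lborel" by measurable
  have "\<bar>\<omega> \<xi>\<bar> * (norm \<xi> powr - r1 * cmod (\<psi> \<xi>)) \<le> 1 * (norm \<xi> powr - r1 * cmod (\<psi> \<xi>))" for \<xi>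
    using l by (intro mult_right_mono) (auto simp: test_functional_def)
  then show "AE \<xi> in lborel. norm (\<omega> \<xi> * norm \<xi> powr - r1 * cmod (\<psi> \<xi>)) \<le> norm (norm \<xi> powr - r1 * cmod (\<psi> \<xi>))"
    by (intro AE_I2) (simp add: abs_mult mult.assoc)
qed

text \<open>The curves may fail to be measurable in \<open>(s, \<xi>)\<close>, so the time integral is estimated after testing
  instead of being exchanged with the frequency integral.\<close>

lemma duhamel_difference_test:
  assumes l: "test_functional l \<omega>" and t: "t > 0" and \<phi>: "\<phi> \<in> schwartz"
    and I: "set_integrable lborel {0<..<t} (\<lambda>s. dist_with_fourier (\<lambda>\<xi>. l (sg (t - s) \<xi> (B (H s) (H s) \<xi>))) \<phi>)"
      "set_integrable lborel {0<..<t} (\<lambda>s. dist_with_fourier (\<lambda>\<xi>. l (sg (t - s) \<xi> (B (H' s) (H' s) \<xi>))) \<phi>)"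
  shows "cmod ((LBINT s:{0<..<t}. dist_with_fourier (\<lambda>\<xi>. l (sg (t - s) \<xi> (B (H s) (H s) \<xi>))) \<phi>)
      - (LBINT s:{0<..<t}. dist_with_fourier (\<lambda>\<xi>. l (sg (t - s) \<xi> (B (H' s) (H' s) \<xi>))) \<phi>))
    \<le> (\<integral>\<xi>. cD * (2 * cB * M * D) * t powr - (1 / p) * \<omega> \<xi> * norm \<xi> powr - r1 * cmod (inv_fourier \<phi> \<xi>) \<partial>lborel)"
proof -
  define \<psi> where "\<psi> = inv_fourier \<phi>"
  have \<psi>: "\<psi> \<in> schwartz" unfolding \<psi>_def by (rule inv_fourier_schwartz[OF \<phi>])
  define Q where "Q = 2 * cB * M * D"
  define W where "W = (\<integral>\<xi>. \<omega> \<xi> * norm \<xi> powr - r1 * cmod (\<psi> \<xi>) \<partial>lborel)"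
  have W0: "0 \<le> W" unfolding W_def using l by (intro integral_nonneg_AE AE_I2) (simp add: test_functional_def)
  have Q0: "0 \<le> Q" unfolding Q_def using cB_nonneg bounds_nonneg by simp
  have lin: "linear l" using l by (simp add: test_functional_def bounded_linear.linear)
  let ?N = "\<lambda>G s. dist_with_fourier (\<lambda>\<xi>. l (sg (t - s) \<xi> (B (G s) (G s) \<xi>))) \<phi>"
  have pt: "cmod (?N H s - ?N H' s) \<le> cS * Q * W * bk (1 / p) t s" if s: "0 < s" "s < t" for s
  proof -
    note T = tame_test_integrable[OF sg_B_tame[OF l s K(1)[OF s(1)]] \<psi>] tame_test_integrable[OF sg_B_tame[OF l s K(2)[OF s(1)]] \<psi>]
    let ?d = "\<lambda>\<xi>. l (sg (t - s) \<xi> (B (H s) (H s) \<xi>)) * \<psi> \<xi> - l (sg (t - s) \<xi> (B (H' s) (H' s) \<xi>)) * \<psi> \<xi>"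
    have "cmod (?N H s - ?N H' s) = cmod (\<integral>\<xi>. ?d \<xi> \<partial>lborel)"
      unfolding dist_with_fourier_apply[OF \<phi>] \<psi>_def[symmetric] Bochner_Integration.integral_diff[OF T] ..
    also have "\<dots> \<le> (\<integral>\<xi>. cmod (?d \<xi>) \<partial>lborel)" by (rule integral_norm_bound)
    also have "\<dots> \<le> (\<integral>\<xi>. (cS * Q * bk (1 / p) t s) * (\<omega> \<xi> * norm \<xi> powr - r1 * cmod (\<psi> \<xi>)) \<partial>lborel)"
    proof (rule integral_mono_AE)
      show "integrable lborel (\<lambda>\<xi>. cmod (?d \<xi>))" by (intro integrable_norm Bochner_Integration.integrable_diff T)
      show "integrable lborel (\<lambda>\<xi>. (cS * Q * bk (1 / p) t s) * (\<omega> \<xi> * norm \<xi> powr - r1 * cmod (\<psi> \<xi>)))"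
        by (intro integrable_mult_right test_weight_integrable[OF l \<psi>])
      show "AE \<xi> in lborel. cmod (?d \<xi>) \<le> (cS * Q * bk (1 / p) t s) * (\<omega> \<xi> * norm \<xi> powr - r1 * cmod (\<psi> \<xi>))"
        using AE_lborel_singleton[of "0 :: real^'d"]
      proof eventually_elim
        case (elim \<xi>)
        let ?z = "B (H s) (H s) \<xi> - B (H' s) (H' s) \<xi>"
        have "qnorm \<xi> ?z \<le> 2 * cB * (M * s powr - (1 / p)) * (D * s powr - (1 / p)) * norm \<xi> powr - r2"
          by (rule B_lipschitz[OF K(1)[OF s(1)] K(2)[OF s(1)] KD[OF s(1)] elim])
        also have "\<dots> = Q * (s powr - (1 / p) * s powr - (1 / p)) * norm \<xi> powr - r2" unfolding Q_def by (simp only: mult_ac)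
        finally have q: "qnorm \<xi> (sg (t - s) \<xi> ?z) \<le> cS * Q * norm \<xi> powr - r1 * bk (1 / p) t s"
          unfolding powr_sq by (rule sg_pointwise[OF s elim])
        have "?d \<xi> = l (sg (t - s) \<xi> ?z) * \<psi> \<xi>"
          unfolding sg_diff linear_diff[OF lin] left_diff_distrib ..
        then have "cmod (?d \<xi>) = cmod (l (sg (t - s) \<xi> ?z)) * cmod (\<psi> \<xi>)" by (simp only: norm_mult)
        also have "\<dots> \<le> (\<omega> \<xi> * qnorm \<xi> (sg (t - s) \<xi> ?z)) * cmod (\<psi> \<xi>)"
          by (intro mult_right_mono norm_ge_zero) (use l in \<open>simp only: test_functional_def\<close>)
        also have "\<dots> \<le> (\<omega> \<xi> * (cS * Q * norm \<xi> powr - r1 * bk (1 / p) t s)) * cmod (\<psi> \<xi>)"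
          by (intro mult_right_mono mult_left_mono q) (use l in \<open>auto simp: test_functional_def\<close>)
        also have "\<dots> = (cS * Q * bk (1 / p) t s) * (\<omega> \<xi> * norm \<xi> powr - r1 * cmod (\<psi> \<xi>))" by (simp only: mult_ac)
        finally show ?case .
      qed
    qed
    also have "\<dots> = cS * Q * W * bk (1 / p) t s" unfolding integral_mult_right_zero W_def by (simp only: mult_ac)
    finally show ?thesis .
  qed
  have nb: "0 \<le> bk (1 / p) t s" for s by (simp add: beta_kernel_def)
  have "cmod ((LBINT s:{0<..<t}. ?N H s) - (LBINT s:{0<..<t}. ?N H' s)) \<le> (\<integral>s. cS * Q * W * bk (1 / p) t s \<partial>lborel)"
    unfolding set_integral_diff(2)[OF I, symmetric] unfolding set_lebesgue_integral_def
  proof (rule integral_norm_le)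
    show "integrable lborel (\<lambda>s. cS * Q * W * bk (1 / p) t s)" using p_facts(3) t by (intro integrable_mult_right bk_integrable)
    show "cmod (indicator {0<..<t} s *\<^sub>R (?N H s - ?N H' s)) \<le> cS * Q * W * bk (1 / p) t s" for s
    proof (cases "s \<in> {0<..<t}")
      case True
      then show ?thesis using pt[of s] by simp
    next
      case False
      have "0 \<le> cS * Q * W * bk (1 / p) t s" using cS(1) Q0 W0 nb by (intro mult_nonneg_nonneg) auto
      then show ?thesis using False by simp
    qed
  qed
  also have "\<dots> = cS * Q * W * (beta_const (1 / p) (1 - 2 / p) * t powr - (1 / p))"
    unfolding integral_mult_right_zero bk_integral[OF t] ..
  also have "\<dots> = (cD * Q * t powr - (1 / p)) * W" unfolding cD_def by (simp only: mult_ac)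
  also have "\<dots> = (\<integral>\<xi>. cD * Q * t powr - (1 / p) * \<omega> \<xi> * norm \<xi> powr - r1 * cmod (\<psi> \<xi>) \<partial>lborel)"
    unfolding W_def integral_mult_right_zero[symmetric] by (simp only: mult.assoc)
  finally show ?thesis unfolding Q_def \<psi>_def .
qed

text \<open>The common linear part L cancels, so the pairing of the difference with any Schwartz
  function is bounded by the Duhamel estimate; \<open>weak_bound_AE\<close> converts these bounds
  into one almost everywhere.\<close>

lemma mild_difference_component:
  assumes l: "test_functional l \<omega>" and t: "t > 0"
    and T: "\<And>\<phi>. \<phi> \<in> schwartz \<Longrightarrow> T \<phi> = L \<phi> + (LBINT s:{0<..<t}. dist_with_fourier (\<lambda>\<xi>. l (sg (t - s) \<xi> (B (H s) (H s) \<xi>))) \<phi>)"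
      "\<And>\<phi>. \<phi> \<in> schwartz \<Longrightarrow> T' \<phi> = L \<phi> + (LBINT s:{0<..<t}. dist_with_fourier (\<lambda>\<xi>. l (sg (t - s) \<xi> (B (H' s) (H' s) \<xi>))) \<phi>)"
    and I: "\<And>\<phi>. \<phi> \<in> schwartz \<Longrightarrow> set_integrable lborel {0<..<t} (\<lambda>s. dist_with_fourier (\<lambda>\<xi>. l (sg (t - s) \<xi> (B (H s) (H s) \<xi>))) \<phi>)"
      "\<And>\<phi>. \<phi> \<in> schwartz \<Longrightarrow> set_integrable lborel {0<..<t} (\<lambda>s. dist_with_fourier (\<lambda>\<xi>. l (sg (t - s) \<xi> (B (H' s) (H' s) \<xi>))) \<phi>)"
    and f: "has_fourier_fun T (\<lambda>\<xi>. l (H t \<xi>))" "has_fourier_fun T' (\<lambda>\<xi>. l (H' t \<xi>))"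
  shows "AE \<xi> in lborel. cmod (l (H t \<xi> - H' t \<xi>)) \<le> cD * (2 * cB * M * D) * t powr - (1 / p) * \<omega> \<xi> * norm \<xi> powr - r1"
proof -
  have lin: "linear l" using l by (simp add: test_functional_def bounded_linear.linear)
  have [measurable]: "\<omega> \<in> borel_measurable borel" using l by (simp add: test_functional_def)
  have m[measurable]: "(\<lambda>\<xi>. l (H t \<xi>)) \<in> borel_measurable borel" "(\<lambda>\<xi>. l (H' t \<xi>)) \<in> borel_measurable borel"
    by (rule has_fourier_fun_measurable[OF f(1)] has_fourier_fun_measurable[OF f(2)])+
  let ?c = "cD * (2 * cB * M * D) * t powr - (1 / p)"
  show ?thesis unfolding linear_diff[OF lin]
  proof (rule weak_bound_AE)
    show "(\<lambda>\<xi>. l (H t \<xi>) - l (H' t \<xi>)) \<in> borel_measurable borel" by measurable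
    show "(\<lambda>\<xi>::real^'d. ?c * \<omega> \<xi> * norm \<xi> powr - r1) \<in> borel_measurable borel" by measurable
    fix \<psi> :: "real^'d \<Rightarrow> complex" assume \<psi>: "\<psi> \<in> schwartz"
    note i = has_fourier_funD(2)[OF f(1) \<psi>] has_fourier_funD(2)[OF f(2) \<psi>]
    have [measurable]: "\<psi> \<in> borel_measurable borel" by (rule schwartz_measurable[OF \<psi>])
    show "integrable lborel (\<lambda>\<xi>. (l (H t \<xi>) - l (H' t \<xi>)) * \<psi> \<xi>)"
      unfolding left_diff_distrib by (rule Bochner_Integration.integrable_diff[OF i])
    show "integrable lborel (\<lambda>\<xi>. complex_of_real (?c * \<omega> \<xi> * norm \<xi> powr - r1) * \<psi> \<xi>)"
    proof (rule Bochner_Integration.integrable_bound[OF integrable_mult_right[OF test_weight_integrable[OF l \<psi>], of ?c]])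
      show "AE \<xi> in lborel. norm (complex_of_real (?c * \<omega> \<xi> * norm \<xi> powr - r1) * \<psi> \<xi>) \<le> norm (?c * (\<omega> \<xi> * norm \<xi> powr - r1 * cmod (\<psi> \<xi>)))"
        by (intro AE_I2) (simp add: norm_mult abs_mult mult_ac)
    qed measurable
    \<comment> \<open>Pairing the Fourier transforms with \<psi> means evaluating the distributions
      at \<open>fourier \<psi>\<close>; in the Duhamel estimate \<open>inv_fourier\<close> then
      gives back \<psi>.\<close>
    have \<phi>: "fourier \<psi> \<in> schwartz" by (rule fourier_schwartz[OF \<psi>])
    have "(\<integral>\<xi>. (l (H t \<xi>) - l (H' t \<xi>)) * \<psi> \<xi> \<partial>lborel) = T (fourier \<psi>) - T' (fourier \<psi>)"
      unfolding left_diff_distrib Bochner_Integration.integral_diff[OF i] has_fourier_funD(1)[OF f(1) \<psi>] has_fourier_funD(1)[OF f(2) \<psi>] ..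
    then have e: "(\<integral>\<xi>. (l (H t \<xi>) - l (H' t \<xi>)) * \<psi> \<xi> \<partial>lborel)
      = (LBINT s:{0<..<t}. dist_with_fourier (\<lambda>\<xi>. l (sg (t - s) \<xi> (B (H s) (H s) \<xi>))) (fourier \<psi>))
      - (LBINT s:{0<..<t}. dist_with_fourier (\<lambda>\<xi>. l (sg (t - s) \<xi> (B (H' s) (H' s) \<xi>))) (fourier \<psi>))"
      unfolding T(1)[OF \<phi>] T(2)[OF \<phi>] add_diff_cancel_left .
    show "cmod (\<integral>\<xi>. (l (H t \<xi>) - l (H' t \<xi>)) * \<psi> \<xi> \<partial>lborel) \<le> (\<integral>\<xi>. ?c * \<omega> \<xi> * norm \<xi> powr - r1 * cmod (\<psi> \<xi>) \<partial>lborel)"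
      unfolding e using duhamel_difference_test[OF l t \<phi> I(1)[OF \<phi>] I(2)[OF \<phi>]] unfolding inv_fourier_fourier[OF \<psi>] .
  qed
qed

text \<open>Reassembles \<open>qnorm\<close> from its components: the weight 1/(1 + |\<xi>|) of the
  density test cancels the weight in \<open>qnorm\<close>, and one density plus d velocity
  components give the factor 1 + d.\<close>

lemma mild_difference_step:
  assumes sol: "nsk_mild_solution p \<mu> \<nu> \<kappa> \<alpha> (a0, u0) (a, u)" "nsk_mild_solution p \<mu> \<nu> \<kappa> \<alpha> (a0, u0) (a', u')"
    and fp: "\<And>s. s > 0 \<Longrightarrow> fourier_pair (a s) (u s) (H s)" "\<And>s. s > 0 \<Longrightarrow> fourier_pair (a' s) (u' s) (H' s)"
    and t: "t > 0"
  shows "freq_bound (((1 + real CARD('d)) * cD * (2 * cB * M)) * D * t powr - (1 / p)) (\<lambda>\<xi>. H t \<xi> - H' t \<xi>)"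
proof -
  let ?c = "cD * (2 * cB * M * D) * t powr - (1 / p)"
  note S = mild_solution_test[OF sol(1) fp(1) K(1) t] and S' = mild_solution_test[OF sol(2) fp(2) K(2) t]
  have f: "has_fourier_fun (a t) (\<lambda>\<xi>. fst (H t \<xi>))" "has_fourier_fun (u t $ j) (\<lambda>\<xi>. snd (H t \<xi>) $ j)"
    "has_fourier_fun (a' t) (\<lambda>\<xi>. fst (H' t \<xi>))" "has_fourier_fun (u' t $ j) (\<lambda>\<xi>. snd (H' t \<xi>) $ j)" for j
    using fp[OF t] by (auto simp: fourier_pair_def)
  have 1: "AE \<xi> in lborel. cmod (fst (H t \<xi> - H' t \<xi>)) \<le> ?c * (1 / (1 + norm \<xi>)) * norm \<xi> powr - r1"
    by (rule mild_difference_component[OF test_functional_fst t S(2) S'(2) S(1) S'(1) f(1,3)])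
  have "AE \<xi> in lborel. cmod (snd (H t \<xi> - H' t \<xi>) $ j) \<le> ?c * 1 * norm \<xi> powr - r1" for j
    by (rule mild_difference_component[OF test_functional_snd t S(4) S'(4) S(3) S'(3) f(2,4)])
  then have 2: "AE \<xi> in lborel. \<forall>j\<in>UNIV. cmod (snd (H t \<xi> - H' t \<xi>) $ j) \<le> ?c * norm \<xi> powr - r1"
    by (intro AE_finite_allI) auto
  have "AE \<xi> in lborel. qnorm \<xi> (H t \<xi> - H' t \<xi>) \<le> (1 + real CARD('d)) * ?c * norm \<xi> powr - r1"
    using 1 2
  proof eventually_elim
    case (elim \<xi>)
    have p: "0 < 1 + norm \<xi>" using norm_ge_zero[of \<xi>] by linarith
    have "(1 + norm \<xi>) * cmod (fst (H t \<xi> - H' t \<xi>)) \<le> (1 + norm \<xi>) * (?c * (1 / (1 + norm \<xi>)) * norm \<xi> powr - r1)"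
      by (rule mult_left_mono[OF elim(1)]) (use p in simp)
    also have "\<dots> = ?c * norm \<xi> powr - r1" using p by simp
    finally have a: "(1 + norm \<xi>) * cmod (fst (H t \<xi> - H' t \<xi>)) \<le> ?c * norm \<xi> powr - r1" .
    have "norm (snd (H t \<xi> - H' t \<xi>)) \<le> (\<Sum>j\<in>UNIV. cmod (snd (H t \<xi> - H' t \<xi>) $ j))" by (rule norm_vec_le_sum)
    also have "\<dots> \<le> real CARD('d) * (?c * norm \<xi> powr - r1)"
      using sum_bounded_above[of "UNIV :: 'd set" "\<lambda>j. cmod (snd (H t \<xi> - H' t \<xi>) $ j)" "?c * norm \<xi> powr - r1"] elim(2) by simp
    finally show ?case using a by (simp add: qnorm_def distrib_right mult.assoc)
  qed
  moreover have "(1 + real CARD('d)) * ?c = ((1 + real CARD('d)) * cD * (2 * cB * M)) * D * t powr - (1 / p)" by (simp only: mult_ac)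
  moreover have "0 \<le> (1 + real CARD('d)) * ?c" using cD_nonneg cB_nonneg bounds_nonneg by simp
  moreover have "(\<lambda>\<xi>. H t \<xi> - H' t \<xi>) \<in> borel_measurable borel" using KD[OF t] by (simp add: freq_bound_def)
  ultimately show ?thesis unfolding freq_bound_def by simp
qed

end

lemma uniqueness:
  assumes sol: "nsk_mild_solution p \<mu> \<nu> \<kappa> \<alpha> (a0, u0) (a, u)" "nsk_mild_solution p \<mu> \<nu> \<kappa> \<alpha> (a0, u0) (a', u')"
    and X: "X_norm p (a, u) \<le> ennreal R" "X_norm p (a', u') \<le> ennreal R" and R: "0 \<le> R"
    and small: "(1 + real CARD('d)) * cD * (2 * cB * (3 * R)) \<le> 1 / 2" and t: "t > 0"
  shows "a' t = a t \<and> u' t = (u t :: 'd dist ^ 'd)"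
proof -
  have XS: "(a, u) \<in> X_space p" "(a', u') \<in> X_space p" using sol by (auto simp: nsk_mild_solution_def)
  obtain H where H: "\<And>t. t > 0 \<Longrightarrow> fourier_pair (a t) (u t) (H t)" "\<And>t. t > 0 \<Longrightarrow> freq_bound (3 * R * t powr - (1 / p)) (H t)"
    using X_norm_representative[OF XS(1) X(1) R] by blast
  obtain H' where H': "\<And>t. t > 0 \<Longrightarrow> fourier_pair (a' t) (u' t) (H' t)" "\<And>t. t > 0 \<Longrightarrow> freq_bound (3 * R * t powr - (1 / p)) (H' t)"
    using X_norm_representative[OF XS(2) X(2) R] by blast
  have Kn: "freq_bound (6 * R * (1 / 2) ^ n * s powr - (1 / p)) (\<lambda>\<xi>. H s \<xi> - H' s \<xi>)" if "s > 0" for n s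
    using that
  proof (induction n arbitrary: s)
    case 0
    \<comment> \<open>The starting constant 6 R is the sum of the two bounds 3 R.\<close>
    show ?case using freq_bound_diff[OF H(2)[OF 0] H'(2)[OF 0]] by (simp add: mult_ac)
  next
    case (Suc n)
    let ?D = "6 * R * (1 / 2) ^ n"
    have "freq_bound (((1 + real CARD('d)) * cD * (2 * cB * (3 * R))) * ?D * s powr - (1 / p)) (\<lambda>\<xi>. H s \<xi> - H' s \<xi>)"
      by (rule mild_difference_step[OF H(2) H'(2) Suc.IH sol H(1) H'(1) Suc.prems])
    moreover have "((1 + real CARD('d)) * cD * (2 * cB * (3 * R))) * ?D * s powr - (1 / p) \<le> (1 / 2) * ?D * s powr - (1 / p)"
      by (intro mult_right_mono small) (use R in auto)
    ultimately show ?case using freq_bound_mono by (simp add: mult_ac)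
  qed
  \<comment> \<open>Each round has its own null set; their countable union is null, so the limit of
    the bounds may be taken at a fixed frequency.\<close>
  have "AE \<xi> in lborel. \<forall>n. qnorm \<xi> (H t \<xi> - H' t \<xi>) \<le> 6 * R * (1 / 2) ^ n * t powr - (1 / p) * norm \<xi> powr - r1"
    unfolding AE_all_countable using Kn[OF t] by (simp add: freq_bound_def)
  then have eq: "AE \<xi> in lborel. H' t \<xi> = H t \<xi>"
  proof eventually_elim
    case (elim \<xi>)
    have "(\<lambda>n. 6 * R * (1 / 2) ^ n * t powr - (1 / p) * norm \<xi> powr - r1) \<longlonglongrightarrow> 6 * R * 0 * t powr - (1 / p) * norm \<xi> powr - r1"
      by (intro tendsto_intros LIMSEQ_power_zero) simp
    then have "qnorm \<xi> (H t \<xi> - H' t \<xi>) \<le> 6 * R * 0 * t powr - (1 / p) * norm \<xi> powr - r1"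
      by (rule LIMSEQ_le_const) (use elim in blast)
    then have "norm (H t \<xi> - H' t \<xi>) \<le> 6 * R * 0 * t powr - (1 / p) * norm \<xi> powr - r1" by (rule order_trans[OF norm_le_qnorm])
    then show ?case by simp
  qed
  have f: "has_fourier_fun (a t) (\<lambda>\<xi>. fst (H t \<xi>))" "has_fourier_fun (u t $ j) (\<lambda>\<xi>. snd (H t \<xi>) $ j)"
    "has_fourier_fun (a' t) (\<lambda>\<xi>. fst (H' t \<xi>))" "has_fourier_fun (u' t $ j) (\<lambda>\<xi>. snd (H' t \<xi>) $ j)" for j
    using H(1)[OF t] H'(1)[OF t] by (auto simp: fourier_pair_def)
  have T: "a t \<in> tempered" "u t $ j \<in> tempered" "a' t \<in> tempered" "u' t $ j \<in> tempered" for j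
    using XS t by (auto simp: X_space_def K_space_def K_vec_space_def PM_def PM_vec_def)
  have unique: "S' = S" if S: "has_fourier_fun S g" "S \<in> tempered" "has_fourier_fun S' g'" "S' \<in> tempered"
    and g: "AE \<xi> in lborel. g' \<xi> = g \<xi>" for S S' :: "'d dist" and g g'
    unfolding tempered_eq_dist_with_fourier[OF S(2,1)] tempered_eq_dist_with_fourier[OF S(4,3)]
    by (rule dist_with_fourier_cong_AE[OF has_fourier_fun_measurable[OF S(3)] has_fourier_fun_measurable[OF S(1)] g])
  have "a' t = a t" by (rule unique[OF f(1) T(1) f(3) T(3)]) (use eq in eventually_elim, simp)
  moreover have "u' t $ j = u t $ j" for j by (rule unique[OF f(2) T(2) f(4) T(4)]) (use eq in eventually_elim, simp)
  ultimately show ?thesis by (simp add: vec_eq_iff)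
qed

end

theorem theorem3p2p1:
  fixes p \<mu> \<nu> \<kappa> \<alpha> :: real
  assumes "CARD('d::finite) \<ge> 2"
    and "p > 2" and "real CARD('d) - 3 + 4 / p > 0"
    and "\<mu> > 0" and "\<mu> + \<nu> > 0" and "\<kappa> > 0" and "\<alpha> > 0"
  shows "\<exists>\<rho>>0. \<exists>R>0. \<forall>(a0 :: 'd dist) (u0 :: ('d dist)^'d).
    a0 \<in> PM (real CARD('d) - 1) \<inter> PM (real CARD('d)) \<longrightarrow>
    u0 \<in> PM_vec (real CARD('d) - 1) \<longrightarrow>
    data_norm (real CARD('d) - 1) a0 u0 \<le> ennreal \<rho> \<longrightarrow>
    (\<exists>a u. nsk_mild_solution p \<mu> \<nu> \<kappa> \<alpha> (a0, u0) (a, u) \<and> X_norm p (a, u) \<le> ennreal R \<and>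
      (\<forall>a' u'. nsk_mild_solution p \<mu> \<nu> \<kappa> \<alpha> (a0, u0) (a', u') \<and> X_norm p (a', u') \<le> ennreal R
        \<longrightarrow> (\<forall>t>0. a' t = a t \<and> u' t = u t)))"
proof -
  interpret nsk_crit \<mu> \<nu> \<kappa> \<alpha> p "TYPE('d)"
    by unfold_locales (use assms in auto)
  \<comment> \<open>Uniqueness in the ball of radius 2 M is the stricter requirement: 12 k M \<le>
    1/2, that is 24 k M \<le> 1. It implies the smallness for the contraction, and the 1 in the
    denominator of \<open>M\<close> covers k = 0.\<close>
  define k where "k = (1 + real CARD('d)) * cD * cB"
  define M where "M = 1 / (1 + 24 * k)"
  have k: "0 \<le> k" unfolding k_def using cD_nonneg cB_nonneg by simp
  then have M: "M > 0" and R: "2 * M > 0" and kM: "24 * (k * M) \<le> 1" by (auto simp: M_def field_simps)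
  have "cD * cB \<le> k" unfolding k_def using cD_nonneg cB_nonneg by (simp add: distrib_right)
  then have "cD * cB * M \<le> k * M" using M by (intro mult_right_mono) auto
  then have M1: "cD * (2 * cB * M) \<le> 1 / 2" using kM by (simp add: mult_ac)
  have M2: "(1 + real CARD('d)) * cD * (2 * cB * (3 * (2 * M))) \<le> 1 / 2"
  proof -
    have "(1 + real CARD('d)) * cD * (2 * cB * (3 * (2 * M))) = 12 * (k * M)" by (simp add: k_def mult_ac)
    then show ?thesis using kM by linarith
  qed
  \<comment> \<open>The representative of the data has the bound 3 \<rho>, and \<open>cL\<close>
    times that is then exactly M / 2.\<close>
  define \<rho> where "\<rho> = M / (6 * cL)"
  have \<rho>: "\<rho> > 0" "cL * (3 * \<rho>) \<le> M / 2" using M cL(1) by (auto simp: \<rho>_def)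
  show ?thesis
  proof (rule exI[of _ \<rho>], rule conjI[OF \<rho>(1)], rule exI[of _ "2 * M"], rule conjI[OF R], intro allI impI)
    fix a0 :: "'d dist" and u0 :: "'d dist ^ 'd"
    assume d: "a0 \<in> PM (real CARD('d) - 1) \<inter> PM (real CARD('d))" "u0 \<in> PM_vec (real CARD('d) - 1)"
      "data_norm (real CARD('d) - 1) a0 u0 \<le> ennreal \<rho>"
    obtain h where h: "data_bound (3 * \<rho>) h" "fourier_pair a0 u0 h"
      using data_representative[OF _ d(2,3)] d(1) \<rho>(1) by auto
    obtain a u where au: "nsk_mild_solution p \<mu> \<nu> \<kappa> \<alpha> (a0, u0) (a, u)" "X_norm p (a, u) \<le> ennreal (2 * M)"
      using existence[OF h less_imp_le[OF M] \<rho>(2) M1] by blast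
    have "\<forall>t>0. a' t = a t \<and> u' t = u t"
      if "nsk_mild_solution p \<mu> \<nu> \<kappa> \<alpha> (a0, u0) (a', u')" "X_norm p (a', u') \<le> ennreal (2 * M)" for a' u'
      using uniqueness[OF au(1) that(1) au(2) that(2) _ M2] M by auto
    with au show "\<exists>a u. nsk_mild_solution p \<mu> \<nu> \<kappa> \<alpha> (a0, u0) (a, u) \<and> X_norm p (a, u) \<le> ennreal (2 * M) \<and>
      (\<forall>a' u'. nsk_mild_solution p \<mu> \<nu> \<kappa> \<alpha> (a0, u0) (a', u') \<and> X_norm p (a', u') \<le> ennreal (2 * M)
        \<longrightarrow> (\<forall>t>0. a' t = a t \<and> u' t = u t))" by blast
  qed
qed

end
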